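(* Let $p\in\mathbb{C}[X_1,\dots,X_d,T]$. Then $N_{\mathcal{L}(\mathcal{D}(\mathbb{R}),\mathcal{S}'(\mathbb{R}^d))}(p)=\{0\}$ if and only if $V(C_{\mathbf{X}}(p))\cap i\mathbb{R}^d=\emptyset$.
   Context: Coordinates on $\mathbb{R}^{d+1}$ are $(\mathbf{x},t)$, $\mathbf{x}\in\mathbb{R}^d$, $t\in\mathbb{R}$, and $\mathbf{X}=(X_1,\dots,X_d)$. $\mathcal{L}(\mathcal{D}(\mathbb{R}),\mathcal{S}'(\mathbb{R}^d))$ is the space of continuous linear maps from $\mathcal{D}(\mathbb{R})$ (inductive limit topology) to $\mathcal{S}'(\mathbb{R}^d)$ (weak-* topology); each such $u$ is identified with the unique $U\in\mathcal{D}'(\mathbb{R}^{d+1})$ with $\langle U,\varphi\otimes\psi\rangle=\langle u(\varphi),\psi\rangle$ for $\varphi\in\mathcal{D}(\mathbb{R})$, $\psi\in\mathcal{D}(\mathbb{R}^d)$, so it is a subspace of $\mathcal{D}'(\mathbb{R}^{d+1})$. For $p\in\mathbb{C}[\mathbf{X},T]$, $D_p=p\left(\frac{\partial}{\partial x_1},\dots,\frac{\partial}{\partial x_d},\frac{\partial}{\partial t}\right)$, and for a subspace $S\subset\mathcal{D}'(\mathbb{R}^{d+1})$, $N_S(p)=\{u\in S: D_pu=0,\ u|_{t<0}=0\}$, where $u|_{t<0}$ is the restriction to $\{t<0\}$. Writing $p=a_0+a_1T+\dots+a_nT^n$ with $a_j\in\mathbb{C}[\mathbf{X}]$, $C_{\mathbf{X}}(p)$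 is the ideal of $\mathbb{C}[\mathbf{X}]$ generated by $a_0,\dots,a_n$. For $I\subset\mathbb{C}[\mathbf{X}]$, $V(I)=\{\boldsymbol{\xi}\in\mathbb{C}^d: q(\boldsymbol{\xi})=0\ \forall q\in I\}$. *)

theory Defs
  imports "HOL-Analysis.Analysis" "HOL-Library.Poly_Mapping"
begin

(* C[X_1..X_d] is represented as poly_mappings from monomial exponent vectors
 ('n =>0 nat) to complex coefficients; Poly_Mapping gives it the commutative ring
 structure. A polynomial p in C[X,T] is represented as nat =>0 C[X], i.e.
 p = sum_j a_j T^j with a_j = Poly_Mapping.lookup p j. *)


definition mpoly_eval :: "(('n::finite \<Rightarrow>\<^sub>0 nat) \<Rightarrow>\<^sub>0 complex) \<Rightarrow> complex^'n \<Rightarrow> complex" where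
  "mpoly_eval q \<xi> = (\<Sum>\<alpha>\<in>Poly_Mapping.keys q. Poly_Mapping.lookup q \<alpha> * (\<Prod>i\<in>UNIV. (\<xi>$i) ^ Poly_Mapping.lookup \<alpha> i))"

definition gen_ideal :: "'a::comm_ring_1 set \<Rightarrow> 'a set" where
  "gen_ideal A = {s. \<exists>F r. finite F \<and> F \<subseteq> A \<and> s = (\<Sum>a\<in>F. r a * a)}"

definition CX :: "(nat \<Rightarrow>\<^sub>0 (('n \<Rightarrow>\<^sub>0 nat) \<Rightarrow>\<^sub>0 complex)) \<Rightarrow> (('n \<Rightarrow>\<^sub>0 nat) \<Rightarrow>\<^sub>0 complex) set" where
  "CX p = gen_ideal (range (Poly_Mapping.lookup p))"

definition variety :: "(('n::finite \<Rightarrow>\<^sub>0 nat) \<Rightarrow>\<^sub>0 complex) set \<Rightarrow> (complex^'n) set" where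
  "variety I = {\<xi>. \<forall>q\<in>I. mpoly_eval q \<xi> = 0}"

definition imag_axis_space :: "(complex^'n) set" where
  "imag_axis_space = {\<xi>. \<exists>y::real^'n. \<xi> = (\<chi> i. \<i> * complex_of_real (y$i))}"

definition dir_deriv :: "'a::euclidean_space \<Rightarrow> ('a \<Rightarrow> complex) \<Rightarrow> 'a \<Rightarrow> complex" where
  "dir_deriv v f x = vector_derivative (\<lambda>s::real. f (x + s *\<^sub>R v)) (at 0)"

fun iterd :: "'a::euclidean_space list \<Rightarrow> ('a \<Rightarrow> complex) \<Rightarrow> 'a \<Rightarrow> complex" where
  "iterd [] f = f"
| "iterd (v # vs) f = dir_deriv v (iterd vs f)"

definition smooth_fun :: "('a::euclidean_space \<Rightarrow> complex) \<Rightarrow> bool" where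
  "smooth_fun f \<longleftrightarrow> (\<forall>vs. set vs \<subseteq> Basis \<longrightarrow>
      continuous_on UNIV (iterd vs f) \<and>
      (\<forall>b\<in>Basis. \<forall>x. ((\<lambda>s::real. iterd vs f (x + s *\<^sub>R b))
                         has_vector_derivative iterd (b # vs) f x) (at 0)))"

definition supported_in :: "('a \<Rightarrow> complex) \<Rightarrow> 'a set \<Rightarrow> bool" where
  "supported_in f K \<longleftrightarrow> (\<forall>x. x \<notin> K \<longrightarrow> f x = 0)"

definition test_fun :: "('a::euclidean_space \<Rightarrow> complex) \<Rightarrow> bool" where
  "test_fun f \<longleftrightarrow> smooth_fun f \<and> (\<exists>K. compact K \<and> supported_in f K)"

definition schwartz_fun :: "('a::euclidean_space \<Rightarrow> complex) \<Rightarrow> bool" where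
  "schwartz_fun f \<longleftrightarrow> smooth_fun f \<and>
     (\<forall>vs k. set vs \<subseteq> Basis \<longrightarrow> bounded (range (\<lambda>x. (1 + norm x) ^ k * norm (iterd vs f x))))"

definition deriv_lists :: "nat \<Rightarrow> 'a::euclidean_space list set" where
  "deriv_lists N = {vs. set vs \<subseteq> Basis \<and> length vs \<le> N}"

definition sup_norm :: "('a \<Rightarrow> complex) \<Rightarrow> real" where
  "sup_norm f = (SUP x. norm (f x))"

text \<open>A distribution: linear functional on D, continuous w.r.t. the
 inductive-limit topology (standard seminorm characterisation). Only its
 values on test functions matter.\<close>
definition distribution :: "(('a::euclidean_space \<Rightarrow> complex) \<Rightarrow> complex) \<Rightarrow> bool" where
  "distribution U \<longleftrightarrow>
     (\<forall>\<phi> \<psi> c. test_fun \<phi> \<longrightarrow> test_fun \<psi> \<longrightarrow>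
        U (\<lambda>x. \<phi> x + \<psi> x) = U \<phi> + U \<psi> \<and> U (\<lambda>x. c * \<phi> x) = c * U \<phi>) \<and>
     (\<forall>K. compact K \<longrightarrow> (\<exists>C N. \<forall>\<phi>. test_fun \<phi> \<longrightarrow> supported_in \<phi> K \<longrightarrow>
        norm (U \<phi>) \<le> C * (\<Sum>vs\<in>deriv_lists N. sup_norm (iterd vs \<phi>))))"

definition tempered :: "(('a::euclidean_space \<Rightarrow> complex) \<Rightarrow> complex) \<Rightarrow> bool" where
  "tempered T \<longleftrightarrow>
     (\<forall>\<phi> \<psi> c. schwartz_fun \<phi> \<longrightarrow> schwartz_fun \<psi> \<longrightarrow>
        T (\<lambda>x. \<phi> x + \<psi> x) = T \<phi> + T \<psi> \<and> T (\<lambda>x. c * \<phi> x) = c * T \<phi>) \<and>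
     (\<exists>C N. \<forall>\<phi>. schwartz_fun \<phi> \<longrightarrow>
        norm (T \<phi>) \<le> C * (\<Sum>vs\<in>deriv_lists N. \<Sum>k\<le>N.
            (SUP x. (1 + norm x) ^ k * norm (iterd vs \<phi> x))))"

text \<open>u \<in> L(D(R), S'(R^d)): linear, values tempered, continuous from D(R)
 into S'(R^d) with weak-* topology (i.e. each \<phi> \<mapsto> u \<phi> \<psi> is a distribution).
 The subspace of D'(R^{d+1}) consists of the U with <U, \<phi>\<otimes>\<psi>> = <u \<phi>, \<psi>>.
 Points of R^{d+1} are pairs (x,t).\<close>
definition LDS :: "(((real^'n::finite) \<times> real \<Rightarrow> complex) \<Rightarrow> complex) set" where
  "LDS = {U. distribution U \<and>
     (\<exists>u :: (real \<Rightarrow> complex) \<Rightarrow> (real^'n \<Rightarrow> complex) \<Rightarrow> complex.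
        (\<forall>\<phi>. test_fun \<phi> \<longrightarrow> tempered (u \<phi>)) \<and>
        (\<forall>\<phi>1 \<phi>2 c \<psi>. test_fun \<phi>1 \<longrightarrow> test_fun \<phi>2 \<longrightarrow> schwartz_fun \<psi> \<longrightarrow>
            u (\<lambda>t. \<phi>1 t + \<phi>2 t) \<psi> = u \<phi>1 \<psi> + u \<phi>2 \<psi> \<and>
            u (\<lambda>t. c * \<phi>1 t) \<psi> = c * u \<phi>1 \<psi>) \<and>
        (\<forall>\<psi>. schwartz_fun \<psi> \<longrightarrow> distribution (\<lambda>\<phi>. u \<phi> \<psi>)) \<and>
        (\<forall>\<phi> \<psi>. test_fun \<phi> \<longrightarrow> test_fun \<psi> \<longrightarrow>
            U (\<lambda>(x, t). \<phi> t * \<psi> x) = u \<phi> \<psi>))}"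

definition enum_idx :: "'n::finite list" where
  "enum_idx = (SOME xs. distinct xs \<and> set xs = UNIV)"

definition xdir :: "'n::finite \<Rightarrow> (real^'n) \<times> real" where
  "xdir i = (axis i 1, 0)"

definition tdir :: "(real^'n::finite) \<times> real" where
  "tdir = (0, 1)"

definition mono_dirs :: "('n::finite \<Rightarrow>\<^sub>0 nat) \<Rightarrow> nat \<Rightarrow> ((real^'n) \<times> real) list" where
  "mono_dirs \<alpha> j = replicate j tdir @ concat (map (\<lambda>i. replicate (Poly_Mapping.lookup \<alpha> i) (xdir i)) enum_idx)"

definition Dp :: "(nat \<Rightarrow>\<^sub>0 (('n::finite \<Rightarrow>\<^sub>0 nat) \<Rightarrow>\<^sub>0 complex)) \<Rightarrow> (((real^'n) \<times> real \<Rightarrow> complex) \<Rightarrow> complex)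
                  \<Rightarrow> ((real^'n) \<times> real \<Rightarrow> complex) \<Rightarrow> complex" where
  "Dp p U \<phi> = (\<Sum>j\<in>Poly_Mapping.keys p. \<Sum>\<alpha>\<in>Poly_Mapping.keys (Poly_Mapping.lookup p j).
       Poly_Mapping.lookup (Poly_Mapping.lookup p j) \<alpha> * (-1) ^ (length (mono_dirs \<alpha> j)) * U (iterd (mono_dirs \<alpha> j) \<phi>))"

definition NS :: "(((real^'n::finite) \<times> real \<Rightarrow> complex) \<Rightarrow> complex) set \<Rightarrow> (nat \<Rightarrow>\<^sub>0 (('n \<Rightarrow>\<^sub>0 nat) \<Rightarrow>\<^sub>0 complex))
                  \<Rightarrow> (((real^'n) \<times> real \<Rightarrow> complex) \<Rightarrow> complex) set" where
  "NS S p = {U\<in>S. (\<forall>\<phi>. test_fun \<phi> \<longrightarrow> Dp p U \<phi> = 0) \<and>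
                  (\<forall>\<phi> K. test_fun \<phi> \<longrightarrow> compact K \<longrightarrow> K \<subseteq> {(x, t). t < 0} \<longrightarrow>
                         supported_in \<phi> K \<longrightarrow> U \<phi> = 0)}"

definition trivial_NS :: "(((real^'n::finite) \<times> real \<Rightarrow> complex) \<Rightarrow> complex) set \<Rightarrow> bool" where
  "trivial_NS N \<longleftrightarrow> (\<forall>U\<in>N. \<forall>\<phi>. test_fun \<phi> \<longrightarrow> U \<phi> = 0)"

end

theory Submission
  imports Defs "HOL-Complex_Analysis.Complex_Analysis" "HOL-Real_Asymp.Real_Asymp"
begin

text \<open>If the coefficients \<open>a\<^sub>j\<close> have a common zero \<open>i y\<close>, then \<open>exp (i x \<bullet> y)\<close> tensored with any distribution
  in \<open>t\<close> supported at \<open>0\<close> is a nontrivial solution.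

  Conversely, test a solution in \<open>t\<close> against translates of a test function and take the Fourier
  transform in \<open>x\<close>. This gives a smooth family \<open>F\<close> of functionals on test functions of \<open>\<xi>\<close>, vanishing for
  small \<open>t\<close>, with \<open>\<Sum>\<^sub>j A\<^sub>j F\<^sup>(\<^sup>j\<^sup>) = 0\<close>, where \<open>A\<^sub>j \<xi> = a\<^sub>j (-i \<xi>)\<close>; by uniform boundedness the order \<open>N\<close> of
  \<open>F\<close> is locally uniform in \<open>t\<close>. One may assume that the \<open>A\<^sub>j\<close> are real. Integrating in \<open>t\<close>, the moments
  of \<open>F\<close> with respect to powers \<open>B\<^sup>r\<close> of the top coefficient \<open>B\<close> decay like \<open>K\<^sup>r / r!\<close>, so
  \<open>y \<mapsto> F (exp (i y B) g)\<close> extends to an entire function of order at most \<open>1/2\<close> which grows polynomially on the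
  real line. Hence it is a polynomial, and \<open>B\<^sup>N\<^sup>+\<^sup>1 F = 0\<close>. By induction on the degree, a power of every \<open>A\<^sub>j\<close>
  annihilates \<open>F\<close>, and if the \<open>A\<^sub>j\<close> have no common zero this forces \<open>F = 0\<close>.\<close>

section \<open>Smooth functions and iterated directional derivatives\<close>

text \<open>The obstacle is that the top coefficient may vanish somewhere while \<open>F\<close> is
  only a distribution in \<xi>: the relation can neither be divided by it nor solved pointwise in
  \<xi> as an ordinary differential equation. Powers of the top coefficient \<open>B\<close> avoid
  the division. The relation expresses the top derivative of the moment with
  \<open>B ^ (r + 1)\<close> by lower derivatives of moments with \<open>B ^ r\<close>; a lower
  derivative that vanishes in the past is the time integral of the next one, so each power gains a
  factor \<open>t / (r + 1)\<close>, whence \<open>K ^ r / r!\<close>. Expanding the exponential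
  supplies a second \<open>1 / r!\<close>, and coefficients of size \<open>K ^ r / (r!) ^ 2\<close>
  mean order at most 1/2. Order below 1 is what Phragmen-Lindelof needs in a half-plane. The
  coefficients are made real so that \<open>exp (i y B)\<close> has modulus 1; then only the
  \<open>N\<close> derivatives in the seminorm contribute powers of \<open>y\<close>. Temperedness
  in x enters through the existence of the Fourier transform; it is why only purely imaginary common
  zeros matter.\<close>

lemma dir_derivI:
  "((\<lambda>s. f (x + s *\<^sub>R b)) has_vector_derivative d) (at 0) \<Longrightarrow> dir_deriv b f x = d"
  unfolding dir_deriv_def by (rule vector_derivative_at)

lemma iterd_append: "iterd (us @ vs) f = iterd us (iterd vs f)"
  by (induction us) auto

text \<open>Smoothness speaks of all iterated derivatives, which rarely have a usable closed form.
  It suffices to place \<open>f\<close> in a class of continuous functions that contains the partial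
  derivatives of its members; by uniqueness of derivatives these are the values of
  \<open>dir_deriv\<close>.\<close>

lemma smooth_coinduct [consumes 1, case_names cont step]:
  assumes "P f"
    and cont: "\<And>g. P g \<Longrightarrow> continuous_on UNIV g"
    and step: "\<And>g b. P g \<Longrightarrow> b \<in> Basis \<Longrightarrow>
      \<exists>g'. P g' \<and> (\<forall>x. ((\<lambda>s. g (x + s *\<^sub>R b)) has_vector_derivative g' x) (at 0))"
  shows "smooth_fun f"
proof -
  have der: "P (dir_deriv b g) \<and> ((\<lambda>s. g (x + s *\<^sub>R b)) has_vector_derivative dir_deriv b g x) (at 0)"
    if Pg: "P g" "b \<in> Basis" for g b x
  proof -
    obtain g' where g': "P g'" "\<And>x. ((\<lambda>s. g (x + s *\<^sub>R b)) has_vector_derivative g' x) (at 0)"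
      using step[OF Pg] by blast
    have "dir_deriv b g = g'"
      using dir_derivI[OF g'(2)] by auto
    then show ?thesis using g' by auto
  qed
  have "P (iterd vs f)" if "set vs \<subseteq> Basis" for vs
    using that by (induction vs) (use assms(1) der in auto)
  then show ?thesis
    unfolding smooth_fun_def using cont der by auto
qed

lemma smooth_continuous: "smooth_fun f \<Longrightarrow> continuous_on UNIV f"
  unfolding smooth_fun_def by (metis empty_subsetI iterd.simps(1) list.set(1))

lemma smooth_deriv:
  "smooth_fun f \<Longrightarrow> b \<in> Basis \<Longrightarrow>
    ((\<lambda>s. f (x + s *\<^sub>R b)) has_vector_derivative dir_deriv b f x) (at 0)"
  unfolding smooth_fun_def by (metis empty_subsetI iterd.simps list.set(1))

lemma smooth_iterd:
  assumes "smooth_fun f" "set vs \<subseteq> Basis"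
  shows "smooth_fun (iterd vs f)"
  unfolding smooth_fun_def
proof (intro allI impI)
  fix us :: "'a list" assume us: "set us \<subseteq> Basis"
  have "set (us @ vs) \<subseteq> Basis" using us assms by auto
  then show "continuous_on UNIV (iterd us (iterd vs f)) \<and>
     (\<forall>b\<in>Basis. \<forall>x. ((\<lambda>s. iterd us (iterd vs f) (x + s *\<^sub>R b)) has_vector_derivative
        iterd (b # us) (iterd vs f) x) (at 0))"
    using assms(1)[unfolded smooth_fun_def, rule_format, of "us @ vs"]
    by (simp add: iterd_append)
qed

lemma smooth_dir_deriv: "smooth_fun f \<Longrightarrow> b \<in> Basis \<Longrightarrow> smooth_fun (dir_deriv b f)"
  using smooth_iterd[of f "[b]"] by simp

lemma smooth_continuous_iterd:
  "smooth_fun f \<Longrightarrow> set vs \<subseteq> Basis \<Longrightarrow> continuous_on S (iterd vs f)"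
  using smooth_iterd smooth_continuous continuous_on_subset by blast

section \<open>Closure of smooth functions under algebraic operations\<close>

lemma smooth_const [simp]: "smooth_fun (\<lambda>x. c)"
proof -
  have "\<exists>c. (\<lambda>x::'a. c :: complex) = (\<lambda>x. c)" by blast
  define P where "P g \<longleftrightarrow> (\<exists>c::complex. g = (\<lambda>x::'a. c))" for g
  have "P (\<lambda>x. c)" by (auto simp: P_def)
  then show ?thesis
  proof (induction rule: smooth_coinduct[where P=P])
    case (cont g) then show ?case by (auto simp: P_def)
  next
    case (step g b) then show ?case
      by (intro exI[of _ "\<lambda>x. 0"]) (auto simp: P_def)
  qed
qed

lemma dir_deriv_add:
  assumes "smooth_fun f" "smooth_fun g" "b \<in> Basis"
  shows "dir_deriv b (\<lambda>x. f x + g x) = (\<lambda>x. dir_deriv b f x + dir_deriv b g x)"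
  by (rule ext, rule dir_derivI) (intro has_vector_derivative_add smooth_deriv assms)

lemma dir_deriv_cmult:
  assumes "smooth_fun f" "b \<in> Basis"
  shows "dir_deriv b (\<lambda>x. c * f x) = (\<lambda>x. c * dir_deriv b f x)"
  by (rule ext, rule dir_derivI) (intro has_vector_derivative_mult_right smooth_deriv assms)

lemma dir_deriv_mult_has:
  assumes "smooth_fun f" "smooth_fun g" "b \<in> Basis"
  shows "((\<lambda>s. f (x + s *\<^sub>R b) * g (x + s *\<^sub>R b)) has_vector_derivative
     (dir_deriv b f x * g x + f x * dir_deriv b g x)) (at 0)"
  using has_vector_derivative_mult[OF smooth_deriv[OF assms(1,3)] smooth_deriv[OF assms(2,3)], of x x]
  by (simp add: add.commute)

lemma dir_deriv_mult:
  assumes "smooth_fun f" "smooth_fun g" "b \<in> Basis"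
  shows "dir_deriv b (\<lambda>x. f x * g x) = (\<lambda>x. dir_deriv b f x * g x + f x * dir_deriv b g x)"
  by (rule ext, rule dir_derivI) (intro dir_deriv_mult_has assms)

lemma smooth_add [intro]:
  assumes "smooth_fun f" "smooth_fun g"
  shows "smooth_fun (\<lambda>x. f x + g x)"
proof -
  define P where "P h \<longleftrightarrow> (\<exists>f g. smooth_fun f \<and> smooth_fun g \<and> h = (\<lambda>x::'a. f x + g x))" for h
  have "P (\<lambda>x. f x + g x)" using assms by (auto simp: P_def)
  then show ?thesis
  proof (induction rule: smooth_coinduct[where P=P])
    case (cont g)
    then show ?case by (auto simp: P_def intro: continuous_on_add dest: smooth_continuous)
  next
    case (step h b)
    then obtain f g where *: "smooth_fun f" "smooth_fun g" "h = (\<lambda>x. f x + g x)" by (auto simp: P_def)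
    show ?case
    proof (intro exI conjI allI)
      show "P (\<lambda>x. dir_deriv b f x + dir_deriv b g x)"
        using * step smooth_dir_deriv by (auto simp: P_def)
    next
      fix x show "((\<lambda>s. h (x + s *\<^sub>R b)) has_vector_derivative dir_deriv b f x + dir_deriv b g x) (at 0)"
        unfolding * by (intro has_vector_derivative_add smooth_deriv * step)
    qed
  qed
qed

text \<open>Products of two smooth functions are not visibly closed under differentiation, their
  finite sums are. This class serves as the predicate for \<open>smooth_coinduct\<close>.\<close>

inductive leibniz_span :: "('a::euclidean_space \<Rightarrow> complex) \<Rightarrow> bool" where
  "smooth_fun f \<Longrightarrow> smooth_fun g \<Longrightarrow> leibniz_span (\<lambda>x. f x * g x)"
| "leibniz_span f \<Longrightarrow> leibniz_span g \<Longrightarrow> leibniz_span (\<lambda>x. f x + g x)"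

lemma smooth_mult [intro]:
  assumes "smooth_fun f" "smooth_fun g"
  shows "smooth_fun (\<lambda>x. f x * g x)"
proof -
  have "leibniz_span (\<lambda>x. f x * g x)" using assms by (rule leibniz_span.intros)
  then show ?thesis
  proof (induction rule: smooth_coinduct[where P=leibniz_span])
    case (cont g)
    then show ?case by induction (auto intro: continuous_on_add continuous_on_mult dest: smooth_continuous)
  next
    case (step h b)
    from step(1) show ?case
    proof induction
      case (1 f g)
      show ?case
        by (rule exI[of _ "\<lambda>x. dir_deriv b f x * g x + f x * dir_deriv b g x"])
          (intro conjI allI dir_deriv_mult_has[OF 1 step(2)] leibniz_span.intros 1
            smooth_dir_deriv step)
    next
      case (2 f g)
      then obtain f' g' where "leibniz_span f'" "leibniz_span g'"
        "\<And>x. ((\<lambda>s. f (x + s *\<^sub>R b)) has_vector_derivative f' x) (at 0)"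
        "\<And>x. ((\<lambda>s. g (x + s *\<^sub>R b)) has_vector_derivative g' x) (at 0)" by blast
      then show ?case
        by (intro exI[of _ "\<lambda>x. f' x + g' x"]) (auto intro: leibniz_span.intros has_vector_derivative_add)
    qed
  qed
qed

lemma smooth_cmult [intro]: "smooth_fun f \<Longrightarrow> smooth_fun (\<lambda>x. c * f x)"
  by (intro smooth_mult smooth_const)

lemma smooth_uminus [intro]: "smooth_fun f \<Longrightarrow> smooth_fun (\<lambda>x. - f x)"
  using smooth_cmult[of f "-1"] by simp

lemma smooth_diff [intro]: "smooth_fun f \<Longrightarrow> smooth_fun g \<Longrightarrow> smooth_fun (\<lambda>x. f x - g x)"
  using smooth_add[of f "\<lambda>x. - g x"] smooth_uminus[of g] by simp

lemma smooth_power [intro]: "smooth_fun f \<Longrightarrow> smooth_fun (\<lambda>x. f x ^ n)"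
  by (induction n) auto

lemma smooth_sum [intro]: "(\<And>i. i \<in> A \<Longrightarrow> smooth_fun (f i)) \<Longrightarrow> smooth_fun (\<lambda>x. \<Sum>i\<in>A. f i x)"
  by (induction A rule: infinite_finite_induct) auto

lemma iterd_add:
  assumes "smooth_fun f" "smooth_fun g" "set vs \<subseteq> Basis"
  shows "iterd vs (\<lambda>x. f x + g x) = (\<lambda>x. iterd vs f x + iterd vs g x)"
  using assms(3) by (induction vs) (auto simp: dir_deriv_add smooth_iterd assms)

lemma iterd_cmult:
  assumes "smooth_fun f" "set vs \<subseteq> Basis"
  shows "iterd vs (\<lambda>x. c * f x) = (\<lambda>x. c * iterd vs f x)"
  using assms(2) by (induction vs) (auto simp: dir_deriv_cmult smooth_iterd assms)

lemma iterd_uminus: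
  assumes "smooth_fun f" "set vs \<subseteq> Basis"
  shows "iterd vs (\<lambda>x. - f x) = (\<lambda>x. - iterd vs f x)"
  using iterd_cmult[OF assms, of "-1"] by simp

lemma iterd_diff:
  assumes "smooth_fun f" "smooth_fun g" "set vs \<subseteq> Basis"
  shows "iterd vs (\<lambda>x. f x - g x) = (\<lambda>x. iterd vs f x - iterd vs g x)"
  using iterd_add[of f "\<lambda>x. - g x" vs] assms by (simp add: iterd_uminus smooth_uminus)

lemma iterd_const: "iterd vs (\<lambda>x. c) = (\<lambda>x. if vs = [] then c else 0)"
proof (induction vs)
  case (Cons b vs)
  have "dir_deriv b (\<lambda>x. k) y = 0" for k y
    by (rule dir_derivI) simp
  then show ?case by (simp add: Cons)
qed simp

lemma iterd_shift: "iterd vs (\<lambda>x. f (x + a)) = (\<lambda>x. iterd vs f (x + a))"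
  by (induction vs) (auto simp: dir_deriv_def fun_eq_iff algebra_simps)

lemma smooth_shift:
  assumes "smooth_fun f"
  shows "smooth_fun (\<lambda>x. f (x + a))"
  unfolding smooth_fun_def iterd_shift
proof (intro allI impI conjI ballI)
  fix vs :: "'a list" assume vs: "set vs \<subseteq> Basis"
  show "continuous_on UNIV (\<lambda>x. iterd vs f (x + a))"
    by (rule continuous_on_compose2[OF smooth_continuous_iterd[OF assms vs, of UNIV]])
      (auto intro!: continuous_intros)
  fix b x :: 'a assume b: "b \<in> Basis"
  show "((\<lambda>s. iterd vs f (x + s *\<^sub>R b + a)) has_vector_derivative iterd (b # vs) f (x + a)) (at 0)"
    using smooth_deriv[OF smooth_iterd[OF assms vs] b, of "x + a"]
    by (simp add: add_ac)
qed

lemma has_vector_derivative_scale0: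
  fixes f :: "'a::euclidean_space \<Rightarrow> complex"
  assumes "((\<lambda>s. f (r *\<^sub>R x + s *\<^sub>R b)) has_vector_derivative d) (at 0)"
  shows "((\<lambda>s. f (r *\<^sub>R (x + s *\<^sub>R b))) has_vector_derivative (of_real r * d)) (at 0)"
proof -
  have "((\<lambda>s. f (r *\<^sub>R x + s *\<^sub>R b)) has_vector_derivative d) (at (r * 0))" using assms by simp
  then have "((\<lambda>s. f (r *\<^sub>R x + s *\<^sub>R b)) \<circ> (\<lambda>s. r * s) has_vector_derivative (r *\<^sub>R d)) (at 0)"
    by (intro vector_diff_chain_at) (auto intro!: derivative_eq_intros)
  then show ?thesis by (simp add: o_def algebra_simps scaleR_conv_of_real)
qed

lemma smooth_scale_iterd:
  assumes "smooth_fun f"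
  shows "smooth_fun (\<lambda>x. f (r *\<^sub>R x))"
    and "set vs \<subseteq> Basis \<Longrightarrow> iterd vs (\<lambda>x. f (r *\<^sub>R x)) = (\<lambda>x. of_real r ^ length vs * iterd vs f (r *\<^sub>R x))"
proof -
  define P where "P h \<longleftrightarrow> (\<exists>c f. smooth_fun f \<and> h = (\<lambda>x::'a. c * f (r *\<^sub>R x)))" for h
  have "P (\<lambda>x. 1 * f (r *\<^sub>R x))" using assms unfolding P_def by blast
  then have "smooth_fun (\<lambda>x. 1 * f (r *\<^sub>R x))"
  proof (induction rule: smooth_coinduct[where P=P])
    case (cont g)
    then obtain c f where *: "smooth_fun f" "g = (\<lambda>x. c * f (r *\<^sub>R x))" by (auto simp: P_def)
    have "continuous_on UNIV (\<lambda>x. f (r *\<^sub>R x))"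
      by (rule continuous_on_compose2[OF smooth_continuous[OF *(1)]]) (auto intro: continuous_intros)
    then show ?case unfolding * by (intro continuous_on_mult continuous_on_const)
  next
    case (step h b)
    then obtain c f where *: "smooth_fun f" "h = (\<lambda>x. c * f (r *\<^sub>R x))" by (auto simp: P_def)
    show ?case
    proof (intro exI conjI allI)
      show "P (\<lambda>x. (c * of_real r) * dir_deriv b f (r *\<^sub>R x))"
        using smooth_dir_deriv[OF *(1) step(2)] unfolding P_def by blast
      show "((\<lambda>s. h (x + s *\<^sub>R b)) has_vector_derivative
         (c * of_real r) * dir_deriv b f (r *\<^sub>R x)) (at 0)" for x
        unfolding * mult.assoc
        by (intro has_vector_derivative_mult_right has_vector_derivative_scale0 smooth_deriv * step)
    qed
  qed
  then show "smooth_fun (\<lambda>x. f (r *\<^sub>R x))" by simp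
  show "iterd vs (\<lambda>x. f (r *\<^sub>R x)) = (\<lambda>x. of_real r ^ length vs * iterd vs f (r *\<^sub>R x))"
    if "set vs \<subseteq> Basis"
    using that
  proof (induction vs)
    case (Cons b vs)
    then have b: "b \<in> Basis" "set vs \<subseteq> Basis" by auto
    show ?case
    proof
      fix x
      have "((\<lambda>s. of_real r ^ length vs * iterd vs f (r *\<^sub>R (x + s *\<^sub>R b))) has_vector_derivative
         (of_real r ^ length vs * (of_real r * dir_deriv b (iterd vs f) (r *\<^sub>R x)))) (at 0)"
        by (intro has_vector_derivative_mult_right has_vector_derivative_scale0 smooth_deriv
            smooth_iterd assms b)
      then show "iterd (b # vs) (\<lambda>x. f (r *\<^sub>R x)) x = of_real r ^ length (b # vs) * iterd (b # vs) f (r *\<^sub>R x)"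
        using Cons b by (simp add: dir_derivI mult_ac)
    qed
  qed simp
qed

lemma hvd_inner:
  "((\<lambda>s. complex_of_real ((x + s *\<^sub>R b) \<bullet> v)) has_vector_derivative complex_of_real (b \<bullet> v)) (at 0)"
  unfolding has_vector_derivative_def inner_add_left inner_scaleR_left of_real_add of_real_mult
  by (auto intro!: derivative_eq_intros simp: scaleR_conv_of_real)

lemma smooth_inner [simp]: "smooth_fun (\<lambda>x. complex_of_real (x \<bullet> v))"
proof -
  define P where "P h \<longleftrightarrow> (h = (\<lambda>x::'a. complex_of_real (x \<bullet> v)) \<or> smooth_fun h)" for h
  have "P (\<lambda>x. complex_of_real (x \<bullet> v))" by (auto simp: P_def)
  then show ?thesis
  proof (induction rule: smooth_coinduct[where P=P])
    case (cont g)
    have "continuous_on UNIV (\<lambda>x::'a. complex_of_real (x \<bullet> v))" by (intro continuous_intros)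
    then show ?case using cont by (auto simp: P_def dest: smooth_continuous)
  next
    case (step h b)
    then consider "h = (\<lambda>x::'a. complex_of_real (x \<bullet> v))" | "smooth_fun h" by (auto simp: P_def)
    then show ?case
    proof cases
      case 1
      then show ?thesis
        by (intro exI[of _ "\<lambda>x. complex_of_real (b \<bullet> v)"]) (auto simp: P_def intro: hvd_inner)
    next
      case 2
      then show ?thesis using step smooth_deriv smooth_dir_deriv unfolding P_def by blast
    qed
  qed
qed

lemma hvd_compose:
  fixes x b :: "'a::euclidean_space"
  assumes "((\<lambda>s. f (x + s *\<^sub>R b)) has_vector_derivative d) (at (0::real))"
    and "(h has_field_derivative h') (at (f x))"
  shows "((\<lambda>s. h (f (x + s *\<^sub>R b))) has_vector_derivative (d * h')) (at 0)"
  using field_vector_diff_chain_at[of "\<lambda>s. f (x + s *\<^sub>R b)" d 0 h h'] assms by (auto simp: o_def)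

lemma dir_deriv_mult_exp_has:
  assumes "smooth_fun f" "smooth_fun B" "b \<in> Basis"
  shows "((\<lambda>s. f (x + s *\<^sub>R b) * exp (c * B (x + s *\<^sub>R b))) has_vector_derivative
     ((dir_deriv b f x + c * dir_deriv b B x * f x) * exp (c * B x))) (at 0)"
proof -
  have "((\<lambda>s. exp (c * B (x + s *\<^sub>R b))) has_vector_derivative dir_deriv b B x * (c * exp (c * B x))) (at 0)"
    by (rule hvd_compose[where h="\<lambda>z. exp (c * z)", OF smooth_deriv[OF assms(2,3)]])
      (auto intro!: derivative_eq_intros)
  from has_vector_derivative_mult[OF smooth_deriv[OF assms(1,3)] this, of x]
  show ?thesis by (simp add: algebra_simps)
qed

text \<open>Differentiation turns the factor \<open>f\<close> into
  \<open>dir_deriv b f + c * dir_deriv b B * f\<close> and leaves the exponential alone, so the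
  functions \<open>f * exp (c * B)\<close> with fixed \<open>c\<close> and \<open>B\<close> form a
  closed class.\<close>

lemma smooth_mult_exp:
  assumes "smooth_fun f" "smooth_fun B"
  shows "smooth_fun (\<lambda>x. f x * exp (c * B x))"
proof -
  define P where "P h \<longleftrightarrow> (\<exists>f. smooth_fun f \<and> h = (\<lambda>x::'a. f x * exp (c * B x)))" for h
  have "P (\<lambda>x. f x * exp (c * B x))" using assms by (auto simp: P_def)
  then show ?thesis
  proof (induction rule: smooth_coinduct[where P=P])
    case (cont g)
    then show ?case by (auto simp: P_def intro!: continuous_on_mult continuous_on_exp dest: smooth_continuous
          simp: smooth_continuous[OF assms(2)])
  next
    case (step h b)
    then obtain f where *: "smooth_fun f" "h = (\<lambda>x. f x * exp (c * B x))" by (auto simp: P_def)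
    show ?case
    proof (intro exI conjI allI)
      show "P (\<lambda>x. (dir_deriv b f x + c * dir_deriv b B x * f x) * exp (c * B x))"
        unfolding P_def
        by (rule exI[of _ "\<lambda>x. dir_deriv b f x + c * dir_deriv b B x * f x"])
          (intro conjI refl smooth_add smooth_mult smooth_cmult smooth_dir_deriv * assms step)
    qed (use dir_deriv_mult_exp_has[OF *(1) assms(2) step(2)] * in auto)
  qed
qed

lemma dir_deriv_mult_exp:
  assumes "smooth_fun f" "smooth_fun B" "b \<in> Basis"
  shows "dir_deriv b (\<lambda>x. f x * exp (c * B x)) =
     (\<lambda>x. (dir_deriv b f x + c * dir_deriv b B x * f x) * exp (c * B x))"
  by (rule ext, rule dir_derivI) (rule dir_deriv_mult_exp_has[OF assms])

lemma smooth_exp [intro]: "smooth_fun B \<Longrightarrow> smooth_fun (\<lambda>x. exp (c * B x))"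
  using smooth_mult_exp[of "\<lambda>x. 1" B c] by simp

text \<open>The quotient rule raises the power of the denominator, so the closed class consists of
  the functions \<open>f / q ^ n\<close> with all \<open>n\<close>.\<close>

lemma smooth_divide:
  assumes "smooth_fun f" "smooth_fun q" "\<And>x. q x \<noteq> 0"
  shows "smooth_fun (\<lambda>x. f x / q x)"
proof -
  define P where "P h \<longleftrightarrow> (\<exists>f n. smooth_fun f \<and> h = (\<lambda>x::'a. f x / q x ^ n))" for h
  have "P (\<lambda>x. f x / q x ^ 1)" unfolding P_def using assms(1) by blast
  then have "smooth_fun (\<lambda>x. f x / q x ^ 1)"
  proof (induction rule: smooth_coinduct[where P=P])
    case (cont g)
    then show ?case using assms(3) smooth_continuous[OF assms(2)]
      by (auto simp: P_def intro!: continuous_on_divide continuous_on_power dest: smooth_continuous)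
  next
    case (step h b)
    then obtain f n where *: "smooth_fun f" "h = (\<lambda>x. f x / q x ^ n)" by (auto simp: P_def)
    show ?case
    proof (intro exI conjI allI)
      show "P (\<lambda>x. (dir_deriv b f x * q x - of_nat n * f x * dir_deriv b q x) / q x ^ Suc n)"
        unfolding P_def
        by (rule exI[of _ "\<lambda>x. dir_deriv b f x * q x - of_nat n * f x * dir_deriv b q x"], rule exI[of _ "Suc n"])
          (intro conjI refl smooth_diff smooth_mult smooth_const smooth_dir_deriv * assms step)
      fix x
      have "((\<lambda>z. inverse (z ^ n)) has_field_derivative - of_nat n * inverse (q x ^ Suc n)) (at (q x))"
      proof (cases n)
        case (Suc m)
        have "((\<lambda>z. inverse (z ^ n)) has_field_derivative
            - (inverse (q x ^ n) * (of_nat n * q x ^ m) * inverse (q x ^ n))) (at (q x))"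
          using DERIV_inverse_fun[OF DERIV_power[OF DERIV_ident], of "q x" n UNIV] assms(3) Suc by (simp add: mult_ac)
        also have "- (inverse (q x ^ n) * (of_nat n * q x ^ m) * inverse (q x ^ n)) =
            - of_nat n * inverse (q x ^ Suc n)"
          using assms(3)[of x] by (simp add: Suc field_simps)
        finally show ?thesis .
      qed simp
      from hvd_compose[OF smooth_deriv[OF assms(2) step(2)] this]
      have "((\<lambda>s. inverse (q (x + s *\<^sub>R b) ^ n)) has_vector_derivative
           dir_deriv b q x * (- of_nat n * inverse (q x ^ Suc n))) (at 0)" .
      from has_vector_derivative_mult[OF smooth_deriv[OF *(1) step(2)] this, of x]
      show "((\<lambda>s. h (x + s *\<^sub>R b)) has_vector_derivative
         (dir_deriv b f x * q x - of_nat n * f x * dir_deriv b q x) / q x ^ Suc n) (at 0)"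
        using assms(3)[of x] by (simp add: * field_simps)
    qed
  qed
  then show ?thesis by simp
qed

section \<open>Weighted derivative bounds\<close>

text \<open>Seminorm estimates are stated as upper bounds instead of suprema, so that no boundedness
  has to be established beforehand. The weight selects the topology: \<open>1\<close> for functions
  with fixed compact support, \<open>sw k\<close> for Schwartz functions, an indicator for bounds on
  a compact set, and \<open>1 / (1 + norm x)\<close> for approximation errors that are small only
  relative to \<open>1 + norm x\<close>.\<close>

definition bndw :: "('a::euclidean_space \<Rightarrow> real) \<Rightarrow> nat \<Rightarrow> ('a \<Rightarrow> complex) \<Rightarrow> real \<Rightarrow> bool" where
  "bndw w N f C \<longleftrightarrow> (\<forall>vs x. set vs \<subseteq> Basis \<longrightarrow> length vs \<le> N \<longrightarrow> w x * norm (iterd vs f x) \<le> C)"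

lemma bndwD: "bndw w N f C \<Longrightarrow> set vs \<subseteq> Basis \<Longrightarrow> length vs \<le> N \<Longrightarrow> w x * norm (iterd vs f x) \<le> C"
  unfolding bndw_def by blast

lemma bndwD0: "bndw w N f C \<Longrightarrow> w x * norm (f x) \<le> C"
  using bndwD[of w N f C "[]"] by simp

lemma bndw_mono: "bndw w N f C \<Longrightarrow> M \<le> N \<Longrightarrow> C \<le> D \<Longrightarrow> bndw w M f D"
  unfolding bndw_def by (meson order_trans)

lemma bndw_nonneg: "bndw w N f C \<Longrightarrow> (\<And>x. 0 \<le> w x) \<Longrightarrow> 0 \<le> C"
  using bndwD0[of w N f C undefined] by (meson mult_nonneg_nonneg norm_ge_zero order_trans)

lemma bndw_0: "bndw w 0 f C \<longleftrightarrow> (\<forall>x. w x * norm (f x) \<le> C)"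
  unfolding bndw_def by auto

text \<open>The derivative split off is the innermost one, the last entry of the list, so the
  recursion replaces \<open>f\<close> by \<open>dir_deriv b f\<close>. This fits inductions on
  \<open>N\<close> in which the function is arbitrary.\<close>

lemma bndw_Suc: "bndw w (Suc N) f C \<longleftrightarrow> bndw w N f C \<and> (\<forall>b\<in>Basis. bndw w N (dir_deriv b f) C)"
proof (intro iffI conjI ballI)
  assume *: "bndw w (Suc N) f C"
  then show "bndw w N f C" by (rule bndw_mono) auto
  fix b :: 'a assume "b \<in> Basis"
  then show "bndw w N (dir_deriv b f) C"
    using * bndwD[OF *, of "_ @ [b]"] unfolding bndw_def[of w N] by (auto simp: iterd_append)
next
  assume *: "bndw w N f C \<and> (\<forall>b\<in>Basis. bndw w N (dir_deriv b f) C)"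
  show "bndw w (Suc N) f C"
    unfolding bndw_def
  proof (intro allI impI)
    fix vs :: "'a list" and x assume vs: "set vs \<subseteq> Basis" "length vs \<le> Suc N"
    show "w x * norm (iterd vs f x) \<le> C"
    proof (cases vs rule: rev_cases)
      case Nil
      then show ?thesis using * bndwD0 by auto
    next
      case (snoc us b)
      then show ?thesis using vs * bndwD[of w N "dir_deriv b f" C us x] by (auto simp: iterd_append)
    qed
  qed
qed

lemma bndw_add:
  assumes "bndw w N f A" "bndw w N g B" "smooth_fun f" "smooth_fun g" "\<And>x. 0 \<le> w x"
  shows "bndw w N (\<lambda>x. f x + g x) (A + B)"
  unfolding bndw_def
proof (intro allI impI)
  fix vs :: "'a list" and x assume vs: "set vs \<subseteq> Basis" "length vs \<le> N"
  have "w x * norm (iterd vs f x + iterd vs g x) \<le> w x * (norm (iterd vs f x) + norm (iterd vs g x))"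
    by (intro mult_left_mono norm_triangle_ineq assms)
  also have "\<dots> \<le> A + B"
    using bndwD[OF assms(1) vs, of x] bndwD[OF assms(2) vs, of x] by (simp add: algebra_simps)
  finally show "w x * norm (iterd vs (\<lambda>x. f x + g x) x) \<le> A + B"
    by (simp add: iterd_add assms vs)
qed

lemma bndw_cmult:
  assumes "bndw w N f A" "smooth_fun f"
  shows "bndw w N (\<lambda>x. c * f x) (norm c * A)"
  unfolding bndw_def
proof (intro allI impI)
  fix vs :: "'a list" and x assume vs: "set vs \<subseteq> Basis" "length vs \<le> N"
  have "norm c * (w x * norm (iterd vs f x)) \<le> norm c * A"
    by (intro mult_left_mono bndwD[OF assms(1) vs]) auto
  then show "w x * norm (iterd vs (\<lambda>x. c * f x) x) \<le> norm c * A"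
    by (simp add: iterd_cmult assms vs norm_mult algebra_simps)
qed

text \<open>The Leibniz rule doubles the number of terms at each derivative, which gives the factor
  \<open>2 ^ N\<close>.\<close>

lemma bndw_mult:
  assumes "bndw w1 N f A" "bndw w2 N g B" "smooth_fun f" "smooth_fun g"
    "\<And>x. 0 \<le> w1 x" "\<And>x. 0 \<le> w2 x"
  shows "bndw (\<lambda>x. w1 x * w2 x) N (\<lambda>x. f x * g x) (2 ^ N * (A * B))"
  using assms(1-4)
proof (induction N arbitrary: f g)
  case 0
  have "(w1 x * norm (f x)) * (w2 x * norm (g x)) \<le> A * B" for x
    using 0 bndw_nonneg[OF 0(1)] by (intro mult_mono) (auto simp: bndw_0 assms)
  then show ?case by (simp add: bndw_0 norm_mult algebra_simps)
next
  case (Suc N)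
  have AB: "0 \<le> A" "0 \<le> B" using bndw_nonneg Suc.prems assms by blast+
  have w: "\<And>x. 0 \<le> w1 x * w2 x" using assms by simp
  from Suc.prems have f: "bndw w1 N f A" "\<And>b. b \<in> Basis \<Longrightarrow> bndw w1 N (dir_deriv b f) A"
    and g: "bndw w2 N g B" "\<And>b. b \<in> Basis \<Longrightarrow> bndw w2 N (dir_deriv b g) B"
    by (auto simp: bndw_Suc)
  note sm = Suc.prems(3,4)
  have "bndw (\<lambda>x. w1 x * w2 x) N (\<lambda>x. f x * g x) (2 ^ Suc N * (A * B))"
    by (rule bndw_mono[OF Suc.IH[OF f(1) g(1) sm]]) (use AB in auto)
  moreover have "bndw (\<lambda>x. w1 x * w2 x) N (dir_deriv b (\<lambda>x. f x * g x)) (2 ^ Suc N * (A * B))"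
    if b: "b \<in> Basis" for b
    unfolding dir_deriv_mult[OF sm b]
    using bndw_add[OF Suc.IH[OF f(2)[OF b] g(1)] Suc.IH[OF f(1) g(2)[OF b]] _ _ w] sm b
    by (simp add: smooth_dir_deriv smooth_mult algebra_simps)
  ultimately show ?case by (auto simp: bndw_Suc)
qed

lemma supported_iterd:
  assumes "closed K" "supported_in f K"
  shows "supported_in (iterd vs f) K"
proof (induction vs)
  case (Cons b vs)
  show ?case unfolding supported_in_def
  proof (intro allI impI)
    fix x assume x: "x \<notin> K"
    have op: "open ((\<lambda>s. x + s *\<^sub>R b) -` (- K))"
      using assms(1) by (intro open_vimage) (auto intro!: continuous_intros)
    have "((\<lambda>s. iterd vs f (x + s *\<^sub>R b)) has_vector_derivative 0) (at 0)"
      by (rule has_vector_derivative_transform_within_open[OF has_vector_derivative_const[of 0] op])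
        (use x Cons in \<open>auto simp: supported_in_def\<close>)
    then show "iterd (b # vs) f x = 0" by (simp add: dir_derivI)
  qed
qed (use assms in simp)

lemma finite_deriv_lists [simp]: "finite (deriv_lists N :: 'a::euclidean_space list set)"
  using finite_lists_length_le[OF finite_Basis, of N] by (simp add: deriv_lists_def)

lemma deriv_lists_iff: "vs \<in> deriv_lists N \<longleftrightarrow> set vs \<subseteq> Basis \<and> length vs \<le> N"
  by (simp add: deriv_lists_def)

text \<open>There are only finitely many lists of basis vectors of length at most \<open>N\<close>,
  so bounds for the single derivatives add up to a common one.\<close>

lemma bndw_finite:
  assumes "\<And>vs. set vs \<subseteq> Basis \<Longrightarrow> length vs \<le> N \<Longrightarrow> \<exists>C. \<forall>x. w x * norm (iterd vs f x) \<le> C"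
  obtains C where "0 \<le> C" "bndw w N f C"
proof -
  obtain c where c: "\<And>vs x. vs \<in> deriv_lists N \<Longrightarrow> w x * norm (iterd vs f x) \<le> c vs"
    using assms unfolding deriv_lists_iff by metis
  have "bndw w N f (\<Sum>vs\<in>deriv_lists N. \<bar>c vs\<bar>)"
    unfolding bndw_def
  proof (intro allI impI)
    fix vs :: "'a list" and x assume "set vs \<subseteq> Basis" "length vs \<le> N"
    then have vs: "vs \<in> deriv_lists N" by (simp add: deriv_lists_iff)
    have "w x * norm (iterd vs f x) \<le> \<bar>c vs\<bar>" using c[OF vs, of x] by linarith
    also have "\<dots> \<le> (\<Sum>vs\<in>deriv_lists N. \<bar>c vs\<bar>)" by (rule member_le_sum[OF vs]) auto
    finally show "w x * norm (iterd vs f x) \<le> (\<Sum>vs\<in>deriv_lists N. \<bar>c vs\<bar>)" .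
  qed
  then show ?thesis using that[of "\<Sum>vs\<in>deriv_lists N. \<bar>c vs\<bar>"] by (simp add: sum_nonneg)
qed

lemma bndw_compact:
  assumes "smooth_fun f" "compact K"
  obtains C where "0 \<le> C" "bndw (indicat_real K) N f C"
proof (rule bndw_finite[where w="indicat_real K" and N=N and f=f])
  fix vs :: "'a list" assume "set vs \<subseteq> Basis"
  then have "compact (iterd vs f ` K)"
    by (intro compact_continuous_image smooth_continuous_iterd assms)
  then have "bounded (iterd vs f ` K)" by (rule compact_imp_bounded)
  then obtain B where "\<And>x. x \<in> K \<Longrightarrow> norm (iterd vs f x) \<le> B" unfolding bounded_iff by auto
  then show "\<exists>C. \<forall>x. indicat_real K x * norm (iterd vs f x) \<le> C"
    by (intro exI[of _ "max 0 B"]) (auto simp: indicator_def intro: max.coboundedI2)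
qed (use that in auto)

lemma bndw_supported:
  assumes "bndw (indicat_real K) N f C" "closed K" "supported_in f K" "0 \<le> C"
  shows "bndw (\<lambda>_. 1) N f C"
  unfolding bndw_def
proof (intro allI impI)
  fix vs :: "'a list" and x assume vs: "set vs \<subseteq> Basis" "length vs \<le> N"
  show "1 * norm (iterd vs f x) \<le> C"
  proof (cases "x \<in> K")
    case True
    then show ?thesis using bndwD[OF assms(1) vs, of x] by simp
  next
    case False
    then show ?thesis using supported_iterd[OF assms(2,3), of vs] assms(4) by (simp add: supported_in_def)
  qed
qed

lemma bndw_test:
  assumes "smooth_fun f" "compact K" "supported_in f K"
  obtains C where "0 \<le> C" "bndw (\<lambda>_. 1) N f C"
proof -
  obtain C where "0 \<le> C" "bndw (indicat_real K) N f C" using bndw_compact assms by blast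
  then show ?thesis using that bndw_supported assms compact_imp_closed by blast
qed

abbreviation sw :: "nat \<Rightarrow> 'a::euclidean_space \<Rightarrow> real" where
  "sw k x \<equiv> (1 + norm x) ^ k"

lemma sw_pos: "0 < sw k x" "0 \<le> sw k x"
  by (simp_all add: add_pos_nonneg)

lemma schwartz_bndw:
  assumes "schwartz_fun f"
  obtains C where "0 \<le> C" "bndw (sw k) N f C"
proof (rule bndw_finite[where w="sw k" and N=N and f=f])
  fix vs :: "'a list" assume vs: "set vs \<subseteq> Basis"
  then have "bounded (range (\<lambda>x. sw k x * norm (iterd vs f x)))"
    using assms by (auto simp: schwartz_fun_def)
  then obtain B where "\<And>x. norm (sw k x * norm (iterd vs f x)) \<le> B" unfolding bounded_iff by auto
  then show "\<exists>C. \<forall>x. sw k x * norm (iterd vs f x) \<le> C"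
    by (metis abs_le_D1 real_norm_def)
qed (use that in auto)

lemma schwartzI:
  assumes "smooth_fun f" "\<And>k N. \<exists>C. bndw (sw k) N f C"
  shows "schwartz_fun f"
  unfolding schwartz_fun_def
proof (intro conjI allI impI assms(1))
  fix vs :: "'a list" and k assume vs: "set vs \<subseteq> Basis"
  obtain C where C: "bndw (sw k) (length vs) f C" using assms(2) by blast
  show "bounded (range (\<lambda>x. sw k x * norm (iterd vs f x)))"
    unfolding bounded_iff using bndwD[OF C vs order_refl] by (intro exI[of _ C]) (auto simp: abs_mult)
qed

lemma bndw_sw_mono:
  assumes "bndw (sw k) N f C" "j \<le> k" "M \<le> N"
  shows "bndw (sw j) M f C"
  unfolding bndw_def
proof (intro allI impI)
  fix vs :: "'a list" and x assume vs: "set vs \<subseteq> Basis" "length vs \<le> M"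
  have "sw j x * norm (iterd vs f x) \<le> sw k x * norm (iterd vs f x)"
    by (intro mult_right_mono power_increasing assms) auto
  also have "\<dots> \<le> C" using vs assms by (intro bndwD[OF assms(1)]) auto
  finally show "sw j x * norm (iterd vs f x) \<le> C" .
qed

section \<open>Schwartz functions and test functions\<close>

lemma schwartz_smooth: "schwartz_fun f \<Longrightarrow> smooth_fun f"
  by (simp add: schwartz_fun_def)

lemma test_smooth: "test_fun f \<Longrightarrow> smooth_fun f"
  by (simp add: test_fun_def)

lemma test_schwartz:
  assumes "test_fun f"
  shows "schwartz_fun f"
proof (rule schwartzI)
  obtain K where K: "compact K" "supported_in f K" "smooth_fun f" using assms by (auto simp: test_fun_def)
  show "smooth_fun f" by fact
  fix k N
  obtain R where R: "0 < R" "\<And>x. x \<in> K \<Longrightarrow> norm x \<le> R"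
    using compact_imp_bounded[OF K(1)] by (meson bounded_pos)
  obtain C where C: "0 \<le> C" "bndw (\<lambda>_. 1) N f C" using bndw_test K by blast
  have "bndw (sw k) N f ((1 + R) ^ k * C)"
    unfolding bndw_def
  proof (intro allI impI)
    fix vs :: "'a list" and x assume vs: "set vs \<subseteq> Basis" "length vs \<le> N"
    show "sw k x * norm (iterd vs f x) \<le> (1 + R) ^ k * C"
    proof (cases "x \<in> K")
      case True
      then show ?thesis using bndwD[OF C(2) vs, of x] R C by (intro mult_mono power_mono) auto
    next
      case False
      then show ?thesis using supported_iterd[OF compact_imp_closed K(2), of vs] K R C
        by (simp add: supported_in_def)
    qed
  qed
  then show "\<exists>C. bndw (sw k) N f C" by blast
qed

lemma schwartz_cmult:
  "schwartz_fun f \<Longrightarrow> schwartz_fun (\<lambda>x. c * f x)"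
proof (rule schwartzI)
  assume f: "schwartz_fun f"
  show "smooth_fun (\<lambda>x. c * f x)" by (intro smooth_cmult schwartz_smooth f)
  fix k N
  obtain C where "bndw (sw k) N f C" using schwartz_bndw[OF f] by blast
  from bndw_cmult[OF this schwartz_smooth[OF f]]
  show "\<exists>C. bndw (sw k) N (\<lambda>x. c * f x) C" by blast
qed

lemma schwartz_add:
  assumes "schwartz_fun f" "schwartz_fun g"
  shows "schwartz_fun (\<lambda>x. f x + g x)"
proof (rule schwartzI)
  show "smooth_fun (\<lambda>x. f x + g x)" using assms schwartz_smooth by blast
  fix k N
  obtain A B where "bndw (sw k) N f A" "bndw (sw k) N g B" using schwartz_bndw assms by metis
  from bndw_add[OF this] show "\<exists>C. bndw (sw k) N (\<lambda>x. f x + g x) C"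
    using assms schwartz_smooth sw_pos by blast
qed

lemma schwartz_iterd:
  assumes "schwartz_fun f" "set vs \<subseteq> Basis"
  shows "schwartz_fun (iterd vs f)"
proof -
  have "set (us @ vs) \<subseteq> Basis" if "set us \<subseteq> Basis" for us using that assms by auto
  then show ?thesis
    using assms unfolding schwartz_fun_def iterd_append[symmetric] by (auto intro: smooth_iterd)
qed

lemma test_cmult: "test_fun f \<Longrightarrow> test_fun (\<lambda>x. c * f x)"
  unfolding test_fun_def by (auto simp: supported_in_def)

lemma test_mult: "test_fun f \<Longrightarrow> smooth_fun g \<Longrightarrow> test_fun (\<lambda>x. g x * f x)"
  unfolding test_fun_def by (auto simp: supported_in_def)

lemma test_add:
  assumes "test_fun f" "test_fun g"
  shows "test_fun (\<lambda>x. f x + g x)"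
proof -
  obtain K L where "compact K" "supported_in f K" "compact L" "supported_in g L" using assms by (auto simp: test_fun_def)
  then have "compact (K \<union> L)" "supported_in (\<lambda>x. f x + g x) (K \<union> L)" by (auto simp: supported_in_def)
  then show ?thesis using assms unfolding test_fun_def by blast
qed

lemma test_iterd: "test_fun f \<Longrightarrow> set vs \<subseteq> Basis \<Longrightarrow> test_fun (iterd vs f)"
  unfolding test_fun_def using smooth_iterd supported_iterd compact_imp_closed by metis

lemma test_shift:
  assumes "test_fun f"
  shows "test_fun (\<lambda>x. f (x + a))"
proof -
  obtain K where K: "compact K" "supported_in f K" using assms by (auto simp: test_fun_def)
  have "compact ((+) (- a) ` K)" by (intro compact_continuous_image K continuous_intros)
  moreover have "supported_in (\<lambda>x. f (x + a)) ((+) (- a) ` K)"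
    using K(2) unfolding supported_in_def by (metis add.commute add_minus_cancel image_eqI)
  ultimately show ?thesis using assms smooth_shift unfolding test_fun_def by blast
qed

lemma test_scale:
  assumes "test_fun f" "r \<noteq> 0"
  shows "test_fun (\<lambda>x. f (r *\<^sub>R x))"
proof -
  obtain K where K: "compact K" "supported_in f K" using assms by (auto simp: test_fun_def)
  have "compact ((\<lambda>x. inverse r *\<^sub>R x) ` K)" by (intro compact_continuous_image K continuous_intros)
  moreover have "supported_in (\<lambda>x. f (r *\<^sub>R x)) ((\<lambda>x. inverse r *\<^sub>R x) ` K)"
    unfolding supported_in_def
  proof (intro allI impI)
    fix x assume x: "x \<notin> (\<lambda>x. inverse r *\<^sub>R x) ` K"
    have "r *\<^sub>R x \<notin> K"
    proof
      assume "r *\<^sub>R x \<in> K"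
      then have "inverse r *\<^sub>R r *\<^sub>R x \<in> (\<lambda>x. inverse r *\<^sub>R x) ` K" by blast
      with x assms(2) show False by simp
    qed
    then show "f (r *\<^sub>R x) = 0" using K by (simp add: supported_in_def)
  qed
  ultimately show ?thesis using assms smooth_scale_iterd(1) unfolding test_fun_def by blast
qed

text \<open>The constants in \<open>distribution\<close> and \<open>tempered\<close> carry no sign
  condition; passing to the absolute value uses that the sum of seminorms is nonnegative.\<close>

lemma abs_const_bound:
  fixes x C S T :: real
  assumes "x \<le> C * S" "0 \<le> S" "S \<le> T"
  shows "x \<le> \<bar>C\<bar> * T"
  using assms(1) mult_right_mono[OF abs_ge_self assms(2), of C] mult_left_mono[OF assms(3) abs_ge_zero, of C]
  by linarith

text \<open>A single \<open>bndw\<close> bound of order \<open>N\<close> controls every seminorm in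
  the definition, since lower weights are dominated by \<open>sw N\<close>; the constant absorbs the
  number of summands.\<close>

lemma tempered_bound:
  assumes "tempered (T :: ('a::euclidean_space \<Rightarrow> complex) \<Rightarrow> complex)"
  obtains C N where "0 \<le> C" "\<And>f B. schwartz_fun f \<Longrightarrow> bndw (sw N) N f B \<Longrightarrow> norm (T f) \<le> C * B"
proof -
  obtain C N where T: "\<And>\<phi>. schwartz_fun \<phi> \<Longrightarrow>
        norm (T \<phi>) \<le> C * (\<Sum>vs\<in>deriv_lists N. \<Sum>k\<le>N. (SUP x. sw k x * norm (iterd vs \<phi> x)))"
    using assms unfolding tempered_def by blast
  have "norm (T f) \<le> (\<bar>C\<bar> * (\<Sum>vs\<in>(deriv_lists N :: 'a list set). \<Sum>k\<le>N. 1)) * B"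
    if f: "schwartz_fun f" "bndw (sw N) N f B" for f B
  proof -
    have "(\<Sum>vs\<in>deriv_lists N. \<Sum>k\<le>N. (SUP x. sw k x * norm (iterd vs f x))) \<le>
       (\<Sum>vs\<in>(deriv_lists N :: 'a list set). \<Sum>k\<le>N. B)"
      using bndwD[OF bndw_sw_mono[OF f(2) _ order_refl]]
      by (intro sum_mono cSUP_least) (auto simp: deriv_lists_iff)
    moreover have "0 \<le> (\<Sum>vs\<in>deriv_lists N. \<Sum>k\<le>N. (SUP x. sw k x * norm (iterd vs f x)))"
      using f(1) by (intro sum_nonneg cSUP_upper2[where x=undefined] bounded_imp_bdd_above)
        (auto simp: deriv_lists_iff schwartz_fun_def)
    ultimately show ?thesis
      using abs_const_bound[OF T[OF f(1)]] by (simp add: sum_distrib_left sum_distrib_right mult.assoc)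
  qed
  then show ?thesis using that[of "\<bar>C\<bar> * (\<Sum>vs\<in>(deriv_lists N :: 'a list set). \<Sum>k\<le>N. 1)" N]
    by (simp add: sum_nonneg)
qed

text \<open>Conversely, the sum of the suprema in the definition is an admissible
  \<open>bndw\<close> bound, because each supremum is finite and nonnegative.\<close>

lemma temperedI:
  assumes "\<And>f g. schwartz_fun f \<Longrightarrow> schwartz_fun g \<Longrightarrow> T (\<lambda>x. f x + g x) = T f + T g"
    and "\<And>f c. schwartz_fun f \<Longrightarrow> T (\<lambda>x. c * f x) = c * T f"
    and "\<And>f B. schwartz_fun f \<Longrightarrow> bndw (sw N) N f B \<Longrightarrow> norm (T f) \<le> C * B"
  shows "tempered T"
  unfolding tempered_def
proof (intro conjI allI impI exI)
  fix f :: "'a \<Rightarrow> complex" assume f: "schwartz_fun f"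
  have bdd: "bdd_above (range (\<lambda>x. sw k x * norm (iterd vs f x)))" if "vs \<in> deriv_lists N" for vs k
    using f that by (intro bounded_imp_bdd_above) (auto simp: deriv_lists_iff schwartz_fun_def)
  have nn: "0 \<le> (SUP x. sw k x * norm (iterd vs f x))" if "vs \<in> deriv_lists N" for vs k
    by (rule cSUP_upper2[OF bdd[OF that], of undefined]) auto
  have "bndw (sw N) N f (\<Sum>vs\<in>deriv_lists N. \<Sum>k\<le>N. (SUP x. sw k x * norm (iterd vs f x)))"
    unfolding bndw_def
  proof (intro allI impI)
    fix vs :: "'a list" and x assume "set vs \<subseteq> Basis" "length vs \<le> N"
    then have vs: "vs \<in> deriv_lists N" by (simp add: deriv_lists_iff)
    have "sw N x * norm (iterd vs f x) \<le> (SUP x. sw N x * norm (iterd vs f x))"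
      by (rule cSUP_upper[OF _ bdd[OF vs]]) simp
    also have "\<dots> \<le> (\<Sum>k\<le>N. (SUP x. sw k x * norm (iterd vs f x)))"
      by (rule member_le_sum[where f="\<lambda>k. (SUP x. sw k x * norm (iterd vs f x))"]) (auto intro: nn vs)
    also have "\<dots> \<le> (\<Sum>vs\<in>deriv_lists N. \<Sum>k\<le>N. (SUP x. sw k x * norm (iterd vs f x)))"
      by (rule member_le_sum[OF vs, where f="\<lambda>vs. \<Sum>k\<le>N. (SUP x. sw k x * norm (iterd vs f x))"])
        (auto intro!: nn sum_nonneg)
    finally show "sw N x * norm (iterd vs f x) \<le> (\<Sum>vs\<in>deriv_lists N. \<Sum>k\<le>N. (SUP x. sw k x * norm (iterd vs f x)))" .
  qed
  from assms(3)[OF f this]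
  show "norm (T f) \<le> C * (\<Sum>vs\<in>deriv_lists N. \<Sum>k\<le>N. (SUP x. sw k x * norm (iterd vs f x)))" .
qed (use assms in auto)

lemma distribution_bound:
  assumes "distribution (U :: ('a::euclidean_space \<Rightarrow> complex) \<Rightarrow> complex)" "compact K"
  obtains C N where "0 \<le> C" "\<And>f B. test_fun f \<Longrightarrow> supported_in f K \<Longrightarrow> bndw (\<lambda>_. 1) N f B \<Longrightarrow> norm (U f) \<le> C * B"
proof -
  obtain C N where U: "\<And>\<phi>. test_fun \<phi> \<Longrightarrow> supported_in \<phi> K \<Longrightarrow>
        norm (U \<phi>) \<le> C * (\<Sum>vs\<in>deriv_lists N. sup_norm (iterd vs \<phi>))"
    using assms unfolding distribution_def by meson
  have "norm (U f) \<le> (\<bar>C\<bar> * (\<Sum>vs\<in>(deriv_lists N :: 'a list set). 1)) * B"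
    if f: "test_fun f" "supported_in f K" "bndw (\<lambda>_. 1) N f B" for f B
  proof -
    have le: "norm (iterd vs f x) \<le> B" if "vs \<in> deriv_lists N" for vs x
      using bndwD[OF f(3), of vs x] that by (simp add: deriv_lists_iff)
    have "(\<Sum>vs\<in>deriv_lists N. sup_norm (iterd vs f)) \<le> (\<Sum>vs\<in>(deriv_lists N :: 'a list set). B)"
      unfolding sup_norm_def by (intro sum_mono cSUP_least le) auto
    moreover have "0 \<le> (\<Sum>vs\<in>deriv_lists N. sup_norm (iterd vs f))"
      unfolding sup_norm_def by (intro sum_nonneg cSUP_upper2[where x=undefined] bdd_aboveI2[OF le]) auto
    ultimately show ?thesis
      using abs_const_bound[OF U[OF f(1,2)]] by (simp add: sum_distrib_left sum_distrib_right mult.assoc)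
  qed
  then show ?thesis using that[of "\<bar>C\<bar> * (\<Sum>vs\<in>(deriv_lists N :: 'a list set). 1)" N]
    by (simp add: sum_nonneg)
qed

lemma distributionI:
  assumes "\<And>f g. test_fun f \<Longrightarrow> test_fun g \<Longrightarrow> U (\<lambda>x. f x + g x) = U f + U g"
    and "\<And>f c. test_fun f \<Longrightarrow> U (\<lambda>x. c * f x) = c * U f"
    and "\<And>K. compact K \<Longrightarrow> \<exists>C N. \<forall>f B. test_fun f \<longrightarrow> supported_in f K \<longrightarrow> bndw (\<lambda>_. 1) N f B \<longrightarrow> norm (U f) \<le> C * B"
  shows "distribution U"
  unfolding distribution_def
proof (intro conjI allI impI)
  fix K :: "'a set" assume "compact K"
  then obtain C N where U: "\<And>f B. test_fun f \<Longrightarrow> supported_in f K \<Longrightarrow> bndw (\<lambda>_. 1) N f B \<Longrightarrow> norm (U f) \<le> C * B"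
    using assms(3) by blast
  show "\<exists>C N. \<forall>\<phi>. test_fun \<phi> \<longrightarrow> supported_in \<phi> K \<longrightarrow> norm (U \<phi>) \<le> C * (\<Sum>vs\<in>deriv_lists N. sup_norm (iterd vs \<phi>))"
  proof (intro exI[of _ C] exI[of _ N] allI impI U)
    fix f :: "'a \<Rightarrow> complex" assume f: "test_fun f"
    obtain B where B: "bndw (\<lambda>_. 1) N f B" using f bndw_test unfolding test_fun_def by metis
    have bdd: "bdd_above (range (\<lambda>x. norm (iterd vs f x)))" if "vs \<in> deriv_lists N" for vs
      using bndwD[OF B, of vs] that by (intro bdd_aboveI2[of _ _ B]) (auto simp: deriv_lists_iff)
    have nn: "0 \<le> sup_norm (iterd vs f)" if "vs \<in> deriv_lists N" for vs
      unfolding sup_norm_def by (rule cSUP_upper2[OF bdd[OF that], of undefined]) auto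
    show "bndw (\<lambda>_. 1) N f (\<Sum>vs\<in>deriv_lists N. sup_norm (iterd vs f))"
      unfolding bndw_def
    proof (intro allI impI)
      fix vs :: "'a list" and x assume "set vs \<subseteq> Basis" "length vs \<le> N"
      then have vs: "vs \<in> deriv_lists N" by (simp add: deriv_lists_iff)
      have "1 * norm (iterd vs f x) \<le> sup_norm (iterd vs f)"
        unfolding sup_norm_def mult_1 by (rule cSUP_upper[OF _ bdd[OF vs]]) simp
      also have "\<dots> \<le> (\<Sum>vs\<in>deriv_lists N. sup_norm (iterd vs f))"
        by (rule member_le_sum[OF vs, where f="\<lambda>vs. sup_norm (iterd vs f)"]) (auto intro!: nn)
      finally show "1 * norm (iterd vs f x) \<le> (\<Sum>vs\<in>deriv_lists N. sup_norm (iterd vs f))" .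
    qed
  qed
qed (use assms in auto)

section \<open>Bump functions, tensor products and cutoffs\<close>

text \<open>The functions \<open>exp (-1/s) / s^j\<close> on \<open>s > 0\<close>, extended by \<open>0\<close>, form a family closed under
  differentiation.\<close>

definition flat :: "nat \<Rightarrow> real \<Rightarrow> real" where
  "flat j s = (if s \<le> 0 then 0 else exp (- inverse s) * inverse s ^ j)"

text \<open>From the right, substituting \<open>inverse s\<close> reduces this to the domination of
  powers by the exponential.\<close>

lemma flat_tendsto_0: "((\<lambda>s. flat j s) \<longlongrightarrow> 0) (at 0)"
proof (rule filterlim_split_at)
  have "eventually (\<lambda>s. 0 = flat j s) (at_left (0::real))"
    by (auto simp: eventually_at_filter flat_def)
  then show "((\<lambda>s. flat j s) \<longlongrightarrow> 0) (at_left 0)"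
    by (rule Lim_transform_eventually[OF tendsto_const])
  have "((\<lambda>s. inverse s ^ j / exp (inverse s)) \<longlongrightarrow> 0) (at_right (0::real))"
    by (rule filterlim_compose[OF tendsto_power_div_exp_0 filterlim_inverse_at_top_right])
  moreover have "eventually (\<lambda>s. inverse s ^ j / exp (inverse s) = flat j s) (at_right (0::real))"
    by (auto simp: eventually_at_filter flat_def exp_minus field_simps)
  ultimately show "((\<lambda>s. flat j s) \<longlongrightarrow> 0) (at_right 0)"
    by (rule Lim_transform_eventually)
qed

lemma flat_deriv:
  "(flat j has_real_derivative (flat (Suc (Suc j)) s - of_nat j * flat (Suc j) s)) (at s)"
proof -
  consider "s < 0" | "s = 0" | "s > 0" by linarith
  then show ?thesis
  proof cases
    case 1
    have "((\<lambda>s. 0) has_real_derivative 0) (at s)" by simp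
    then have "(flat j has_real_derivative 0) (at s)"
      by (rule DERIV_cong_ev[THEN iffD1, rotated -1, OF _ refl _ refl])
        (use 1 in \<open>auto simp: flat_def intro!: eventually_nhds_in_open[of "{..<0}", THEN eventually_mono]\<close>)
    then show ?thesis using 1 by (simp add: flat_def)
  next
    case 2
    \<comment> \<open>At the origin the difference quotient of \<open>flat j\<close> is
      \<open>flat (Suc j)\<close>, which tends to 0.\<close>
    have "((\<lambda>h. (flat j (0 + h) - flat j 0) / h) \<longlongrightarrow> 0) (at 0)"
      by (rule Lim_transform_eventually[OF flat_tendsto_0[of "Suc j"]])
        (auto simp: eventually_at_filter flat_def field_simps)
    then show ?thesis using 2 by (simp add: DERIV_def flat_def)
  next
    case 3
    have "((\<lambda>s. exp (- inverse s) * inverse s ^ j) has_real_derivative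
        (flat (Suc (Suc j)) s - of_nat j * flat (Suc j) s)) (at s)"
    proof -
      have inv: "(inverse has_real_derivative - (inverse s * inverse s)) (at s)"
        using DERIV_inverse[of s UNIV] 3 by (simp add: power2_eq_square)
      have pow: "((\<lambda>s. inverse s ^ j) has_real_derivative
          of_nat j * (- (inverse s * inverse s) * inverse s ^ (j - Suc 0))) (at s)"
        by (rule DERIV_power[OF inv])
      have ex: "((\<lambda>s. exp (- inverse s)) has_real_derivative
          exp (- inverse s) * - (- (inverse s * inverse s))) (at s)"
        by (rule DERIV_chain2[OF DERIV_exp DERIV_minus[OF inv]])
      show ?thesis
        by (rule DERIV_cong[OF DERIV_mult[OF ex pow]])
          (use 3 in \<open>cases j; simp add: flat_def algebra_simps\<close>)
    qed
    then show ?thesis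
      by (rule DERIV_cong_ev[THEN iffD1, rotated -1, OF _ refl _ refl])
        (use 3 in \<open>auto simp: flat_def intro!: eventually_nhds_in_open[of "{0<..}", THEN eventually_mono]\<close>)
  qed
qed

text \<open>Composing with \<open>1 - x \<bullet> x\<close> brings in polynomial factors and raises
  the index of \<open>flat\<close>; sums enter because one derivative yields several such
  terms.\<close>

inductive bump_span :: "('a::euclidean_space \<Rightarrow> complex) \<Rightarrow> bool" where
  "smooth_fun g \<Longrightarrow> bump_span (\<lambda>x. g x * of_real (flat j (1 - x \<bullet> x)))"
| "bump_span f \<Longrightarrow> bump_span g \<Longrightarrow> bump_span (\<lambda>x. f x + g x)"

lemma flat_quad_deriv:
  fixes x b :: "'a::euclidean_space"
  shows "((\<lambda>s. complex_of_real (flat j (1 - (x + s *\<^sub>R b) \<bullet> (x + s *\<^sub>R b)))) has_vector_derivative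
     of_real (- 2 * (x \<bullet> b) * (flat (Suc (Suc j)) (1 - x \<bullet> x) - of_nat j * flat (Suc j) (1 - x \<bullet> x)))) (at 0)"
proof -
  have *: "((\<lambda>s. 1 - (x + s *\<^sub>R b) \<bullet> (x + s *\<^sub>R b)) has_real_derivative - 2 * (x \<bullet> b)) (at 0)"
    by (auto intro!: derivative_eq_intros simp: inner_add_left inner_add_right inner_commute)
  have "((\<lambda>s. flat j (1 - (x + s *\<^sub>R b) \<bullet> (x + s *\<^sub>R b))) has_real_derivative
     (flat (Suc (Suc j)) (1 - x \<bullet> x) - of_nat j * flat (Suc j) (1 - x \<bullet> x)) * (- 2 * (x \<bullet> b))) (at 0)"
    by (rule DERIV_chain2[OF _ *]) (use flat_deriv in simp)
  from has_vector_derivative_of_real[OF this] show ?thesis by (simp only: mult.commute)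
qed

lemma continuous_flat: "continuous_on S (flat j)"
  by (meson DERIV_isCont continuous_at_imp_continuous_on flat_deriv)

lemma smooth_bump_span:
  assumes "bump_span f"
  shows "smooth_fun f"
  using assms
proof (induction rule: smooth_coinduct[where P=bump_span])
  case (cont g)
  then show ?case
  proof induction
    case (1 g j)
    have "continuous_on UNIV (\<lambda>x::'a. flat j (1 - x \<bullet> x))"
      by (rule continuous_on_compose2[OF continuous_flat[of UNIV]]) (auto intro!: continuous_intros)
    then show ?case by (intro continuous_on_mult smooth_continuous[OF 1] continuous_on_of_real)
  next
    case (2 f g)
    then show ?case by (intro continuous_on_add)
  qed
next
  case (step g b)
  from step(1) show ?case
  proof induction
    case (1 g j)
    let ?g' = "\<lambda>x. dir_deriv b g x * of_real (flat j (1 - x \<bullet> x))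
      + ((g x * (- 2 * of_real (x \<bullet> b))) * of_real (flat (Suc (Suc j)) (1 - x \<bullet> x))
      + (g x * (2 * of_nat j * of_real (x \<bullet> b))) * of_real (flat (Suc j) (1 - x \<bullet> x)))"
    have "bump_span ?g'"
      by (intro bump_span.intros smooth_dir_deriv smooth_mult 1 step smooth_const smooth_inner)
    moreover have "((\<lambda>s. g (x + s *\<^sub>R b) * of_real (flat j (1 - (x + s *\<^sub>R b) \<bullet> (x + s *\<^sub>R b))))
       has_vector_derivative ?g' x) (at 0)" for x
      using has_vector_derivative_mult[OF smooth_deriv[OF 1 step(2)] flat_quad_deriv, of x j x]
      by (simp add: algebra_simps)
    ultimately show ?case by (intro exI[of _ ?g']) blast
  next
    case (2 f g)
    then obtain f' g' where "bump_span f'" "bump_span g'"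
      "\<And>x. ((\<lambda>s. f (x + s *\<^sub>R b)) has_vector_derivative f' x) (at 0)"
      "\<And>x. ((\<lambda>s. g (x + s *\<^sub>R b)) has_vector_derivative g' x) (at 0)" by blast
    then show ?case
      by (intro exI[of _ "\<lambda>x. f' x + g' x"]) (auto intro: bump_span.intros has_vector_derivative_add)
  qed
qed

text \<open>The factor \<open>exp 1\<close> normalises the value at the origin to 1, so that the
  dilates by \<open>\<epsilon>\<close> tend to 1 as \<open>\<epsilon>\<close> tends to 0 and serve
  as cutoffs. The real-valued version is kept for the positivity of the integral.\<close>

definition bumpr :: "'a::euclidean_space \<Rightarrow> real" where
  "bumpr x = exp 1 * flat 0 (1 - x \<bullet> x)"

definition bump :: "'a::euclidean_space \<Rightarrow> complex" where
  "bump x = of_real (bumpr x)"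

lemma bumpr_nonneg: "0 \<le> bumpr x" and bumpr_0: "bumpr 0 = 1" and bump_0: "bump 0 = 1"
  by (auto simp: bumpr_def bump_def flat_def exp_minus)

lemma continuous_bumpr: "continuous_on S (bumpr :: 'a::euclidean_space \<Rightarrow> real)"
  unfolding bumpr_def
  by (intro continuous_on_mult continuous_on_const continuous_on_compose2[OF continuous_flat[of UNIV]])
    (auto intro!: continuous_intros)

lemma bump_smooth: "smooth_fun bump"
proof -
  have "bump_span (\<lambda>x::'a. of_real (exp 1) * of_real (flat 0 (1 - x \<bullet> x)))"
    by (rule bump_span.intros) simp
  moreover have "bump = (\<lambda>x::'a. of_real (exp 1) * of_real (flat 0 (1 - x \<bullet> x)))"
    by (simp add: bump_def bumpr_def fun_eq_iff)
  ultimately show ?thesis using smooth_bump_span by metis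
qed

lemma bump_supported: "supported_in bump (cball 0 1)"
  unfolding supported_in_def bump_def bumpr_def
proof (intro allI impI)
  fix x :: 'a assume "x \<notin> cball 0 1"
  then have "1 \<le> (norm x)\<^sup>2" by (simp add: one_le_power)
  then show "complex_of_real (exp 1 * flat 0 (1 - x \<bullet> x)) = 0"
    by (simp add: flat_def power2_norm_eq_inner)
qed

lemma bump_test: "test_fun bump"
  unfolding test_fun_def using bump_smooth bump_supported compact_cball by blast

section \<open>Tensor products and cutoffs\<close>

lemma smooth_fst:
  assumes "smooth_fun (f :: 'a::euclidean_space \<Rightarrow> complex)"
  shows "smooth_fun (\<lambda>z::'a \<times> 'b::euclidean_space. f (fst z))"
proof -
  define P where "P h \<longleftrightarrow> (\<exists>f. smooth_fun f \<and> h = (\<lambda>z::'a\<times>'b. f (fst z)))" for h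
  have "P (\<lambda>z. f (fst z))" using assms by (auto simp: P_def)
  then show ?thesis
  proof (induction rule: smooth_coinduct[where P=P])
    case (cont g)
    then obtain f where f: "smooth_fun f" "g = (\<lambda>z. f (fst z))" by (auto simp: P_def)
    show ?case unfolding f
      by (rule continuous_on_compose2[OF smooth_continuous[OF f(1)]]) (auto intro: continuous_intros)
  next
    case (step g b)
    then obtain f where f: "smooth_fun f" "g = (\<lambda>z. f (fst z))" by (auto simp: P_def)
    from step(2) consider u where "u \<in> Basis" "b = (u, 0)" | v where "b = (0, v)"
      by (auto simp: Basis_prod_def)
    then show ?case
    proof cases
      case 1
      then show ?thesis using smooth_dir_deriv[OF f(1) 1(1)] smooth_deriv[OF f(1) 1(1)]
        by (intro exI[of _ "\<lambda>z. dir_deriv u f (fst z)"]) (auto simp: P_def f)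
    next
      case 2
      then show ?thesis
        by (intro exI[of _ "\<lambda>z. 0"]) (auto simp: P_def f intro: exI[of _ "\<lambda>x. 0"])
    qed
  qed
qed

lemma smooth_snd:
  assumes "smooth_fun (f :: 'b::euclidean_space \<Rightarrow> complex)"
  shows "smooth_fun (\<lambda>z::'a::euclidean_space \<times> 'b. f (snd z))"
proof -
  define P where "P h \<longleftrightarrow> (\<exists>f. smooth_fun f \<and> h = (\<lambda>z::'a\<times>'b. f (snd z)))" for h
  have "P (\<lambda>z. f (snd z))" using assms by (auto simp: P_def)
  then show ?thesis
  proof (induction rule: smooth_coinduct[where P=P])
    case (cont g)
    then obtain f where f: "smooth_fun f" "g = (\<lambda>z. f (snd z))" by (auto simp: P_def)
    show ?case unfolding f
      by (rule continuous_on_compose2[OF smooth_continuous[OF f(1)]]) (auto intro: continuous_intros)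
  next
    case (step g b)
    then obtain f where f: "smooth_fun f" "g = (\<lambda>z. f (snd z))" by (auto simp: P_def)
    from step(2) consider u where "u \<in> Basis" "b = (0, u)" | v where "b = (v, 0)"
      by (auto simp: Basis_prod_def)
    then show ?case
    proof cases
      case 1
      then show ?thesis using smooth_dir_deriv[OF f(1) 1(1)] smooth_deriv[OF f(1) 1(1)]
        by (intro exI[of _ "\<lambda>z. dir_deriv u f (snd z)"]) (auto simp: P_def f)
    next
      case 2
      then show ?thesis
        by (intro exI[of _ "\<lambda>z. 0"]) (auto simp: P_def f intro: exI[of _ "\<lambda>x. 0"])
    qed
  qed
qed

lemma test_tensor:
  assumes "test_fun \<phi>" "test_fun \<psi>"
  shows "test_fun (\<lambda>(x::'a::euclidean_space, t::'b::euclidean_space). \<phi> t * \<psi> x)"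
proof -
  obtain K L where "compact K" "supported_in \<phi> K" "compact L" "supported_in \<psi> L" using assms by (auto simp: test_fun_def)
  then have "compact (L \<times> K)" "supported_in (\<lambda>(x, t). \<phi> t * \<psi> x) (L \<times> K)"
    by (auto simp: supported_in_def intro: compact_Times)
  moreover have "smooth_fun (\<lambda>z::'a\<times>'b. \<phi> (snd z) * \<psi> (fst z))"
    by (intro smooth_mult smooth_fst smooth_snd test_smooth assms)
  ultimately show ?thesis unfolding test_fun_def by (auto simp: case_prod_beta')
qed

lemma dir_deriv_tensor_fst:
  "smooth_fun \<psi> \<Longrightarrow> b \<in> Basis \<Longrightarrow>
    dir_deriv (b, 0) (\<lambda>(x, t). \<phi> t * \<psi> x) = (\<lambda>(x, t). \<phi> t * dir_deriv b \<psi> x)"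
  by (auto simp: fun_eq_iff intro!: dir_derivI has_vector_derivative_mult_right smooth_deriv)

lemma dir_deriv_tensor_snd:
  "smooth_fun \<phi> \<Longrightarrow> b \<in> Basis \<Longrightarrow>
    dir_deriv (0, b) (\<lambda>(x, t). \<phi> t * \<psi> x) = (\<lambda>(x, t). dir_deriv b \<phi> t * \<psi> x)"
  by (auto simp: fun_eq_iff intro!: dir_derivI has_vector_derivative_mult_left smooth_deriv)

text \<open>The order of the directions, time derivatives outermost, is that of
  \<open>mono_dirs\<close>, so that no exchange of mixed derivatives enters.\<close>

lemma iterd_tensor:
  assumes "smooth_fun \<psi>" "smooth_fun \<phi>" "set xs \<subseteq> Basis" "set ts \<subseteq> Basis"
  shows "iterd (map (Pair 0) ts @ map (\<lambda>x. (x, 0)) xs) (\<lambda>(x, t). \<phi> t * \<psi> x) =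
     (\<lambda>(x, t). iterd ts \<phi> t * iterd xs \<psi> x)"
proof -
  have 1: "iterd (map (\<lambda>x. (x, 0)) xs) (\<lambda>(x, t). \<phi> t * \<psi> x) = (\<lambda>(x, t). \<phi> t * iterd xs \<psi> x)"
    using assms(3) by (induction xs) (auto simp: dir_deriv_tensor_fst smooth_iterd assms)
  show ?thesis
    using assms(4) by (induction ts) (auto simp: 1 dir_deriv_tensor_snd smooth_iterd assms)
qed

text \<open>Where \<open>\<epsilon> x\<close> is close to the origin, continuity of
  \<open>\<kappa>\<close> makes the difference small; elsewhere \<open>1 + norm x\<close> is at
  least \<open>r / \<epsilon>\<close> and the weight makes up for the merely bounded difference.
  Every derivative carries a factor \<open>\<epsilon>\<close>.\<close>

lemma bndw_dilation_diff:
  fixes \<kappa> :: "'a::euclidean_space \<Rightarrow> complex"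
  assumes \<kappa>: "smooth_fun \<kappa>" "bndw (\<lambda>_. 1) N \<kappa> C" and "0 < \<eta>"
  obtains \<epsilon>0 where "0 < \<epsilon>0"
    "\<And>\<epsilon>. 0 < \<epsilon> \<Longrightarrow> \<epsilon> < \<epsilon>0 \<Longrightarrow> bndw (\<lambda>x. 1 / (1 + norm x)) N (\<lambda>x. \<kappa> (\<epsilon> *\<^sub>R x) - \<kappa> 0) \<eta>"
proof -
  have C: "0 \<le> C" "\<And>x. norm (\<kappa> x) \<le> C" using bndw_nonneg[OF \<kappa>(2)] bndwD0[OF \<kappa>(2)] by auto
  have "isCont \<kappa> 0" using smooth_continuous[OF \<kappa>(1)] by (simp add: continuous_on_eq_continuous_at)
  then obtain r where r: "0 < r" "\<And>y. norm y < r \<Longrightarrow> norm (\<kappa> y - \<kappa> 0) < \<eta>"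
    unfolding continuous_at_eps_delta dist_norm using \<open>0 < \<eta>\<close> by (metis diff_zero)
  \<comment> \<open>The three terms of the minimum serve, in order, the powers of
    \<open>\<epsilon>\<close>, the derivatives of positive order (at most
    \<open>\<epsilon> * C\<close>), and the far region (at most
    \<open>\<epsilon> / r * (2 * C)\<close>).\<close>
  define \<epsilon>0 where "\<epsilon>0 = min 1 (min (\<eta> / (C + 1)) (\<eta> * r / (2 * C + 1)))"
  show ?thesis
  proof (rule that)
    show "0 < \<epsilon>0" using C r \<open>0 < \<eta>\<close> by (auto simp: \<epsilon>0_def)
    fix \<epsilon> :: real assume e: "0 < \<epsilon>" "\<epsilon> < \<epsilon>0"
    then have e1: "\<epsilon> \<le> 1" "\<epsilon> * (C + 1) \<le> \<eta>" "\<epsilon> * (2 * C + 1) \<le> \<eta> * r"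
      using C by (auto simp: \<epsilon>0_def field_simps)
    show "bndw (\<lambda>x. 1 / (1 + norm x)) N (\<lambda>x. \<kappa> (\<epsilon> *\<^sub>R x) - \<kappa> 0) \<eta>"
      unfolding bndw_def
    proof (intro allI impI)
      fix vs :: "'a list" and x :: 'a assume vs: "set vs \<subseteq> Basis" "length vs \<le> N"
      have w: "0 < 1 + norm x" "1 / (1 + norm x) \<le> 1" by (auto simp: add_pos_nonneg)
      show "1 / (1 + norm x) * norm (iterd vs (\<lambda>x. \<kappa> (\<epsilon> *\<^sub>R x) - \<kappa> 0) x) \<le> \<eta>"
      proof (cases "vs = []")
        case True
        show ?thesis
        proof (cases "norm (\<epsilon> *\<^sub>R x) < r")
          case True
          have "1 / (1 + norm x) * norm (\<kappa> (\<epsilon> *\<^sub>R x) - \<kappa> 0) \<le> 1 * \<eta>"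
            using w r(2)[OF True] by (intro mult_mono) auto
          then show ?thesis using \<open>vs = []\<close> by simp
        next
          case False
          then have "r \<le> \<epsilon> * (1 + norm x)" using e by (simp add: algebra_simps)
          then have "1 / (1 + norm x) \<le> \<epsilon> / r" using w r(1) by (simp add: field_simps)
          moreover have "norm (\<kappa> (\<epsilon> *\<^sub>R x) - \<kappa> 0) \<le> 2 * C"
            using norm_triangle_ineq4[of "\<kappa> (\<epsilon> *\<^sub>R x)" "\<kappa> 0"] C(2)[of 0] C(2)[of "\<epsilon> *\<^sub>R x"] by linarith
          ultimately have "1 / (1 + norm x) * norm (\<kappa> (\<epsilon> *\<^sub>R x) - \<kappa> 0) \<le> \<epsilon> / r * (2 * C)"
            using e r by (intro mult_mono) auto
          also have "\<dots> \<le> \<eta>" using e1 e r by (simp add: field_simps)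
          finally show ?thesis using \<open>vs = []\<close> by simp
        qed
      next
        case False
        have "iterd vs (\<lambda>x. \<kappa> (\<epsilon> *\<^sub>R x) - \<kappa> 0) x = of_real \<epsilon> ^ length vs * iterd vs \<kappa> (\<epsilon> *\<^sub>R x)"
          using False by (simp add: iterd_diff smooth_scale_iterd \<kappa> vs iterd_const)
        moreover have "norm (of_real \<epsilon> ^ length vs * iterd vs \<kappa> (\<epsilon> *\<^sub>R x)) \<le> \<epsilon> * C"
        proof -
          have "\<epsilon> ^ length vs \<le> \<epsilon> ^ 1"
            using False e e1 by (intro power_decreasing) (auto simp: Suc_le_eq)
          moreover have "norm (iterd vs \<kappa> (\<epsilon> *\<^sub>R x)) \<le> C" using bndwD[OF \<kappa>(2) vs] by simp
          ultimately show ?thesis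
            unfolding norm_mult norm_power using e by (intro mult_mono) auto
        qed
        moreover have "\<epsilon> * C \<le> \<eta>" using e1 e by (simp add: algebra_simps)
        ultimately have "1 / (1 + norm x) * norm (iterd vs (\<lambda>x. \<kappa> (\<epsilon> *\<^sub>R x) - \<kappa> 0) x) \<le> 1 * \<eta>"
          using w by (intro mult_mono) auto
        then show ?thesis by simp
      qed
    qed
  qed
qed

text \<open>The dilated cutoff converges only with the weight \<open>1 / (1 + norm x)\<close>; the
  lost power is taken from the bound of \<open>\<psi>\<close> with weight
  \<open>sw (Suc N)\<close>.\<close>

lemma schwartz_cutoff:
  fixes \<psi> :: "'a::euclidean_space \<Rightarrow> complex"
  assumes \<kappa>: "smooth_fun \<kappa>" "bndw (\<lambda>_. 1) N \<kappa> C" and \<psi>: "schwartz_fun \<psi>" and "0 < \<delta>"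
  shows "\<exists>\<epsilon>>0. bndw (sw N) N (\<lambda>x. \<kappa> (\<epsilon> *\<^sub>R x) * \<psi> x - \<kappa> 0 * \<psi> x) \<delta>"
proof -
  obtain A where A: "0 \<le> A" "bndw (sw (Suc N)) N \<psi> A" using schwartz_bndw[OF \<psi>] by blast
  define \<eta> where "\<eta> = \<delta> / (2 ^ N * (A + 1))"
  have "0 < \<eta>" using A \<open>0 < \<delta>\<close> by (simp add: \<eta>_def)
  from bndw_dilation_diff[OF \<kappa> this] obtain \<epsilon>0 where e: "0 < \<epsilon>0"
    "\<And>\<epsilon>. 0 < \<epsilon> \<Longrightarrow> \<epsilon> < \<epsilon>0 \<Longrightarrow> bndw (\<lambda>x. 1 / (1 + norm x)) N (\<lambda>x. \<kappa> (\<epsilon> *\<^sub>R x) - \<kappa> 0) \<eta>"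
    by blast
  have w: "1 / (1 + norm x) * sw (Suc N) x = sw N x" for x :: 'a
    using sw_pos(1)[of x 1] by (simp add: field_simps)
  have le: "2 ^ N * (\<eta> * A) \<le> \<delta>"
  proof -
    have "2 ^ N * (\<eta> * A) \<le> 2 ^ N * (\<eta> * (A + 1))" using \<open>0 < \<eta>\<close> by simp
    also have "\<dots> = \<delta>"
    proof -
      have "A + 1 \<noteq> 0" using A(1) by linarith
      then show ?thesis by (simp add: \<eta>_def)
    qed
    finally show ?thesis .
  qed
  have pos: "0 < \<epsilon>0 / 2" "\<epsilon>0 / 2 < \<epsilon>0" using e(1) by auto
  have "bndw (\<lambda>x. 1 / (1 + norm x) * sw (Suc N) x) N (\<lambda>x. (\<kappa> ((\<epsilon>0 / 2) *\<^sub>R x) - \<kappa> 0) * \<psi> x) (2 ^ N * (\<eta> * A))"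
    using bndw_mult[OF e(2)[OF pos] A(2)] smooth_scale_iterd(1)[OF \<kappa>(1)] schwartz_smooth[OF \<psi>]
    by (auto simp: smooth_diff add_nonneg_nonneg)
  then have "bndw (sw N) N (\<lambda>x. (\<kappa> ((\<epsilon>0 / 2) *\<^sub>R x) - \<kappa> 0) * \<psi> x) (2 ^ N * (\<eta> * A))"
    by (simp only: w)
  from bndw_mono[OF this order_refl le] pos(1) show ?thesis
    by (intro exI[of _ "\<epsilon>0 / 2"]) (simp add: left_diff_distrib)
qed

section \<open>Uniform boundedness for test functions\<close>

lemma hvd_line:
  fixes x b :: "'a::euclidean_space"
  assumes "\<And>x. ((\<lambda>s. f (x + s *\<^sub>R b)) has_vector_derivative f' x) (at (0::real))"
  shows "((\<lambda>s. f (x + s *\<^sub>R b)) has_vector_derivative f' (x + s0 *\<^sub>R b)) (at s0)"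
proof -
  have "((\<lambda>s. f ((x + s0 *\<^sub>R b) + s *\<^sub>R b)) has_vector_derivative f' (x + s0 *\<^sub>R b)) (at (s0 - s0))"
    using assms by simp
  then have "((\<lambda>s. f ((x + s0 *\<^sub>R b) + s *\<^sub>R b)) \<circ> (\<lambda>s. s - s0) has_vector_derivative 1 *\<^sub>R f' (x + s0 *\<^sub>R b)) (at s0)"
    by (intro vector_diff_chain_at) (auto intro!: derivative_eq_intros)
  then show ?thesis by (simp add: o_def algebra_simps flip: scaleR_left_distrib)
qed

text \<open>The functions \<open>h vs\<close> are the candidates for the derivatives of
  \<open>h []\<close>. Along each line in a basis direction the one-dimensional theorem on termwise
  differentiation identifies the derivative of \<open>h vs\<close> as
  \<open>h (b # vs)\<close>.\<close>

lemma smooth_limit: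
  fixes S :: "nat \<Rightarrow> 'a::euclidean_space \<Rightarrow> complex"
  assumes S: "\<And>n. smooth_fun (S n)"
    and lim: "\<And>vs. set vs \<subseteq> Basis \<Longrightarrow> uniform_limit UNIV (\<lambda>n. iterd vs (S n)) (h vs) sequentially"
  shows "smooth_fun (h [])" and "set vs \<subseteq> Basis \<Longrightarrow> iterd vs (h []) = h vs"
proof -
  have cont: "continuous_on UNIV (h vs)" if "set vs \<subseteq> Basis" for vs
    using smooth_continuous_iterd[OF S that]
    by (intro uniform_limit_theorem[OF _ lim[OF that]] always_eventually allI) auto
  have der: "((\<lambda>s. h vs (x + s *\<^sub>R b)) has_vector_derivative h (b # vs) x) (at 0)"
    if vs: "set vs \<subseteq> Basis" and b: "b \<in> Basis" for vs b x
  proof -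
    let ?f = "\<lambda>n s. iterd vs (S n) (x + s *\<^sub>R b)"
    let ?f' = "\<lambda>n s. iterd (b # vs) (S n) (x + s *\<^sub>R b)"
    have l: "(\<lambda>n. iterd us (S n) y) \<longlonglongrightarrow> h us y" if "set us \<subseteq> Basis" for us y
      by (rule tendsto_uniform_limitI[OF lim[OF that]]) simp
    have "\<exists>g. \<forall>s\<in>UNIV. (\<lambda>n. ?f n s) \<longlonglongrightarrow> g s \<and>
        (g has_derivative (\<lambda>k. k *\<^sub>R h (b # vs) (x + s *\<^sub>R b))) (at s within UNIV)"
    proof (rule has_derivative_sequence[where f'="\<lambda>n s k. k *\<^sub>R ?f' n s"])
      show "((\<lambda>s. ?f n s) has_derivative (\<lambda>k. k *\<^sub>R ?f' n s)) (at s within UNIV)" for n s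
        using hvd_line[of "iterd vs (S n)" b "iterd (b # vs) (S n)" x s]
          smooth_deriv[OF smooth_iterd[OF S vs] b]
        by (simp add: has_vector_derivative_def)
      show "\<forall>\<^sub>F n in sequentially. \<forall>s\<in>UNIV. \<forall>k. norm (k *\<^sub>R ?f' n s - k *\<^sub>R h (b # vs) (x + s *\<^sub>R b)) \<le> e * norm k"
        if "0 < e" for e
      proof -
        have "\<forall>\<^sub>F n in sequentially. \<forall>y\<in>UNIV. dist (iterd (b # vs) (S n) y) (h (b # vs) y) < e"
          using uniform_limitD[OF lim[of "b # vs"] that] vs b by simp
        then show ?thesis
        proof eventually_elim
          case (elim n)
          have "norm (k *\<^sub>R ?f' n s - k *\<^sub>R h (b # vs) (x + s *\<^sub>R b)) \<le> e * norm k" for s k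
          proof -
            have "norm (k *\<^sub>R ?f' n s - k *\<^sub>R h (b # vs) (x + s *\<^sub>R b)) =
               \<bar>k\<bar> * norm (?f' n s - h (b # vs) (x + s *\<^sub>R b))"
              by (simp flip: scaleR_diff_right)
            also have "\<dots> \<le> \<bar>k\<bar> * e"
              using elim by (intro mult_left_mono) (auto simp: dist_norm less_imp_le)
            finally show ?thesis by (simp add: mult.commute)
          qed
          then show ?case by blast
        qed
      qed
      show "(\<lambda>n. ?f n 0) \<longlonglongrightarrow> h vs x" using l[OF vs] by simp
    qed auto
    then obtain g where g: "\<And>s. (\<lambda>n. ?f n s) \<longlonglongrightarrow> g s"
      "\<And>s. (g has_derivative (\<lambda>k. k *\<^sub>R h (b # vs) (x + s *\<^sub>R b))) (at s)" by auto
    have "g = (\<lambda>s. h vs (x + s *\<^sub>R b))"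
      using LIMSEQ_unique[OF g(1) l[OF vs]] by blast
    then show ?thesis using g(2)[of 0] by (simp add: has_vector_derivative_def)
  qed
  have it: "iterd vs (h []) = h vs" if "set vs \<subseteq> Basis" for vs
    using that
  proof (induction vs)
    case (Cons b vs)
    then have "iterd (b # vs) (h []) = dir_deriv b (h vs)" by simp
    also have "\<dots> = h (b # vs)" using Cons by (intro ext dir_derivI der) auto
    finally show ?case .
  qed simp
  then show "set vs \<subseteq> Basis \<Longrightarrow> iterd vs (h []) = h vs" .
  show "smooth_fun (h [])"
    unfolding smooth_fun_def
  proof (intro allI impI conjI ballI)
    fix vs :: "'a list" and b x assume vs: "set vs \<subseteq> Basis"
    then show "continuous_on UNIV (iterd vs (h []))" using cont it by simp
    assume b: "b \<in> (Basis :: 'a set)"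
    have "iterd (b # vs) (h []) = h (b # vs)" using vs b by (intro it) simp
    then show "((\<lambda>s. iterd vs (h []) (x + s *\<^sub>R b)) has_vector_derivative iterd (b # vs) (h []) x) (at 0)"
      using der[OF vs b, of x] it[OF vs] by (simp del: iterd.simps)
  qed
qed

text \<open>The seminorms of this space are the bounds \<open>bndw\<close> with weight 1. Fixing the
  closed set \<open>L\<close> makes it complete, as the gliding hump argument requires.\<close>

definition DK :: "'a::euclidean_space set \<Rightarrow> ('a \<Rightarrow> complex) \<Rightarrow> bool" where
  "DK L g \<longleftrightarrow> smooth_fun g \<and> supported_in g L"

lemma DK_smooth: "DK L g \<Longrightarrow> smooth_fun g" by (simp add: DK_def)
lemma DK_add: "DK L g \<Longrightarrow> DK L h \<Longrightarrow> DK L (\<lambda>x. g x + h x)"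
  unfolding DK_def supported_in_def by (simp add: smooth_add)
lemma DK_diff: "DK L g \<Longrightarrow> DK L h \<Longrightarrow> DK L (\<lambda>x. g x - h x)"
  unfolding DK_def supported_in_def by (simp add: smooth_diff)
lemma DK_cmult: "DK L g \<Longrightarrow> DK L (\<lambda>x. c * g x)"
  unfolding DK_def supported_in_def by (simp add: smooth_cmult)
lemma DK_mult: "smooth_fun q \<Longrightarrow> DK L g \<Longrightarrow> DK L (\<lambda>x. q x * g x)"
  unfolding DK_def supported_in_def by (simp add: smooth_mult)
lemma DK_sum: "(\<And>i. i \<in> I \<Longrightarrow> DK L (g i)) \<Longrightarrow> DK L (\<lambda>x. \<Sum>i\<in>I. g i x)"
  unfolding DK_def supported_in_def by (simp add: smooth_sum)
lemma DK_zero: "DK L (\<lambda>x. 0)"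
  unfolding DK_def supported_in_def by simp
lemma DK_dir_deriv: "closed L \<Longrightarrow> DK L g \<Longrightarrow> b \<in> Basis \<Longrightarrow> DK L (dir_deriv b g)"
  unfolding DK_def using supported_iterd[of L g "[b]"] by (simp add: smooth_dir_deriv)

text \<open>Functionals are total functions on all maps, but only their values on the relevant space
  are meaningful, hence linearity relative to a predicate \<open>D\<close>.\<close>

definition lin_on :: "(('a \<Rightarrow> complex) \<Rightarrow> bool) \<Rightarrow> (('a \<Rightarrow> complex) \<Rightarrow> complex) \<Rightarrow> bool" where
  "lin_on D l \<longleftrightarrow> (\<forall>g h. D g \<longrightarrow> D h \<longrightarrow> l (\<lambda>x. g x + h x) = l g + l h) \<and>
     (\<forall>g c. D g \<longrightarrow> l (\<lambda>x. c * g x) = c * l g)"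

lemma lin_onD:
  assumes "lin_on D l"
  shows "D g \<Longrightarrow> D h \<Longrightarrow> l (\<lambda>x. g x + h x) = l g + l h" "D g \<Longrightarrow> l (\<lambda>x. c * g x) = c * l g"
  using assms unfolding lin_on_def by blast+

lemma lin_on_diff:
  assumes "lin_on D l" "D g" "D h" "D (\<lambda>x. (-1) * h x)"
  shows "l (\<lambda>x. g x - h x) = l g - l h"
  using lin_onD(1)[of D l g "\<lambda>x. (-1) * h x"] lin_onD(2)[of D l h "-1"] assms by simp

lemma lin_on_zero: "lin_on D l \<Longrightarrow> D (\<lambda>x. 0) \<Longrightarrow> l (\<lambda>x. 0) = 0"
  using lin_onD(2)[of D l "\<lambda>x. 0" 0] by simp

lemma lin_on_sum:
  assumes "lin_on (DK L) l" "finite I" "\<And>i. i \<in> I \<Longrightarrow> DK L (g i)"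
  shows "l (\<lambda>x. \<Sum>i\<in>I. g i x) = (\<Sum>i\<in>I. l (g i))"
  using assms(2,3) by (induction I) (simp_all add: lin_on_zero[OF assms(1)] DK_zero lin_onD[OF assms(1)] DK_sum)

text \<open>Since \<open>N n\<close> is at least \<open>n\<close>, the increments of any fixed
  derivative are eventually dominated by a geometric series, so all derivatives converge uniformly.
  The second conclusion sums a tail: \<open>c * (1/2) ^ i\<close> from \<open>n\<close> on gives
  \<open>2 * c * (1/2) ^ n\<close>.\<close>

lemma DK_limit:
  assumes L: "closed L" and S: "\<And>n. DK L (S n)"
    and N: "\<And>n. n \<le> N n"
    and inc: "\<And>n. bndw (\<lambda>_. 1) (N n) (\<lambda>x. S (Suc n) x - S n x) ((1/2) ^ n)"
  obtains g where "DK L g"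
    "\<And>n k c. (\<And>i. n \<le> i \<Longrightarrow> bndw (\<lambda>_. 1) k (\<lambda>x. S (Suc i) x - S i x) (c * (1/2) ^ i)) \<Longrightarrow>
       bndw (\<lambda>_. 1) k (\<lambda>x. g x - S n x) (2 * c * (1/2) ^ n)"
proof -
  have sm: "smooth_fun (S n)" for n using S DK_smooth by blast
  define h where "h vs x = iterd vs (S 0) x + suminf (\<lambda>i. iterd vs (S (Suc i)) x - iterd vs (S i) x)" for vs x
  have sum_half: "summable (\<lambda>n. (1/2::real) ^ n)" by (simp add: summable_geometric)
  have lim: "uniform_limit UNIV (\<lambda>n. iterd vs (S n)) (h vs) sequentially" if vs: "set vs \<subseteq> Basis" for vs
  proof -
    have "uniform_limit UNIV (\<lambda>n x. \<Sum>i<n. iterd vs (S (Suc i)) x - iterd vs (S i) x)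
        (\<lambda>x. suminf (\<lambda>i. iterd vs (S (Suc i)) x - iterd vs (S i) x)) sequentially"
    proof (rule Weierstrass_m_test_ev[OF _ sum_half])
      show "\<forall>\<^sub>F n in sequentially. \<forall>x\<in>UNIV. norm (iterd vs (S (Suc n)) x - iterd vs (S n) x) \<le> (1/2) ^ n"
        using eventually_ge_at_top[of "length vs"]
      proof eventually_elim
        case (elim n)
        then have "length vs \<le> N n" using N[of n] by linarith
        then show ?case using bndwD[OF inc[of n] vs] by (simp add: iterd_diff sm vs)
      qed
    qed
    from uniform_limit_add[OF uniform_limit_const[of "iterd vs (S 0)" UNIV sequentially] this]
    have "uniform_limit UNIV (\<lambda>n x. iterd vs (S 0) x + (\<Sum>i<n. iterd vs (S (Suc i)) x - iterd vs (S i) x)) (h vs) sequentially"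
      unfolding h_def[abs_def] .
    moreover have "(\<Sum>i<n. iterd vs (S (Suc i)) x - iterd vs (S i) x) = iterd vs (S n) x - iterd vs (S 0) x" for n x
      by (rule sum_lessThan_telescope[of "\<lambda>i. iterd vs (S i) x"])
    ultimately show ?thesis by simp
  qed
  note sl = smooth_limit[OF sm lim]
  have pl: "(\<lambda>n. iterd vs (S n) x) \<longlonglongrightarrow> h vs x" if "set vs \<subseteq> Basis" for vs x
    by (rule tendsto_uniform_limitI[OF lim[OF that]]) simp
  show ?thesis
  proof (rule that[of "h []"])
    have "h [] x = 0" if "x \<notin> L" for x
      using pl[of "[]" x] S that by (simp add: DK_def supported_in_def LIMSEQ_const_iff)
    then show "DK L (h [])" using sl(1) by (simp add: DK_def supported_in_def)
    fix n k and c :: real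
    assume *: "\<And>i. n \<le> i \<Longrightarrow> bndw (\<lambda>_. 1) k (\<lambda>x. S (Suc i) x - S i x) (c * (1/2) ^ i)"
    show "bndw (\<lambda>_. 1) k (\<lambda>x. h [] x - S n x) (2 * c * (1/2) ^ n)"
      unfolding bndw_def
    proof (intro allI impI)
      fix vs :: "'a list" and x assume vs: "set vs \<subseteq> Basis" "length vs \<le> k"
      have "0 < (1/2::real) ^ n" "0 \<le> c * (1/2) ^ n" using bndw_nonneg[OF *[of n]] by auto
      then have c: "0 \<le> c" by (metis less_imp_le mult.commute mult_pos_neg not_le)
      have b: "norm (iterd vs (S (m + n)) x - iterd vs (S n) x) \<le> 2 * c * (1/2)^n * (1 - (1/2)^m)" for m
      proof (induction m)
        case (Suc m)
        have "norm (iterd vs (S (Suc (m + n))) x - iterd vs (S (m + n)) x) \<le> c * (1/2) ^ (m + n)"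
          using bndwD[OF *[of "m + n"] vs, of x] by (simp add: iterd_diff sm vs)
        then have "norm (iterd vs (S (Suc m + n)) x - iterd vs (S n) x) \<le>
           c * (1/2) ^ (m + n) + 2 * c * (1/2)^n * (1 - (1/2)^m)"
          using Suc norm_triangle_ineq[of "iterd vs (S (Suc (m + n))) x - iterd vs (S (m + n)) x"
             "iterd vs (S (m + n)) x - iterd vs (S n) x"] by simp
        also have "\<dots> = 2 * c * (1/2)^n * (1 - (1/2)^Suc m)"
          by (simp add: power_add algebra_simps)
        finally show ?case .
      qed simp
      have "norm (h vs x - iterd vs (S n) x) \<le> 2 * c * (1/2)^n"
      proof (rule LIMSEQ_le_const2)
        show "(\<lambda>m. norm (iterd vs (S (m + n)) x - iterd vs (S n) x)) \<longlonglongrightarrow> norm (h vs x - iterd vs (S n) x)"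
          by (intro tendsto_intros LIMSEQ_ignore_initial_segment pl vs)
        have "2 * c * (1/2)^n * (1 - (1/2)^m) \<le> 2 * c * (1/2)^n" for m :: nat
          using c by (intro mult_left_le) auto
        then show "\<exists>M. \<forall>m\<ge>M. norm (iterd vs (S (m + n)) x - iterd vs (S n) x) \<le> 2 * c * (1/2)^n"
          using b order_trans by blast
      qed
      then show "1 * norm (iterd vs (\<lambda>x. h [] x - S n x) x) \<le> 2 * c * (1/2)^n"
        using vs by (simp add: iterd_diff sm sl)
    qed
  qed
qed

text \<open>The Banach-Steinhaus theorem in the Frechet space \<open>DK L\<close>, by a gliding hump.\<close>

lemma DK_uniform_boundedness:
  fixes \<Lambda> :: "'i \<Rightarrow> ('a::euclidean_space \<Rightarrow> complex) \<Rightarrow> complex"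
  assumes L: "closed L"
    and lin: "\<And>a. a \<in> A \<Longrightarrow> lin_on (DK L) (\<Lambda> a)"
    and ord: "\<And>a. a \<in> A \<Longrightarrow> \<exists>C\<ge>0. \<exists>N. \<forall>g B. DK L g \<longrightarrow> bndw (\<lambda>_. 1) N g B \<longrightarrow> norm (\<Lambda> a g) \<le> C * B"
    and ptw: "\<And>g. DK L g \<Longrightarrow> \<exists>M. \<forall>a\<in>A. norm (\<Lambda> a g) \<le> M"
  shows "\<exists>C\<ge>0. \<exists>N. \<forall>a\<in>A. \<forall>g B. DK L g \<longrightarrow> bndw (\<lambda>_. 1) N g B \<longrightarrow> norm (\<Lambda> a g) \<le> C * B"
proof (rule ccontr)
  assume no: "\<not> ?thesis"
  have big: "\<exists>a\<in>A. \<exists>g. DK L g \<and> bndw (\<lambda>_. 1) N g \<eta> \<and> R < norm (\<Lambda> a g)"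
    if "0 < \<eta>" "0 \<le> R" for N \<eta> R
  proof -
    have "0 \<le> R / \<eta>" using that by simp
    then have "\<not> (\<forall>a\<in>A. \<forall>g B. DK L g \<longrightarrow> bndw (\<lambda>_. 1) N g B \<longrightarrow> norm (\<Lambda> a g) \<le> R / \<eta> * B)"
      using no by blast
    then obtain a g B where *: "a \<in> A" "DK L g" "bndw (\<lambda>_. 1) N g B" "R / \<eta> * B < norm (\<Lambda> a g)"
      by (auto simp: not_le)
    have B: "0 \<le> B" using bndw_nonneg[OF *(3)] by simp
    \<comment> \<open>If \<open>B = 0\<close> then \<open>g\<close> has vanishing seminorm but a
      nonzero value, so it can be scaled up at no cost; otherwise it is scaled to seminorm
      \<open>\<eta>\<close>.\<close>
    define c where "c = (if B = 0 then (R + 1) / norm (\<Lambda> a g) else \<eta> / B)"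
    have pos: "0 < norm (\<Lambda> a g)" using *(4) that B by (smt (verit) divide_nonneg_pos mult_nonneg_nonneg)
    then have c: "0 \<le> c" using B that by (auto simp: c_def)
    have "bndw (\<lambda>_. 1) N (\<lambda>x. of_real c * g x) (norm (complex_of_real c) * B)"
      by (rule bndw_cmult[OF *(3) DK_smooth[OF *(2)]])
    then have "bndw (\<lambda>_. 1) N (\<lambda>x. of_real c * g x) \<eta>"
      by (rule bndw_mono) (use c B that in \<open>auto simp: c_def\<close>)
    moreover have "R < norm (\<Lambda> a (\<lambda>x. of_real c * g x))"
      unfolding lin_onD(2)[OF lin[OF *(1)] *(2)] norm_mult
      using * c B pos that by (auto simp: c_def field_simps split: if_splits)
    ultimately show ?thesis using * DK_cmult by blast
  qed
  \<comment> \<open>A state consists of the index of the current functional, the partial sum of the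
    humps, and an order and a constant bounding that functional.\<close>
  define P where "P n s \<longleftrightarrow> (case s of (a, S, N, C) \<Rightarrow> a \<in> A \<and> DK L S \<and> n \<le> N \<and> 0 \<le> C \<and>
      (\<forall>g B. DK L g \<longrightarrow> bndw (\<lambda>_. 1) N g B \<longrightarrow> norm (\<Lambda> a g) \<le> C * B))"
    for n :: nat and s :: "'i \<times> ('a \<Rightarrow> complex) \<times> nat \<times> real"
  \<comment> \<open>The new hump is tiny relative to the constants collected so far, so it hardly
    disturbs the values already made large, while it makes the next functional at least
    \<open>n\<close>.\<close>
  define Q where "Q n s s' \<longleftrightarrow> (case s of (a, S, N, C) \<Rightarrow> case s' of (a', S', N', C') \<Rightarrow>
      N \<le> N' \<and> C \<le> C' \<and> bndw (\<lambda>_. 1) N (\<lambda>x. S' x - S x) (1 / (C + 1) * (1/2) ^ n) \<and> real n \<le> norm (\<Lambda> a' S'))"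
    for n :: nat and s s' :: "'i \<times> ('a \<Rightarrow> complex) \<times> nat \<times> real"
  have "\<exists>f. \<forall>n. P n (f n) \<and> Q n (f n) (f (Suc n))"
  proof (rule dependent_nat_choice)
    obtain a where "a \<in> A" using big[of 1 0] by auto
    then obtain C N where "0 \<le> C" "\<forall>g B. DK L g \<longrightarrow> bndw (\<lambda>_. 1) N g B \<longrightarrow> norm (\<Lambda> a g) \<le> C * B"
      using ord by blast
    then have "P 0 (a, \<lambda>x. 0, N, C)" using \<open>a \<in> A\<close> by (simp add: P_def DK_zero)
    then show "\<exists>s. P 0 s" by blast
  next
    fix s n assume "P n s"
    then obtain a S N C where s: "s = (a, S, N, C)" "a \<in> A" "DK L S" "n \<le> N" "0 \<le> C"
      by (auto simp: P_def)
    obtain M where M: "\<And>a. a \<in> A \<Longrightarrow> norm (\<Lambda> a S) \<le> M" using ptw s by blast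
    have "0 \<le> M" using M[OF s(2)] norm_ge_zero order_trans by blast
    with s have "0 < 1 / (C + 1) * (1/2::real) ^ n" "0 \<le> real n + M" by auto
    \<comment> \<open>The threshold contains \<open>M\<close>, the pointwise bound at the old
      partial sum, so that the value on the new sum still exceeds \<open>n\<close>.\<close>
    from big[OF this] obtain a' g where a': "a' \<in> A" "DK L g"
      "bndw (\<lambda>_. 1) N g (1 / (C + 1) * (1/2) ^ n)" "real n + M < norm (\<Lambda> a' g)" by blast
    obtain C0 N0 where 0: "0 \<le> C0" "\<And>g B. DK L g \<Longrightarrow> bndw (\<lambda>_. 1) N0 g B \<Longrightarrow> norm (\<Lambda> a' g) \<le> C0 * B"
      using ord a' by meson
    let ?N' = "max (Suc N) N0" and ?C' = "max C C0" and ?S' = "\<lambda>x. S x + g x"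
    have "norm (\<Lambda> a' h) \<le> ?C' * B" if "DK L h" "bndw (\<lambda>_. 1) ?N' h B" for h B
    proof -
      have "norm (\<Lambda> a' h) \<le> C0 * B" by (rule 0(2)[OF that(1) bndw_mono[OF that(2)]]) auto
      also have "\<dots> \<le> ?C' * B" using bndw_nonneg[OF that(2)] by (intro mult_right_mono) auto
      finally show ?thesis .
    qed
    then have "P (Suc n) (a', ?S', ?N', ?C')"
      using s a' 0 by (auto simp: P_def DK_add)
    moreover have "real n \<le> norm (\<Lambda> a' ?S')"
      unfolding lin_onD(1)[OF lin[OF a'(1)] s(3) a'(2)]
      using M[OF a'(1)] a'(4) norm_diff_ineq[of "\<Lambda> a' g" "\<Lambda> a' S"] by (simp add: add.commute)
    then have "Q n s (a', ?S', ?N', ?C')"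
      using a' s by (auto simp: Q_def)
    ultimately show "\<exists>s'. P (Suc n) s' \<and> Q n s s'" by blast
  qed
  then obtain f where f: "\<And>n. P n (f n)" "\<And>n. Q n (f n) (f (Suc n))" by blast
  define a where "a n = fst (f n)" for n
  define S where "S n = fst (snd (f n))" for n
  define N where "N n = fst (snd (snd (f n)))" for n
  define C where "C n = snd (snd (snd (f n)))" for n
  have fe: "f n = (a n, S n, N n, C n)" for n by (simp add: a_def S_def N_def C_def)
  have P: "a n \<in> A" "DK L (S n)" "n \<le> N n" "0 \<le> C n"
    "DK L g \<Longrightarrow> bndw (\<lambda>_. 1) (N n) g B \<Longrightarrow> norm (\<Lambda> (a n) g) \<le> C n * B" for n g B
    using f(1)[of n] by (auto simp: P_def fe)
  have Q: "N n \<le> N (Suc n)" "C n \<le> C (Suc n)"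
    "bndw (\<lambda>_. 1) (N n) (\<lambda>x. S (Suc n) x - S n x) (1 / (C n + 1) * (1/2) ^ n)"
    "real n \<le> norm (\<Lambda> (a (Suc n)) (S (Suc n)))" for n
    using f(2)[of n] by (auto simp: Q_def fe)
  have mono: "N n \<le> N m" "C n \<le> C m" if "n \<le> m" for n m
    using lift_Suc_mono_le[of N, OF Q(1) that] lift_Suc_mono_le[of C, OF Q(2) that] by auto
  have inc: "bndw (\<lambda>_. 1) (N n) (\<lambda>x. S (Suc i) x - S i x) (1 / (C n + 1) * (1/2) ^ i)" if "n \<le> i" for n i
    by (rule bndw_mono[OF Q(3)]) (use mono[OF that] P(4)[of n] P(4)[of i] in \<open>auto intro!: mult_right_mono frac_le\<close>)
  obtain g where g: "DK L g"
    "\<And>n k c. (\<And>i. n \<le> i \<Longrightarrow> bndw (\<lambda>_. 1) k (\<lambda>x. S (Suc i) x - S i x) (c * (1/2) ^ i)) \<Longrightarrow>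
       bndw (\<lambda>_. 1) k (\<lambda>x. g x - S n x) (2 * c * (1/2) ^ n)"
  proof (rule DK_limit[OF L P(2) P(3)])
    show "bndw (\<lambda>_. 1) (N n) (\<lambda>x. S (Suc n) x - S n x) ((1/2) ^ n)" for n
      by (rule bndw_mono[OF Q(3)]) (use mult_right_mono[of "1 / (C n + 1)" 1 "(1/2) ^ n"] P(4)[of n] in auto)
  qed auto
  obtain M where M: "\<And>b. b \<in> A \<Longrightarrow> norm (\<Lambda> b g) \<le> M" using ptw[OF g(1)] by blast
  \<comment> \<open>The humps after stage \<open>Suc n\<close> alter the value of the functional
    chosen there by at most 1, so its value on the limit still grows with \<open>n\<close>, against
    the pointwise bound \<open>M\<close>.\<close>
  have "real n \<le> M + 2" for n
  proof -
    let ?n = "Suc n"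
    have "norm (\<Lambda> (a ?n) (\<lambda>x. g x - S ?n x)) \<le> C ?n * (2 * (1 / (C ?n + 1)) * (1/2) ^ ?n)"
      by (intro P(5) DK_diff g P(2) inc)
    also have "\<dots> = (C ?n / (C ?n + 1)) * (1/2) ^ n"
      using P(4)[of ?n] by (simp add: divide_simps)
    also have "\<dots> \<le> 1 * 1" using P(4)[of ?n] by (intro mult_mono power_le_one) auto
    finally have "norm (\<Lambda> (a ?n) g - \<Lambda> (a ?n) (S ?n)) \<le> 1"
      by (simp add: lin_on_diff[OF lin[OF P(1)] g(1) P(2) DK_cmult[OF P(2)]])
    then show ?thesis
      using Q(4)[of n] M[OF P(1)[of ?n]] norm_triangle_ineq2[of "\<Lambda> (a ?n) (S ?n)" "\<Lambda> (a ?n) g"]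
      by (simp add: norm_minus_commute)
  qed
  then show False by (meson gt_ex not_le reals_Archimedean2)
qed

section \<open>A Phragmen-Lindelof argument\<close>

text \<open>The exponent 3/4 exceeds 1/2, so the damping beats the growth on large arcs.\<close>

lemma sqrt_power_growth:
  fixes K A \<epsilon> c :: real
  assumes "0 < \<epsilon>" "0 < c" "0 < C"
  shows "eventually (\<lambda>R. A * exp (K * sqrt R - \<epsilon> * c * (R - 1) powr (3/4)) \<le> C) at_top"
proof -
  have "((\<lambda>R. A * exp (K * sqrt R - \<epsilon> * c * (R - 1) powr (3/4))) \<longlongrightarrow> 0) at_top"
    using assms by real_asymp
  then have "eventually (\<lambda>R. A * exp (K * sqrt R - \<epsilon> * c * (R - 1) powr (3/4)) < C) at_top"
    using assms(3) by (rule order_tendstoD)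
  then show ?thesis by eventually_elim simp
qed

text \<open>Damping \<open>f\<close> by \<open>exp (- \<epsilon> w)\<close> with
  \<open>w z = (1 - \<i> z) powr (3/4)\<close> works because 3/4 lies between 1/2, the order of
  \<open>f\<close>, and 1: on large arcs \<open>Re w\<close> outgrows the square root, and it stays
  nonnegative in the closed half-plane. The maximum principle on a large half disc, followed by
  \<open>\<epsilon>\<close> tending to 0, gives the bound.\<close>

lemma phragmen_lindelof_halfplane:
  fixes f :: "complex \<Rightarrow> complex"
  assumes hol: "f holomorphic_on {z. Im z > -1}"
    and growth: "\<And>z. 0 \<le> Im z \<Longrightarrow> norm (f z) \<le> A * exp (K * sqrt (norm z))"
    and real: "\<And>x. norm (f (of_real x)) \<le> C"
    and "0 < C" "0 \<le> Im z0"
  shows "norm (f z0) \<le> C"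
proof -
  define w where "w z = (1 - \<i> * z) powr (3/4 :: complex)" for z
  \<comment> \<open>In the closed half-plane the argument of \<open>1 - \<i> z\<close> is below
    \<open>pi / 2\<close> in absolute value, so after the power it is below
    \<open>3 * pi / 8\<close>, where the cosine is at least this positive constant.\<close>
  define c where "c = cos (3 * pi / 8)"
  have c: "0 < c" unfolding c_def by (intro cos_gt_zero_pi) auto
  have w_hol: "w holomorphic_on {z. Im z > -1}"
  proof -
    have "1 - \<i> * z \<notin> \<real>\<^sub>\<le>\<^sub>0" if "Im z > -1" for z
    proof
      assume "1 - \<i> * z \<in> \<real>\<^sub>\<le>\<^sub>0"
      then have "Re (1 - \<i> * z) \<le> 0" by (simp add: complex_nonpos_Reals_iff)
      then show False using that by simp
    qed
    then show ?thesis unfolding w_def by (intro holomorphic_intros) blast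
  qed
  have Re_w: "c * norm (1 - \<i> * z) powr (3/4) \<le> Re (w z)" if z: "0 \<le> Im z" for z
  proof -
    let ?u = "1 - \<i> * z"
    have u: "0 < Re ?u" using z by simp
    then have u0: "?u \<noteq> 0" by (metis less_irrefl zero_complex.sel(1))
    have "\<bar>Im (Ln ?u)\<bar> < pi / 2" using Re_Ln_pos_lt[OF u0] u by simp
    then have "c \<le> cos (3 / 4 * Im (Ln ?u))"
      unfolding c_def by (subst (2) cos_abs_real[symmetric], intro cos_monotone_0_pi_le) (auto simp: abs_mult)
    moreover have "Re (w z) = norm ?u powr (3/4) * cos (3 / 4 * Im (Ln ?u))"
    proof -
      have "Re (w z) = exp (3 / 4 * Re (Ln ?u)) * cos (3 / 4 * Im (Ln ?u))"
        using u0 by (simp add: w_def powr_def Re_exp)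
      also have "exp (3 / 4 * Re (Ln ?u)) = norm ?u powr (3/4)"
        using u0 by (simp add: Re_Ln powr_def)
      finally show ?thesis .
    qed
    ultimately show ?thesis using u0 by (simp add: mult.commute mult_left_mono)
  qed
  have Re_w0: "0 \<le> Re (w z)" if z: "0 \<le> Im z" for z
  proof -
    have "0 \<le> c * norm (1 - \<i> * z) powr (3/4)" using c by simp
    then show ?thesis using Re_w[OF z] by linarith
  qed
  have bound: "norm (f z0) \<le> C * exp (\<epsilon> * Re (w z0))" if e: "0 < \<epsilon>" for \<epsilon>
  proof -
    define G where "G z = f z * exp (- of_real \<epsilon> * w z)" for z
    have normG: "norm (G z) = norm (f z) * exp (- \<epsilon> * Re (w z))" for z
      by (simp add: G_def norm_mult)
    have "eventually (\<lambda>R. A * exp (K * sqrt R - \<epsilon> * c * (R - 1) powr (3/4)) \<le> C \<and> R > 1 \<and> R > norm z0) at_top"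
      by (intro eventually_conj sqrt_power_growth e c assms eventually_gt_at_top)
    then obtain R where R: "A * exp (K * sqrt R - \<epsilon> * c * (R - 1) powr (3/4)) \<le> C" "R > 1" "R > norm z0"
      using eventually_happens' by (metis (no_types, lifting) trivial_limit_at_top_linorder)
    define S where "S = cball 0 R \<inter> {z. 0 \<le> Im z}"
    have sub: "S \<subseteq> {z. Im z > -1}" by (auto simp: S_def)
    have G_hol: "G holomorphic_on {z. Im z > -1}"
      unfolding G_def by (intro holomorphic_intros hol w_hol)
    have "closed S" unfolding S_def by (intro closed_Int closed_cball closed_halfspace_Im_ge)
    have "norm (G z0) \<le> C"
    proof (rule maximum_modulus_frontier[of G S])
      show "G holomorphic_on interior S"
        by (rule holomorphic_on_subset[OF G_hol]) (use sub interior_subset in blast)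
      show "continuous_on (closure S) G"
        using \<open>closed S\<close> sub
        by (intro holomorphic_on_imp_continuous_on holomorphic_on_subset[OF G_hol]) simp
      show "bounded S" unfolding S_def by (intro bounded_Int) auto
      show "z0 \<in> S" using assms R by (auto simp: S_def)
      fix z assume "z \<in> frontier S"
      then have z: "z \<in> S" "z \<notin> interior S" using \<open>closed S\<close> by (auto simp: frontier_def)
      have "ball 0 R \<inter> {z. 0 < Im z} \<subseteq> interior S"
        by (rule interior_maximal) (auto simp: S_def intro!: open_Int open_halfspace_Im_gt)
      with z have "Im z = 0 \<or> norm z = R" by (force simp: S_def)
      then show "norm (G z) \<le> C"
      proof
        assume "Im z = 0"
        then have "z = of_real (Re z)" by (simp add: complex_eq_iff)
        then have "norm (f z) \<le> C" using real[of "Re z"] by simp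
        moreover have "exp (- \<epsilon> * Re (w z)) \<le> 1" using Re_w0[of z] e \<open>Im z = 0\<close> by simp
        ultimately have "norm (f z) * exp (- \<epsilon> * Re (w z)) \<le> C * 1" using \<open>0 < C\<close> by (intro mult_mono) auto
        then show ?thesis by (simp add: normG)
      next
        assume zR: "norm z = R"
        have im: "0 \<le> Im z" using z by (simp add: S_def)
        have "R - 1 \<le> norm (1 - \<i> * z)"
          using norm_triangle_ineq3[of "\<i> * z" 1] zR by (simp add: norm_mult norm_minus_commute)
        then have "(R - 1) powr (3/4) \<le> norm (1 - \<i> * z) powr (3/4)" using R by (intro powr_mono2) auto
        then have "c * (R - 1) powr (3/4) \<le> Re (w z)"
          using Re_w[OF im] c by (meson mult_left_mono less_imp_le order_trans)
        then have "\<epsilon> * c * (R - 1) powr (3/4) \<le> \<epsilon> * Re (w z)" using e by (simp add: mult.assoc)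
        then have "exp (- \<epsilon> * Re (w z)) \<le> exp (- (\<epsilon> * c * (R - 1) powr (3/4)))" by simp
        with growth[OF im] have "norm (f z) * exp (- \<epsilon> * Re (w z)) \<le>
            (A * exp (K * sqrt R)) * exp (- (\<epsilon> * c * (R - 1) powr (3/4)))"
          using order_trans[OF norm_ge_zero growth[OF im]] by (intro mult_mono) (auto simp: zR)
        also have "\<dots> \<le> C" using R(1) by (simp add: mult.assoc flip: exp_add)
        finally show ?thesis by (simp add: normG)
      qed
    qed
    then have "norm (f z0) * exp (- \<epsilon> * Re (w z0)) * exp (\<epsilon> * Re (w z0)) \<le> C * exp (\<epsilon> * Re (w z0))"
      unfolding normG by (intro mult_right_mono) auto
    then show ?thesis by (simp add: mult.assoc flip: exp_add)
  qed
  have "((\<lambda>\<epsilon>. C * exp (\<epsilon> * Re (w z0))) \<longlongrightarrow> C * exp (0 * Re (w z0))) (at_right 0)"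
    by (intro tendsto_intros)
  then have "norm (f z0) \<le> C * exp (0 * Re (w z0))"
    by (rule tendsto_lowerbound) (auto simp: eventually_at_filter bound)
  then show ?thesis by simp
qed

text \<open>Dividing by \<open>(z + \<i>) ^ N\<close>, which in the upper half-plane has modulus at
  least 1, makes the boundary values bounded; the constant \<open>2 ^ N\<close> comes from
  \<open>1 + \<bar>x\<bar> \<le> 2 * norm (x + \<i>)\<close>.\<close>

lemma polynomial_growth_halfplane:
  fixes f :: "complex \<Rightarrow> complex"
  assumes hol: "f holomorphic_on UNIV"
    and growth: "\<And>z. norm (f z) \<le> A * exp (K * sqrt (norm z))"
    and real: "\<And>x. norm (f (of_real x)) \<le> C * (1 + \<bar>x\<bar>) ^ N"
    and "0 < C" "0 \<le> Im z"
  shows "norm (f z) \<le> C * 2 ^ N * (1 + norm z) ^ N"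
proof -
  have ne: "z + \<i> \<noteq> 0" if "Im z > -1" for z
  proof
    assume "z + \<i> = 0"
    then have "Im (z + \<i>) = 0" by simp
    then show False using that by simp
  qed
  have "norm (f z / (z + \<i>) ^ N) \<le> C * 2 ^ N"
  proof (rule phragmen_lindelof_halfplane[where A=A and K=K and f="\<lambda>z. f z / (z + \<i>) ^ N" and ?z0.0=z])
    show "(\<lambda>z. f z / (z + \<i>) ^ N) holomorphic_on {z. Im z > -1}"
      by (intro holomorphic_intros holomorphic_on_subset[OF hol]) (use ne in auto)
    show "norm (f z / (z + \<i>) ^ N) \<le> A * exp (K * sqrt (norm z))" if "0 \<le> Im z" for z
    proof -
      have "1 \<le> norm (z + \<i>)" using abs_Im_le_cmod[of "z + \<i>"] that by simp
      then have "1 \<le> norm (z + \<i>) ^ N" by (rule one_le_power)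
      then have "norm (f z) / norm (z + \<i>) ^ N \<le> norm (f z) / 1" by (intro divide_left_mono) auto
      then show ?thesis using growth[of z] by (simp add: norm_divide norm_power)
    qed
    show "norm (f (of_real x) / (of_real x + \<i>) ^ N) \<le> C * 2 ^ N" for x
    proof -
      have 1: "1 + \<bar>x\<bar> \<le> 2 * norm (of_real x + \<i>)"
        using abs_Im_le_cmod[of "of_real x + \<i>"] abs_Re_le_cmod[of "of_real x + \<i>"] by simp
      have pos: "0 < norm (of_real x + \<i>)" using ne[of "of_real x"] by simp
      have "norm (f (of_real x)) \<le> C * (2 * norm (of_real x + \<i>)) ^ N"
        using real[of x] power_mono[OF 1, of N] \<open>0 < C\<close>
        by (meson order_trans mult_left_mono less_imp_le abs_ge_zero add_nonneg_nonneg zero_le_one)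
      then show ?thesis using pos by (simp add: norm_divide norm_power power_mult_distrib field_simps)
    qed
  qed (use assms in auto)
  moreover have "0 < norm (z + \<i>)" using ne[of z] assms(5) by simp
  ultimately have "norm (f z) \<le> C * 2 ^ N * norm (z + \<i>) ^ N"
    by (simp add: norm_divide norm_power field_simps)
  also have "\<dots> \<le> C * 2 ^ N * (1 + norm z) ^ N"
    using norm_triangle_ineq[of z \<i>] \<open>0 < C\<close> by (intro mult_left_mono power_mono) auto
  finally show ?thesis .
qed

lemma higher_deriv_powser_0:
  fixes c :: "nat \<Rightarrow> complex"
  assumes "\<And>z. summable (\<lambda>n. c n * z ^ n)"
  shows "(deriv ^^ k) (\<lambda>z. suminf (\<lambda>n. c n * z ^ n)) 0 = fact k * c k"
  using assms
proof (induction k arbitrary: c)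
  case 0
  then show ?case by simp
next
  case (Suc k)
  have "deriv (\<lambda>z. suminf (\<lambda>n. c n * z ^ n)) = (\<lambda>z. suminf (\<lambda>n. diffs c n * z ^ n))"
    by (intro ext DERIV_imp_deriv termdiffs_strong_converges_everywhere Suc.prems)
  moreover have "(deriv ^^ k) (\<lambda>z. suminf (\<lambda>n. diffs c n * z ^ n)) 0 = fact k * diffs c k"
    by (intro Suc.IH termdiff_converges_all Suc.prems)
  ultimately show ?case
    by (simp add: funpow_Suc_right diffs_def del: funpow.simps)
qed

text \<open>Coefficients of this size make the series entire of order at most 1/2. Polynomial growth
  on the real axis then spreads to both half-planes, and Cauchy estimates on circles of radius
  tending to infinity kill every coefficient of index above \<open>N\<close>.\<close>

lemma powser_coeff_eq_0:
  fixes e :: "nat \<Rightarrow> complex"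
  assumes coeff: "\<And>r. norm (e r) \<le> M * K ^ r / (fact r)\<^sup>2" and "0 \<le> M" "0 \<le> K"
    and real: "\<And>x. norm (suminf (\<lambda>r. e r * of_real x ^ r)) \<le> C * (1 + \<bar>x\<bar>) ^ N"
    and "N < r"
  shows "e r = 0"
proof -
  define f where "f z = (suminf (\<lambda>r. e r * z ^ r))" for z
  \<comment> \<open>With \<open>s = sqrt (K * norm z)\<close> the majorant is
    \<open>M * (s ^ r / fact r) ^ 2\<close>; one factor is bounded by \<open>exp s\<close>, the
    other is left to be summed to a second \<open>exp s\<close>.\<close>
  have termb: "norm (e r * z ^ r) \<le> (M * exp (sqrt (K * norm z))) * (sqrt (K * norm z) ^ r / fact r)" for r z
  proof -
    let ?s = "sqrt (K * norm z)"
    have s: "0 \<le> ?s" "?s\<^sup>2 = K * norm z" using \<open>0 \<le> K\<close> by auto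
    have le: "?s ^ r / fact r \<le> exp ?s"
    proof -
      have "(\<Sum>i\<in>{r}. ?s ^ i /\<^sub>R fact i) \<le> (suminf (\<lambda>i. ?s ^ i /\<^sub>R fact i))"
        using \<open>0 \<le> K\<close> summable_exp[of ?s]
        by (intro sum_le_suminf) (auto simp: divide_inverse mult.commute)
      then show ?thesis by (simp add: exp_def divide_inverse mult.commute)
    qed
    have "norm (e r * z ^ r) \<le> (M * K ^ r / (fact r)\<^sup>2) * norm z ^ r"
      unfolding norm_mult norm_power by (intro mult_right_mono coeff) auto
    also have "\<dots> = M * ((?s ^ r / fact r) * (?s ^ r / fact r))"
    proof -
      have "?s ^ r * ?s ^ r = (K * norm z) ^ r"
        using s(2) by (simp only: power2_eq_square flip: power_mult_distrib)
      then show ?thesis by (simp add: power2_eq_square power_mult_distrib mult.assoc)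
    qed
    also have "\<dots> \<le> M * (exp ?s * (?s ^ r / fact r))"
      using \<open>0 \<le> M\<close> s(1) by (intro mult_left_mono mult_right_mono le) auto
    finally show ?thesis by (simp add: mult.assoc)
  qed
  have maj: "(\<lambda>r. (M * exp (sqrt (K * norm z))) * (sqrt (K * norm z) ^ r / fact r)) sums
      (M * exp (sqrt (K * norm z)) * exp (sqrt (K * norm z)))" for z :: complex
    using exp_converges[of "sqrt (K * norm z)"] by (intro sums_mult) (simp add: divide_inverse mult.commute)
  have summ: "summable (\<lambda>r. norm (e r * z ^ r))" for z
    by (rule summable_comparison_test[OF _ sums_summable[OF maj[of z]]]) (use termb in auto)
  have summ': "summable (\<lambda>r. e r * z ^ r)" for z using summable_norm_cancel[OF summ] .
  have growth: "norm (f z) \<le> M * exp (2 * sqrt K * sqrt (norm z))" for z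
  proof -
    have "norm (f z) \<le> (suminf (\<lambda>r. norm (e r * z ^ r)))" unfolding f_def by (rule summable_norm[OF summ])
    also have "\<dots> \<le> M * exp (sqrt (K * norm z)) * exp (sqrt (K * norm z))"
      unfolding sums_unique[OF maj] by (intro suminf_le termb summ sums_summable[OF maj])
    also have "\<dots> = M * exp (2 * sqrt K * sqrt (norm z))"
      by (simp add: mult.assoc real_sqrt_mult flip: exp_add)
    finally show ?thesis .
  qed
  have hol: "f holomorphic_on UNIV"
    unfolding holomorphic_on_def f_def[abs_def] field_differentiable_def
    using termdiffs_strong_converges_everywhere[OF summ'] has_field_derivative_at_within by blast
  define C' where "C' = max C 1"
  have C': "0 < C'" "\<And>x. norm (f (of_real x)) \<le> C' * (1 + \<bar>x\<bar>) ^ N"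
    using real order_trans[OF real mult_right_mono[of C C']] by (auto simp: C'_def f_def)
  have up: "norm (f z) \<le> C' * 2 ^ N * (1 + norm z) ^ N" if "0 \<le> Im z" for z
    by (rule polynomial_growth_halfplane[OF hol growth C'(2,1) that])
  have "norm (f z) \<le> C' * 2 ^ N * (1 + norm z) ^ N" for z
  proof (cases "0 \<le> Im z")
    case False
    \<comment> \<open>The lower half-plane follows from the bound for the reflected function
      \<open>f (- z)\<close>.\<close>
    have "(f \<circ> uminus) holomorphic_on UNIV"
      by (rule holomorphic_on_compose) (auto intro: holomorphic_on_minus holomorphic_on_ident holomorphic_on_subset[OF hol])
    then have "(\<lambda>z. f (- z)) holomorphic_on UNIV" by (simp add: o_def)
    moreover have "norm (f (- z)) \<le> M * exp (2 * sqrt K * sqrt (norm z))" for z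
      using growth[of "- z"] by simp
    moreover have "norm (f (- of_real x)) \<le> C' * (1 + \<bar>x\<bar>) ^ N" for x
      using C'(2)[of "- x"] by simp
    ultimately have "norm (f (- (- z))) \<le> C' * 2 ^ N * (1 + norm (- z)) ^ N"
      using False C'(1) by (intro polynomial_growth_halfplane[where f="\<lambda>z. f (- z)"]) auto
    then show ?thesis by simp
  qed (rule up)
  note poly = this
  have cauchy: "norm ((deriv ^^ r) f 0) \<le> fact r * (C' * 2 ^ N * (1 + R) ^ N) / R ^ r" if "0 < R" for R
  proof (rule Cauchy_inequality)
    show "f holomorphic_on ball 0 R" "continuous_on (cball 0 R) f"
      using hol by (auto intro: holomorphic_on_subset holomorphic_on_imp_continuous_on)
    show "norm (f x) \<le> C' * 2 ^ N * (1 + R) ^ N" if "norm (0 - x) = R" for x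
      using poly[of x] that by simp
  qed fact
  have "norm (e r) \<le> C' * 2 ^ N * ((1 + R) ^ N / R ^ r)" if "0 < R" for R
  proof -
    have "fact r * norm (e r) \<le> fact r * (C' * 2 ^ N * ((1 + R) ^ N / R ^ r))"
      using cauchy[OF that] higher_deriv_powser_0[OF summ', of r]
      by (simp add: f_def[abs_def] norm_mult)
    then show ?thesis by (rule mult_left_le_imp_le) simp
  qed
  moreover have "((\<lambda>R::real. C' * 2 ^ N * ((1 + R) ^ N / R ^ r)) \<longlongrightarrow> C' * 2 ^ N * 0) at_top"
  proof (intro tendsto_mult tendsto_const)
    have "((\<lambda>R::real. (inverse R + 1) ^ N * inverse R ^ (r - N)) \<longlongrightarrow> (0 + 1) ^ N * 0 ^ (r - N)) at_top"
      by (intro tendsto_intros tendsto_inverse_0_at_top filterlim_ident)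
    moreover have "eventually (\<lambda>R::real. (inverse R + 1) ^ N * inverse R ^ (r - N) = (1 + R) ^ N / R ^ r) at_top"
      using eventually_gt_at_top[of 0]
    proof eventually_elim
      case (elim R)
      have "R ^ r = R ^ N * R ^ (r - N)" using \<open>N < r\<close> by (simp flip: power_add)
      moreover have "inverse R + 1 = (1 + R) / R" using elim by (simp add: field_simps)
      ultimately show ?case using elim by (simp add: power_divide field_simps)
    qed
    ultimately show "((\<lambda>R::real. (1 + R) ^ N / R ^ r) \<longlongrightarrow> 0) at_top"
      using \<open>N < r\<close> by (simp add: power_0_left Lim_transform_eventually)
  qed
  ultimately have "norm (e r) \<le> C' * 2 ^ N * 0"
    by (intro tendsto_lowerbound[of _ _ at_top]) (auto intro: eventually_mono[OF eventually_gt_at_top[of 0]])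
  then show ?thesis by simp
qed

section \<open>Functionals with rapidly decaying moments\<close>

lemma DK_mult_right: "smooth_fun q \<Longrightarrow> DK L g \<Longrightarrow> DK L (\<lambda>x. g x * q x)"
  unfolding DK_def supported_in_def by (simp add: smooth_mult)

text \<open>The constant depends on \<open>L\<close> because \<open>q\<close>, for instance a
  polynomial, may be unbounded; only its derivatives on \<open>L\<close> enter.\<close>

lemma DK_mult_bndw:
  assumes L: "compact L" and q: "smooth_fun q"
  obtains \<beta> where "0 \<le> \<beta>"
    "\<And>g B. DK L g \<Longrightarrow> bndw (\<lambda>_. 1) N g B \<Longrightarrow> bndw (\<lambda>_. 1) N (\<lambda>x. q x * g x) (\<beta> * B)"
proof -
  obtain A where A: "0 \<le> A" "bndw (indicat_real L) N q A" using bndw_compact[OF q L] by blast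
  show ?thesis
  proof (rule that[of "2 ^ N * A"])
    fix g B assume g: "DK L g" "bndw (\<lambda>_. 1) N g B"
    have "bndw (\<lambda>x. indicat_real L x * 1) N (\<lambda>x. q x * g x) (2 ^ N * (A * B))"
      by (rule bndw_mult[OF A(2) g(2) q DK_smooth[OF g(1)]]) auto
    then show "bndw (\<lambda>_. 1) N (\<lambda>x. q x * g x) (2 ^ N * A * B)"
      using bndw_supported[of L N "\<lambda>x. q x * g x"] DK_mult[OF q g(1)] compact_imp_closed[OF L] A(1) bndw_nonneg[OF g(2)]
      by (simp add: DK_def mult.assoc)
  qed (use A in simp)
qed

definition exp_tail :: "nat \<Rightarrow> complex \<Rightarrow> complex" where
  "exp_tail R z = exp z - (\<Sum>r<R. z ^ r / fact r)"

text \<open>Differentiating drops one Taylor term. For \<open>R = 0\<close> the tail is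
  \<open>exp\<close> itself, and truncated subtraction makes \<open>0 - 1 = 0\<close> give the right
  answer.\<close>

lemma exp_tail_deriv: "(exp_tail R has_field_derivative exp_tail (R - 1) z) (at z)"
proof (cases R)
  case 0
  then show ?thesis by (auto simp: exp_tail_def[abs_def] intro!: derivative_eq_intros)
next
  case (Suc n)
  have term_deriv: "((\<lambda>z::complex. z ^ Suc r / fact (Suc r)) has_field_derivative z ^ r / fact r) (at z)" for r
    by (rule derivative_eq_intros refl | simp add: field_simps del: of_nat_Suc)+
  have "((\<lambda>z. exp z - (\<Sum>r<n. z ^ Suc r / fact (Suc r)) - 1) has_field_derivative
      exp z - (\<Sum>r<n. z ^ r / fact r) - 0) (at z)"
    by (intro DERIV_diff DERIV_exp DERIV_sum term_deriv DERIV_const)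
  moreover have "exp_tail R = (\<lambda>z. exp z - (\<Sum>r<n. z ^ Suc r / fact (Suc r)) - 1)"
    unfolding exp_tail_def Suc by (intro ext, subst sum.lessThan_Suc_shift) simp
  ultimately show ?thesis by (simp add: exp_tail_def Suc)
qed

lemma exp_tail_small:
  assumes "0 < \<delta>"
  shows "\<forall>\<^sub>F R in sequentially. \<forall>z. norm z \<le> \<rho> \<longrightarrow> norm (exp_tail R z) \<le> \<delta>"
proof -
  have "uniform_limit (cball 0 \<rho>) (\<lambda>n z. \<Sum>i<n. z ^ i /\<^sub>R fact i) (\<lambda>z::complex. suminf (\<lambda>i. z ^ i /\<^sub>R fact i)) sequentially"
  proof (rule Weierstrass_m_test)
    show "norm (z ^ n /\<^sub>R fact n) \<le> \<rho> ^ n /\<^sub>R fact n" if "z \<in> cball 0 \<rho>" for n and z :: complex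
      using that by (auto simp: norm_power divide_inverse mult.commute intro!: mult_left_mono power_mono)
    show "summable (\<lambda>n. \<rho> ^ n /\<^sub>R fact n)" by (rule summable_exp_generic)
  qed
  from uniform_limitD[OF this assms]
  show ?thesis
    by eventually_elim (auto simp: exp_tail_def dist_norm exp_def scaleR_conv_of_real divide_inverse
        norm_minus_commute mult.commute less_imp_le)
qed

lemma smooth_exp_tail: "smooth_fun B \<Longrightarrow> smooth_fun (\<lambda>x. exp_tail R (c * B x))"
  unfolding exp_tail_def divide_inverse
  by (intro smooth_diff smooth_exp smooth_sum smooth_mult smooth_power smooth_const) auto

text \<open>A derivative produces a tail of index \<open>R - 1\<close> times a new member of
  \<open>DK L\<close> and a tail of index \<open>R\<close> times \<open>dir_deriv b g\<close>. Since
  the claim concerns all large \<open>R\<close>, the index shift is harmless, and induction on the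
  order applies with \<open>g\<close> and \<open>\<delta>\<close> arbitrary.\<close>

lemma exp_tail_bndw:
  assumes L: "compact L" and B: "smooth_fun B" and "DK L g" "0 < \<delta>"
  shows "\<forall>\<^sub>F R in sequentially. bndw (\<lambda>_. 1) N (\<lambda>x. exp_tail R (c * B x) * g x) \<delta>"
  using assms(3,4)
proof (induction N arbitrary: g \<delta>)
  case 0
  obtain \<rho> where \<rho>: "\<And>x. x \<in> L \<Longrightarrow> norm (c * B x) \<le> \<rho>"
  proof -
    have "compact ((\<lambda>x. c * B x) ` L)"
      by (intro compact_continuous_image L continuous_on_subset[OF smooth_continuous[OF smooth_cmult[OF B]]]) simp
    from compact_imp_bounded[OF this] show ?thesis using that unfolding bounded_iff by auto
  qed
  obtain A where A: "0 \<le> A" "bndw (\<lambda>_. 1) 0 g A" using bndw_test[of g L 0] 0 L by (auto simp: DK_def)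
  have "0 < \<delta> / (A + 1)" using 0 A by simp
  from exp_tail_small[OF this, of \<rho>] show ?case
  proof eventually_elim
    case (elim R)
    have "norm (exp_tail R (c * B x) * g x) \<le> \<delta>" for x
    proof (cases "x \<in> L")
      case True
      have "norm (exp_tail R (c * B x) * g x) \<le> \<delta> / (A + 1) * A"
        unfolding norm_mult using elim \<rho>[OF True] bndwD0[OF A(2), of x] A 0 by (intro mult_mono) auto
      also have "\<dots> \<le> \<delta>" using A 0 by (simp add: field_simps)
      finally show ?thesis .
    next
      case False
      then show ?thesis using 0 by (simp add: DK_def supported_in_def)
    qed
    then show ?case by (simp add: bndw_0)
  qed
next
  case (Suc N)
  note g = Suc.prems(1)
  have "\<forall>\<^sub>F R in sequentially. \<forall>b\<in>Basis.
      bndw (\<lambda>_. 1) N (\<lambda>x. exp_tail R (c * B x) * (c * dir_deriv b B x * g x)) (\<delta>/2)"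
    using Suc.prems(2)
    by (intro eventually_ball_finite ballI Suc.IH DK_mult[OF smooth_cmult[OF smooth_dir_deriv[OF B]] g]) auto
  then have "\<forall>\<^sub>F R in sequentially. \<forall>b\<in>Basis.
      bndw (\<lambda>_. 1) N (\<lambda>x. exp_tail (R - 1) (c * B x) * (c * dir_deriv b B x * g x)) (\<delta>/2)"
    by (rule eventually_compose_filterlim[OF _ filterlim_minus_const_nat_at_top])
  moreover have "\<forall>\<^sub>F R in sequentially. \<forall>b\<in>Basis.
      bndw (\<lambda>_. 1) N (\<lambda>x. exp_tail R (c * B x) * dir_deriv b g x) (\<delta>/2)"
    using Suc.prems(2)
    by (intro eventually_ball_finite ballI Suc.IH DK_dir_deriv[OF compact_imp_closed[OF L] g]) auto
  moreover have "\<forall>\<^sub>F R in sequentially. bndw (\<lambda>_. 1) N (\<lambda>x. exp_tail R (c * B x) * g x) \<delta>"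
    by (rule Suc.IH[OF g Suc.prems(2)])
  ultimately show ?case
  proof eventually_elim
    case (elim R)
    have "bndw (\<lambda>_. 1) N (dir_deriv b (\<lambda>x. exp_tail R (c * B x) * g x)) \<delta>" if b: "b \<in> Basis" for b
    proof -
      have "((\<lambda>s. exp_tail R (c * B (x + s *\<^sub>R b)) * g (x + s *\<^sub>R b)) has_vector_derivative
          (exp_tail (R - 1) (c * B x) * (c * dir_deriv b B x * g x) + exp_tail R (c * B x) * dir_deriv b g x)) (at 0)" for x
      proof -
        have "((\<lambda>s. c * B (x + s *\<^sub>R b)) has_vector_derivative c * dir_deriv b B x) (at 0)"
          by (intro has_vector_derivative_mult_right smooth_deriv B b)
        from hvd_compose[where f="\<lambda>x. c * B x", OF this exp_tail_deriv]
        have "((\<lambda>s. exp_tail R (c * B (x + s *\<^sub>R b))) has_vector_derivative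
            c * dir_deriv b B x * exp_tail (R - 1) (c * B x)) (at 0)" .
        from has_vector_derivative_mult[OF this smooth_deriv[OF DK_smooth[OF g] b], of x]
        show ?thesis by (simp add: algebra_simps)
      qed
      then have "dir_deriv b (\<lambda>x. exp_tail R (c * B x) * g x) =
         (\<lambda>x. exp_tail (R - 1) (c * B x) * (c * dir_deriv b B x * g x) + exp_tail R (c * B x) * dir_deriv b g x)"
        by (intro ext dir_derivI)
      moreover have "bndw (\<lambda>_. 1) N (\<lambda>x. exp_tail (R - 1) (c * B x) * (c * dir_deriv b B x * g x)
           + exp_tail R (c * B x) * dir_deriv b g x) (\<delta>/2 + \<delta>/2)"
        using elim b
        by (intro bndw_add smooth_mult smooth_exp_tail smooth_cmult smooth_dir_deriv B DK_smooth[OF g] smooth_const) auto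
      ultimately show ?thesis by simp
    qed
    then show ?case using elim by (simp add: bndw_Suc)
  qed
qed

text \<open>Since \<open>B\<close> is real the exponential has modulus 1; each derivative that falls
  on it contributes one factor \<open>y\<close>, so \<open>N\<close> derivatives cost at most a
  multiple of \<open>(1 + \<bar>y\<bar>) ^ N\<close>.\<close>

lemma exp_mult_bndw:
  assumes L: "compact L" and B: "smooth_fun B" "\<And>x. Im (B x) = 0" and "DK L g"
  shows "\<exists>C\<ge>0. \<forall>y::real. bndw (\<lambda>_. 1) N (\<lambda>x. g x * exp ((\<i> * of_real y) * B x)) (C * (1 + \<bar>y\<bar>) ^ N)"
  using assms(4)
proof (induction N arbitrary: g)
  case 0
  obtain A where "0 \<le> A" "bndw (\<lambda>_. 1) 0 g A" using bndw_test[of g L 0] 0 L by (auto simp: DK_def)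
  then show ?case by (intro exI[of _ A]) (auto simp: bndw_0 norm_mult B(2))
next
  case (Suc N)
  note g = Suc.prems
  let ?e = "\<lambda>y x. exp ((\<i> * of_real y) * B x)"
  obtain C0 where C0: "0 \<le> C0" "\<And>y. bndw (\<lambda>_. 1) N (\<lambda>x. g x * ?e y x) (C0 * (1 + \<bar>y\<bar>) ^ N)"
    using Suc.IH[OF g] by blast
  have "\<forall>b\<in>Basis. \<exists>C\<ge>0. \<forall>y. bndw (\<lambda>_. 1) N (\<lambda>x. dir_deriv b g x * ?e y x) (C * (1 + \<bar>y\<bar>) ^ N)"
    using Suc.IH[OF DK_dir_deriv[OF compact_imp_closed[OF L] g]] by blast
  then obtain C1 where C1: "\<And>b. b \<in> Basis \<Longrightarrow> 0 \<le> C1 b"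
    "\<And>b y. b \<in> Basis \<Longrightarrow> bndw (\<lambda>_. 1) N (\<lambda>x. dir_deriv b g x * ?e y x) (C1 b * (1 + \<bar>y\<bar>) ^ N)" by metis
  have "\<forall>b\<in>Basis. \<exists>C\<ge>0. \<forall>y. bndw (\<lambda>_. 1) N (\<lambda>x. (dir_deriv b B x * g x) * ?e y x) (C * (1 + \<bar>y\<bar>) ^ N)"
    using Suc.IH[OF DK_mult[OF smooth_dir_deriv[OF B(1)] g]] by blast
  then obtain C2 where C2: "\<And>b. b \<in> Basis \<Longrightarrow> 0 \<le> C2 b"
    "\<And>b y. b \<in> Basis \<Longrightarrow> bndw (\<lambda>_. 1) N (\<lambda>x. (dir_deriv b B x * g x) * ?e y x) (C2 b * (1 + \<bar>y\<bar>) ^ N)" by metis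
  define C where "C = C0 + (\<Sum>b\<in>Basis. C1 b + C2 b)"
  have Cb: "C1 b + C2 b \<le> C" if "b \<in> Basis" for b
  proof -
    have "C1 b + C2 b \<le> (\<Sum>b\<in>Basis. C1 b + C2 b)"
      using C1(1) C2(1) by (intro member_le_sum[OF that, where f="\<lambda>b. C1 b + C2 b"]) auto
    then show ?thesis using C0 by (simp add: C_def)
  qed
  have C: "C0 \<le> C" "0 \<le> C" using C0 C1(1) C2(1) by (auto simp: C_def intro!: sum_nonneg add_nonneg_nonneg)
  show ?case
  proof (intro exI conjI allI)
    show "0 \<le> C" by fact
    fix y :: real
    have p: "(1 + \<bar>y\<bar>) ^ N \<le> (1 + \<bar>y\<bar>) ^ Suc N" by (intro power_increasing) auto
    have "bndw (\<lambda>_. 1) N (\<lambda>x. g x * ?e y x) (C * (1 + \<bar>y\<bar>) ^ Suc N)"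
      by (rule bndw_mono[OF C0(2) order_refl]) (intro mult_mono p C, auto)
    moreover have "bndw (\<lambda>_. 1) N (dir_deriv b (\<lambda>x. g x * ?e y x)) (C * (1 + \<bar>y\<bar>) ^ Suc N)"
      if b: "b \<in> Basis" for b
    proof -
      let ?f1 = "\<lambda>x. dir_deriv b g x * ?e y x" and ?f2 = "\<lambda>x. (dir_deriv b B x * g x) * ?e y x"
      have sm: "smooth_fun ?f1" "smooth_fun ?f2"
        by (intro smooth_mult_exp smooth_mult smooth_dir_deriv B b DK_smooth[OF g])+
      have eq: "dir_deriv b (\<lambda>x. g x * ?e y x) = (\<lambda>x. ?f1 x + (\<i> * of_real y) * ?f2 x)"
        unfolding dir_deriv_mult_exp[OF DK_smooth[OF g] B(1) b] by (simp add: fun_eq_iff algebra_simps)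
      have "bndw (\<lambda>_. 1) N (\<lambda>x. ?f1 x + (\<i> * of_real y) * ?f2 x)
         (C1 b * (1 + \<bar>y\<bar>) ^ N + norm (\<i> * of_real y) * (C2 b * (1 + \<bar>y\<bar>) ^ N))"
        by (intro bndw_add bndw_cmult C1 C2 b sm smooth_cmult) auto
      then show ?thesis unfolding eq
      proof (rule bndw_mono[OF _ order_refl])
        have "C1 b * (1 + \<bar>y\<bar>) ^ N + norm (\<i> * of_real y) * (C2 b * (1 + \<bar>y\<bar>) ^ N) \<le>
            C1 b * (1 + \<bar>y\<bar>) ^ Suc N + C2 b * (1 + \<bar>y\<bar>) ^ Suc N"
          using C1(1)[OF b] C2(1)[OF b] p
          by (intro add_mono mult_left_mono) (auto simp: norm_mult algebra_simps)
        also have "\<dots> \<le> C * (1 + \<bar>y\<bar>) ^ Suc N"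
          unfolding distrib_right[symmetric] using Cb[OF b] by (intro mult_right_mono) auto
        finally show "C1 b * (1 + \<bar>y\<bar>) ^ N + norm (\<i> * of_real y) * (C2 b * (1 + \<bar>y\<bar>) ^ N) \<le> C * (1 + \<bar>y\<bar>) ^ Suc N" .
      qed
    qed
    ultimately show "bndw (\<lambda>_. 1) (Suc N) (\<lambda>x. g x * ?e y x) (C * (1 + \<bar>y\<bar>) ^ Suc N)"
      by (simp add: bndw_Suc)
  qed
qed

text \<open>The function \<open>y \<mapsto> l (exp (i y B) g)\<close> has polynomial growth on the real line since \<open>l\<close> has order \<open>N\<close>,
  and extends to an entire function of order at most \<open>1/2\<close> because of the decay of the moments; by
  Phragmen-Lindelof it is a polynomial of degree at most \<open>N\<close>.\<close>

lemma moments_vanish: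
  fixes l :: "('a::euclidean_space \<Rightarrow> complex) \<Rightarrow> complex"
  assumes L: "compact L" and lin: "lin_on (DK L) l"
    and ord: "0 \<le> C" "\<And>g D. DK L g \<Longrightarrow> bndw (\<lambda>_. 1) N g D \<Longrightarrow> norm (l g) \<le> C * D"
    and B: "smooth_fun B" "\<And>x. Im (B x) = 0" and g: "DK L g"
    and mom: "0 \<le> M" "0 \<le> K" "\<And>r. norm (l (\<lambda>x. B x ^ r * g x)) \<le> M * K ^ r / fact r"
    and "N < r"
  shows "l (\<lambda>x. B x ^ r * g x) = 0"
proof -
  \<comment> \<open>The Taylor coefficients of \<open>y \<mapsto> l (exp (i y B) g)\<close>; the
    factorial here and the one in the moment bound make up the squared factorial in
    \<open>powser_coeff_eq_0\<close>.\<close>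
  define e where "e r = \<i> ^ r * l (\<lambda>x. B x ^ r * g x) / fact r" for r
  obtain A where A: "0 \<le> A" "\<And>y. bndw (\<lambda>_. 1) N (\<lambda>x. g x * exp ((\<i> * of_real y) * B x)) (A * (1 + \<bar>y\<bar>) ^ N)"
    using exp_mult_bndw[OF L B g] by blast
  have Bg: "DK L (\<lambda>x. B x ^ r * g x)" for r
    by (intro DK_mult smooth_power B g)
  have lin_term: "l (\<lambda>x. c * (B x ^ r * g x)) = c * l (\<lambda>x. B x ^ r * g x)" for c r
    using lin Bg[of r] unfolding lin_on_def by blast
  \<comment> \<open>Exchanging \<open>l\<close> with the exponential series: the tail tends to 0 in
    the seminorm of order \<open>N\<close>, with respect to which \<open>l\<close> is
    continuous.\<close>
  have sums: "(\<lambda>r. e r * of_real y ^ r) sums l (\<lambda>x. g x * exp ((\<i> * of_real y) * B x))" for y :: real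
    unfolding sums_def
  proof (rule LIMSEQ_I)
    fix \<epsilon> :: real assume "0 < \<epsilon>"
    let ?h = "\<lambda>x. g x * exp ((\<i> * of_real y) * B x)"
    have "0 < \<epsilon> / (2 * (C + 1))" using \<open>0 < \<epsilon>\<close> ord by simp
    from exp_tail_bndw[OF L B(1) g this] obtain R0 where R0:
      "\<And>R. R \<ge> R0 \<Longrightarrow> bndw (\<lambda>_. 1) N (\<lambda>x. exp_tail R ((\<i> * of_real y) * B x) * g x) (\<epsilon> / (2 * (C + 1)))"
      unfolding eventually_sequentially by blast
    have "norm ((\<Sum>r<R. e r * of_real y ^ r) - l ?h) < \<epsilon>" if "R \<ge> R0" for R
    proof -
      let ?P = "\<lambda>x. \<Sum>r<R. ((\<i> * of_real y) ^ r / fact r) * (B x ^ r * g x)"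
      have DP: "DK L ?P" by (intro DK_sum DK_cmult Bg)
      have Dh: "DK L ?h" by (rule DK_mult_right[OF smooth_exp[OF B(1)] g])
      have "l ?P = (\<Sum>r<R. l (\<lambda>x. ((\<i> * of_real y) ^ r / fact r) * (B x ^ r * g x)))"
        by (rule lin_on_sum[OF lin finite_lessThan]) (rule DK_cmult[OF Bg])
      also have "\<dots> = (\<Sum>r<R. ((\<i> * of_real y) ^ r / fact r) * l (\<lambda>x. B x ^ r * g x))"
        by (intro sum.cong refl lin_term)
      also have "\<dots> = (\<Sum>r<R. e r * of_real y ^ r)"
        by (intro sum.cong) (auto simp: e_def power_mult_distrib)
      finally have 1: "l ?P = (\<Sum>r<R. e r * of_real y ^ r)" .
      have "(\<lambda>x. ?h x - ?P x) = (\<lambda>x. exp_tail R ((\<i> * of_real y) * B x) * g x)"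
        by (simp add: fun_eq_iff exp_tail_def algebra_simps sum_distrib_left power_mult_distrib)
      then have "norm (l (\<lambda>x. ?h x - ?P x)) \<le> C * (\<epsilon> / (2 * (C + 1)))"
        using ord(2)[OF _ R0[OF that]] DK_diff[OF Dh DP] by simp
      also have "\<dots> \<le> \<epsilon> / 2" using ord(1) \<open>0 < \<epsilon>\<close> by (simp add: field_simps)
      also have "\<dots> < \<epsilon>" using \<open>0 < \<epsilon>\<close> by simp
      finally have "norm (l ?h - l ?P) < \<epsilon>"
        unfolding lin_on_diff[OF lin Dh DP DK_cmult[OF DP]] .
      then show ?thesis unfolding 1 by (subst norm_minus_commute)
    qed
    then show "\<exists>no. \<forall>n\<ge>no. norm ((\<Sum>r<n. e r * of_real y ^ r) - l ?h) < \<epsilon>" by blast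
  qed
  have "e r = 0"
  proof (rule powser_coeff_eq_0[OF _ mom(1,2) _ \<open>N < r\<close>])
    show "norm (e r) \<le> M * K ^ r / (fact r)\<^sup>2" for r
      using divide_right_mono[OF mom(3)[of r], of "fact r"]
      by (simp add: e_def norm_mult norm_divide norm_power power2_eq_square)
    show "norm (suminf (\<lambda>r. e r * of_real y ^ r)) \<le> (C * A) * (1 + \<bar>y\<bar>) ^ N" for y
    proof -
      have "DK L (\<lambda>x. g x * exp ((\<i> * of_real y) * B x))" by (rule DK_mult_right[OF smooth_exp[OF B(1)] g])
      from ord(2)[OF this A(2)] show ?thesis by (simp add: sums_unique[OF sums, symmetric] mult.assoc)
    qed
  qed
  then show ?thesis by (simp add: e_def)
qed

section \<open>Causal families with polynomial relations\<close>

text \<open>\<open>F i\<close> stands for the \<open>i\<close>-th time derivative of one family of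
  functionals, up to \<open>i = m\<close>. Order and constant are uniform in time below
  \<open>T\<close>. The derivatives are listed explicitly so that a differential relation becomes a
  finite sum over the index.\<close>

definition causal_family :: "'a::euclidean_space set \<Rightarrow> real \<Rightarrow> real \<Rightarrow> nat \<Rightarrow> nat \<Rightarrow>
    (nat \<Rightarrow> real \<Rightarrow> ('a \<Rightarrow> complex) \<Rightarrow> complex) \<Rightarrow> bool" where
  "causal_family L t0 T N m F \<longleftrightarrow>
     (\<forall>i\<le>m. \<forall>t. lin_on (DK L) (F i t)) \<and>
     (\<exists>C\<ge>0. \<forall>i\<le>m. \<forall>t<T. \<forall>g B. DK L g \<longrightarrow> bndw (\<lambda>_. 1) N g B \<longrightarrow> norm (F i t g) \<le> C * B) \<and>
     (\<forall>i<m. \<forall>t<T. \<forall>g. DK L g \<longrightarrow> ((\<lambda>t. F i t g) has_vector_derivative F (Suc i) t g) (at t)) \<and>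
     (\<forall>i\<le>m. \<forall>t\<le>t0. \<forall>g. DK L g \<longrightarrow> F i t g = 0)"

lemma causal_familyD:
  assumes "causal_family L t0 T N m F"
  shows "i \<le> m \<Longrightarrow> lin_on (DK L) (F i t)"
    and "\<exists>C\<ge>0. \<forall>i\<le>m. \<forall>t<T. \<forall>g B. DK L g \<longrightarrow> bndw (\<lambda>_. 1) N g B \<longrightarrow> norm (F i t g) \<le> C * B"
    and "i < m \<Longrightarrow> t < T \<Longrightarrow> DK L g \<Longrightarrow> ((\<lambda>t. F i t g) has_vector_derivative F (Suc i) t g) (at t)"
    and "i \<le> m \<Longrightarrow> t \<le> t0 \<Longrightarrow> DK L g \<Longrightarrow> F i t g = 0"
proof -
  note * = assms[unfolded causal_family_def]
  show "i \<le> m \<Longrightarrow> lin_on (DK L) (F i t)" using *[THEN conjunct1] by simp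
  show "\<exists>C\<ge>0. \<forall>i\<le>m. \<forall>t<T. \<forall>g B. DK L g \<longrightarrow> bndw (\<lambda>_. 1) N g B \<longrightarrow> norm (F i t g) \<le> C * B"
    by (rule *[THEN conjunct2, THEN conjunct1])
  show "i < m \<Longrightarrow> t < T \<Longrightarrow> DK L g \<Longrightarrow> ((\<lambda>t. F i t g) has_vector_derivative F (Suc i) t g) (at t)"
    using *[THEN conjunct2, THEN conjunct2, THEN conjunct1] by simp
  show "i \<le> m \<Longrightarrow> t \<le> t0 \<Longrightarrow> DK L g \<Longrightarrow> F i t g = 0"
    using *[THEN conjunct2, THEN conjunct2, THEN conjunct2] by simp
qed

text \<open>The multiplier does not depend on time, so it commutes with the time derivatives, and on
  compact \<open>L\<close> it preserves the order \<open>N\<close>.\<close>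

lemma causal_family_mult:
  assumes F: "causal_family L t0 T N m F" and L: "compact L" and q: "smooth_fun q"
  shows "causal_family L t0 T N m (\<lambda>i t g. F i t (\<lambda>x. q x * g x))"
  unfolding causal_family_def
proof (intro conjI allI impI)
  note D = causal_familyD[OF F] DK_mult[OF q]
  show "lin_on (DK L) (\<lambda>g. F i t (\<lambda>x. q x * g x))" if "i \<le> m" for i t
    unfolding lin_on_def
    using lin_onD[OF D(1)[OF that] D(5)] lin_onD(1)[OF D(1)[OF that] D(5) D(5)]
    by (simp add: distrib_left mult.left_commute)
  obtain C where C: "0 \<le> C" "\<And>i t g B. i \<le> m \<Longrightarrow> t < T \<Longrightarrow> DK L g \<Longrightarrow> bndw (\<lambda>_. 1) N g B \<Longrightarrow> norm (F i t g) \<le> C * B"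
    using D(2) by blast
  obtain \<beta> where b: "0 \<le> \<beta>" "\<And>g B. DK L g \<Longrightarrow> bndw (\<lambda>_. 1) N g B \<Longrightarrow> bndw (\<lambda>_. 1) N (\<lambda>x. q x * g x) (\<beta> * B)"
    using DK_mult_bndw[OF L q] by blast
  have "norm (F i t (\<lambda>x. q x * g x)) \<le> (C * \<beta>) * B" if "i \<le> m" "t < T" "DK L g" "bndw (\<lambda>_. 1) N g B" for i t g B
    using C(2)[OF that(1,2) D(5) b(2)] that by (simp add: mult.assoc)
  then show "\<exists>C\<ge>0. \<forall>i\<le>m. \<forall>t<T. \<forall>g B. DK L g \<longrightarrow> bndw (\<lambda>_. 1) N g B \<longrightarrow> norm (F i t (\<lambda>x. q x * g x)) \<le> C * B"
    using C b by (intro exI[of _ "C * \<beta>"]) auto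
qed (use causal_familyD[OF F] DK_mult[OF q] in auto)

lemma causal_family_mono: "causal_family L t0 T N m F \<Longrightarrow> k \<le> m \<Longrightarrow> causal_family L t0 T N k F"
  unfolding causal_family_def by (meson dual_order.strict_trans1 order_trans)

text \<open>For a function that vanishes up to \<open>t0\<close>, integration raises the power of
  \<open>t - t0\<close> by one and divides by the new exponent; the maximum with 0 makes one formula
  serve before and after \<open>t0\<close>.\<close>

lemma integrate_power_bound:
  fixes h h' :: "real \<Rightarrow> complex"
  assumes der: "\<And>s. s < T \<Longrightarrow> (h has_vector_derivative h' s) (at s)"
    and zero: "\<And>s. s \<le> t0 \<Longrightarrow> h s = 0"
    and bnd: "\<And>s. s < T \<Longrightarrow> norm (h' s) \<le> M * (max 0 (s - t0)) ^ r"
    and "t < T"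
  shows "norm (h t) \<le> M * (max 0 (t - t0)) ^ Suc r / real (Suc r)"
proof (cases "t \<le> t0")
  case True
  then show ?thesis using zero[of t] by simp
next
  case False
  let ?\<phi> = "\<lambda>s. M * (s - t0) ^ Suc r / real (Suc r)"
  have d\<phi>: "(?\<phi> has_vector_derivative M * (s - t0) ^ r) (at s)" for s
    unfolding has_real_derivative_iff_has_vector_derivative[symmetric]
    by (rule derivative_eq_intros refl | simp add: field_simps del: of_nat_Suc)+
  have "norm (h t - h t0) \<le> ?\<phi> t - ?\<phi> t0"
  proof (rule differentiable_bound_general[where f'=h' and \<phi>'="\<lambda>s. M * (s - t0) ^ r"])
    show "t0 < t" using False by simp
    show "continuous_on {t0..t} h"
      using der \<open>t < T\<close> by (intro continuous_at_imp_continuous_on ballI) (auto intro!: has_vector_derivative_continuous der)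
    show "continuous_on {t0..t} ?\<phi>"
      by (intro continuous_at_imp_continuous_on ballI) (rule has_vector_derivative_continuous[OF d\<phi>])
    show "norm (h' s) \<le> M * (s - t0) ^ r" if "t0 < s" "s < t" for s
      using bnd[of s] that \<open>t < T\<close> by simp
  qed (use der d\<phi> \<open>t < T\<close> in auto)
  then show ?thesis using zero[of t0] False by simp
qed

text \<open>Induction on \<open>r\<close>. The relation tested with \<open>B m ^ r * g\<close>
  writes the top moment of power \<open>r + 1\<close> through \<open>F k\<close> with
  \<open>k < m\<close> and power \<open>r\<close>. Each such \<open>F k\<close> is the primitive of
  \<open>F (Suc k)\<close>, to which the induction hypothesis applies, and the integration supplies
  the factor \<open>(t - t0) / (r + 1)\<close>. The moments of lower index with power
  \<open>r + 1\<close> are then obtained by integrating down from the top.\<close>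

lemma causal_moments:
  assumes F: "causal_family L t0 T N m F" and L: "compact L"
    and B: "\<And>k. k \<le> m \<Longrightarrow> smooth_fun (B k)"
    and eq: "\<And>t g. t < T \<Longrightarrow> DK L g \<Longrightarrow> (\<Sum>k\<le>m. F k t (\<lambda>x. B k x * g x)) = 0"
  shows "\<exists>C\<ge>0. \<exists>K\<ge>0. \<forall>r i t g D. i \<le> m \<longrightarrow> t < T \<longrightarrow> DK L g \<longrightarrow> bndw (\<lambda>_. 1) N g D \<longrightarrow>
      norm (F i t (\<lambda>x. B m x ^ r * g x)) \<le> C * K ^ r * (max 0 (t - t0)) ^ r / fact r * D"
proof -
  note FD = causal_familyD[OF F]
  obtain C where C: "0 \<le> C" "\<And>i t g B. i \<le> m \<Longrightarrow> t < T \<Longrightarrow> DK L g \<Longrightarrow> bndw (\<lambda>_. 1) N g B \<Longrightarrow> norm (F i t g) \<le> C * B"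
    using FD(2) by blast
  have "\<forall>k\<in>{..m}. \<exists>\<beta>\<ge>0. \<forall>g D. DK L g \<longrightarrow> bndw (\<lambda>_. 1) N g D \<longrightarrow> bndw (\<lambda>_. 1) N (\<lambda>x. B k x * g x) (\<beta> * D)"
    using DK_mult_bndw[OF L B] by (metis atMost_iff)
  then obtain \<beta>f where \<beta>f: "\<And>k. k \<le> m \<Longrightarrow> 0 \<le> \<beta>f k"
    "\<And>k g D. k \<le> m \<Longrightarrow> DK L g \<Longrightarrow> bndw (\<lambda>_. 1) N g D \<Longrightarrow> bndw (\<lambda>_. 1) N (\<lambda>x. B k x * g x) (\<beta>f k * D)"
    unfolding Ball_def atMost_iff by metis
  define \<beta> where "\<beta> = (\<Sum>k\<le>m. \<beta>f k)"
  have \<beta>0: "0 \<le> \<beta>" using \<beta>f(1) by (auto simp: \<beta>_def intro: sum_nonneg)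
  have \<beta>: "bndw (\<lambda>_. 1) N (\<lambda>x. B k x * g x) (\<beta> * D)" if "k \<le> m" "DK L g" "bndw (\<lambda>_. 1) N g D" for k g D
  proof (rule bndw_mono[OF \<beta>f(2)[OF that] order_refl])
    have "\<beta>f k \<le> \<beta>" unfolding \<beta>_def using \<beta>f(1) that by (intro member_le_sum) auto
    then show "\<beta>f k * D \<le> \<beta> * D" using bndw_nonneg[OF that(3)] by (intro mult_right_mono) auto
  qed
  \<comment> \<open>\<open>W\<close> bounds the elapsed time and is at least 1; each downward
    integration costs at most one factor \<open>W\<close>.\<close>
  define W where "W = 1 + max 0 (T - t0)"
  have W: "1 \<le> W" by (simp add: W_def)
  \<comment> \<open>Passing from \<open>r\<close> to \<open>r + 1\<close> costs \<open>m\<close>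
    terms in the relation, the multiplier bound \<open>\<beta>\<close>, and at most \<open>m\<close>
    factors \<open>W\<close> lost on the way down.\<close>
  define K where "K = real m * \<beta> * W ^ m"
  have K: "0 \<le> K" using \<beta>0 W by (simp add: K_def)
  let ?\<tau> = "\<lambda>t. max 0 (t - t0)"
  \<comment> \<open>Index \<open>i\<close> lies \<open>m - i\<close> integrations below the top,
    hence the exponent of \<open>W\<close>; it is 0 at the top, where the relation gives the bound
    directly.\<close>
  have claim: "norm (F i t (\<lambda>x. B m x ^ r * g x)) \<le> C * W ^ (m - i) * K ^ r * ?\<tau> t ^ r / fact r * D"
    if "i \<le> m" "t < T" "DK L g" "bndw (\<lambda>_. 1) N g D" for r i t g D
    using that
  proof (induction r arbitrary: i t g D)
    case 0
    have D0: "0 \<le> D" using bndw_nonneg[OF 0(4)] by simp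
    have "C * 1 * D \<le> C * W ^ (m - i) * D"
      using W C D0 by (intro mult_right_mono mult_left_mono one_le_power) auto
    then show ?case using C(2)[OF 0] by simp
  next
    case (Suc r)
    note g = Suc.prems(3,4)
    have D0: "0 \<le> D" using bndw_nonneg[OF g(2)] by simp
    have smB: "smooth_fun (\<lambda>x. B m x ^ r)" for r using B by blast
    have lower: "norm (F k s (\<lambda>x. B m x ^ r * (B k x * g x))) \<le>
        (C * W ^ m * K ^ r / fact r * (\<beta> * D)) * ?\<tau> s ^ Suc r / real (Suc r)"
      if k: "k < m" and s: "s < T" for k s
    proof (rule integrate_power_bound[OF _ _ _ s])
      have Dk: "DK L (\<lambda>x. B k x * g x)" using k by (intro DK_mult B g) auto
      have Dr: "DK L (\<lambda>x. B m x ^ r * (B k x * g x))" by (rule DK_mult[OF smB Dk])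
      show "((\<lambda>t. F k t (\<lambda>x. B m x ^ r * (B k x * g x))) has_vector_derivative
           F (Suc k) s (\<lambda>x. B m x ^ r * (B k x * g x))) (at s)" if "s < T" for s
        by (rule FD(3)[OF k that Dr])
      show "F k s (\<lambda>x. B m x ^ r * (B k x * g x)) = 0" if "s \<le> t0" for s
        by (rule FD(4)[OF _ that Dr]) (use k in simp)
      show "norm (F (Suc k) s (\<lambda>x. B m x ^ r * (B k x * g x))) \<le> (C * W ^ m * K ^ r / fact r * (\<beta> * D)) * ?\<tau> s ^ r"
        if "s < T" for s
      proof -
        have "norm (F (Suc k) s (\<lambda>x. B m x ^ r * (B k x * g x))) \<le>
            C * W ^ (m - Suc k) * K ^ r * ?\<tau> s ^ r / fact r * (\<beta> * D)"
          using k by (intro Suc.IH Dk that \<beta> g) auto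
        also have "\<dots> \<le> C * W ^ m * K ^ r * ?\<tau> s ^ r / fact r * (\<beta> * D)"
          using W C K \<beta>0 D0
          by (intro mult_right_mono divide_right_mono mult_left_mono power_increasing) auto
        finally show ?thesis by (simp add: algebra_simps)
      qed
    qed
    have top: "norm (F m s (\<lambda>x. B m x ^ Suc r * g x)) \<le> C * K ^ Suc r * ?\<tau> s ^ Suc r / fact (Suc r) * D"
      if s: "s < T" for s
    proof -
      have "(\<Sum>k\<le>m. F k s (\<lambda>x. B k x * (B m x ^ r * g x))) = 0"
        by (rule eq[OF s DK_mult[OF smB g(1)]])
      then have "F m s (\<lambda>x. B m x ^ Suc r * g x) = - (\<Sum>k<m. F k s (\<lambda>x. B m x ^ r * (B k x * g x)))"
        unfolding lessThan_Suc_atMost[symmetric] sum.lessThan_Suc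
        by (simp add: eq_neg_iff_add_eq_0 mult_ac add.commute)
      then have "norm (F m s (\<lambda>x. B m x ^ Suc r * g x)) \<le> (\<Sum>k<m. norm (F k s (\<lambda>x. B m x ^ r * (B k x * g x))))"
        by (simp only: norm_minus_cancel norm_sum)
      also have "\<dots> \<le> (\<Sum>k<m. (C * W ^ m * K ^ r / fact r * (\<beta> * D)) * ?\<tau> s ^ Suc r / real (Suc r))"
        using s by (intro sum_mono lower) auto
      also have "\<dots> = C * K ^ Suc r * ?\<tau> s ^ Suc r / fact (Suc r) * D"
        by (simp add: K_def field_simps)
      finally show ?thesis .
    qed
    have "norm (F (m - j) s (\<lambda>x. B m x ^ Suc r * g x)) \<le> C * W ^ j * K ^ Suc r * ?\<tau> s ^ Suc r / fact (Suc r) * D"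
      if "j \<le> m" "s < T" for j s
      using that
    proof (induction j arbitrary: s)
      case 0
      then show ?case using top by simp
    next
      case (Suc j)
      have Dr: "DK L (\<lambda>x. B m x ^ Suc r * g x)" by (rule DK_mult[OF smB g(1)])
      have k: "Suc (m - Suc j) = m - j" "m - Suc j < m" using Suc by auto
      let ?M = "C * W ^ j * K ^ Suc r / fact (Suc r) * D"
      have M: "0 \<le> ?M" using C W K D0 by (intro mult_nonneg_nonneg divide_nonneg_nonneg) auto
      have "norm (F (m - Suc j) s (\<lambda>x. B m x ^ Suc r * g x)) \<le> ?M * ?\<tau> s ^ Suc (Suc r) / real (Suc (Suc r))"
      proof (rule integrate_power_bound[OF _ _ _ Suc.prems(2)])
        show "((\<lambda>t. F (m - Suc j) t (\<lambda>x. B m x ^ Suc r * g x)) has_vector_derivative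
           F (m - j) s (\<lambda>x. B m x ^ Suc r * g x)) (at s)" if "s < T" for s
          using FD(3)[OF k(2) that Dr] by (simp only: k(1))
        show "F (m - Suc j) s (\<lambda>x. B m x ^ Suc r * g x) = 0" if "s \<le> t0" for s
          by (rule FD(4)[OF _ that Dr]) simp
        show "norm (F (m - j) s (\<lambda>x. B m x ^ Suc r * g x)) \<le> ?M * ?\<tau> s ^ Suc r" if "s < T" for s
          using Suc.IH[OF _ that] Suc.prems(1) by (simp add: algebra_simps)
      qed
      \<comment> \<open>The gain \<open>1 / (r + 2)\<close> of this further integration is
        discarded, and the surplus power of the elapsed time is bounded by \<open>W\<close>.\<close>
      also have "\<dots> \<le> ?M * ?\<tau> s ^ Suc (Suc r)"
        using divide_left_mono[of 1 "real (Suc (Suc r))" "?M * ?\<tau> s ^ Suc (Suc r)"]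
          mult_nonneg_nonneg[OF M, of "?\<tau> s ^ Suc (Suc r)"] by simp
      also have "\<dots> = (?M * ?\<tau> s ^ Suc r) * ?\<tau> s" by simp
      also have "\<dots> \<le> (?M * ?\<tau> s ^ Suc r) * W"
        using Suc.prems(2) by (intro mult_left_mono mult_nonneg_nonneg[OF M]) (auto simp: W_def)
      also have "\<dots> = C * W ^ Suc j * K ^ Suc r * ?\<tau> s ^ Suc r / fact (Suc r) * D" by (simp add: algebra_simps)
      finally show ?case .
    qed
    from this[of "m - i" t] show ?case using Suc.prems by simp
  qed
  show ?thesis
  proof (rule exI[of _ "C * W ^ m"], rule conjI)
    show "0 \<le> C * W ^ m" using C W by simp
    show "\<exists>K\<ge>0. \<forall>r i t g D. i \<le> m \<longrightarrow> t < T \<longrightarrow> DK L g \<longrightarrow> bndw (\<lambda>_. 1) N g D \<longrightarrow>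
      norm (F i t (\<lambda>x. B m x ^ r * g x)) \<le> C * W ^ m * K ^ r * ?\<tau> t ^ r / fact r * D"
    proof (intro exI[of _ K] conjI K allI impI)
      fix r i t g D assume *: "i \<le> m" "t < T" "DK L g" "bndw (\<lambda>_. 1) N g D"
      have "C * W ^ (m - i) * K ^ r * ?\<tau> t ^ r / fact r * D \<le> C * W ^ m * K ^ r * ?\<tau> t ^ r / fact r * D"
        using W C K bndw_nonneg[OF *(4)]
        by (intro mult_right_mono divide_right_mono mult_left_mono power_increasing) auto
      with claim[OF *] show "norm (F i t (\<lambda>x. B m x ^ r * g x)) \<le> C * W ^ m * K ^ r * ?\<tau> t ^ r / fact r * D"
        by (rule order_trans)
    qed
  qed
qed

text \<open>At a fixed time the moment estimate has the form \<open>M * K ^ r / fact r\<close>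
  demanded by \<open>moments_vanish\<close>, with the elapsed time absorbed into the base and the
  seminorm of \<open>g\<close> into the constant.\<close>

lemma causal_top_vanish:
  assumes F: "causal_family L t0 T N m F" and L: "compact L"
    and B: "\<And>k. k \<le> m \<Longrightarrow> smooth_fun (B k)" "\<And>x. Im (B m x) = 0"
    and eq: "\<And>t g. t < T \<Longrightarrow> DK L g \<Longrightarrow> (\<Sum>k\<le>m. F k t (\<lambda>x. B k x * g x)) = 0"
    and "N < r" "i \<le> m" "t < T" "DK L g"
  shows "F i t (\<lambda>x. B m x ^ r * g x) = 0"
proof -
  have "\<exists>C\<ge>0. \<exists>K\<ge>0. \<forall>r i t g D. i \<le> m \<longrightarrow> t < T \<longrightarrow> DK L g \<longrightarrow> bndw (\<lambda>_. 1) N g D \<longrightarrow>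
      norm (F i t (\<lambda>x. B m x ^ r * g x)) \<le> C * K ^ r * (max 0 (t - t0)) ^ r / fact r * D"
    by (rule causal_moments[OF F L]) (auto intro: B(1) eq)
  then obtain C K where CK: "0 \<le> C" "0 \<le> K"
    "\<And>r i t g D. i \<le> m \<Longrightarrow> t < T \<Longrightarrow> DK L g \<Longrightarrow> bndw (\<lambda>_. 1) N g D \<Longrightarrow>
      norm (F i t (\<lambda>x. B m x ^ r * g x)) \<le> C * K ^ r * (max 0 (t - t0)) ^ r / fact r * D"
    by blast
  obtain D where D: "0 \<le> D" "bndw (\<lambda>_. 1) N g D"
    using bndw_test[of g L N] \<open>DK L g\<close> L by (auto simp: DK_def)
  obtain C0 where C0: "0 \<le> C0" "\<And>i t g B. i \<le> m \<Longrightarrow> t < T \<Longrightarrow> DK L g \<Longrightarrow> bndw (\<lambda>_. 1) N g B \<Longrightarrow> norm (F i t g) \<le> C0 * B"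
    using causal_familyD(2)[OF F] by blast
  show ?thesis
  proof (rule moments_vanish[OF L causal_familyD(1)[OF F \<open>i \<le> m\<close>] C0(1) _ B(1)[OF order_refl] B(2) \<open>DK L g\<close> _ _ _ \<open>N < r\<close>])
    show "norm (F i t (\<lambda>x. B m x ^ r * g x)) \<le> (C * D) * (K * max 0 (t - t0)) ^ r / fact r" for r
      using CK(3)[OF \<open>i \<le> m\<close> \<open>t < T\<close> \<open>DK L g\<close> D(2), of r] by (simp add: power_mult_distrib mult_ac)
  qed (use C0(2) assms CK D in auto)
qed

text \<open>Here \<open>R\<close> is uniform over all families of order \<open>N\<close>; this uniformity is what lets the induction
  pass to the families \<open>B m ^ s * F\<close>.\<close>

lemma causal_annihilator:
  fixes B :: "nat \<Rightarrow> 'a::euclidean_space \<Rightarrow> complex"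
  assumes L: "compact L"
    and "\<And>k. k \<le> m \<Longrightarrow> smooth_fun (B k)" "\<And>k x. k \<le> m \<Longrightarrow> Im (B k x) = 0"
  shows "\<exists>R. \<forall>F. causal_family L t0 T N m F \<longrightarrow>
      (\<forall>t<T. \<forall>g. DK L g \<longrightarrow> (\<Sum>k\<le>m. F k t (\<lambda>x. B k x * g x)) = 0) \<longrightarrow>
      (\<forall>k\<le>m. \<forall>i\<le>m. \<forall>t<T. \<forall>g. DK L g \<longrightarrow> F i t (\<lambda>x. B k x ^ R * g x) = 0)"
  using assms(2,3)
proof (induction m)
  case 0
  show ?case by (intro exI[of _ 1]) simp
next
  case (Suc m)
  have "\<exists>R. \<forall>F. causal_family L t0 T N m F \<longrightarrow>
      (\<forall>t<T. \<forall>g. DK L g \<longrightarrow> (\<Sum>k\<le>m. F k t (\<lambda>x. B k x * g x)) = 0) \<longrightarrow>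
      (\<forall>k\<le>m. \<forall>i\<le>m. \<forall>t<T. \<forall>g. DK L g \<longrightarrow> F i t (\<lambda>x. B k x ^ R * g x) = 0)"
    by (rule Suc.IH) (use Suc.prems in auto)
  then obtain R' where R': "\<And>F k i t g. causal_family L t0 T N m F \<Longrightarrow>
      (\<And>t g. t < T \<Longrightarrow> DK L g \<Longrightarrow> (\<Sum>k\<le>m. F k t (\<lambda>x. B k x * g x)) = 0) \<Longrightarrow>
      k \<le> m \<Longrightarrow> i \<le> m \<Longrightarrow> t < T \<Longrightarrow> DK L g \<Longrightarrow> F i t (\<lambda>x. B k x ^ R' * g x) = 0"
    by blast
  note B = Suc.prems
  let ?b = "B (Suc m)"
  define M where "M = Suc N"
  show ?case
  \<comment> \<open>Trading the \<open>M\<close> factors of the top coefficient one at a time for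
    \<open>R'\<close> factors of \<open>B k\<close> gives the exponent \<open>M * R'\<close>; the
    additional \<open>M\<close> makes the same exponent work for the top coefficient itself.\<close>
  proof (intro exI[of _ "M * R' + M"] allI impI)
    fix F k i t g
    assume F: "causal_family L t0 T N (Suc m) F"
      and eq': "\<forall>t<T. \<forall>g. DK L g \<longrightarrow> (\<Sum>k\<le>Suc m. F k t (\<lambda>x. B k x * g x)) = 0"
      and k: "k \<le> Suc m" and i: "i \<le> Suc m" and t: "t < T" and g: "DK L g"
    from eq' have eq: "\<And>t g. t < T \<Longrightarrow> DK L g \<Longrightarrow> (\<Sum>k\<le>Suc m. F k t (\<lambda>x. B k x * g x)) = 0" by blast
    have top: "F i t (\<lambda>x. ?b x ^ M * g x) = 0" if "i \<le> Suc m" "t < T" "DK L g" for i t g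
      using that by (intro causal_top_vanish[OF F L B(1) B(2) eq]) (auto simp: M_def)
    show "F i t (\<lambda>x. B k x ^ (M * R' + M) * g x) = 0"
    proof (cases "k = Suc m")
      case True
      have "DK L (\<lambda>x. ?b x ^ (M * R') * g x)" by (intro DK_mult smooth_power B g) simp
      from top[OF i t this] show ?thesis using True by (simp add: power_add mult_ac)
    next
      case False
      then have k: "k \<le> m" using k by simp
      have "F i t (\<lambda>x. ?b x ^ (M - j) * (B k x ^ (j * R') * g x)) = 0"
        if "j \<le> M" "i \<le> Suc m" "t < T" "DK L g" for j i t g
        using that
      proof (induction j arbitrary: i t g)
        case 0
        then show ?case using top by simp
      next
        case (Suc j)
        \<comment> \<open>With one factor \<open>?b\<close> held back, the family \<open>H\<close>
          obtained by multiplying with \<open>q\<close> is annihilated by \<open>?b\<close>, by the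
          induction hypothesis. The top term of the relation drops out, \<open>H\<close> satisfies
          the relation of degree \<open>m\<close>, and \<open>R'\<close> further powers of
          \<open>B k\<close> annihilate it.\<close>
        define q where "q x = ?b x ^ (M - Suc j) * B k x ^ (j * R')" for x
        have q: "smooth_fun q" unfolding q_def using k by (intro smooth_mult smooth_power B) auto
        define H where "H i t g = F i t (\<lambda>x. q x * g x)" for i t g
        have H: "causal_family L t0 T N (Suc m) H"
          unfolding H_def[abs_def] by (rule causal_family_mult[OF F L q])
        have Htop: "H i t (\<lambda>x. ?b x * g x) = 0" if "i \<le> Suc m" "t < T" "DK L g" for i t g
        proof -
          have "M - j = Suc (M - Suc j)" using Suc.prems by simp
          then have "(\<lambda>x. q x * (?b x * g x)) = (\<lambda>x. ?b x ^ (M - j) * (B k x ^ (j * R') * g x))"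
            by (simp add: q_def fun_eq_iff)
          then show ?thesis using Suc.IH[OF _ that] Suc.prems(1) by (simp add: H_def)
        qed
        have Heq: "(\<Sum>k\<le>m. H k t (\<lambda>x. B k x * g x)) = 0" if "t < T" "DK L g" for t g
        proof -
          have "(\<Sum>k\<le>Suc m. F k t (\<lambda>x. B k x * (q x * g x))) = 0"
            by (rule eq[OF that(1) DK_mult[OF q that(2)]])
          then have "(\<Sum>k\<le>Suc m. H k t (\<lambda>x. B k x * g x)) = 0" by (simp add: H_def mult_ac)
          then show ?thesis using Htop[OF order_refl that] by simp
        qed
        have van: "H i t (\<lambda>x. B k x ^ R' * g x) = 0" if "i \<le> m" "t < T" "DK L g" for i t g
          using R'[OF causal_family_mono[OF H] Heq k that] by simp
        have "H i t (\<lambda>x. B k x ^ R' * g x) = 0"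
        proof (cases "i \<le> m")
          case True
          then show ?thesis using van Suc.prems by blast
        next
          case False
          \<comment> \<open>The shortened family stops at index \<open>m\<close>; the member of
            index \<open>Suc m\<close> is the time derivative of one that vanishes identically below
            \<open>T\<close>.\<close>
          then have i: "i = Suc m" using Suc.prems by simp
          have Dk: "DK L (\<lambda>x. B k x ^ R' * g x)" using k by (intro DK_mult smooth_power B Suc.prems) auto
          have "((\<lambda>t. H m t (\<lambda>x. B k x ^ R' * g x)) has_vector_derivative H (Suc m) t (\<lambda>x. B k x ^ R' * g x)) (at t)"
            using causal_familyD(3)[OF H _ Suc.prems(3) Dk] by simp
          moreover have "((\<lambda>t. H m t (\<lambda>x. B k x ^ R' * g x)) has_vector_derivative 0) (at t)"
            by (rule has_vector_derivative_transform_within_open[OF has_vector_derivative_const[of 0], of "{..<T}"])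
              (use van Suc.prems in auto)
          ultimately show ?thesis unfolding i by (rule vector_derivative_unique_at)
        qed
        then show ?case by (simp add: H_def q_def power_add mult_ac)
      qed
      from this[OF order_refl i t DK_mult[OF smooth_power[OF B(1), of k M] g]] k
      show ?thesis by (simp add: power_add mult_ac)
    qed
  qed
qed

text \<open>For real coefficients without common zero, \<open>s\<close>, the sum of the squares of
  \<open>B k ^ R\<close>, is positive everywhere. Dividing by it writes \<open>g\<close> as a sum of
  terms each with a factor \<open>B k ^ R\<close>, and every such term is annihilated.\<close>

lemma causal_family_zero_real:
  assumes F: "causal_family L t0 T N m F" and L: "compact L"
    and B: "\<And>k. k \<le> m \<Longrightarrow> smooth_fun (B k)" "\<And>k x. k \<le> m \<Longrightarrow> Im (B k x) = 0"
    and nz: "\<And>x. \<exists>k\<le>m. B k x \<noteq> 0"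
    and eq: "\<And>t g. t < T \<Longrightarrow> DK L g \<Longrightarrow> (\<Sum>k\<le>m. F k t (\<lambda>x. B k x * g x)) = 0"
    and it: "i \<le> m" "t < T" and g: "DK L g"
  shows "F i t g = 0"
proof -
  have "\<exists>R. \<forall>F. causal_family L t0 T N m F \<longrightarrow>
      (\<forall>t<T. \<forall>g. DK L g \<longrightarrow> (\<Sum>k\<le>m. F k t (\<lambda>x. B k x * g x)) = 0) \<longrightarrow>
      (\<forall>k\<le>m. \<forall>i\<le>m. \<forall>t<T. \<forall>g. DK L g \<longrightarrow> F i t (\<lambda>x. B k x ^ R * g x) = 0)"
    by (rule causal_annihilator[OF L B])
  then obtain R where "\<forall>F. causal_family L t0 T N m F \<longrightarrow>
      (\<forall>t<T. \<forall>g. DK L g \<longrightarrow> (\<Sum>k\<le>m. F k t (\<lambda>x. B k x * g x)) = 0) \<longrightarrow>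
      (\<forall>k\<le>m. \<forall>i\<le>m. \<forall>t<T. \<forall>g. DK L g \<longrightarrow> F i t (\<lambda>x. B k x ^ R * g x) = 0)" ..
  with F eq have R: "\<And>k i t g. k \<le> m \<Longrightarrow> i \<le> m \<Longrightarrow> t < T \<Longrightarrow> DK L g \<Longrightarrow> F i t (\<lambda>x. B k x ^ R * g x) = 0"
    by simp
  define s where "s x = (\<Sum>k\<le>m. B k x ^ R * B k x ^ R)" for x
  have s: "smooth_fun s" unfolding s_def by (intro smooth_sum smooth_mult smooth_power B) auto
  have s0: "s x \<noteq> 0" for x
  proof -
    have sq: "B k x ^ R * B k x ^ R = of_real ((Re (B k x) ^ R)\<^sup>2)" if "k \<le> m" for k
    proof -
      have "B k x = of_real (Re (B k x))" using B(2)[OF that, of x] by (simp add: complex_eq_iff)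
      then show ?thesis by (metis of_real_power power2_eq_square)
    qed
    then have "s x = of_real (\<Sum>k\<le>m. (Re (B k x) ^ R)\<^sup>2)" by (simp add: s_def)
    moreover
    obtain k where k: "k \<le> m" "B k x \<noteq> 0" using nz by blast
    have "Re (B k x) \<noteq> 0" using k B(2)[OF k(1), of x] by (simp add: complex_eq_iff)
    then have "0 < (\<Sum>k\<le>m. (Re (B k x) ^ R)\<^sup>2)"
      using k by (intro sum_pos2[of _ k]) auto
    ultimately show ?thesis by (metis less_irrefl of_real_eq_0_iff)
  qed
  have Dk: "DK L (\<lambda>x. B k x ^ R * (g x / s x))" if "k \<le> m" for k
  proof -
    have "DK L (\<lambda>x. g x / s x)"
      using g smooth_divide[OF DK_smooth[OF g] s s0] by (simp add: DK_def supported_in_def)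
    then show ?thesis using that by (intro DK_mult smooth_power B)
  qed
  have "g = (\<lambda>x. \<Sum>k\<le>m. B k x ^ R * (B k x ^ R * (g x / s x)))"
  proof
    fix x
    have "(\<Sum>k\<le>m. B k x ^ R * (B k x ^ R * h)) = s x * h" for h
      by (simp add: s_def sum_distrib_right mult.assoc)
    then have "(\<Sum>k\<le>m. B k x ^ R * (B k x ^ R * (g x / s x))) = s x * (g x / s x)" .
    also have "\<dots> = g x" using s0 by simp
    finally show "g x = (\<Sum>k\<le>m. B k x ^ R * (B k x ^ R * (g x / s x)))" by (rule sym)
  qed
  then have "F i t g = F i t (\<lambda>x. \<Sum>k\<le>m. B k x ^ R * (B k x ^ R * (g x / s x)))" by metis
  also have "\<dots> = (\<Sum>k\<le>m. F i t (\<lambda>x. B k x ^ R * (B k x ^ R * (g x / s x))))"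
  proof (rule lin_on_sum[OF causal_familyD(1)[OF F it(1)] finite_atMost])
    show "DK L (\<lambda>x. B k x ^ R * (B k x ^ R * (g x / s x)))" if "k \<in> {..m}" for k
      using that by (intro DK_mult[OF smooth_power[OF B(1)] Dk]) simp_all
  qed
  also have "\<dots> = 0" using R[OF _ it Dk] by simp
  finally show ?thesis .
qed

lemma smooth_cnj:
  assumes "smooth_fun f"
  shows "smooth_fun (\<lambda>x. cnj (f x))"
proof -
  define P where "P h \<longleftrightarrow> (\<exists>f. smooth_fun f \<and> h = (\<lambda>x::'a. cnj (f x)))" for h
  have "P (\<lambda>x. cnj (f x))" using assms by (auto simp: P_def)
  then show ?thesis
  proof (induction rule: smooth_coinduct[where P=P])
    case (cont g)
    then show ?case using continuous_on_cnj[OF smooth_continuous] by (auto simp: P_def)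
  next
    case (step g b)
    then obtain f where f: "smooth_fun f" "g = (\<lambda>x. cnj (f x))" by (auto simp: P_def)
    show ?case
      using smooth_dir_deriv[OF f(1) step(2)] has_vector_derivative_cnj[OF smooth_deriv[OF f(1) step(2)]]
      by (intro exI[of _ "\<lambda>x. cnj (dir_deriv b f x)"]) (auto simp: P_def f)
  qed
qed

text \<open>The coefficients are made real by multiplying the polynomial in the time derivative by its
  conjugate.\<close>

lemma causal_family_zero:
  fixes A :: "nat \<Rightarrow> 'a::euclidean_space \<Rightarrow> complex"
  assumes F: "causal_family L t0 T N (2 * n) F" and L: "compact L"
    and A: "\<And>k. k \<le> n \<Longrightarrow> smooth_fun (A k)"
    and nz: "\<And>x. \<exists>k\<le>n. A k x \<noteq> 0"
    and eq: "\<And>i t g. i \<le> n \<Longrightarrow> t < T \<Longrightarrow> DK L g \<Longrightarrow> (\<Sum>j\<le>n. F (i + j) t (\<lambda>x. A j x * g x)) = 0"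
    and it: "i \<le> 2 * n" "t < T" and g: "DK L g"
  shows "F i t g = 0"
proof -
  define P where "P k = {(i, j). i \<le> n \<and> j \<le> n \<and> i + j = k}" for k
  have P: "finite (P k)" for k
    by (rule finite_subset[of _ "{..n} \<times> {..n}"]) (auto simp: P_def)
  \<comment> \<open>\<open>B k\<close> is the coefficient of degree \<open>k\<close> in the product
    of the polynomial with coefficients \<open>A j\<close> and its conjugate; exchanging the two
    indices shows that it is real.\<close>
  define B where "B k x = (\<Sum>(i, j)\<in>P k. cnj (A i x) * A j x)" for k x
  have smB: "smooth_fun (\<lambda>x. cnj (A (fst z) x) * A (snd z) x)" if "z \<in> P k" for z k
    using that by (intro smooth_mult smooth_cnj A) (auto simp: P_def)
  show ?thesis
  proof (rule causal_family_zero_real[OF F L _ _ _ _ it g])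
    show "smooth_fun (B k)" for k
      unfolding B_def[abs_def] case_prod_beta' by (intro smooth_sum smB)
    show "Im (B k x) = 0" for k x
    proof -
      have "cnj (B k x) = (\<Sum>(i, j)\<in>P k. A i x * cnj (A j x))"
        by (simp add: B_def case_prod_beta')
      also have "\<dots> = B k x"
        unfolding B_def
        by (rule sum.reindex_bij_witness[of _ prod.swap prod.swap]) (auto simp: P_def mult.commute)
      finally show ?thesis by (simp add: complex_eq_iff)
    qed
    show "\<exists>k\<le>2 * n. B k x \<noteq> 0" for x
    proof -
      \<comment> \<open>Among the coefficients not vanishing at \<open>x\<close> the one of lowest
        index \<open>j\<close> is taken: in degree \<open>2 * j\<close> of the product every other
        pair has an index below \<open>j\<close>, so only the squared modulus of
        \<open>A j x\<close> is left.\<close>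
      define j where "j = (LEAST k. A k x \<noteq> 0)"
      obtain k where k: "k \<le> n" "A k x \<noteq> 0" using nz by blast
      then have j: "A j x \<noteq> 0" "j \<le> n" "\<And>i. i < j \<Longrightarrow> A i x = 0"
        unfolding j_def using LeastI[of "\<lambda>k. A k x \<noteq> 0" k] Least_le[of "\<lambda>k. A k x \<noteq> 0" k] not_less_Least by auto
      have "B (2 * j) x = (\<Sum>(i, j')\<in>{(j, j)}. cnj (A i x) * A j' x)"
        unfolding B_def
      proof (rule sum.mono_neutral_right[OF P])
        show "{(j, j)} \<subseteq> P (2 * j)" using j by (auto simp: P_def)
        have zero: "cnj (A i x) * A j' x = 0" if "i + j' = 2 * j" "\<not> (i = j \<and> j' = j)" for i j'
        proof -
          have "i < j \<or> j' < j" using that by linarith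
          then show ?thesis using j(3) by auto
        qed
        show "\<forall>z\<in>P (2 * j) - {(j, j)}. (case z of (i, j') \<Rightarrow> cnj (A i x) * A j' x) = 0"
        proof
          fix z assume "z \<in> P (2 * j) - {(j, j)}"
          moreover obtain i j' where "z = (i, j')" by (cases z)
          ultimately have "z = (i, j')" "i + j' = 2 * j" "\<not> (i = j \<and> j' = j)" by (auto simp: P_def)
          then show "(case z of (i, j') \<Rightarrow> cnj (A i x) * A j' x) = 0" using zero by simp
        qed
      qed
      then show ?thesis using j by (intro exI[of _ "2 * j"]) auto
    qed
    \<comment> \<open>The relation shifted by \<open>i\<close> time derivatives is tested with
      \<open>cnj (A i) * g\<close>, and these relations are summed over \<open>i\<close>; grouping
      by \<open>k = i + j\<close> yields the coefficients \<open>B k\<close>.\<close>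
    show "(\<Sum>k\<le>2 * n. F k t (\<lambda>x. B k x * g x)) = 0" if t: "t < T" and g: "DK L g" for t g
    proof -
      have "F k t (\<lambda>x. B k x * g x) = (\<Sum>(i, j)\<in>P k. F (i + j) t (\<lambda>x. A j x * (cnj (A i x) * g x)))"
        if "k \<le> 2 * n" for k
      proof -
        have "(\<lambda>x. B k x * g x) = (\<lambda>x. \<Sum>z\<in>P k. (cnj (A (fst z) x) * A (snd z) x) * g x)"
          by (simp add: B_def sum_distrib_right case_prod_beta')
        then have "F k t (\<lambda>x. B k x * g x) = (\<Sum>z\<in>P k. F k t (\<lambda>x. (cnj (A (fst z) x) * A (snd z) x) * g x))"
          using lin_on_sum[OF causal_familyD(1)[OF F that] P, where g="\<lambda>z x. (cnj (A (fst z) x) * A (snd z) x) * g x"]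
            DK_mult[OF smB g] by simp
        also have "\<dots> = (\<Sum>(i, j)\<in>P k. F (i + j) t (\<lambda>x. A j x * (cnj (A i x) * g x)))"
          by (intro sum.cong) (auto simp: P_def mult_ac)
        finally show ?thesis .
      qed
      then have "(\<Sum>k\<le>2 * n. F k t (\<lambda>x. B k x * g x)) =
          (\<Sum>k\<le>2 * n. \<Sum>(i, j)\<in>P k. F (i + j) t (\<lambda>x. A j x * (cnj (A i x) * g x)))" by simp
      also have "\<dots> = (\<Sum>(k, i, j)\<in>Sigma {..2 * n} P. F (i + j) t (\<lambda>x. A j x * (cnj (A i x) * g x)))"
        using P by (subst sum.Sigma) (auto simp: case_prod_beta')
      also have "\<dots> = (\<Sum>(i, j)\<in>{..n} \<times> {..n}. F (i + j) t (\<lambda>x. A j x * (cnj (A i x) * g x)))"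
        by (rule sum.reindex_bij_witness[of _ "\<lambda>(i, j). (i + j, i, j)" snd]) (auto simp: P_def)
      also have "\<dots> = (\<Sum>i\<le>n. \<Sum>j\<le>n. F (i + j) t (\<lambda>x. A j x * (cnj (A i x) * g x)))"
        by (simp add: sum.cartesian_product)
      also have "\<dots> = 0"
        using eq[OF _ t DK_mult[OF smooth_cnj[OF A] g]] by (intro sum.neutral) auto
      finally show ?thesis .
    qed
  qed
qed

section \<open>Fourier transforms of test functions\<close>

definition cc :: "('a::euclidean_space \<Rightarrow> complex) \<Rightarrow> bool" where
  "cc g \<longleftrightarrow> continuous_on UNIV g \<and> (\<exists>K. compact K \<and> supported_in g K)"

lemma compact_cbox_symmetric:
  fixes K :: "'a::euclidean_space set"
  assumes "compact K"
  obtains a where "K \<subseteq> cbox (-a) a"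
  using bounded_subset_cbox_symmetric[OF compact_imp_bounded[OF assms]] .

lemma has_integral_cbox_UNIV:
  fixes g :: "'a::euclidean_space \<Rightarrow> complex"
  assumes "continuous_on UNIV g" "supported_in g (cbox a b)"
  shows "(g has_integral integral (cbox a b) g) UNIV"
proof (rule has_integral_on_superset[of _ _ "cbox a b"])
  show "(g has_integral integral (cbox a b) g) (cbox a b)"
    by (intro integrable_integral integrable_continuous continuous_on_subset[OF assms(1)]) simp
qed (use assms in \<open>auto simp: supported_in_def\<close>)

lemma supported_in_mono: "supported_in g K \<Longrightarrow> K \<subseteq> L \<Longrightarrow> supported_in g L"
  unfolding supported_in_def by blast

lemma cc_integrable: "cc g \<Longrightarrow> g integrable_on UNIV"
  unfolding cc_def by (metis compact_cbox_symmetric has_integral_cbox_UNIV has_integral_integrable supported_in_mono)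

lemma integral_eq_cbox:
  assumes "continuous_on UNIV g" "supported_in g (cbox a b)"
  shows "integral UNIV g = integral (cbox a b) g"
  using has_integral_cbox_UNIV[OF assms] by (rule integral_unique)

lemma test_cc: "test_fun g \<Longrightarrow> cc g"
  unfolding cc_def test_fun_def using smooth_continuous by blast

lemma cc_mult: "cc g \<Longrightarrow> continuous_on UNIV h \<Longrightarrow> cc (\<lambda>x. g x * h x)"
  unfolding cc_def supported_in_def by (auto intro!: continuous_on_mult)

lemma integral_affine:
  fixes g :: "'a::euclidean_space \<Rightarrow> complex"
  assumes "cc g" "m \<noteq> 0"
  shows "integral UNIV (\<lambda>x. g (m *\<^sub>R x + c)) = (1 / \<bar>m\<bar> ^ DIM('a)) *\<^sub>R integral UNIV g"
proof -
  obtain K where K: "compact K" "supported_in g K" "continuous_on UNIV g" using assms by (auto simp: cc_def)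
  obtain a where a: "supported_in g (cbox (-a) a)"
    using compact_cbox_symmetric[OF K(1)] supported_in_mono[OF K(2)] by metis
  let ?S = "(\<lambda>x. (1 / m) *\<^sub>R x + - ((1 / m) *\<^sub>R c)) ` cbox (-a) a"
  have "((\<lambda>x. g (m *\<^sub>R x + c)) has_integral (1 / \<bar>m\<bar> ^ DIM('a)) *\<^sub>R integral (cbox (-a) a) g) ?S"
    by (intro has_integral_affinity integrable_integral integrable_continuous continuous_on_subset[OF K(3)] assms) simp
  then have "((\<lambda>x. g (m *\<^sub>R x + c)) has_integral (1 / \<bar>m\<bar> ^ DIM('a)) *\<^sub>R integral (cbox (-a) a) g) UNIV"
  proof (rule has_integral_on_superset)
    fix x assume x: "x \<notin> ?S"
    have "m *\<^sub>R x + c \<notin> cbox (-a) a"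
    proof
      assume "m *\<^sub>R x + c \<in> cbox (-a) a"
      moreover have "x = (1 / m) *\<^sub>R (m *\<^sub>R x + c) + - ((1 / m) *\<^sub>R c)"
        using assms(2) by (simp add: algebra_simps)
      ultimately show False using x by blast
    qed
    then show "g (m *\<^sub>R x + c) = 0" using a by (simp add: supported_in_def)
  qed simp
  then show ?thesis using integral_eq_cbox[OF K(3) a] by (metis integral_unique)
qed

text \<open>The common compact support for times near \<open>t0\<close> turns the integral into one
  over a fixed box, where the Leibniz rule applies.\<close>

lemma leibniz_UNIV:
  fixes G :: "real \<Rightarrow> 'a::euclidean_space \<Rightarrow> complex"
  assumes der: "\<And>t x. ((\<lambda>t. G t x) has_vector_derivative G' t x) (at t)"
    and cont: "continuous_on UNIV (\<lambda>(t, x). G' t x)"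
    and contG: "\<And>t. continuous_on UNIV (G t)"
    and K: "compact K" "\<And>t x. \<bar>t - t0\<bar> \<le> 1 \<Longrightarrow> x \<notin> K \<Longrightarrow> G t x = 0" "\<And>x. x \<notin> K \<Longrightarrow> G' t0 x = 0"
  shows "((\<lambda>t. integral UNIV (G t)) has_vector_derivative integral UNIV (G' t0)) (at t0)"
proof -
  obtain a where a: "K \<subseteq> cbox (-a) a" using compact_cbox_symmetric[OF K(1)] .
  let ?U = "{t0 - 1..t0 + 1}"
  have "((\<lambda>t. integral (cbox (-a) a) (G t)) has_vector_derivative integral (cbox (-a) a) (G' t0)) (at t0 within ?U)"
  proof (rule leibniz_rule_vector_derivative)
    show "((\<lambda>t. G t x) has_vector_derivative G' t x) (at t within ?U)" for t x
      by (rule has_vector_derivative_at_within[OF der])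
    show "G t integrable_on cbox (-a) a" for t
      by (intro integrable_continuous continuous_on_subset[OF contG]) simp
  qed (auto intro: continuous_on_subset[OF cont])
  then have "((\<lambda>t. integral (cbox (-a) a) (G t)) has_vector_derivative integral (cbox (-a) a) (G' t0)) (at t0)"
    by (subst (asm) at_within_interior) auto
  then have "((\<lambda>t. integral UNIV (G t)) has_vector_derivative integral (cbox (-a) a) (G' t0)) (at t0)"
  proof (rule has_vector_derivative_transform_within_open[where S="{t0 - 1<..<t0 + 1}"])
    fix t assume "t \<in> {t0 - 1<..<t0 + 1}"
    then have "supported_in (G t) (cbox (-a) a)"
      unfolding supported_in_def using a by (intro allI impI K(2)) auto
    from integral_eq_cbox[OF contG this]
    show "integral (cbox (-a) a) (G t) = integral UNIV (G t)" by simp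
  qed auto
  moreover have "integral UNIV (G' t0) = integral (cbox (-a) a) (G' t0)"
  proof (rule integral_eq_cbox)
    show "continuous_on UNIV (G' t0)"
      using continuous_on_compose2[OF cont, of UNIV "\<lambda>x. (t0, x)"] by (simp add: continuous_on_Pair)
    show "supported_in (G' t0) (cbox (-a) a)" unfolding supported_in_def using K(3) a by blast
  qed
  ultimately show ?thesis by simp
qed

text \<open>The integral of the translate \<open>g (x + t b)\<close> does not depend on
  \<open>t\<close>; differentiating it under the integral sign gives the claim.\<close>

lemma integral_dir_deriv_zero:
  fixes g :: "'a::euclidean_space \<Rightarrow> complex"
  assumes g: "test_fun g" and b: "b \<in> Basis"
  shows "integral UNIV (dir_deriv b g) = 0"
proof -
  obtain K where K: "compact K" "supported_in g K" using g by (auto simp: test_fun_def)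
  let ?K = "(\<lambda>(x, t). x - t *\<^sub>R b) ` (K \<times> {-1..1})"
  have sm: "smooth_fun g" by (rule test_smooth[OF g])
  have "((\<lambda>t. integral UNIV (\<lambda>x. g (x + t *\<^sub>R b))) has_vector_derivative
      integral UNIV (\<lambda>x. dir_deriv b g (x + 0 *\<^sub>R b))) (at 0)"
  proof (rule leibniz_UNIV[where K="?K \<union> K" and G'="\<lambda>t x. dir_deriv b g (x + t *\<^sub>R b)"])
    show "((\<lambda>t. g (x + t *\<^sub>R b)) has_vector_derivative dir_deriv b g (x + t *\<^sub>R b)) (at t)" for t x
      by (rule hvd_line) (rule smooth_deriv[OF sm b])
    show "continuous_on UNIV (\<lambda>(t, x). dir_deriv b g (x + t *\<^sub>R b))"
      unfolding case_prod_beta'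
      by (rule continuous_on_compose2[OF smooth_continuous[OF smooth_dir_deriv[OF sm b]]])
        (auto intro!: continuous_intros)
    show "continuous_on UNIV (\<lambda>x. g (x + t *\<^sub>R b))" for t
      by (rule continuous_on_compose2[OF smooth_continuous[OF sm]]) (auto intro!: continuous_intros)
    have "compact ?K"
      unfolding case_prod_beta'
      by (intro compact_continuous_image compact_Times K compact_Icc) (auto intro!: continuous_intros)
    then show "compact (?K \<union> K)" using K by auto
    show "g (x + t *\<^sub>R b) = 0" if "\<bar>t - 0\<bar> \<le> 1" "x \<notin> ?K \<union> K" for t x
    proof -
      have "x + t *\<^sub>R b \<notin> K"
      proof
        assume "x + t *\<^sub>R b \<in> K"
        then have "(\<lambda>(x, t). x - t *\<^sub>R b) (x + t *\<^sub>R b, t) \<in> ?K" using that(1) by (intro imageI) auto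
        then show False using that(2) by simp
      qed
      then show ?thesis using K by (simp add: supported_in_def)
    qed
    show "dir_deriv b g (x + 0 *\<^sub>R b) = 0" if "x \<notin> ?K \<union> K" for x
      using supported_iterd[OF compact_imp_closed[OF K(1)] K(2), of "[b]"] that by (simp add: supported_in_def)
  qed
  moreover have "(\<lambda>t. integral UNIV (\<lambda>x. g (x + t *\<^sub>R b))) = (\<lambda>t. integral UNIV g)"
    using integral_affine[OF test_cc[OF g], of 1] by simp
  ultimately have "((\<lambda>t::real. integral UNIV g) has_vector_derivative integral UNIV (dir_deriv b g)) (at 0)"
    by simp
  then show ?thesis using vector_derivative_unique_at[OF _ has_vector_derivative_const] by blast
qed

text \<open>The convention is a positive exponent without normalising constant, so a derivative of
  the transform in direction \<open>b\<close> corresponds to the multiplier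
  \<open>\<i> * (\<xi> \<bullet> b)\<close> of \<open>mulx\<close>, without further factors.\<close>

definition fourier :: "('a::euclidean_space \<Rightarrow> complex) \<Rightarrow> 'a \<Rightarrow> complex" where
  "fourier \<theta> x = integral UNIV (\<lambda>\<xi>. \<theta> \<xi> * exp (\<i> * of_real (\<xi> \<bullet> x)))"

lemma continuous_cexp: "continuous_on S (\<lambda>\<xi>::'a::euclidean_space. exp (\<i> * of_real (\<xi> \<bullet> x)))"
  by (intro continuous_intros)

lemma cc_fourier: "cc \<theta> \<Longrightarrow> cc (\<lambda>\<xi>. \<theta> \<xi> * exp (\<i> * of_real (\<xi> \<bullet> x)))"
  by (rule cc_mult[OF _ continuous_cexp])

lemma fourier_add: "cc f \<Longrightarrow> cc g \<Longrightarrow> fourier (\<lambda>x. f x + g x) y = fourier f y + fourier g y"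
  unfolding fourier_def by (simp add: distrib_right integral_add cc_integrable cc_fourier)

lemma fourier_cmult: "fourier (\<lambda>x. c * f x) y = c * fourier f y"
  unfolding fourier_def by (simp add: mult.assoc)

definition mulx :: "'a::euclidean_space \<Rightarrow> ('a \<Rightarrow> complex) \<Rightarrow> 'a \<Rightarrow> complex" where
  "mulx b \<theta> \<xi> = (\<i> * of_real (\<xi> \<bullet> b)) * \<theta> \<xi>"

lemma mulx_smooth_factor: "smooth_fun (\<lambda>\<xi>. \<i> * complex_of_real (\<xi> \<bullet> b))"
  by (intro smooth_cmult smooth_inner)

lemma test_mulx: "test_fun \<theta> \<Longrightarrow> test_fun (mulx b \<theta>)"
  unfolding mulx_def by (rule test_mult[OF _ mulx_smooth_factor])

lemma DK_mulx: "DK L \<theta> \<Longrightarrow> DK L (mulx b \<theta>)"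
  unfolding mulx_def[abs_def] by (rule DK_mult[OF mulx_smooth_factor])

lemma fourier_continuous:
  fixes \<theta> :: "'a::euclidean_space \<Rightarrow> complex"
  assumes "test_fun \<theta>"
  shows "continuous_on UNIV (fourier \<theta>)"
proof -
  obtain K where K: "compact K" "supported_in \<theta> K" using assms by (auto simp: test_fun_def)
  obtain a where a: "supported_in \<theta> (cbox (-a) a)"
    using compact_cbox_symmetric[OF K(1)] supported_in_mono[OF K(2)] by metis
  have c: "continuous_on UNIV \<theta>" by (rule smooth_continuous[OF test_smooth[OF assms]])
  have "fourier \<theta> x = integral (cbox (-a) a) (\<lambda>\<xi>. \<theta> \<xi> * exp (\<i> * of_real (\<xi> \<bullet> x)))" for x
    unfolding fourier_def using a
    by (intro integral_eq_cbox continuous_on_mult c continuous_cexp) (auto simp: supported_in_def)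
  moreover have "continuous_on UNIV (\<lambda>x. integral (cbox (-a) a) (\<lambda>\<xi>. \<theta> \<xi> * exp (\<i> * of_real (\<xi> \<bullet> x))))"
  proof (rule integral_continuous_on_param)
    have "continuous_on (UNIV \<times> cbox (-a) a) (\<lambda>z::'a \<times> 'a. \<theta> (snd z))"
      by (rule continuous_on_compose2[OF c]) (auto intro: continuous_on_snd continuous_on_id)
    then show "continuous_on (UNIV \<times> cbox (-a) a) (\<lambda>(x, \<xi>). \<theta> \<xi> * exp (\<i> * of_real (\<xi> \<bullet> x)))"
      unfolding case_prod_beta' by (intro continuous_on_mult, (assumption | intro continuous_intros)+)
  qed
  ultimately show ?thesis by presburger
qed

lemma fourier_deriv:
  fixes \<theta> :: "'a::euclidean_space \<Rightarrow> complex"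
  assumes "test_fun \<theta>"
  shows "((\<lambda>s. fourier \<theta> (x + s *\<^sub>R b)) has_vector_derivative fourier (mulx b \<theta>) x) (at 0)"
proof -
  obtain K where K: "compact K" "supported_in \<theta> K" using assms by (auto simp: test_fun_def)
  have c: "continuous_on UNIV \<theta>" by (rule smooth_continuous[OF test_smooth[OF assms]])
  have "((\<lambda>s. integral UNIV (\<lambda>\<xi>. \<theta> \<xi> * exp (\<i> * of_real (\<xi> \<bullet> (x + s *\<^sub>R b))))) has_vector_derivative
     integral UNIV (\<lambda>\<xi>. (\<i> * of_real (\<xi> \<bullet> b)) * \<theta> \<xi> * exp (\<i> * of_real (\<xi> \<bullet> (x + 0 *\<^sub>R b))))) (at 0)"
  proof (rule leibniz_UNIV[where K=K])
    show "((\<lambda>s. \<theta> \<xi> * exp (\<i> * of_real (\<xi> \<bullet> (x + s *\<^sub>R b)))) has_vector_derivative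
       (\<i> * of_real (\<xi> \<bullet> b)) * \<theta> \<xi> * exp (\<i> * of_real (\<xi> \<bullet> (x + s *\<^sub>R b)))) (at s)" for s \<xi>
    proof -
      have "((\<lambda>s. \<i> * complex_of_real ((x + s *\<^sub>R b) \<bullet> \<xi>)) has_vector_derivative \<i> * of_real (b \<bullet> \<xi>)) (at s)"
        by (rule has_vector_derivative_mult_right,
          rule hvd_line[of "\<lambda>y. complex_of_real (y \<bullet> \<xi>)" b "\<lambda>_. complex_of_real (b \<bullet> \<xi>)" x s])
          (rule hvd_inner)
      from field_vector_diff_chain_at[OF this DERIV_exp]
      have "((\<lambda>s. exp (\<i> * complex_of_real (\<xi> \<bullet> (x + s *\<^sub>R b)))) has_vector_derivative
          \<i> * of_real (\<xi> \<bullet> b) * exp (\<i> * complex_of_real (\<xi> \<bullet> (x + s *\<^sub>R b)))) (at s)"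
        by (simp add: o_def inner_commute)
      from has_vector_derivative_mult_right[OF this, of "\<theta> \<xi>"]
      show ?thesis by (simp add: mult_ac)
    qed
    show "continuous_on UNIV (\<lambda>(s, \<xi>). \<i> * of_real (\<xi> \<bullet> b) * \<theta> \<xi> * exp (\<i> * of_real (\<xi> \<bullet> (x + s *\<^sub>R b))))"
      proof -
      have "continuous_on UNIV (\<lambda>z::real \<times> 'a. \<theta> (snd z))"
        by (rule continuous_on_compose2[OF c]) (auto intro: continuous_on_snd continuous_on_id)
      then show ?thesis unfolding case_prod_beta' by (intro continuous_on_mult, (assumption | intro continuous_intros)+)
    qed
    show "continuous_on UNIV (\<lambda>\<xi>. \<theta> \<xi> * exp (\<i> * of_real (\<xi> \<bullet> (x + s *\<^sub>R b))))" for s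
      by (intro continuous_on_mult c continuous_cexp)
  qed (use K in \<open>auto simp: supported_in_def\<close>)
  then show ?thesis by (simp add: fourier_def mulx_def)
qed

lemma fourier_smooth:
  assumes "test_fun \<theta>"
  shows "smooth_fun (fourier \<theta>)"
proof -
  define P where "P h \<longleftrightarrow> (\<exists>\<theta>. test_fun \<theta> \<and> h = fourier (\<theta> :: 'a \<Rightarrow> complex))" for h
  have "P (fourier \<theta>)" using assms by (auto simp: P_def)
  then show ?thesis
  proof (induction rule: smooth_coinduct[where P=P])
    case (cont g)
    then show ?case using fourier_continuous by (auto simp: P_def)
  next
    case (step g b)
    then obtain \<theta> where \<theta>: "test_fun \<theta>" "g = fourier \<theta>" by (auto simp: P_def)
    then have "P (fourier (mulx b \<theta>))" using test_mulx by (auto simp: P_def)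
    then show ?case using fourier_deriv[OF \<theta>(1)] \<theta>(2) by blast
  qed
qed

lemma test_mulxs: "test_fun \<theta> \<Longrightarrow> test_fun (foldr mulx vs \<theta>)"
  by (induction vs) (auto intro: test_mulx)

lemma DK_mulxs: "DK L \<theta> \<Longrightarrow> DK L (foldr mulx vs \<theta>)"
  by (induction vs) (auto intro: DK_mulx)

lemma iterd_fourier: "test_fun \<theta> \<Longrightarrow> iterd vs (fourier \<theta>) = fourier (foldr mulx vs \<theta>)"
  by (induction vs) (auto intro!: ext dir_derivI fourier_deriv test_mulxs)

text \<open>Integration by parts, in the form that the derivative of the product of
  \<open>\<theta>\<close> with the exponential has integral 0.\<close>

lemma fourier_dir_deriv:
  assumes \<theta>: "test_fun \<theta>" and b: "b \<in> Basis"
  shows "fourier (dir_deriv b \<theta>) x = - (\<i> * of_real (x \<bullet> b)) * fourier \<theta> x"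
proof -
  let ?e = "\<lambda>\<xi>. exp (\<i> * complex_of_real (\<xi> \<bullet> x))"
  have db: "dir_deriv b (\<lambda>\<xi>. complex_of_real (\<xi> \<bullet> x)) = (\<lambda>\<xi>. of_real (b \<bullet> x))"
    by (intro ext dir_derivI hvd_inner)
  have sm: "smooth_fun \<theta>" by (rule test_smooth[OF \<theta>])
  have "test_fun (\<lambda>\<xi>. ?e \<xi> * \<theta> \<xi>)" by (intro test_mult[OF \<theta>] smooth_exp smooth_inner)
  then have "test_fun (\<lambda>\<xi>. \<theta> \<xi> * ?e \<xi>)" by (simp add: mult.commute)
  from integral_dir_deriv_zero[OF this b]
  have "integral UNIV (\<lambda>\<xi>. dir_deriv b \<theta> \<xi> * ?e \<xi> + (\<i> * of_real (b \<bullet> x)) * (\<theta> \<xi> * ?e \<xi>)) = 0"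
    by (simp add: dir_deriv_mult_exp[OF sm smooth_inner b] db distrib_right mult.assoc)
  moreover have "integral UNIV (\<lambda>\<xi>. dir_deriv b \<theta> \<xi> * ?e \<xi> + (\<i> * of_real (b \<bullet> x)) * (\<theta> \<xi> * ?e \<xi>)) =
     fourier (dir_deriv b \<theta>) x + (\<i> * of_real (b \<bullet> x)) * fourier \<theta> x"
  proof -
    have "test_fun (dir_deriv b \<theta>)" using test_iterd[OF \<theta>, of "[b]"] b by simp
    then have i1: "(\<lambda>\<xi>. dir_deriv b \<theta> \<xi> * ?e \<xi>) integrable_on UNIV"
      by (intro cc_integrable cc_fourier test_cc)
    have i2: "(\<lambda>\<xi>. (\<i> * of_real (b \<bullet> x)) * (\<theta> \<xi> * ?e \<xi>)) integrable_on UNIV"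
      by (intro integrable_on_mult_right cc_integrable[OF cc_fourier] test_cc \<theta>)
    show ?thesis unfolding fourier_def integral_add[OF i1 i2] by simp
  qed
  ultimately show ?thesis by (simp add: inner_commute eq_neg_iff_add_eq_0)
qed

lemma DK_test: "compact L \<Longrightarrow> DK L g \<Longrightarrow> test_fun g"
  unfolding DK_def test_fun_def by blast

lemma fourier_bound:
  fixes L :: "'a::euclidean_space set"
  assumes "compact L"
  obtains V where "0 \<le> V" "\<And>\<theta> D x. DK L \<theta> \<Longrightarrow> bndw (\<lambda>_. 1) 0 \<theta> D \<Longrightarrow> norm (fourier \<theta> x) \<le> V * D"
proof -
  obtain a where a: "L \<subseteq> cbox (-a) a" using compact_cbox_symmetric[OF assms] .
  show ?thesis
  proof (rule that[of "measure lborel (cbox (-a) a)"])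
    fix \<theta> :: "'a \<Rightarrow> complex" and D x assume \<theta>: "DK L \<theta>" "bndw (\<lambda>_. 1) 0 \<theta> D"
    have c: "continuous_on UNIV (\<lambda>\<xi>. \<theta> \<xi> * exp (\<i> * of_real (\<xi> \<bullet> x)))"
      by (intro continuous_on_mult continuous_cexp smooth_continuous DK_smooth[OF \<theta>(1)])
    have "fourier \<theta> x = integral (cbox (-a) a) (\<lambda>\<xi>. \<theta> \<xi> * exp (\<i> * of_real (\<xi> \<bullet> x)))"
      unfolding fourier_def using \<theta>(1) a
      by (intro integral_eq_cbox c) (auto simp: supported_in_def DK_def)
    moreover have "norm (integral (cbox (-a) a) (\<lambda>\<xi>. \<theta> \<xi> * exp (\<i> * of_real (\<xi> \<bullet> x)))) \<le> D * measure lborel (cbox (-a) a)"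
      using bndw_nonneg[OF \<theta>(2)] bndwD0[OF \<theta>(2)]
      by (intro has_integral_bound[OF _ integrable_integral] integrable_continuous continuous_on_subset[OF c])
        (auto simp: norm_mult)
    ultimately show "norm (fourier \<theta> x) \<le> measure lborel (cbox (-a) a) * D" by (simp add: mult.commute)
  qed simp
qed

text \<open>The norm of \<open>x\<close> is at most the sum of its absolute coordinates, so each
  further power of the weight is paid for by one more derivative of \<open>\<theta>\<close>.\<close>

lemma fourier_weighted_bound:
  fixes L :: "'a::euclidean_space set"
  assumes L: "compact L"
  shows "\<exists>V\<ge>0. \<forall>\<theta> D x. DK L \<theta> \<longrightarrow> bndw (\<lambda>_. 1) k \<theta> D \<longrightarrow> sw k x * norm (fourier \<theta> x) \<le> V * D"
proof (induction k)
  case 0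
  show ?case using fourier_bound[OF L] by (metis mult_1 power_0)
next
  case (Suc k)
  then obtain V where V: "0 \<le> V" "\<And>\<theta> D x. DK L \<theta> \<Longrightarrow> bndw (\<lambda>_. 1) k \<theta> D \<Longrightarrow> sw k x * norm (fourier \<theta> x) \<le> V * D"
    by blast
  have "sw (Suc k) x * norm (fourier \<theta> x) \<le> (V * (1 + real DIM('a))) * D"
    if \<theta>: "DK L \<theta>" "bndw (\<lambda>_. 1) (Suc k) \<theta> D" for \<theta> D x
  proof -
    note t = DK_test[OF L \<theta>(1)]
    from \<theta>(2) have B: "bndw (\<lambda>_. 1) k \<theta> D" "\<And>b. b \<in> Basis \<Longrightarrow> bndw (\<lambda>_. 1) k (dir_deriv b \<theta>) D"
      by (auto simp: bndw_Suc)
    have "sw (Suc k) x * norm (fourier \<theta> x) = (1 + norm x) * (sw k x * norm (fourier \<theta> x))" by simp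
    also have "\<dots> \<le> (1 + (\<Sum>b\<in>Basis. \<bar>x \<bullet> b\<bar>)) * (sw k x * norm (fourier \<theta> x))"
      using norm_le_l1[of x] by (intro mult_right_mono) auto
    also have "\<dots> = sw k x * norm (fourier \<theta> x) + (\<Sum>b\<in>Basis. sw k x * norm (fourier (dir_deriv b \<theta>) x))"
      by (simp add: fourier_dir_deriv[OF t] norm_mult distrib_left distrib_right sum_distrib_left sum_distrib_right mult_ac)
    also have "\<dots> \<le> V * D + (\<Sum>b\<in>(Basis::'a set). V * D)"
      using V(2)[OF \<theta>(1) B(1)] V(2)[OF DK_dir_deriv[OF compact_imp_closed[OF L] \<theta>(1)] B(2)]
      by (intro add_mono sum_mono) auto
    also have "\<dots> = (V * (1 + real DIM('a))) * D" by (simp add: algebra_simps)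
    finally show ?thesis .
  qed
  then show ?case using V(1) by (intro exI[of _ "V * (1 + real DIM('a))"]) auto
qed

text \<open>Decay of order \<open>k\<close> costs \<open>k\<close> derivatives of
  \<open>\<theta>\<close>, whereas derivatives of the transform only multiply
  \<open>\<theta>\<close> by polynomials, which are bounded on \<open>L\<close>. Hence a functional
  of order \<open>N\<close> on Schwartz functions becomes one of order \<open>N\<close> on
  \<open>DK L\<close>.\<close>

lemma fourier_bndw:
  fixes L :: "'a::euclidean_space set"
  assumes L: "compact L"
  obtains V where "0 \<le> V" "\<And>\<theta> D. DK L \<theta> \<Longrightarrow> bndw (\<lambda>_. 1) k \<theta> D \<Longrightarrow> bndw (sw k) N (fourier \<theta>) (V * D)"
proof -
  have mulxs: "\<exists>\<beta>\<ge>0. \<forall>\<theta> D. DK L \<theta> \<longrightarrow> bndw (\<lambda>_. 1) k \<theta> D \<longrightarrow> bndw (\<lambda>_. 1) k (foldr mulx vs \<theta>) (\<beta> * D)" for vs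
  proof (induction vs)
    case Nil
    then show ?case by (intro exI[of _ 1]) auto
  next
    case (Cons v vs)
    then obtain \<beta> where \<beta>: "0 \<le> \<beta>" "\<And>\<theta> D. DK L \<theta> \<Longrightarrow> bndw (\<lambda>_. 1) k \<theta> D \<Longrightarrow> bndw (\<lambda>_. 1) k (foldr mulx vs \<theta>) (\<beta> * D)"
      by blast
    obtain \<gamma> where \<gamma>: "0 \<le> \<gamma>" "\<And>g B. DK L g \<Longrightarrow> bndw (\<lambda>_. 1) k g B \<Longrightarrow> bndw (\<lambda>_. 1) k (\<lambda>\<xi>. (\<i> * of_real (\<xi> \<bullet> v)) * g \<xi>) (\<gamma> * B)"
      using DK_mult_bndw[OF L mulx_smooth_factor] by blast
    have "bndw (\<lambda>_. 1) k (foldr mulx (v # vs) \<theta>) (\<gamma> * \<beta> * D)" if "DK L \<theta>" "bndw (\<lambda>_. 1) k \<theta> D" for \<theta> D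
      using \<gamma>(2)[OF DK_mulxs[OF that(1)] \<beta>(2)[OF that]] by (simp add: mulx_def[abs_def] mult.assoc)
    then show ?case using \<beta>(1) \<gamma>(1) by (intro exI[of _ "\<gamma> * \<beta>"]) auto
  qed
  then obtain \<beta> where \<beta>: "\<And>vs. 0 \<le> \<beta> vs"
    "\<And>vs \<theta> D. DK L \<theta> \<Longrightarrow> bndw (\<lambda>_. 1) k \<theta> D \<Longrightarrow> bndw (\<lambda>_. 1) k (foldr mulx vs \<theta>) (\<beta> vs * D)"
    by metis
  obtain V where V: "0 \<le> V" "\<And>\<theta> D x. DK L \<theta> \<Longrightarrow> bndw (\<lambda>_. 1) k \<theta> D \<Longrightarrow> sw k x * norm (fourier \<theta> x) \<le> V * D"
    using fourier_weighted_bound[OF L] by blast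
  define W where "W = (\<Sum>vs\<in>(deriv_lists N :: 'a list set). V * \<beta> vs)"
  show ?thesis
  proof (rule that[of W])
    show "0 \<le> W" unfolding W_def using V \<beta> by (intro sum_nonneg) auto
    fix \<theta> D assume \<theta>: "DK L \<theta>" "bndw (\<lambda>_. 1) k \<theta> D"
    show "bndw (sw k) N (fourier \<theta>) (W * D)"
      unfolding bndw_def
    proof (intro allI impI)
      fix vs :: "'a list" and x assume vs: "set vs \<subseteq> Basis" "length vs \<le> N"
      have "sw k x * norm (iterd vs (fourier \<theta>) x) \<le> V * (\<beta> vs * D)"
        unfolding iterd_fourier[OF DK_test[OF L \<theta>(1)]] by (intro V DK_mulxs \<beta> \<theta>)
      also have "\<dots> \<le> W * D"
      proof -
        have "V * \<beta> vs \<le> W"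
          unfolding W_def using V \<beta> vs by (intro member_le_sum) (auto simp: deriv_lists_iff)
        then have "(V * \<beta> vs) * D \<le> W * D" using bndw_nonneg[OF \<theta>(2)] by (intro mult_right_mono) auto
        then show ?thesis by (simp add: mult.assoc)
      qed
      finally show "sw k x * norm (iterd vs (fourier \<theta>) x) \<le> W * D" .
    qed
  qed
qed

lemma fourier_schwartz:
  assumes "test_fun \<theta>"
  shows "schwartz_fun (fourier \<theta>)"
proof (rule schwartzI[OF fourier_smooth[OF assms]])
  fix k N
  obtain L where L: "compact L" "DK L \<theta>" using assms by (auto simp: test_fun_def DK_def)
  obtain D where "bndw (\<lambda>_. 1) k \<theta> D" using bndw_test[of \<theta> L k] L by (auto simp: DK_def)
  then show "\<exists>C. bndw (sw k) N (fourier \<theta>) C" using fourier_bndw[OF L(1)] L(2) by metis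
qed

lemma fourier_modulate:
  assumes "cc \<theta>"
  shows "fourier \<theta> x * exp (\<i> * of_real (x \<bullet> \<eta>)) = fourier (\<lambda>\<xi>. \<theta> (\<xi> - \<eta>)) x"
proof -
  let ?g = "\<lambda>\<xi>. \<theta> \<xi> * exp (\<i> * complex_of_real (\<xi> \<bullet> x))"
  have "fourier (\<lambda>\<xi>. \<theta> (\<xi> - \<eta>)) x = integral UNIV (\<lambda>\<xi>. exp (\<i> * of_real (\<eta> \<bullet> x)) * ?g (1 *\<^sub>R \<xi> + - \<eta>))"
    unfolding fourier_def by (intro integral_cong) (simp add: inner_diff_left algebra_simps flip: exp_add)
  also have "\<dots> = exp (\<i> * of_real (\<eta> \<bullet> x)) * integral UNIV ?g"
    using integral_affine[OF cc_fourier[OF assms, of x], of 1 "- \<eta>"] by simp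
  finally show ?thesis by (simp add: fourier_def inner_commute mult.commute)
qed

lemma fourier_dilate:
  fixes \<theta> :: "'a::euclidean_space \<Rightarrow> complex"
  assumes "cc \<theta>" "0 < \<epsilon>"
  shows "fourier \<theta> (\<epsilon> *\<^sub>R x) = fourier (\<lambda>\<xi>. of_real (1 / \<epsilon> ^ DIM('a)) * \<theta> (inverse \<epsilon> *\<^sub>R \<xi>)) x"
proof -
  let ?g = "\<lambda>\<xi>. \<theta> \<xi> * exp (\<i> * complex_of_real (\<xi> \<bullet> (\<epsilon> *\<^sub>R x)))"
  have "fourier (\<lambda>\<xi>. of_real (1 / \<epsilon> ^ DIM('a)) * \<theta> (inverse \<epsilon> *\<^sub>R \<xi>)) x =
      of_real (1 / \<epsilon> ^ DIM('a)) * integral UNIV (\<lambda>\<xi>. ?g (inverse \<epsilon> *\<^sub>R \<xi> + 0))"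
  proof -
    have "(inverse \<epsilon> *\<^sub>R \<xi> + 0) \<bullet> (\<epsilon> *\<^sub>R x) = \<xi> \<bullet> x" for \<xi>
      using assms(2) by simp
    then show ?thesis unfolding fourier_cmult unfolding fourier_def by (simp only: add_0_right)
  qed
  also have "\<dots> = fourier \<theta> (\<epsilon> *\<^sub>R x)"
    using integral_affine[OF cc_fourier[OF assms(1), of "\<epsilon> *\<^sub>R x"], of "inverse \<epsilon>" 0] assms(2)
    by (simp add: fourier_def power_inverse scaleR_conv_of_real field_simps)
  finally show ?thesis by simp
qed

lemma integral_bump_pos: "0 < integral UNIV (bumpr :: 'a::euclidean_space \<Rightarrow> real)"
  and integral_bump: "integral UNIV (bump :: 'a::euclidean_space \<Rightarrow> complex) = of_real (integral UNIV (bumpr :: 'a \<Rightarrow> real))"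
proof -
  let ?B = "bumpr :: 'a \<Rightarrow> real"
  let ?Q = "cbox (- One) (One :: 'a)"
  have sub: "cball 0 1 \<subseteq> ?Q"
  proof
    fix x :: 'a assume "x \<in> cball 0 1"
    then have "\<bar>x \<bullet> b\<bar> \<le> 1" if "b \<in> Basis" for b
      using Basis_le_norm[OF that, of x] by simp
    then show "x \<in> ?Q" by (auto simp: mem_box abs_le_iff)
  qed
  have out: "bumpr x = 0" if "x \<notin> ?Q" for x :: 'a
    using bump_supported[unfolded supported_in_def] sub that by (metis bump_def of_real_eq_0_iff subsetD)
  have hi: "(?B has_integral integral ?Q ?B) ?Q"
    by (intro integrable_integral integrable_continuous continuous_bumpr)
  then have hU: "(?B has_integral integral ?Q ?B) UNIV"
    by (rule has_integral_on_superset) (use out in auto)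
  have "integral ?Q ?B \<noteq> 0"
  proof
    assume "integral ?Q ?B = 0"
    moreover have "(0::'a) \<in> box (- One) One" by (simp add: mem_box)
    then have "box (- One) (One::'a) \<noteq> {}" by blast
    ultimately have "?B 0 = 0"
      using hi by (intro has_integral_0_cbox_imp_0[OF continuous_bumpr, of "- One" One])
        (auto simp: bumpr_nonneg mem_box)
    then show False by (simp add: bumpr_0)
  qed
  moreover have "0 \<le> integral ?Q ?B" by (intro integral_nonneg has_integral_integrable[OF hi]) (auto simp: bumpr_nonneg)
  ultimately show "0 < integral UNIV ?B" using integral_unique[OF hU] by simp
  have "((bump :: 'a \<Rightarrow> complex) has_integral complex_of_real (integral ?Q ?B)) UNIV"
    unfolding bump_def[abs_def] using has_integral_linear[OF hU, of complex_of_real] by (simp add: o_def bounded_linear_of_real)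
  then show "integral UNIV (bump :: 'a \<Rightarrow> complex) = of_real (integral UNIV ?B)"
    using integral_unique[OF hU] by (simp add: integral_unique)
qed

section \<open>Approximation by trigonometric polynomials\<close>

text \<open>These are the approximants because multiplication by an exponential is a translation on
  the Fourier side, and because an exponential on a product space is a tensor product.\<close>

inductive trigpoly :: "('a::euclidean_space \<Rightarrow> complex) \<Rightarrow> bool" where
  trigpoly_exp: "trigpoly (\<lambda>x. exp (\<i> * of_real (x \<bullet> \<eta>)))"
| trigpoly_cmult: "trigpoly P \<Longrightarrow> trigpoly (\<lambda>x. c * P x)"
| trigpoly_add: "trigpoly P \<Longrightarrow> trigpoly Q \<Longrightarrow> trigpoly (\<lambda>x. P x + Q x)"

lemma trigpoly_mult:
  assumes "trigpoly P" "trigpoly Q"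
  shows "trigpoly (\<lambda>x. P x * Q x)"
  using assms(1)
proof induction
  case (trigpoly_exp \<eta>)
  show ?case using assms(2)
  proof induction
    case (trigpoly_exp \<zeta>)
    have "(\<lambda>x. exp (\<i> * of_real (x \<bullet> \<eta>)) * exp (\<i> * of_real (x \<bullet> \<zeta>))) = (\<lambda>x. exp (\<i> * of_real (x \<bullet> (\<eta> + \<zeta>))))"
      by (simp add: inner_add_right distrib_left exp_add)
    then show ?case by (simp add: trigpoly.trigpoly_exp)
  next
    case (trigpoly_cmult P c)
    then show ?case using trigpoly.trigpoly_cmult[of _ c] by (simp add: mult.left_commute)
  next
    case (trigpoly_add P Q)
    then show ?case using trigpoly.trigpoly_add by (simp add: distrib_left)
  qed
next
  case (trigpoly_cmult P c)
  then show ?case using trigpoly.trigpoly_cmult[of _ c] by (simp add: mult.assoc)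
next
  case (trigpoly_add P Q)
  then show ?case using trigpoly.trigpoly_add by (simp add: distrib_right)
qed

lemma trigpoly_const: "trigpoly (\<lambda>x. c)"
  using trigpoly_cmult[OF trigpoly_exp[of 0], of c] by simp

lemma trigpoly_power: "trigpoly P \<Longrightarrow> trigpoly (\<lambda>x. P x ^ n)"
  by (induction n) (auto intro: trigpoly_mult trigpoly_const)

lemma trigpoly_prod: "finite I \<Longrightarrow> (\<And>i. i \<in> I \<Longrightarrow> trigpoly (P i)) \<Longrightarrow> trigpoly (\<lambda>x. \<Prod>i\<in>I. P i x)"
  by (induction I rule: finite_induct) (auto intro: trigpoly_mult trigpoly_const)

lemma trigpoly_smooth: "trigpoly P \<Longrightarrow> smooth_fun P"
  by (induction rule: trigpoly.induct) (auto intro: smooth_exp smooth_inner smooth_cmult smooth_add)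

lemma trigpoly_continuous: "trigpoly P \<Longrightarrow> continuous_on UNIV P"
  by (rule smooth_continuous[OF trigpoly_smooth])

section \<open>Convolution with a periodic kernel\<close>

definition conv :: "('a::euclidean_space \<Rightarrow> complex) \<Rightarrow> ('a \<Rightarrow> complex) \<Rightarrow> 'a \<Rightarrow> complex" where
  "conv \<sigma> P x = integral UNIV (\<lambda>y. \<sigma> y * P (x - y))"

lemma conv_integrable:
  assumes "test_fun \<sigma>" "continuous_on UNIV P"
  shows "(\<lambda>y. \<sigma> y * P (x - y)) integrable_on UNIV"
proof -
  have "continuous_on UNIV (\<lambda>y. P (x - y))"
    by (rule continuous_on_compose2[OF assms(2)]) (auto intro: continuous_intros)
  then show ?thesis by (intro cc_integrable cc_mult test_cc assms)
qed

text \<open>Exponentials are eigenfunctions of convolution, with eigenvalue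
  \<open>fourier \<sigma> (- \<eta>)\<close>. That derivatives may be moved onto
  \<open>\<sigma>\<close> is thus checked on eigenvalues, through the transform of a
  derivative.\<close>

lemma conv_trigpoly:
  assumes "trigpoly P" "test_fun \<sigma>"
  shows "trigpoly (conv \<sigma> P)"
    and "b \<in> Basis \<Longrightarrow> ((\<lambda>s. conv \<sigma> P (x + s *\<^sub>R b)) has_vector_derivative conv (dir_deriv b \<sigma>) P x) (at 0)"
proof -
  have exp_eq: "conv \<tau> (\<lambda>x. exp (\<i> * of_real (x \<bullet> \<eta>))) = (\<lambda>x. fourier \<tau> (- \<eta>) * exp (\<i> * of_real (x \<bullet> \<eta>)))"
    for \<tau> :: "'a \<Rightarrow> complex" and \<eta>
  proof
    fix x
    have "(\<lambda>y. \<tau> y * exp (\<i> * of_real ((x - y) \<bullet> \<eta>))) =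
        (\<lambda>y. (\<tau> y * exp (\<i> * of_real (y \<bullet> - \<eta>))) * exp (\<i> * of_real (x \<bullet> \<eta>)))"
      by (simp add: inner_diff_left right_diff_distrib exp_diff exp_minus divide_inverse mult_ac)
    then show "conv \<tau> (\<lambda>x. exp (\<i> * of_real (x \<bullet> \<eta>))) x = fourier \<tau> (- \<eta>) * exp (\<i> * of_real (x \<bullet> \<eta>))"
      unfolding conv_def fourier_def by (simp only: integral_mult_left)
  qed
  have "trigpoly (conv \<sigma> P) \<and> (\<forall>b\<in>Basis. \<forall>x.
      ((\<lambda>s. conv \<sigma> P (x + s *\<^sub>R b)) has_vector_derivative conv (dir_deriv b \<sigma>) P x) (at 0))"
    using assms(1)
  proof induction
    case (trigpoly_exp \<eta>)
    have "((\<lambda>s. fourier \<sigma> (- \<eta>) * exp (\<i> * of_real ((x + s *\<^sub>R b) \<bullet> \<eta>))) has_vector_derivative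
         fourier (dir_deriv b \<sigma>) (- \<eta>) * exp (\<i> * of_real (x \<bullet> \<eta>))) (at 0)" if b: "b \<in> Basis" for b x
    proof -
      have "dir_deriv b (\<lambda>x. complex_of_real (x \<bullet> \<eta>)) x = of_real (b \<bullet> \<eta>)"
        by (rule dir_derivI[OF hvd_inner])
      from dir_deriv_mult_exp_has[OF smooth_const[of "fourier \<sigma> (- \<eta>)"] smooth_inner[of \<eta>] b, of \<i> x, unfolded this]
      show ?thesis
        using iterd_const[of "[b]" "fourier \<sigma> (- \<eta>)"]
        by (simp add: fourier_dir_deriv[OF assms(2) b] inner_commute mult_ac)
    qed
    then show ?case unfolding exp_eq
      by (intro conjI ballI allI trigpoly.trigpoly_cmult trigpoly.trigpoly_exp)
  next
    case (trigpoly_cmult P c)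
    have eq: "conv \<tau> (\<lambda>x. c * P x) = (\<lambda>x. c * conv \<tau> P x)" for \<tau>
      by (simp add: conv_def fun_eq_iff mult.left_commute[of _ c])
    show ?case unfolding eq
      using trigpoly_cmult by (auto intro: trigpoly.trigpoly_cmult has_vector_derivative_mult_right)
  next
    case (trigpoly_add P Q)
    have eq: "conv \<tau> (\<lambda>x. P x + Q x) = (\<lambda>x. conv \<tau> P x + conv \<tau> Q x)" if "test_fun \<tau>" for \<tau>
      using trigpoly_add
      by (simp add: conv_def fun_eq_iff distrib_left integral_add conv_integrable[OF that] trigpoly_continuous)
    have t: "test_fun (dir_deriv b \<sigma>)" if "b \<in> Basis" for b
      using test_iterd[OF assms(2), of "[b]"] that by simp
    show ?case unfolding eq[OF assms(2)]
      using trigpoly_add by (auto simp: eq[OF t] intro: trigpoly.trigpoly_add has_vector_derivative_add)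
  qed
  then show "trigpoly (conv \<sigma> P)"
    "b \<in> Basis \<Longrightarrow> ((\<lambda>s. conv \<sigma> P (x + s *\<^sub>R b)) has_vector_derivative conv (dir_deriv b \<sigma>) P x) (at 0)" by auto
qed

lemma iterd_conv:
  assumes "trigpoly P" "test_fun \<sigma>" "set vs \<subseteq> Basis"
  shows "iterd vs (conv \<sigma> P) = conv (iterd vs \<sigma>) P"
  using assms(3)
proof (induction vs)
  case (Cons b vs)
  then show ?case
    using conv_trigpoly(2)[OF assms(1) test_iterd[OF assms(2)]] by (auto intro!: dir_derivI)
qed simp

lemma conv_commute:
  assumes "test_fun \<sigma>" "continuous_on UNIV P"
  shows "conv \<sigma> P x = integral UNIV (\<lambda>z. \<sigma> (x - z) * P z)"
proof -
  have "continuous_on UNIV (\<lambda>y. P (x - y))"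
    by (rule continuous_on_compose2[OF assms(2)]) (auto intro: continuous_intros)
  from integral_affine[OF cc_mult[OF test_cc[OF assms(1)] this], of "-1" x]
  show ?thesis by (simp add: conv_def)
qed

text \<open>Away from the origin \<open>w\<close> is at most some \<open>q < 1\<close>, while on a
  small box around it \<open>w\<close> exceeds some \<open>q' > q\<close>. So the power outside is
  smaller than the integral by a factor of order \<open>(q / q') ^ n\<close>.\<close>

lemma kernel_concentration:
  fixes w :: "'a::euclidean_space \<Rightarrow> real"
  assumes w: "continuous_on UNIV w" "w 0 = 1" "\<And>z. 0 \<le> w z" "\<And>z. z \<in> cbox a b \<Longrightarrow> z \<noteq> 0 \<Longrightarrow> w z < 1"
    and 0: "0 \<in> box a b" and "0 < r" "0 < \<eta>"
  shows "\<forall>\<^sub>F n in sequentially. \<forall>z\<in>cbox a b. r \<le> norm z \<longrightarrow> w z ^ n \<le> \<eta> * integral (cbox a b) (\<lambda>z. w z ^ n)"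
proof -
  define S where "S = cbox a b \<inter> {z. r \<le> norm z}"
  have "closed {z::'a. r \<le> norm z}" by (intro closed_Collect_le continuous_intros)
  then have S: "compact S" unfolding S_def by (intro compact_Int_closed compact_cbox)
  obtain q where q: "0 \<le> q" "q < 1" "\<And>z. z \<in> S \<Longrightarrow> w z \<le> q"
  proof (cases "S = {}")
    case False
    obtain z where z: "z \<in> S" "\<And>y. y \<in> S \<Longrightarrow> w y \<le> w z"
      using continuous_attains_sup[OF S False continuous_on_subset[OF w(1)]] by auto
    have "z \<noteq> 0" using z(1) \<open>0 < r\<close> by (auto simp: S_def)
    then show ?thesis using that[of "w z"] z w(3,4) by (auto simp: S_def)
  qed (use that[of 0] in auto)
  define q' where "q' = (1 + q) / 2"
  have q': "q < q'" "q' < 1" "0 < q'" using q by (auto simp: q'_def)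
  have op: "open (w -` {q'<..} \<inter> box a b)"
    by (intro open_Int open_vimage open_greaterThan w(1) open_box)
  have mem: "0 \<in> w -` {q'<..} \<inter> box a b" using q' w(2) 0 by simp
  obtain c d where cd: "0 \<in> box c d" "cbox c d \<subseteq> w -` {q'<..} \<inter> box a b"
    using open_contains_cbox[OF op mem] by metis
  define m where "m = measure lborel (cbox c d)"
  have m: "0 < m" using cd(1) unfolding m_def content_pos_lt_eq by (auto simp: mem_box intro: less_trans)
  have int: "(\<lambda>z. w z ^ n) integrable_on cbox u v" for n u v
    by (intro integrable_continuous continuous_on_power continuous_on_subset[OF w(1)]) simp
  have lower: "q' ^ n * m \<le> integral (cbox a b) (\<lambda>z. w z ^ n)" for n
  proof -
    have "q' ^ n * m = integral (cbox c d) (\<lambda>z. q' ^ n)" by (simp add: m_def)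
    also have "\<dots> \<le> integral (cbox c d) (\<lambda>z. w z ^ n)"
      using cd(2) q' by (intro integral_le int integrable_const power_mono) (auto simp: less_imp_le)
    also have "\<dots> \<le> integral (cbox a b) (\<lambda>z. w z ^ n)"
      using cd(2) box_subset_cbox[of a b] w(3) by (intro integral_subset_le int) auto
    finally show ?thesis .
  qed
  have "(\<lambda>n. (q / q') ^ n) \<longlonglongrightarrow> 0" using q q' by (intro LIMSEQ_power_zero) simp
  then have "\<forall>\<^sub>F n in sequentially. (q / q') ^ n < \<eta> * m"
    by (rule order_tendstoD) (use m \<open>0 < \<eta>\<close> in simp)
  then show ?thesis
  proof eventually_elim
    case (elim n)
    show ?case
    proof (intro ballI impI)
      fix z assume "z \<in> cbox a b" "r \<le> norm z"
      then have "w z ^ n \<le> q ^ n" using q(3)[of z] w(3) by (intro power_mono) (auto simp: S_def)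
      also have "\<dots> \<le> \<eta> * (q' ^ n * m)"
        using elim q' by (simp add: power_divide field_simps)
      also have "\<dots> \<le> \<eta> * integral (cbox a b) (\<lambda>z. w z ^ n)"
        using lower \<open>0 < \<eta>\<close> by (intro mult_left_mono) auto
      finally show "w z ^ n \<le> \<eta> * integral (cbox a b) (\<lambda>z. w z ^ n)" .
    qed
  qed
qed

text \<open>Its powers are, up to normalisation, products of de la Vallee Poussin kernels of period
  \<open>2 * L\<close> in the coordinates, for positive \<open>L\<close>. The value 1 is attained
  only on the lattice of periods.\<close>

definition cos_kernel :: "real \<Rightarrow> 'a::euclidean_space \<Rightarrow> real" where
  "cos_kernel L z = (\<Prod>b\<in>Basis. (1 + cos (pi / L * (z \<bullet> b))) / 2)"

lemma cos_kernel_factor: "0 \<le> (1 + cos (t::real)) / 2" "(1 + cos (t::real)) / 2 \<le> 1"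
proof -
  have "0 \<le> (1 + c) / 2" if "-1 \<le> c" for c :: real using that by simp
  then show "0 \<le> (1 + cos t) / 2" using cos_ge_minus_one by blast
  have "(1 + c) / 2 \<le> 1" if "c \<le> 1" for c :: real using that by simp
  then show "(1 + cos t) / 2 \<le> 1" using cos_le_one by blast
qed

lemma cos_kernel_nonneg: "0 \<le> cos_kernel L z"
  unfolding cos_kernel_def by (intro prod_nonneg ballI cos_kernel_factor)

lemma cos_kernel_0: "cos_kernel L 0 = 1"
  by (simp add: cos_kernel_def)

lemma cos_kernel_continuous: "continuous_on S (cos_kernel L)"
  unfolding cos_kernel_def[abs_def] by (intro continuous_intros) auto

lemma cos_kernel_less:
  assumes "0 < L" "\<And>b. b \<in> Basis \<Longrightarrow> \<bar>z \<bullet> b\<bar> < 2 * L" "z \<noteq> (0::'a::euclidean_space)"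
  shows "cos_kernel L z < 1"
proof -
  obtain b where b: "b \<in> Basis" "z \<bullet> b \<noteq> 0" using assms(3) by (auto simp: euclidean_eq_iff[where x=z])
  let ?u = "pi / L * (z \<bullet> b)"
  have "cos ?u \<noteq> 1"
  proof
    assume "cos ?u = 1"
    then obtain k :: int where k: "?u = of_int k * 2 * pi" by (auto simp: cos_one_2pi_int)
    then have "z \<bullet> b = of_int k * 2 * L" using assms(1) by (simp add: field_simps)
    moreover have "k \<noteq> 0" using b(2) \<open>z \<bullet> b = of_int k * 2 * L\<close> by auto
    then have "1 \<le> \<bar>real_of_int k\<bar>" by linarith
    ultimately have "2 * L \<le> \<bar>z \<bullet> b\<bar>" using assms(1) by (simp add: abs_mult)
    then show False using assms(2)[OF b(1)] by simp
  qed
  then have "cos ?u < 1" using cos_le_one[of ?u] by (metis order_less_le)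
  moreover have "(1 + u) / 2 < 1" if "u < 1" for u :: real using that by simp
  ultimately have lt: "(1 + cos ?u) / 2 < 1" by blast
  have "cos_kernel L z = (1 + cos ?u) / 2 * (\<Prod>b\<in>Basis - {b}. (1 + cos (pi / L * (z \<bullet> b))) / 2)"
    unfolding cos_kernel_def by (rule prod.remove) (use b in auto)
  also have "\<dots> \<le> (1 + cos ?u) / 2 * 1"
    by (intro mult_left_mono prod_le_1 cos_kernel_factor conjI)
  also have "\<dots> < 1" using lt by simp
  finally show ?thesis .
qed

lemma cos_kernel_trigpoly: "trigpoly (\<lambda>z::'a::euclidean_space. complex_of_real (cos_kernel L z))"
proof -
  have "trigpoly (\<lambda>z. complex_of_real ((1 + cos (pi / L * (z \<bullet> b))) / 2))" for b :: 'a
  proof -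
    have "complex_of_real ((1 + cos (pi / L * (z \<bullet> b))) / 2) =
       1/2 + (1/4 * exp (\<i> * of_real (z \<bullet> ((pi / L) *\<^sub>R b))) + 1/4 * exp (\<i> * of_real (z \<bullet> ((- pi / L) *\<^sub>R b))))" for z :: 'a
    proof -
      have "complex_of_real (cos (pi / L * (z \<bullet> b))) = (exp (\<i> * of_real (pi / L * (z \<bullet> b))) + exp (- (\<i> * of_real (pi / L * (z \<bullet> b))))) / 2"
        by (simp only: cos_of_real[symmetric] cos_exp_eq)
      then show ?thesis by (simp add: add_divide_distrib)
    qed
    then show ?thesis by (simp only:) (intro trigpoly_add trigpoly_cmult trigpoly_exp trigpoly_const)
  qed
  then have "trigpoly (\<lambda>z::'a. \<Prod>b\<in>Basis. complex_of_real ((1 + cos (pi / L * (z \<bullet> b))) / 2))"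
    by (intro trigpoly_prod) auto
  then show ?thesis by (simp only: cos_kernel_def of_real_prod)
qed

lemma cos_kernel_period:
  assumes "0 < L"
  shows "cos_kernel L (z - (\<Sum>b\<in>Basis. (2 * L * of_int (m b)) *\<^sub>R b)) = cos_kernel L (z::'a::euclidean_space)"
  unfolding cos_kernel_def
proof (intro prod.cong refl)
  fix b :: 'a assume b: "b \<in> Basis"
  have "pi / L * ((z - (\<Sum>b\<in>Basis. (2 * L * of_int (m b)) *\<^sub>R b)) \<bullet> b) = pi / L * (z \<bullet> b) - 2 * pi * of_int (m b)"
    using b assms by (simp add: inner_diff_left right_diff_distrib)
  then show "(1 + cos (pi / L * ((z - (\<Sum>b\<in>Basis. (2 * L * of_int (m b)) *\<^sub>R b)) \<bullet> b))) / 2 = (1 + cos (pi / L * (z \<bullet> b))) / 2"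
    by (simp add: cos_diff cos_int_2pin sin_int_2pin)
qed

text \<open>The half side \<open>3/2 * L\<close> is the sum of \<open>L\<close>, the range of the
  evaluation points, and \<open>L / 2\<close>, the size of the support of the functions to be
  approximated. As it is below \<open>2 * L\<close>, the origin is the only lattice point in the
  cube, so the normalised powers concentrate there.\<close>

definition cos_kernel_n :: "real \<Rightarrow> nat \<Rightarrow> 'a::euclidean_space \<Rightarrow> real" where
  "cos_kernel_n L n z = cos_kernel L z ^ n /
     integral (cbox (- ((3/2 * L) *\<^sub>R One)) ((3/2 * L) *\<^sub>R One)) (\<lambda>z::'a. cos_kernel L z ^ n)"

context
  fixes L :: real and Q :: "'a::euclidean_space set"
  assumes L: "0 < L"
  defines "Q \<equiv> cbox (- ((3/2 * L) *\<^sub>R One)) ((3/2 * L) *\<^sub>R One)"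
begin

lemma mem_Q: "z \<in> Q \<longleftrightarrow> (\<forall>b\<in>Basis. \<bar>z \<bullet> b\<bar> \<le> 3/2 * L)"
  by (auto simp: Q_def mem_box abs_le_iff)

lemma cos_kernel_pow_integrable: "(\<lambda>z. cos_kernel L z ^ n) integrable_on Q"
  unfolding Q_def by (intro integrable_continuous continuous_on_power cos_kernel_continuous)

lemma integral_cos_kernel_pos: "0 < integral Q (\<lambda>z. cos_kernel L z ^ n)"
proof -
  have "integral Q (\<lambda>z. cos_kernel L z ^ n) \<noteq> 0"
  proof
    assume z: "integral Q (\<lambda>z. cos_kernel L z ^ n) = 0"
    have "((\<lambda>z. cos_kernel L z ^ n) has_integral 0) Q"
      using integrable_integral[OF cos_kernel_pow_integrable, of n] z by simp
    moreover have "(0::'a) \<in> box (- ((3/2 * L) *\<^sub>R One)) ((3/2 * L) *\<^sub>R One)"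
      using L by (simp add: mem_box)
    moreover from this have "box (- ((3/2 * L) *\<^sub>R One)) ((3/2 * L) *\<^sub>R One :: 'a) \<noteq> {}" by blast
    moreover have "continuous_on Q (\<lambda>z. cos_kernel L z ^ n)"
      by (rule continuous_on_power[OF cos_kernel_continuous])
    ultimately have "cos_kernel L (0::'a) ^ n = 0"
      using has_integral_0_cbox_imp_0[of "- ((3/2 * L) *\<^sub>R One)" "(3/2 * L) *\<^sub>R One" "\<lambda>z::'a. cos_kernel L z ^ n" 0]
        box_subset_cbox unfolding Q_def by (auto simp: cos_kernel_nonneg)
    then show False by (simp add: cos_kernel_0)
  qed
  moreover have "0 \<le> integral Q (\<lambda>z. cos_kernel L z ^ n)"
    by (intro integral_nonneg cos_kernel_pow_integrable) (auto simp: cos_kernel_nonneg)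
  ultimately show ?thesis by simp
qed

lemma cos_kernel_n_nonneg: "0 \<le> cos_kernel_n L n (z::'a)"
  unfolding cos_kernel_n_def using integral_cos_kernel_pos[of n, unfolded Q_def]
  by (intro divide_nonneg_pos) (auto simp: cos_kernel_nonneg)

lemma cos_kernel_n_has_integral: "(cos_kernel_n L n has_integral 1) Q"
  using has_integral_divide[OF integrable_integral[OF cos_kernel_pow_integrable[of n]], of "integral Q (\<lambda>z. cos_kernel L z ^ n)"]
    integral_cos_kernel_pos[of n]
  by (simp add: cos_kernel_n_def[abs_def] Q_def)

lemma cos_kernel_n_trigpoly: "trigpoly (\<lambda>z::'a. complex_of_real (cos_kernel_n L n z))"
  using trigpoly_cmult[OF trigpoly_power[OF cos_kernel_trigpoly[of L], of n],
      of "complex_of_real (1 / integral Q (\<lambda>z. cos_kernel L z ^ n))"]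
  by (simp add: cos_kernel_n_def Q_def)

text \<open>For \<open>x\<close> in the cube of half side \<open>L\<close> the factor
  \<open>\<sigma> (x - z)\<close> vanishes outside \<open>Q\<close>, so only the peak of the
  periodic kernel at the origin is seen.\<close>

lemma conv_local:
  fixes \<sigma> :: "'a \<Rightarrow> complex"
  assumes \<sigma>: "test_fun \<sigma>" "\<And>y b. \<sigma> y \<noteq> 0 \<Longrightarrow> b \<in> Basis \<Longrightarrow> \<bar>y \<bullet> b\<bar> \<le> L / 2"
    and x: "\<And>b. b \<in> Basis \<Longrightarrow> \<bar>x \<bullet> b\<bar> \<le> L"
  shows "((\<lambda>z. \<sigma> (x - z) * of_real (cos_kernel_n L n z)) has_integral conv \<sigma> (\<lambda>z. of_real (cos_kernel_n L n z)) x) Q"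
proof -
  let ?g = "\<lambda>z. \<sigma> (x - z) * complex_of_real (cos_kernel_n L n z)"
  have c: "continuous_on UNIV ?g"
  proof -
    have "continuous_on UNIV (\<lambda>z. \<sigma> (x - z))"
      by (rule continuous_on_compose2[OF smooth_continuous[OF test_smooth[OF \<sigma>(1)]]])
        (auto intro: continuous_intros)
    then show ?thesis by (rule continuous_on_mult[OF _ trigpoly_continuous[OF cos_kernel_n_trigpoly]])
  qed
  have s: "supported_in ?g Q"
    unfolding supported_in_def
  proof (intro allI impI)
    fix z assume "z \<notin> Q"
    then obtain b where b: "b \<in> Basis" "3/2 * L < \<bar>z \<bullet> b\<bar>" by (auto simp: mem_Q not_le)
    have "\<sigma> (x - z) = 0"
    proof (rule ccontr)
      assume "\<sigma> (x - z) \<noteq> 0"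
      then have "\<bar>x \<bullet> b - z \<bullet> b\<bar> \<le> L / 2" using \<sigma>(2)[of "x - z", OF _ b(1)] by (simp add: inner_diff_left)
      then show False using x[OF b(1)] b(2) by linarith
    qed
    then show "?g z = 0" by simp
  qed
  have "conv \<sigma> (\<lambda>z. of_real (cos_kernel_n L n z)) x = integral Q ?g"
    using integral_eq_cbox[OF c s[unfolded Q_def]]
    by (simp add: conv_commute[OF \<sigma>(1) trigpoly_continuous[OF cos_kernel_n_trigpoly]] Q_def)
  then show ?thesis
    using integrable_integral[OF integrable_continuous[OF continuous_on_subset[OF c]]]
    by (metis Q_def subset_UNIV)
qed

text \<open>By periodicity the point may be moved into the cube of half side \<open>L\<close>, where
  the kernel acts as a probability density on \<open>Q\<close>. The bound therefore holds at every
  point, also where the approximation fails.\<close>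

lemma conv_bound:
  fixes \<sigma> :: "'a \<Rightarrow> complex"
  assumes \<sigma>: "test_fun \<sigma>" "\<And>y b. \<sigma> y \<noteq> 0 \<Longrightarrow> b \<in> Basis \<Longrightarrow> \<bar>y \<bullet> b\<bar> \<le> L / 2"
    and S: "\<And>y. norm (\<sigma> y) \<le> S"
  shows "norm (conv \<sigma> (\<lambda>z. of_real (cos_kernel_n L n z)) x) \<le> S"
proof -
  define m where "m b = round ((x \<bullet> b) / (2 * L))" for b
  define x' where "x' = x - (\<Sum>b\<in>Basis. (2 * L * of_int (m b)) *\<^sub>R b)"
  have "cos_kernel_n L n (x' - y) = cos_kernel_n L n (x - y)" for y
    using cos_kernel_period[OF L, of "x - y" m]
    by (simp add: cos_kernel_n_def x'_def algebra_simps)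
  then have eq: "conv \<sigma> (\<lambda>z. of_real (cos_kernel_n L n z)) x = conv \<sigma> (\<lambda>z. of_real (cos_kernel_n L n z)) x'"
    by (simp add: conv_def)
  have x': "\<bar>x' \<bullet> b\<bar> \<le> L" if b: "b \<in> Basis" for b
  proof -
    have 1: "x' \<bullet> b = 2 * L * ((x \<bullet> b) / (2 * L) - of_int (m b))"
      using b L by (simp add: x'_def inner_diff_left right_diff_distrib)
    have "\<bar>(x \<bullet> b) / (2 * L) - of_int (m b)\<bar> \<le> 1/2"
      unfolding m_def using of_int_round_abs_le[of "(x \<bullet> b) / (2 * L)"] by (simp add: abs_minus_commute)
    then have "2 * L * \<bar>(x \<bullet> b) / (2 * L) - of_int (m b)\<bar> \<le> 2 * L * (1/2)"
      using L by (intro mult_left_mono) auto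
    then show ?thesis unfolding 1 using L by (simp add: abs_mult)
  qed
  have h: "((\<lambda>z. \<sigma> (x' - z) * of_real (cos_kernel_n L n z)) has_integral conv \<sigma> (\<lambda>z. of_real (cos_kernel_n L n z)) x') Q"
    by (rule conv_local[OF \<sigma>(1)]) (use \<sigma>(2) x' in auto)
  have "norm (conv \<sigma> (\<lambda>z. of_real (cos_kernel_n L n z)) x') \<le> integral Q (\<lambda>z. S * cos_kernel_n L n z)"
    unfolding integral_unique[OF h, symmetric]
  proof (rule integral_norm_bound_integral[OF has_integral_integrable[OF h]])
    show "(\<lambda>z. S * cos_kernel_n L n z) integrable_on Q"
      by (rule integrable_on_mult_right[OF has_integral_integrable[OF cos_kernel_n_has_integral]])
    show "norm (\<sigma> (x' - z) * of_real (cos_kernel_n L n z)) \<le> S * cos_kernel_n L n z" for z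
      using mult_right_mono[OF S cos_kernel_n_nonneg] cos_kernel_n_nonneg by (simp add: norm_mult)
  qed
  also have "\<dots> = S"
    using integral_unique[OF cos_kernel_n_has_integral[of n]] by simp
  finally have "norm (conv \<sigma> (\<lambda>z. of_real (cos_kernel_n L n z)) x') \<le> S" .
  then show ?thesis by (simp add: eq)
qed

text \<open>The usual splitting for an approximate identity: near the origin uniform continuity of
  \<open>\<sigma>\<close> is used, elsewhere the kernel itself is at most
  \<open>\<eta>\<close>.\<close>

lemma conv_approx:
  fixes \<sigma> :: "'a \<Rightarrow> complex"
  assumes \<sigma>: "test_fun \<sigma>" "\<And>y b. \<sigma> y \<noteq> 0 \<Longrightarrow> b \<in> Basis \<Longrightarrow> \<bar>y \<bullet> b\<bar> \<le> L / 2"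
    and "0 < \<delta>"
  shows "\<forall>\<^sub>F n in sequentially. \<forall>x. (\<forall>b\<in>Basis. \<bar>x \<bullet> b\<bar> \<le> L) \<longrightarrow>
     norm (conv \<sigma> (\<lambda>z. of_real (cos_kernel_n L n z)) x - \<sigma> x) \<le> \<delta>"
proof -
  obtain K where K: "compact K" "supported_in \<sigma> K" using \<sigma> by (auto simp: test_fun_def)
  obtain S where S: "0 \<le> S" "\<And>y. norm (\<sigma> y) \<le> S"
    using bndw_test[OF test_smooth[OF \<sigma>(1)] K, of 0] by (auto simp: bndw_0)
  define V where "V = measure lborel Q"
  have V: "0 \<le> V" by (simp add: V_def)
  have "uniformly_continuous_on UNIV \<sigma>"
  proof -
    \<comment> \<open>Uniform continuity on a unit neighbourhood of \<open>K\<close> extends to the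
      whole space: two points at distance below 1 either both lie in the neighbourhood or both lie
      outside \<open>K\<close>.\<close>
    have "uniformly_continuous_on (\<Union>y\<in>K. cball y 1) \<sigma>"
      using compact_minkowski_sum_cball[OF K(1), of 1]
      by (intro compact_uniformly_continuous continuous_on_subset[OF smooth_continuous[OF test_smooth[OF \<sigma>(1)]]]) auto
    then show ?thesis
      unfolding uniformly_continuous_on_def
    proof (intro allI impI)
      fix e :: real assume "0 < e" and *: "\<forall>e>0. \<exists>d>0. \<forall>x\<in>(\<Union>y\<in>K. cball y 1). \<forall>x'\<in>(\<Union>y\<in>K. cball y 1). dist x' x < d \<longrightarrow> dist (\<sigma> x') (\<sigma> x) < e"
      then obtain d where d: "0 < d" "\<And>x x'. x \<in> (\<Union>y\<in>K. cball y 1) \<Longrightarrow> x' \<in> (\<Union>y\<in>K. cball y 1) \<Longrightarrow> dist x' x < d \<Longrightarrow> dist (\<sigma> x') (\<sigma> x) < e"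
        by metis
      have "dist (\<sigma> x') (\<sigma> x) < e" if "dist x' x < min d 1" for x x'
      proof (cases "x \<in> K \<or> x' \<in> K")
        case True
        have "x \<in> (\<Union>y\<in>K. cball y 1)" "x' \<in> (\<Union>y\<in>K. cball y 1)"
          using True that by (force simp: dist_commute)+
        then show ?thesis using d(2) that by auto
      next
        case False
        then show ?thesis using K(2) \<open>0 < e\<close> by (simp add: supported_in_def)
      qed
      then show "\<exists>d>0. \<forall>x\<in>UNIV. \<forall>x'\<in>UNIV. dist x' x < d \<longrightarrow> dist (\<sigma> x') (\<sigma> x) < e"
        using d(1) by (intro exI[of _ "min d 1"]) auto
    qed
  qed
  then obtain r where r: "0 < r" "\<And>x y. dist y x < r \<Longrightarrow> dist (\<sigma> y) (\<sigma> x) < \<delta> / 2"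
    unfolding uniformly_continuous_on_def using \<open>0 < \<delta>\<close> by (metis UNIV_I half_gt_zero)
  \<comment> \<open>Chosen such that the far part, at most \<open>2 * S * \<eta>\<close> times the
    volume \<open>V\<close> of the cube, contributes at most \<open>\<delta> / 2\<close>.\<close>
  define \<eta> where "\<eta> = \<delta> / (4 * (S + 1) * (V + 1))"
  have \<eta>: "0 < \<eta>" using S V \<open>0 < \<delta>\<close> by (simp add: \<eta>_def add_nonneg_pos)
  have small: "2 * S * \<eta> * V \<le> \<delta> / 2"
  proof -
    have "2 * S * \<eta> * V = (2 * \<eta>) * (S * V)" by simp
    also have "\<dots> \<le> (2 * \<eta>) * ((S + 1) * (V + 1))" using S V \<eta> by (intro mult_left_mono mult_mono) auto
    also have "\<dots> = \<delta> / 2"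
    proof -
      have "(2 * (\<delta> / (4 * a * b))) * (a * b) = \<delta> / 2" if "a \<noteq> 0" "b \<noteq> 0" for a b using that by simp
      moreover have "S + 1 \<noteq> 0" "V + 1 \<noteq> 0" using S V by linarith+
      ultimately show ?thesis unfolding \<eta>_def by blast
    qed
    finally show ?thesis .
  qed
  have "\<forall>\<^sub>F n in sequentially. \<forall>z\<in>Q. r \<le> norm z \<longrightarrow> cos_kernel L z ^ n \<le> \<eta> * integral Q (\<lambda>z. cos_kernel L z ^ n)"
    unfolding Q_def
  proof (rule kernel_concentration[where w="cos_kernel L"])
    show "cos_kernel L z < 1" if "z \<in> cbox (- ((3/2 * L) *\<^sub>R One)) ((3/2 * L) *\<^sub>R One)" "z \<noteq> 0" for z :: 'a
    proof (rule cos_kernel_less[OF L _ that(2)])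
      fix b :: 'a assume "b \<in> Basis"
      then have "\<bar>z \<bullet> b\<bar> \<le> 3/2 * L" using that(1) unfolding Q_def[symmetric] mem_Q by blast
      then show "\<bar>z \<bullet> b\<bar> < 2 * L" using L by linarith
    qed
  qed (use L r(1) \<eta> in \<open>auto simp: mem_box cos_kernel_continuous cos_kernel_0 cos_kernel_nonneg\<close>)
  then show ?thesis
  proof eventually_elim
    case (elim n)
    show ?case
    proof (intro allI impI)
      fix x :: 'a assume x: "\<forall>b\<in>Basis. \<bar>x \<bullet> b\<bar> \<le> L"
      let ?D = "cos_kernel_n L n"
      have hD: "((\<lambda>z. \<sigma> x * of_real (?D z)) has_integral \<sigma> x) Q"
      proof -
        have "((\<lambda>z. complex_of_real (?D z)) has_integral 1) Q"
          using has_integral_linear[OF cos_kernel_n_has_integral[of n], of complex_of_real]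
          by (simp add: o_def bounded_linear_of_real)
        from has_integral_mult_right[OF this, of "\<sigma> x"] show ?thesis by simp
      qed
      have h: "((\<lambda>z. \<sigma> (x - z) * of_real (?D z) - \<sigma> x * of_real (?D z)) has_integral
          (conv \<sigma> (\<lambda>z. of_real (?D z)) x - \<sigma> x)) Q"
        by (rule has_integral_diff[OF conv_local[OF \<sigma>(1)] hD]) (use \<sigma>(2) x in auto)
      have hm: "((\<lambda>z. \<delta> / 2 * ?D z + 2 * S * \<eta>) has_integral (\<delta> / 2 * 1 + 2 * S * \<eta> * V)) Q"
      proof (rule has_integral_add[OF has_integral_mult_right[OF cos_kernel_n_has_integral[of n]]])
        show "((\<lambda>z. 2 * S * \<eta>) has_integral 2 * S * \<eta> * V) Q"
          using has_integral_const[of "2 * S * \<eta>" "- ((3/2 * L) *\<^sub>R One)" "(3/2 * L) *\<^sub>R One :: 'a"]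
          by (simp add: Q_def V_def mult.commute)
      qed
      have "norm (conv \<sigma> (\<lambda>z. of_real (?D z)) x - \<sigma> x) \<le> integral Q (\<lambda>z. \<delta> / 2 * ?D z + 2 * S * \<eta>)"
        unfolding integral_unique[OF h, symmetric]
      proof (rule integral_norm_bound_integral[OF has_integral_integrable[OF h] has_integral_integrable[OF hm]])
        fix z assume z: "z \<in> Q"
        have n: "norm (\<sigma> (x - z) * of_real (?D z) - \<sigma> x * of_real (?D z)) = norm (\<sigma> (x - z) - \<sigma> x) * ?D z"
          using cos_kernel_n_nonneg by (simp add: norm_mult flip: left_diff_distrib)
        show "norm (\<sigma> (x - z) * of_real (?D z) - \<sigma> x * of_real (?D z)) \<le> \<delta> / 2 * ?D z + 2 * S * \<eta>"
        proof (cases "norm z < r")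
          case True
          then have "norm (\<sigma> (x - z) - \<sigma> x) \<le> \<delta> / 2"
            using r(2)[of "x - z" x] by (simp add: dist_norm less_imp_le)
          then have "norm (\<sigma> (x - z) - \<sigma> x) * ?D z \<le> \<delta> / 2 * ?D z"
            by (intro mult_right_mono cos_kernel_n_nonneg)
          moreover have "0 \<le> 2 * S * \<eta>" using S \<eta> by simp
          ultimately show ?thesis unfolding n by linarith
        next
          case False
          then have "?D z \<le> \<eta>"
            using elim z integral_cos_kernel_pos[of n] unfolding cos_kernel_n_def Q_def[symmetric]
            by (auto simp: divide_le_eq)
          moreover have "norm (\<sigma> (x - z) - \<sigma> x) \<le> 2 * S"
            using norm_triangle_ineq4[of "\<sigma> (x - z)" "\<sigma> x"] S(2)[of x] S(2)[of "x - z"] by linarith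
          ultimately have "norm (\<sigma> (x - z) - \<sigma> x) * ?D z \<le> 2 * S * \<eta>"
            using S cos_kernel_n_nonneg by (intro mult_mono) auto
          moreover have "0 \<le> \<delta> / 2 * ?D z" using \<open>0 < \<delta>\<close> cos_kernel_n_nonneg by simp
          ultimately show ?thesis unfolding n by linarith
        qed
      qed
      also have "\<dots> \<le> \<delta>" unfolding integral_unique[OF hm] using small by linarith
      finally show "norm (conv \<sigma> (\<lambda>z. of_real (?D z)) x - \<sigma> x) \<le> \<delta>" .
    qed
  qed
qed

end

text \<open>On the cube of half side \<open>L\<close> the convolution approximates all derivatives
  up to order \<open>N\<close>. Outside it the periodic copies spoil the approximation, but the
  derivatives of both functions are bounded by \<open>S\<close> and the weight is at most
  \<open>1 / L\<close>; this is why the error is measured with the weight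
  \<open>1 / (1 + norm x)\<close>.\<close>

lemma trigpoly_approx:
  fixes \<psi> :: "'a::euclidean_space \<Rightarrow> complex"
  assumes \<psi>: "test_fun \<psi>" and "0 < \<eta>"
  obtains P where "trigpoly P" "bndw (\<lambda>x. 1 / (1 + norm x)) N (\<lambda>x. P x - \<psi> x) \<eta>"
proof -
  obtain K where K: "compact K" "supported_in \<psi> K" using \<psi> by (auto simp: test_fun_def)
  obtain R where R: "0 < R" "\<And>y. y \<in> K \<Longrightarrow> norm y \<le> R"
    using compact_imp_bounded[OF K(1)] by (meson bounded_pos)
  obtain S where S: "0 \<le> S" "bndw (\<lambda>_. 1) N \<psi> S"
    using bndw_test[OF test_smooth[OF \<psi>] K] by blast
  \<comment> \<open>The first term keeps the support within \<open>L / 2\<close>, the second makes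
    \<open>2 * S / L\<close> at most \<open>\<eta>\<close> outside the cube.\<close>
  define L where "L = max (2 * R) (2 * S / \<eta>)"
  have L: "0 < L" "R \<le> L / 2" "2 * S / \<eta> \<le> L" using R by (auto simp: L_def)
  have supp: "\<bar>y \<bullet> b\<bar> \<le> L / 2" if "iterd vs \<psi> y \<noteq> 0" "b \<in> Basis" for vs y and b :: 'a
  proof -
    have "y \<in> K" using supported_iterd[OF compact_imp_closed[OF K(1)] K(2), of vs] that by (auto simp: supported_in_def)
    then show ?thesis using Basis_le_norm[OF that(2), of y] R(2)[of y] L(2) by linarith
  qed
  have "\<forall>\<^sub>F n in sequentially. \<forall>vs\<in>deriv_lists N. \<forall>x. (\<forall>b\<in>Basis. \<bar>x \<bullet> b\<bar> \<le> L) \<longrightarrow>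
     norm (conv (iterd vs \<psi>) (\<lambda>z. of_real (cos_kernel_n L n z)) x - iterd vs \<psi> x) \<le> \<eta>"
    using supp by (intro eventually_ball_finite ballI conv_approx[OF L(1)] test_iterd \<psi> \<open>0 < \<eta>\<close>)
      (auto simp: deriv_lists_iff)
  from eventually_happens'[OF sequentially_bot this]
  obtain n where n: "\<And>vs x. vs \<in> deriv_lists N \<Longrightarrow> (\<And>b. b \<in> Basis \<Longrightarrow> \<bar>x \<bullet> b\<bar> \<le> L) \<Longrightarrow>
     norm (conv (iterd vs \<psi>) (\<lambda>z. of_real (cos_kernel_n L n z)) x - iterd vs \<psi> x) \<le> \<eta>"
    by blast
  let ?D = "\<lambda>z::'a. complex_of_real (cos_kernel_n L n z)"
  have D: "trigpoly ?D" by (rule cos_kernel_n_trigpoly[OF L(1)])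
  show ?thesis
  proof (rule that[of "conv \<psi> ?D"])
    show "trigpoly (conv \<psi> ?D)" by (rule conv_trigpoly(1)[OF D \<psi>])
    show "bndw (\<lambda>x. 1 / (1 + norm x)) N (\<lambda>x. conv \<psi> ?D x - \<psi> x) \<eta>"
      unfolding bndw_def
    proof (intro allI impI)
      fix vs :: "'a list" and x :: 'a assume vs: "set vs \<subseteq> Basis" "length vs \<le> N"
      have eq: "iterd vs (\<lambda>x. conv \<psi> ?D x - \<psi> x) x = conv (iterd vs \<psi>) ?D x - iterd vs \<psi> x"
        by (simp add: iterd_diff trigpoly_smooth[OF conv_trigpoly(1)[OF D \<psi>]] test_smooth[OF \<psi>] vs iterd_conv[OF D \<psi>])
      have w: "0 < 1 + norm x" by (simp add: add_pos_nonneg)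
      show "1 / (1 + norm x) * norm (iterd vs (\<lambda>x. conv \<psi> ?D x - \<psi> x) x) \<le> \<eta>"
      proof (cases "\<forall>b\<in>Basis. \<bar>x \<bullet> b\<bar> \<le> L")
        case True
        have "1 / (1 + norm x) * norm (conv (iterd vs \<psi>) ?D x - iterd vs \<psi> x) \<le> 1 * \<eta>"
          using n[of vs x] True vs w by (intro mult_mono) (auto simp: deriv_lists_iff)
        then show ?thesis unfolding eq by simp
      next
        case False
        then obtain b where b: "b \<in> Basis" "L < \<bar>x \<bullet> b\<bar>" by (auto simp: not_le)
        have "L \<le> 1 + norm x" using b Basis_le_norm[OF b(1), of x] by linarith
        have le: "norm (iterd vs \<psi> y) \<le> S" for y using bndwD[OF S(2) vs, of y] by simp
        have "norm (conv (iterd vs \<psi>) ?D x) \<le> S"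
          using supp vs by (intro conv_bound[OF L(1)] test_iterd \<psi> le) auto
        then have "norm (conv (iterd vs \<psi>) ?D x - iterd vs \<psi> x) \<le> 2 * S"
          using norm_triangle_ineq4[of "conv (iterd vs \<psi>) ?D x" "iterd vs \<psi> x"] le[of x] by linarith
        also have "\<dots> \<le> \<eta> * (1 + norm x)"
          using L(3) \<open>L \<le> 1 + norm x\<close> \<open>0 < \<eta>\<close> by (simp add: divide_le_eq) (smt (verit) mult.commute mult_left_mono)
        finally show ?thesis unfolding eq using w by (simp add: field_simps)
      qed
    qed
  qed
qed

text \<open>The Schwartz factor \<open>k\<close> pays for the lost weight; it also supplies the
  decay that a trigonometric polynomial lacks.\<close>

lemma trigpoly_approx_schwartz:
  fixes \<psi> :: "'a::euclidean_space \<Rightarrow> complex"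
  assumes \<psi>: "test_fun \<psi>" and k: "schwartz_fun k" and "0 < \<delta>"
  obtains P where "trigpoly P" "bndw (sw N) N (\<lambda>x. (P x - \<psi> x) * k x) \<delta>"
proof -
  obtain A where A: "0 \<le> A" "bndw (sw (Suc N)) N k A" using schwartz_bndw[OF k] by blast
  define \<eta> where "\<eta> = \<delta> / (2 ^ N * (A + 1))"
  have "0 < \<eta>" using A \<open>0 < \<delta>\<close> by (simp add: \<eta>_def)
  from trigpoly_approx[OF \<psi> this] obtain P where P: "trigpoly P" "bndw (\<lambda>x. 1 / (1 + norm x)) N (\<lambda>x. P x - \<psi> x) \<eta>"
    by blast
  have w: "1 / (1 + norm x) * sw (Suc N) x = sw N x" for x :: 'a
    using sw_pos(1)[of x 1] by (simp add: field_simps)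
  have le: "2 ^ N * (\<eta> * A) \<le> \<delta>"
  proof -
    have "2 ^ N * (\<eta> * A) \<le> 2 ^ N * (\<eta> * (A + 1))" using \<open>0 < \<eta>\<close> by simp
    also have "\<dots> = \<delta>"
    proof -
      have "A + 1 \<noteq> 0" using A(1) by linarith
      then show ?thesis by (simp add: \<eta>_def)
    qed
    finally show ?thesis .
  qed
  have "bndw (\<lambda>x. 1 / (1 + norm x) * sw (Suc N) x) N (\<lambda>x. (P x - \<psi> x) * k x) (2 ^ N * (\<eta> * A))"
    by (rule bndw_mult[OF P(2) A(2) smooth_diff[OF trigpoly_smooth[OF P(1)] test_smooth[OF \<psi>]] schwartz_smooth[OF k]])
      (auto simp: add_nonneg_nonneg)
  then have "bndw (sw N) N (\<lambda>x. (P x - \<psi> x) * k x) (2 ^ N * (\<eta> * A))"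
    by (simp only: w)
  from that[OF P(1) bndw_mono[OF this order_refl le]] show ?thesis .
qed

section \<open>Reduction to band-limited functions and tensor products\<close>

text \<open>The density argument shared by all extensions: with \<open>K = UNIV\<close> it serves
  Schwartz functions, with compact \<open>K\<close> distributions, whose continuity estimate depends
  on the support.\<close>

lemma vanish_by_approximation:
  fixes S :: "('a::euclidean_space \<Rightarrow> complex) \<Rightarrow> complex"
  assumes lin: "lin_on D S" and neg: "\<And>f. D f \<Longrightarrow> D (\<lambda>x. (-1) * f x)"
    and bd: "0 \<le> C" "\<And>f B. D f \<Longrightarrow> supported_in f K \<Longrightarrow> bndw (sw N) N f B \<Longrightarrow> norm (S f) \<le> C * B"
    and f: "D f"
    and app: "\<And>\<delta>. 0 < \<delta> \<Longrightarrow> \<exists>g. D g \<and> S g = 0 \<and> D (\<lambda>x. g x - f x) \<and> supported_in (\<lambda>x. g x - f x) K \<and>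
      bndw (sw N) N (\<lambda>x. g x - f x) \<delta>"
  shows "S f = 0"
proof (rule ccontr)
  assume nz: "S f \<noteq> 0"
  define \<delta> where "\<delta> = norm (S f) / (2 * (C + 1))"
  have \<delta>: "0 < \<delta>" using nz bd(1) by (simp add: \<delta>_def)
  obtain g where g: "D g" "S g = 0" "D (\<lambda>x. g x - f x)" "supported_in (\<lambda>x. g x - f x) K"
      "bndw (sw N) N (\<lambda>x. g x - f x) \<delta>" using app[OF \<delta>] by blast
  have "S (\<lambda>x. g x - f x) = - S f"
    using lin_on_diff[OF lin g(1) f neg[OF f]] g(2) by simp
  then have "norm (S f) \<le> C * \<delta>" using bd(2)[OF g(3,4,5)] by simp
  also have "\<dots> \<le> (C + 1) * \<delta>" using \<delta> by (intro mult_right_mono) auto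
  also have "\<dots> = norm (S f) / 2"
  proof -
    have "a * (x / (2 * a)) = x / 2" if "a \<noteq> 0" for a x :: real using that by simp
    moreover have "C + 1 \<noteq> 0" using bd(1) by linarith
    ultimately show ?thesis unfolding \<delta>_def by blast
  qed
  finally show False using nz by simp
qed

text \<open>Continuity on Schwartz functions in a form that is visibly stable under sums, scalars
  and composition with derivatives. The left side of the differential equation, as a functional of
  the space variable, is built in this way.\<close>

definition schwartz_cont :: "(('a::euclidean_space \<Rightarrow> complex) \<Rightarrow> complex) \<Rightarrow> bool" where
  "schwartz_cont S \<longleftrightarrow> lin_on schwartz_fun S \<and>
     (\<exists>C\<ge>0. \<exists>N. \<forall>f B. schwartz_fun f \<longrightarrow> bndw (sw N) N f B \<longrightarrow> norm (S f) \<le> C * B)"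

lemma schwartz_contD:
  assumes "schwartz_cont S"
  obtains C N where "0 \<le> C" "\<And>f B. schwartz_fun f \<Longrightarrow> bndw (sw N) N f B \<Longrightarrow> norm (S f) \<le> C * B"
  using assms unfolding schwartz_cont_def by blast

lemma tempered_schwartz_cont: 
  assumes "tempered T"
  shows "schwartz_cont T"
proof -
  have "lin_on schwartz_fun T"
    using assms unfolding tempered_def lin_on_def by blast
  moreover obtain C N where "0 \<le> C" "\<And>f B. schwartz_fun f \<Longrightarrow> bndw (sw N) N f B \<Longrightarrow> norm (T f) \<le> C * B"
    using tempered_bound[OF assms] by blast
  ultimately show ?thesis unfolding schwartz_cont_def by blast
qed

lemma schwartz_cont_iterd:
  assumes S: "schwartz_cont S" and vs: "set vs \<subseteq> Basis"
  shows "schwartz_cont (\<lambda>f. S (iterd vs f))"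
proof -
  have lin: "lin_on schwartz_fun S" using S by (simp add: schwartz_cont_def)
  obtain C N where C: "0 \<le> C" "\<And>f B. schwartz_fun f \<Longrightarrow> bndw (sw N) N f B \<Longrightarrow> norm (S f) \<le> C * B"
    using schwartz_contD[OF S] by blast
  let ?M = "N + length vs"
  have "norm (S (iterd vs f)) \<le> C * B" if f: "schwartz_fun f" "bndw (sw ?M) ?M f B" for f B
  proof (rule C(2)[OF schwartz_iterd[OF f(1) vs]])
    have "bndw (sw ?M) N (iterd vs f) B"
      using f(2) vs unfolding bndw_def by (simp flip: iterd_append)
    then show "bndw (sw N) N (iterd vs f) B" by (rule bndw_sw_mono) auto
  qed
  moreover have "lin_on schwartz_fun (\<lambda>f. S (iterd vs f))"
    unfolding lin_on_def
    by (auto simp: iterd_add iterd_cmult vs schwartz_smooth lin_onD[OF lin] schwartz_iterd)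
  ultimately show ?thesis unfolding schwartz_cont_def using C(1) by blast
qed

lemma schwartz_cont_cmult:
  assumes S: "schwartz_cont S"
  shows "schwartz_cont (\<lambda>f. c * S f)"
proof -
  have lin: "lin_on schwartz_fun S" using S by (simp add: schwartz_cont_def)
  obtain C N where C: "0 \<le> C" "\<And>f B. schwartz_fun f \<Longrightarrow> bndw (sw N) N f B \<Longrightarrow> norm (S f) \<le> C * B"
    using schwartz_contD[OF S] by blast
  have "norm (c * S f) \<le> (norm c * C) * B" if "schwartz_fun f" "bndw (sw N) N f B" for f B
    using mult_left_mono[OF C(2)[OF that] norm_ge_zero[of c]] by (simp add: norm_mult mult.assoc)
  moreover have "lin_on schwartz_fun (\<lambda>f. c * S f)"
    unfolding lin_on_def by (auto simp: lin_onD[OF lin] distrib_left)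
  moreover have "0 \<le> norm c * C" using C(1) by simp
  ultimately show ?thesis unfolding schwartz_cont_def by blast
qed

lemma schwartz_cont_add:
  assumes S: "schwartz_cont S" and T: "schwartz_cont T"
  shows "schwartz_cont (\<lambda>f. S f + T f)"
proof -
  have lin: "lin_on schwartz_fun S" "lin_on schwartz_fun T" using S T by (auto simp: schwartz_cont_def)
  obtain C N where C: "0 \<le> C" "\<And>f B. schwartz_fun f \<Longrightarrow> bndw (sw N) N f B \<Longrightarrow> norm (S f) \<le> C * B"
    using schwartz_contD[OF S] by blast
  obtain C' N' where C': "0 \<le> C'" "\<And>f B. schwartz_fun f \<Longrightarrow> bndw (sw N') N' f B \<Longrightarrow> norm (T f) \<le> C' * B"
    using schwartz_contD[OF T] by blast
  let ?M = "max N N'"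
  have "norm (S f + T f) \<le> (C + C') * B" if f: "schwartz_fun f" "bndw (sw ?M) ?M f B" for f B
  proof -
    have "norm (S f) \<le> C * B" by (rule C(2)[OF f(1) bndw_sw_mono[OF f(2)]]) auto
    moreover have "norm (T f) \<le> C' * B" by (rule C'(2)[OF f(1) bndw_sw_mono[OF f(2)]]) auto
    ultimately show ?thesis using norm_triangle_ineq[of "S f" "T f"] by (simp add: distrib_right)
  qed
  moreover have "lin_on schwartz_fun (\<lambda>f. S f + T f)"
    unfolding lin_on_def by (auto simp: lin_onD[OF lin(1)] lin_onD[OF lin(2)] distrib_left)
  moreover have "0 \<le> C + C'" using C C' by simp
  ultimately show ?thesis unfolding schwartz_cont_def by blast
qed

lemma schwartz_cont_zero: "schwartz_cont (\<lambda>f. 0)"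
proof -
  have "norm (0::complex) \<le> 0 * B" for B by simp
  then show ?thesis unfolding schwartz_cont_def lin_on_def by (auto intro!: exI[of _ 0])
qed

lemma schwartz_cont_sum:
  "finite I \<Longrightarrow> (\<And>i. i \<in> I \<Longrightarrow> schwartz_cont (S i)) \<Longrightarrow> schwartz_cont (\<lambda>f. \<Sum>i\<in>I. S i f)"
  by (induction I rule: finite_induct) (auto intro: schwartz_cont_zero schwartz_cont_add)

lemma schwartz_neg: "schwartz_fun f \<Longrightarrow> schwartz_fun (\<lambda>x. (-1) * f x)"
  by (rule schwartz_cmult)

lemma schwartz_diff: "schwartz_fun f \<Longrightarrow> schwartz_fun g \<Longrightarrow> schwartz_fun (\<lambda>x. f x - g x)"
  using schwartz_add[of f "\<lambda>x. (-1) * g x"] schwartz_cmult[of g "-1"] by simp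

lemma bump_dilate_test: "0 < \<epsilon> \<Longrightarrow> test_fun (\<lambda>x. bump (\<epsilon> *\<^sub>R x))"
  by (rule test_scale[OF bump_test]) simp

lemma test_mult_right: "test_fun f \<Longrightarrow> smooth_fun g \<Longrightarrow> test_fun (\<lambda>x. f x * g x)"
  using test_mult[of f g] by (simp add: mult.commute)

text \<open>Test functions are dense: \<open>\<psi>\<close> is approximated by its products with
  dilated bumps.\<close>

lemma schwartz_cont_ext:
  fixes S :: "('a::euclidean_space \<Rightarrow> complex) \<Rightarrow> complex"
  assumes S: "schwartz_cont S" and zero: "\<And>f. test_fun f \<Longrightarrow> S f = 0" and \<psi>: "schwartz_fun \<psi>"
  shows "S \<psi> = 0"
proof -
  have lin: "lin_on schwartz_fun S" using S by (simp add: schwartz_cont_def)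
  obtain C N where C: "0 \<le> C" "\<And>f B. schwartz_fun f \<Longrightarrow> bndw (sw N) N f B \<Longrightarrow> norm (S f) \<le> C * B"
    using schwartz_contD[OF S] by blast
  obtain B where B: "bndw (\<lambda>_. 1) N (bump :: 'a \<Rightarrow> complex) B"
    using bndw_test[OF bump_smooth compact_cball bump_supported] by blast
  show ?thesis
  proof (rule vanish_by_approximation[OF lin schwartz_neg C(1), where K=UNIV and N=N])
    fix \<delta> :: real assume "0 < \<delta>"
    obtain \<epsilon> where e: "0 < \<epsilon>" "bndw (sw N) N (\<lambda>x. bump (\<epsilon> *\<^sub>R x) * \<psi> x - bump (0::'a) * \<psi> x) \<delta>"
      using schwartz_cutoff[OF bump_smooth B \<psi> \<open>0 < \<delta>\<close>] by blast
    let ?g = "\<lambda>x. bump (\<epsilon> *\<^sub>R x) * \<psi> x"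
    have g: "test_fun ?g" using e(1) by (intro test_mult_right bump_dilate_test schwartz_smooth \<psi>) simp
    show "\<exists>g. schwartz_fun g \<and> S g = 0 \<and> schwartz_fun (\<lambda>x. g x - \<psi> x) \<and> supported_in (\<lambda>x. g x - \<psi> x) UNIV \<and>
        bndw (sw N) N (\<lambda>x. g x - \<psi> x) \<delta>"
      using e(1) e(2) zero[OF g] schwartz_diff[OF test_schwartz[OF g] \<psi>] test_schwartz[OF g]
      by (intro exI[of _ ?g]) (simp add: bump_0 supported_in_def)
  qed (use \<psi> C in auto)
qed

lemma trigpoly_fourier:
  assumes "trigpoly P" "test_fun \<theta>"
  shows "\<exists>\<theta>'. test_fun \<theta>' \<and> (\<lambda>x. P x * fourier \<theta> x) = fourier \<theta>'"
  using assms(1)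
proof induction
  case (trigpoly_exp \<eta>)
  have "test_fun (\<lambda>\<xi>. \<theta> (\<xi> - \<eta>))" using test_shift[OF assms(2), of "- \<eta>"] by simp
  moreover have "(\<lambda>x. exp (\<i> * of_real (x \<bullet> \<eta>)) * fourier \<theta> x) = fourier (\<lambda>\<xi>. \<theta> (\<xi> - \<eta>))"
    using fourier_modulate[OF test_cc[OF assms(2)]] by (simp add: fun_eq_iff mult.commute)
  ultimately show ?case by blast
next
  case (trigpoly_cmult P c)
  then obtain \<theta>' where "test_fun \<theta>'" "(\<lambda>x. P x * fourier \<theta> x) = fourier \<theta>'" by blast
  then show ?case
    by (intro exI[of _ "\<lambda>x. c * \<theta>' x"]) (auto simp: test_cmult fourier_cmult mult.assoc fun_eq_iff)
next
  case (trigpoly_add P Q)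
  then obtain \<theta>1 \<theta>2 where "test_fun \<theta>1" "(\<lambda>x. P x * fourier \<theta> x) = fourier \<theta>1"
    "test_fun \<theta>2" "(\<lambda>x. Q x * fourier \<theta> x) = fourier \<theta>2" by blast
  then show ?case
    by (intro exI[of _ "\<lambda>x. \<theta>1 x + \<theta>2 x"]) (auto simp: test_add fourier_add test_cc distrib_right fun_eq_iff)
qed

lemma schwartz_test_mult: "schwartz_fun k \<Longrightarrow> test_fun \<psi> \<Longrightarrow> schwartz_fun (\<lambda>x. k x * \<psi> x)"
  by (rule test_schwartz[OF test_mult[OF _ schwartz_smooth]])

text \<open>Replaces Fourier inversion: only the vanishing of \<open>S\<close> on band-limited functions is used.\<close>

lemma schwartz_cont_fourier:
  fixes S :: "('a::euclidean_space \<Rightarrow> complex) \<Rightarrow> complex"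
  assumes S: "schwartz_cont S" and zero: "\<And>\<theta>. test_fun \<theta> \<Longrightarrow> S (fourier \<theta>) = 0" and \<psi>: "test_fun \<psi>"
  shows "S \<psi> = 0"
proof -
  have lin: "lin_on schwartz_fun S" using S by (simp add: schwartz_cont_def)
  obtain C N where C: "0 \<le> C" "\<And>f B. schwartz_fun f \<Longrightarrow> bndw (sw N) N f B \<Longrightarrow> norm (S f) \<le> C * B"
    using schwartz_contD[OF S] by blast
  let ?k = "fourier (bump :: 'a \<Rightarrow> complex)"
  have k: "schwartz_fun ?k" by (rule fourier_schwartz[OF bump_test])
  have \<psi>s: "schwartz_fun \<psi>" by (rule test_schwartz[OF \<psi>])
  \<comment> \<open>With the dilated transform as a factor, \<open>\<psi>\<close> may be replaced by
    a trigonometric polynomial \<open>P\<close>: the product of \<open>P\<close> with that factor is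
    again the transform of a test function, so \<open>S\<close> vanishes on it.\<close>
  have 1: "S (\<lambda>x. ?k (\<epsilon> *\<^sub>R x) * \<psi> x) = 0" if e: "0 < \<epsilon>" for \<epsilon>
  proof -
    define \<theta>e where "\<theta>e = (\<lambda>\<xi>. of_real (1 / \<epsilon> ^ DIM('a)) * bump (inverse \<epsilon> *\<^sub>R \<xi> :: 'a))"
    have t: "test_fun \<theta>e" unfolding \<theta>e_def using e by (intro test_cmult bump_dilate_test) simp
    have ke: "(\<lambda>x. ?k (\<epsilon> *\<^sub>R x)) = fourier \<theta>e"
      unfolding \<theta>e_def by (intro ext fourier_dilate test_cc bump_test e)
    have kes: "schwartz_fun (\<lambda>x. ?k (\<epsilon> *\<^sub>R x))" unfolding ke by (rule fourier_schwartz[OF t])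
    show ?thesis
    proof (rule vanish_by_approximation[OF lin schwartz_neg C(1), where K=UNIV and N=N])
      fix \<delta> :: real assume "0 < \<delta>"
      obtain P where P: "trigpoly P" "bndw (sw N) N (\<lambda>x. (P x - \<psi> x) * ?k (\<epsilon> *\<^sub>R x)) \<delta>"
        using trigpoly_approx_schwartz[OF \<psi> kes \<open>0 < \<delta>\<close>] by blast
      obtain \<theta>' where \<theta>': "test_fun \<theta>'" "(\<lambda>x. P x * ?k (\<epsilon> *\<^sub>R x)) = fourier \<theta>'"
        using trigpoly_fourier[OF P(1) t] unfolding ke[symmetric, THEN fun_cong] by blast
      have "S (\<lambda>x. P x * ?k (\<epsilon> *\<^sub>R x)) = 0" "schwartz_fun (\<lambda>x. P x * ?k (\<epsilon> *\<^sub>R x))"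
        unfolding \<theta>'(2) using zero \<theta>'(1) fourier_schwartz by blast+
      then show "\<exists>g. schwartz_fun g \<and> S g = 0 \<and> schwartz_fun (\<lambda>x. g x - ?k (\<epsilon> *\<^sub>R x) * \<psi> x) \<and>
          supported_in (\<lambda>x. g x - ?k (\<epsilon> *\<^sub>R x) * \<psi> x) UNIV \<and> bndw (sw N) N (\<lambda>x. g x - ?k (\<epsilon> *\<^sub>R x) * \<psi> x) \<delta>"
        using P(2) schwartz_diff[OF _ schwartz_test_mult[OF kes \<psi>]]
        by (intro exI[of _ "\<lambda>x. P x * ?k (\<epsilon> *\<^sub>R x)"])
          (simp add: supported_in_def left_diff_distrib mult.commute[of "\<psi> _"])
    qed (use C schwartz_test_mult[OF kes \<psi>] in auto)
  qed
  obtain B where B: "bndw (\<lambda>_. 1) N ?k B" using schwartz_bndw[OF k, of 0 N] by auto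
  \<comment> \<open>As \<open>\<epsilon>\<close> tends to 0 the factor tends to the constant
    \<open>?k 0\<close>, the integral of \<open>bump\<close>, which is not 0.\<close>
  have "S (\<lambda>x. ?k 0 * \<psi> x) = 0"
  proof (rule vanish_by_approximation[OF lin schwartz_neg C(1), where K=UNIV and N=N])
    fix \<delta> :: real assume "0 < \<delta>"
    obtain \<epsilon> where e: "0 < \<epsilon>" "bndw (sw N) N (\<lambda>x. ?k (\<epsilon> *\<^sub>R x) * \<psi> x - ?k 0 * \<psi> x) \<delta>"
      using schwartz_cutoff[OF schwartz_smooth[OF k] B \<psi>s \<open>0 < \<delta>\<close>] by blast
    let ?g = "\<lambda>x. ?k (\<epsilon> *\<^sub>R x) * \<psi> x"
    have g: "schwartz_fun ?g"
      by (intro test_schwartz test_mult \<psi> smooth_scale_iterd(1) schwartz_smooth k)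
    show "\<exists>g. schwartz_fun g \<and> S g = 0 \<and> schwartz_fun (\<lambda>x. g x - ?k 0 * \<psi> x) \<and>
        supported_in (\<lambda>x. g x - ?k 0 * \<psi> x) UNIV \<and> bndw (sw N) N (\<lambda>x. g x - ?k 0 * \<psi> x) \<delta>"
      using e(1) e(2) 1 g schwartz_diff[OF g schwartz_cmult[OF \<psi>s]]
      by (intro exI[of _ ?g]) (simp add: supported_in_def)
  qed (use C schwartz_cmult[OF \<psi>s] in auto)
  moreover have "?k 0 \<noteq> 0"
    using integral_bump_pos[where 'a='a] by (simp add: fourier_def integral_bump)
  ultimately show ?thesis by (simp add: lin_onD(2)[OF lin, OF \<psi>s])
qed

text \<open>The same two approximations as for band-limited functions: the dilated product bump
  times an exponential is a tensor product, so its product with a trigonometric polynomial is a sum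
  of such. The factors keep all supports in one compact set at each stage.\<close>

lemma distribution_tensor_zero:
  fixes U :: "('a::euclidean_space \<times> 'b::euclidean_space \<Rightarrow> complex) \<Rightarrow> complex"
  assumes U: "distribution U"
    and zero: "\<And>\<phi> \<psi>. test_fun \<phi> \<Longrightarrow> test_fun \<psi> \<Longrightarrow> U (\<lambda>(x, t). \<phi> t * \<psi> x) = 0"
    and \<Phi>: "test_fun \<Phi>"
  shows "U \<Phi> = 0"
proof -
  have lin: "lin_on test_fun U" using U unfolding distribution_def lin_on_def by blast
  have test_neg: "\<And>f. test_fun f \<Longrightarrow> test_fun (\<lambda>x. (-1) * f x)" by (rule test_cmult)
  have test_diff: "test_fun (\<lambda>x. f x - g x)" if "test_fun f" "test_fun g" for f g :: "'a \<times> 'b \<Rightarrow> complex"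
    using test_add[of f "\<lambda>x. (-1) * g x"] test_cmult[of g "-1"] that by simp
  have bd: "\<exists>C\<ge>0. \<exists>N. \<forall>f B. test_fun f \<longrightarrow> supported_in f K \<longrightarrow> bndw (sw N) N f B \<longrightarrow> norm (U f) \<le> C * B"
    if Kc: "compact K" for K
  proof -
    obtain C N where C: "0 \<le> C" "\<And>f B. test_fun f \<Longrightarrow> supported_in f K \<Longrightarrow> bndw (\<lambda>_. 1) N f B \<Longrightarrow> norm (U f) \<le> C * B"
      using distribution_bound[OF U Kc] by blast
    have "bndw (\<lambda>_. 1) N f B" if "bndw (sw N) N f B" for f :: "'a \<times> 'b \<Rightarrow> complex" and B
      using bndw_sw_mono[OF that, of 0 N] by simp
    then show ?thesis using C by blast
  qed
  let ?k = "\<lambda>(x::'a, t::'b). bump t * bump x"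
  have k: "test_fun ?k" by (rule test_tensor[OF bump_test bump_test])
  have 1: "U (\<lambda>z. ?k (\<epsilon> *\<^sub>R z) * \<Phi> z) = 0" if e: "0 < \<epsilon>" for \<epsilon>
  proof -
    let ?ke = "\<lambda>z. ?k (\<epsilon> *\<^sub>R z)"
    have ke: "test_fun ?ke" by (rule test_scale[OF k]) (use e in simp)
    have trig: "U (\<lambda>z. P z * ?ke z) = 0" if "trigpoly P" for P
      using that
    proof induction
      case (trigpoly_exp \<eta>)
      obtain a b where \<eta>: "\<eta> = (a, b)" by (cases \<eta>)
      have "(\<lambda>z. exp (\<i> * of_real (z \<bullet> \<eta>)) * ?ke z) =
          (\<lambda>(x, t). (bump (\<epsilon> *\<^sub>R t) * exp (\<i> * of_real (t \<bullet> b))) * (bump (\<epsilon> *\<^sub>R x) * exp (\<i> * of_real (x \<bullet> a))))"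
        by (simp add: fun_eq_iff \<eta> distrib_left exp_add mult_ac)
      moreover have "test_fun (\<lambda>t::'b. bump (\<epsilon> *\<^sub>R t) * exp (\<i> * of_real (t \<bullet> b)))"
        "test_fun (\<lambda>x::'a. bump (\<epsilon> *\<^sub>R x) * exp (\<i> * of_real (x \<bullet> a)))"
        by (intro test_mult_right bump_dilate_test e smooth_exp smooth_inner)+
      from zero[OF this]
      have "U (\<lambda>(x, t). (bump (\<epsilon> *\<^sub>R t) * exp (\<i> * of_real (t \<bullet> b))) * (bump (\<epsilon> *\<^sub>R x) * exp (\<i> * of_real (x \<bullet> a)))) = 0" .
      ultimately show ?case by simp
    next
      case (trigpoly_cmult P c)
      have "test_fun (\<lambda>z. P z * ?ke z)" by (intro test_mult ke trigpoly_smooth trigpoly_cmult)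
      from lin_onD(2)[OF lin, OF this, of c] show ?case using trigpoly_cmult by (simp add: mult.assoc)
    next
      case (trigpoly_add P Q)
      have "test_fun (\<lambda>z. P z * ?ke z)" "test_fun (\<lambda>z. Q z * ?ke z)"
        by (intro test_mult ke trigpoly_smooth trigpoly_add)+
      from lin_onD(1)[OF lin, OF this] show ?case using trigpoly_add by (simp add: distrib_right)
    qed
    obtain K where K: "compact K" "supported_in ?ke K" using ke by (auto simp: test_fun_def)
    obtain C N where C: "0 \<le> C" "\<And>f B. test_fun f \<Longrightarrow> supported_in f K \<Longrightarrow> bndw (sw N) N f B \<Longrightarrow> norm (U f) \<le> C * B"
      using bd[OF K(1)] by blast
    have f: "test_fun (\<lambda>z. ?ke z * \<Phi> z)" by (intro test_mult_right ke test_smooth \<Phi>)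
    show ?thesis
    proof (rule vanish_by_approximation[OF lin test_neg C(1), where K=K and N=N])
      fix \<delta> :: real assume "0 < \<delta>"
      obtain P where P: "trigpoly P" "bndw (sw N) N (\<lambda>z. (P z - \<Phi> z) * ?ke z) \<delta>"
        using trigpoly_approx_schwartz[OF \<Phi> test_schwartz[OF ke] \<open>0 < \<delta>\<close>] by blast
      have g: "test_fun (\<lambda>z. P z * ?ke z)" by (intro test_mult ke trigpoly_smooth P)
      have eq: "(\<lambda>z. (P z - \<Phi> z) * ?ke z) = (\<lambda>z. P z * ?ke z - ?ke z * \<Phi> z)"
        by (simp add: left_diff_distrib mult.commute)
      show "\<exists>g. test_fun g \<and> U g = 0 \<and> test_fun (\<lambda>x. g x - ?ke x * \<Phi> x) \<and> supported_in (\<lambda>x. g x - ?ke x * \<Phi> x) K \<and>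
          bndw (sw N) N (\<lambda>x. g x - ?ke x * \<Phi> x) \<delta>"
      proof (intro exI[of _ "\<lambda>z. P z * ?ke z"] conjI g trig P(1) test_diff f)
        show "supported_in (\<lambda>x. P x * ?ke x - ?ke x * \<Phi> x) K" using K(2) by (simp add: supported_in_def)
        show "bndw (sw N) N (\<lambda>x. P x * ?ke x - ?ke x * \<Phi> x) \<delta>" using P(2) unfolding eq .
      qed
    qed (use C f in auto)
  qed
  obtain K where K: "compact K" "supported_in \<Phi> K" using \<Phi> by (auto simp: test_fun_def)
  obtain C N where C: "0 \<le> C" "\<And>f B. test_fun f \<Longrightarrow> supported_in f K \<Longrightarrow> bndw (sw N) N f B \<Longrightarrow> norm (U f) \<le> C * B"
    using bd[OF K(1)] by blast
  obtain B where B: "bndw (\<lambda>_. 1) N ?k B" using k bndw_test unfolding test_fun_def by metis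
  show ?thesis
  proof (rule vanish_by_approximation[OF lin test_neg C(1), where K=K and N=N])
    fix \<delta> :: real assume "0 < \<delta>"
    obtain \<epsilon> where e: "0 < \<epsilon>" "bndw (sw N) N (\<lambda>x. ?k (\<epsilon> *\<^sub>R x) * \<Phi> x - ?k 0 * \<Phi> x) \<delta>"
      using schwartz_cutoff[OF test_smooth[OF k] B test_schwartz[OF \<Phi>] \<open>0 < \<delta>\<close>] by blast
    let ?g = "\<lambda>z. ?k (\<epsilon> *\<^sub>R z) * \<Phi> z"
    have g: "test_fun ?g" by (intro test_mult \<Phi> smooth_scale_iterd(1) test_smooth k)
    have k0: "?k 0 = 1" by (simp add: bump_0 zero_prod_def)
    show "\<exists>g. test_fun g \<and> U g = 0 \<and> test_fun (\<lambda>x. g x - \<Phi> x) \<and> supported_in (\<lambda>x. g x - \<Phi> x) K \<and>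
        bndw (sw N) N (\<lambda>x. g x - \<Phi> x) \<delta>"
    proof (intro exI[of _ ?g] conjI g 1 test_diff \<Phi>)
      show "supported_in (\<lambda>x. ?g x - \<Phi> x) K" using K(2) by (simp add: supported_in_def)
      show "bndw (sw N) N (\<lambda>x. ?g x - \<Phi> x) \<delta>"
        using e(1) e(2) unfolding k0 by simp
    qed (use e(1) in simp)
  qed (use C \<Phi> in auto)
qed

lemma Basis_real_list: "set vs \<subseteq> (Basis :: real set) \<Longrightarrow> vs = replicate (length vs) 1"
  by (metis Basis_real_def replicate_eqI singletonD subsetD)

lemma taylor_translate:
  fixes r :: "real \<Rightarrow> complex"
  assumes r: "smooth_fun r" and M: "bndw (\<lambda>_. 1) 2 r M"
  shows "norm (r (x - h) - r x + of_real h * dir_deriv 1 r x) \<le> M * h\<^sup>2"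
proof -
  have der: "(r has_vector_derivative dir_deriv 1 r y) (at y)" if "smooth_fun r" for r and y :: real
    using hvd_line[of r 1 "dir_deriv 1 r" 0 y] smooth_deriv[OF that, of 1] by simp
  let ?S = "closed_segment x (x - h)"
  have seg: "norm (y - x) \<le> \<bar>h\<bar>" if "y \<in> ?S" for y
    using segment_bound(1)[OF that] by (simp add: norm_minus_commute)
  have M2: "norm (dir_deriv 1 (dir_deriv 1 r) y) \<le> M" for y
    using bndwD[OF M, of "[1, 1]" y] by simp
  have 1: "norm (dir_deriv 1 r y - dir_deriv 1 r x) \<le> \<bar>h\<bar> * M" if y: "y \<in> ?S" for y
  proof -
    have "norm (dir_deriv 1 r y - dir_deriv 1 r x) \<le> M * norm (y - x)"
    proof (rule differentiable_bound[of UNIV])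
      show "(dir_deriv 1 r has_derivative (\<lambda>s. s *\<^sub>R dir_deriv 1 (dir_deriv 1 r) z)) (at z within UNIV)" for z
        using der[OF smooth_dir_deriv[OF r, of 1], of z] by (simp add: has_vector_derivative_def)
      show "onorm (\<lambda>s. s *\<^sub>R dir_deriv 1 (dir_deriv 1 r) z) \<le> M" for z
        by (rule onorm_le) (use mult_left_mono[OF M2[of z] abs_ge_zero] in \<open>simp add: mult.commute\<close>)
    qed auto
    also have "\<dots> \<le> M * \<bar>h\<bar>" using seg[OF y] order_trans[OF norm_ge_zero M2] by (intro mult_left_mono) auto
    finally show ?thesis by (simp add: mult.commute)
  qed
  have "norm (r (x - h) - r x - ((x - h) - x) *\<^sub>R dir_deriv 1 r x) \<le> norm ((x - h) - x) * (\<bar>h\<bar> * M)"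
  proof (rule vector_differentiable_bound_linearization[where S="?S"])
    show "(r has_vector_derivative dir_deriv 1 r y) (at y within ?S)" for y
      by (rule has_vector_derivative_at_within[OF der[OF r]])
  qed (use 1 in auto)
  then show ?thesis by (simp add: power2_eq_square scaleR_conv_of_real mult_ac)
qed

text \<open>The difference quotients of the translates converge in every seminorm by Taylor's
  formula, and for steps of size at most 1 all supports lie in one compact interval, where
  \<open>W\<close> has finite order. The minus sign is the derivative of \<open>s - t\<close> in
  \<open>t\<close>.\<close>

lemma distribution_translate_deriv:
  fixes W :: "(real \<Rightarrow> complex) \<Rightarrow> complex"
  assumes W: "distribution W" and \<rho>: "test_fun \<rho>"
  shows "((\<lambda>t. W (\<lambda>s. \<rho> (s - t))) has_vector_derivative - W (\<lambda>s. dir_deriv 1 \<rho> (s - t))) (at t)"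
proof -
  have lin: "lin_on test_fun W" using W unfolding distribution_def lin_on_def by blast
  obtain K where K: "compact K" "supported_in \<rho> K" using \<rho> by (auto simp: test_fun_def)
  obtain R where R: "0 < R" "\<And>y. y \<in> K \<Longrightarrow> \<bar>y\<bar> \<le> R"
    using compact_imp_bounded[OF K(1)] unfolding bounded_pos by auto
  let ?K = "{t - R - 1..t + R + 1}"
  obtain C N where C: "0 \<le> C" "\<And>f B. test_fun f \<Longrightarrow> supported_in f ?K \<Longrightarrow> bndw (\<lambda>_. 1) N f B \<Longrightarrow> norm (W f) \<le> C * B"
    using distribution_bound[OF W compact_Icc] by blast
  have sm: "smooth_fun \<rho>" by (rule test_smooth[OF \<rho>])
  \<comment> \<open>Two derivatives beyond the order of \<open>W\<close>, for the second-order
    remainder.\<close>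
  obtain M where M: "0 \<le> M" "bndw (\<lambda>_. 1) (N + 2) \<rho> M" using bndw_test[OF sm K] by blast
  have \<rho>': "test_fun (dir_deriv 1 \<rho>)" using test_iterd[OF \<rho>, of "[1]"] by simp
  have shift: "test_fun (\<lambda>s. f (s - a))" if "test_fun f" for f :: "real \<Rightarrow> complex" and a
    using test_shift[OF that, of "- a"] by simp
  have main: "norm (W (\<lambda>s. \<rho> (s - (t + h))) - W (\<lambda>s. \<rho> (s - t)) + of_real h * W (\<lambda>s. dir_deriv 1 \<rho> (s - t))) \<le> C * (M * h\<^sup>2)"
    if h: "\<bar>h\<bar> \<le> 1" for h
  proof -
    let ?a = "\<lambda>s. \<rho> (s - (t + h))" and ?b = "\<lambda>s. \<rho> (s - t)" and ?c = "\<lambda>s. dir_deriv 1 \<rho> (s - t)"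
    let ?g = "\<lambda>s. (?a s - ?b s) + of_real h * ?c s"
    have t: "test_fun ?a" "test_fun (\<lambda>s. (-1) * ?b s)" "test_fun ?b" "test_fun ?c" "test_fun (\<lambda>s. of_real h * ?c s)"
      by (intro shift test_cmult \<rho> \<rho>')+
    have tab: "test_fun (\<lambda>s. ?a s - ?b s)" using test_add[OF t(1,2)] by simp
    have tg: "test_fun ?g" by (intro test_add tab t)
    have out: "\<rho> (s - a) = 0" "dir_deriv 1 \<rho> (s - a) = 0" if "s \<notin> ?K" "\<bar>a - t\<bar> \<le> 1" for s a
    proof -
      have "s - a \<notin> K" using that R(2)[of "s - a"] by auto
      then show "\<rho> (s - a) = 0" "dir_deriv 1 \<rho> (s - a) = 0"
        using K(2) supported_iterd[OF compact_imp_closed[OF K(1)] K(2), of "[1]"] by (auto simp: supported_in_def)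
    qed
    have sg: "supported_in ?g ?K"
      unfolding supported_in_def
    proof (intro allI impI)
      fix s assume s: "s \<notin> ?K"
      show "?g s = 0" using out(1)[OF s, of "t + h"] out[OF s, of t] h by simp
    qed
    have "bndw (\<lambda>_. 1) N ?g (M * h\<^sup>2)"
      unfolding bndw_def
    proof (intro allI impI)
      fix vs :: "real list" and s assume vs: "set vs \<subseteq> Basis" "length vs \<le> N"
      let ?r = "iterd vs \<rho>"
      have sh: "iterd vs (\<lambda>s. f (s - a)) = (\<lambda>s. iterd vs f (s - a))" for f :: "real \<Rightarrow> complex" and a
        using iterd_shift[of vs f "- a"] by simp
      \<comment> \<open>On the real line all entries of \<open>vs\<close> are 1, so an innermost
        derivative may be moved to the outside.\<close>
      have "vs @ [1] = 1 # vs"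
        using Basis_real_list[OF vs(1)] by (metis replicate_append_same)
      then have swap: "iterd vs (dir_deriv 1 \<rho>) = dir_deriv 1 ?r"
        by (metis iterd.simps(1,2) iterd_append)
      have "iterd vs ?g s = (?r (s - (t + h)) - ?r (s - t)) + of_real h * dir_deriv 1 ?r (s - t)"
        unfolding iterd_add[OF test_smooth[OF tab] test_smooth[OF t(5)] vs(1)]
          iterd_diff[OF test_smooth[OF t(1)] test_smooth[OF t(3)] vs(1)]
          iterd_cmult[OF test_smooth[OF t(4)] vs(1)] sh swap ..
      also have "\<dots> = ?r ((s - t) - h) - ?r (s - t) + of_real h * dir_deriv 1 ?r (s - t)"
        by (simp add: diff_diff_eq)
      finally have eq: "iterd vs ?g s = ?r ((s - t) - h) - ?r (s - t) + of_real h * dir_deriv 1 ?r (s - t)" .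
      have "bndw (\<lambda>_. 1) 2 ?r M"
        unfolding bndw_def
      proof (intro allI impI)
        fix us :: "real list" and y assume us: "set us \<subseteq> Basis" "length us \<le> 2"
        show "1 * norm (iterd us ?r y) \<le> M"
          using bndwD[OF M(2), of "us @ vs" y] us vs by (simp add: iterd_append)
      qed
      from taylor_translate[OF smooth_iterd[OF sm vs(1)] this]
      show "1 * norm (iterd vs ?g s) \<le> M * h\<^sup>2" unfolding eq by simp
    qed
    then have le: "norm (W ?g) \<le> C * (M * h\<^sup>2)" by (rule C(2)[OF tg sg])
    have add: "W (\<lambda>s. f s + g s) = W f + W g" if "test_fun f" "test_fun g" for f g
      using lin that unfolding lin_on_def by blast
    have cmult: "W (\<lambda>s. c * f s) = c * W f" if "test_fun f" for c f
      using lin that unfolding lin_on_def by blast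
    have diff: "W (\<lambda>s. f s - g s) = W f - W g" if "test_fun f" "test_fun g" for f g
      using add[OF that(1) test_cmult[OF that(2), of "-1"]] cmult[OF that(2), of "-1"] by simp
    show ?thesis
      using le unfolding add[OF tab t(5)] diff[OF t(1) t(3)] cmult[OF t(4)] .
  qed
  show ?thesis
    unfolding has_vector_derivative_def
  proof (rule has_derivativeI_sandwich[of 1])
    show "bounded_linear (\<lambda>x. x *\<^sub>R - W (\<lambda>s. dir_deriv 1 \<rho> (s - t)))" by (rule bounded_linear_scaleR_left)
    have "((\<lambda>y. C * M * \<bar>y - t\<bar>) \<longlongrightarrow> C * M * \<bar>t - t\<bar>) (at t)" by (intro tendsto_intros)
    then show "((\<lambda>y. C * M * \<bar>y - t\<bar>) \<longlongrightarrow> 0) (at t)" by simp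
    fix y assume y: "y \<noteq> t" "dist y t < 1"
    have "norm (W (\<lambda>s. \<rho> (s - y)) - W (\<lambda>s. \<rho> (s - t)) - (y - t) *\<^sub>R - W (\<lambda>s. dir_deriv 1 \<rho> (s - t))) \<le> C * (M * (y - t)\<^sup>2)"
    proof -
      have 1: "t + (y - t) = y" by simp
      have 2: "a - b - (y - t) *\<^sub>R - c = a - b + of_real (y - t) * c" for a b c :: complex
        by (simp only: scaleR_conv_of_real mult_minus_right diff_minus_eq_add)
      have "\<bar>y - t\<bar> \<le> 1" using y(2) by (simp add: dist_real_def)
      from main[OF this, unfolded 1] show ?thesis unfolding 2 .
    qed
    also have "\<dots> = (C * M * \<bar>y - t\<bar>) * norm (y - t)" 
    proof -
      have "(y - t)\<^sup>2 = \<bar>y - t\<bar> * \<bar>y - t\<bar>" by (simp add: power2_eq_square)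
      then show ?thesis by (simp only: real_norm_def mult.assoc)
    qed
    finally show "norm (W (\<lambda>s. \<rho> (s - y)) - W (\<lambda>s. \<rho> (s - t)) - (y - t) *\<^sub>R - W (\<lambda>s. dir_deriv 1 \<rho> (s - t))) / norm (y - t) \<le> C * M * \<bar>y - t\<bar>"
      using y by (simp add: divide_le_eq)
  qed simp
qed

section \<open>The symbol and the vanishing of solutions\<close>

definition mono_eval :: "('n::finite \<Rightarrow>\<^sub>0 nat) \<Rightarrow> complex^'n \<Rightarrow> complex" where
  "mono_eval \<alpha> \<xi> = (\<Prod>i\<in>UNIV. (\<xi>$i) ^ Poly_Mapping.lookup \<alpha> i)"

lemma mono_eval_add: "mono_eval (\<alpha> + \<beta>) \<xi> = mono_eval \<alpha> \<xi> * mono_eval \<beta> \<xi>"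
  by (simp add: mono_eval_def lookup_add power_add prod.distrib)

lemma mpoly_eval_superset:
  assumes "finite S" "Poly_Mapping.keys q \<subseteq> S"
  shows "mpoly_eval q \<xi> = (\<Sum>\<alpha>\<in>S. Poly_Mapping.lookup q \<alpha> * mono_eval \<alpha> \<xi>)"
  unfolding mpoly_eval_def mono_eval_def
  by (rule sum.mono_neutral_left) (use assms in \<open>auto simp: in_keys_iff\<close>)

lemma mpoly_eval_zero: "mpoly_eval 0 \<xi> = 0"
  by (simp add: mpoly_eval_def)

lemma mpoly_eval_add: "mpoly_eval (p + q) \<xi> = mpoly_eval p \<xi> + mpoly_eval q \<xi>"
proof -
  let ?S = "Poly_Mapping.keys p \<union> Poly_Mapping.keys q"
  have "Poly_Mapping.keys (p + q) \<subseteq> ?S" by (rule keys_add)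
  then show ?thesis
    by (simp add: mpoly_eval_superset[of ?S] lookup_add distrib_right sum.distrib)
qed

lemma mpoly_eval_sum: "mpoly_eval (\<Sum>i\<in>I. f i) \<xi> = (\<Sum>i\<in>I. mpoly_eval (f i) \<xi>)"
  by (induction I rule: infinite_finite_induct) (auto simp: mpoly_eval_zero mpoly_eval_add)

lemma mpoly_eval_single: "mpoly_eval (Poly_Mapping.single \<alpha> c) \<xi> = c * mono_eval \<alpha> \<xi>"
  by (subst mpoly_eval_superset[of "{\<alpha>}"]) auto

lemma poly_mapping_eq_sum_single:
  fixes q :: "'a \<Rightarrow>\<^sub>0 'b::comm_monoid_add"
  shows "q = (\<Sum>\<alpha>\<in>Poly_Mapping.keys q. Poly_Mapping.single \<alpha> (Poly_Mapping.lookup q \<alpha>))"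
proof (rule poly_mapping_eqI)
  fix k
  have "(\<Sum>\<alpha>\<in>Poly_Mapping.keys q. Poly_Mapping.lookup (Poly_Mapping.single \<alpha> (Poly_Mapping.lookup q \<alpha>)) k) =
      (\<Sum>\<alpha>\<in>Poly_Mapping.keys q. if k = \<alpha> then Poly_Mapping.lookup q \<alpha> else 0)"
    by (intro sum.cong refl) (auto simp: lookup_single when_def)
  also have "\<dots> = Poly_Mapping.lookup q k"
    by (simp add: in_keys_iff)
  finally show "Poly_Mapping.lookup q k = Poly_Mapping.lookup (\<Sum>\<alpha>\<in>Poly_Mapping.keys q. Poly_Mapping.single \<alpha> (Poly_Mapping.lookup q \<alpha>)) k"
    by (simp add: lookup_sum)
qed

lemma mpoly_eval_mult: "mpoly_eval (p * q) \<xi> = mpoly_eval p \<xi> * mpoly_eval q \<xi>"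
proof -
  have "p * q = (\<Sum>\<alpha>\<in>Poly_Mapping.keys p. Poly_Mapping.single \<alpha> (Poly_Mapping.lookup p \<alpha>)) *
      (\<Sum>\<beta>\<in>Poly_Mapping.keys q. Poly_Mapping.single \<beta> (Poly_Mapping.lookup q \<beta>))"
    using poly_mapping_eq_sum_single[of p] poly_mapping_eq_sum_single[of q] by simp
  also have "\<dots> = (\<Sum>\<alpha>\<in>Poly_Mapping.keys p. \<Sum>\<beta>\<in>Poly_Mapping.keys q.
      Poly_Mapping.single (\<alpha> + \<beta>) (Poly_Mapping.lookup p \<alpha> * Poly_Mapping.lookup q \<beta>))"
    by (simp add: sum_product mult_single)
  finally have "mpoly_eval (p * q) \<xi> = (\<Sum>\<alpha>\<in>Poly_Mapping.keys p. \<Sum>\<beta>\<in>Poly_Mapping.keys q.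
      (Poly_Mapping.lookup p \<alpha> * Poly_Mapping.lookup q \<beta>) * mono_eval (\<alpha> + \<beta>) \<xi>)"
    by (simp add: mpoly_eval_sum mpoly_eval_single)
  also have "\<dots> = mpoly_eval p \<xi> * mpoly_eval q \<xi>"
    unfolding mpoly_eval_superset[OF finite_keys order_refl] sum_product
    by (simp add: mono_eval_add mult_ac)
  finally show ?thesis .
qed

text \<open>Evaluation is a ring homomorphism, so the common zeros of an ideal are those of its
  generators, here the coefficients of \<open>p\<close>.\<close>

lemma variety_CX: "\<xi> \<in> variety (CX p) \<longleftrightarrow> (\<forall>j. mpoly_eval (Poly_Mapping.lookup p j) \<xi> = 0)"
proof
  assume \<xi>: "\<xi> \<in> variety (CX p)"
  have "Poly_Mapping.lookup p j \<in> CX p" for j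
    unfolding CX_def gen_ideal_def
    by (intro CollectI exI[of _ "{Poly_Mapping.lookup p j}"] exI[of _ "\<lambda>_. 1"]) auto
  then show "\<forall>j. mpoly_eval (Poly_Mapping.lookup p j) \<xi> = 0" using \<xi> by (auto simp: variety_def)
next
  assume *: "\<forall>j. mpoly_eval (Poly_Mapping.lookup p j) \<xi> = 0"
  show "\<xi> \<in> variety (CX p)"
    unfolding variety_def CX_def gen_ideal_def
  proof (intro CollectI ballI)
    fix q assume "q \<in> {s. \<exists>F r. finite F \<and> F \<subseteq> range (Poly_Mapping.lookup p) \<and> s = (\<Sum>a\<in>F. r a * a)}"
    then obtain F r where F: "F \<subseteq> range (Poly_Mapping.lookup p)" "q = (\<Sum>a\<in>F. r a * a)" by blast
    have "mpoly_eval a \<xi> = 0" if "a \<in> F" for a using F(1) * that by blast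
    then show "mpoly_eval q \<xi> = 0" unfolding F(2) by (simp add: mpoly_eval_sum mpoly_eval_mult)
  qed
qed

definition mono_list :: "('n::finite \<Rightarrow>\<^sub>0 nat) \<Rightarrow> (real^'n) list" where
  "mono_list \<alpha> = concat (map (\<lambda>i. replicate (Poly_Mapping.lookup \<alpha> i) (axis i 1)) enum_idx)"

lemma enum_idx: "distinct (enum_idx :: 'n::finite list)" "set (enum_idx :: 'n list) = UNIV"
proof -
  have "\<exists>xs :: 'n list. distinct xs \<and> set xs = UNIV" using finite_distinct_list[of "UNIV :: 'n set"] by auto
  from someI_ex[OF this] show "distinct (enum_idx :: 'n list)" "set (enum_idx :: 'n list) = UNIV"
    unfolding enum_idx_def by auto
qed

lemma mono_list_Basis: "set (mono_list \<alpha>) \<subseteq> Basis"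
  by (auto simp: mono_list_def axis_in_Basis_iff)

lemma prod_mono_list:
  fixes z :: "real^'n::finite \<Rightarrow> complex"
  shows "prod_list (map z (mono_list \<alpha>)) = (\<Prod>i\<in>UNIV. z (axis i 1) ^ Poly_Mapping.lookup \<alpha> i)"
proof -
  have "prod_list (map z (concat (map (\<lambda>i. replicate (Poly_Mapping.lookup \<alpha> i) (axis i 1)) xs))) =
      prod_list (map (\<lambda>i. z (axis i 1) ^ Poly_Mapping.lookup \<alpha> i) xs)" for xs
    by (induction xs) (auto simp: prod_list_replicate)
  moreover have "prod_list (map g enum_idx) = prod g UNIV" for g :: "'n \<Rightarrow> complex"
    using prod.distinct_set_conv_list[OF enum_idx(1), of g] by (simp add: enum_idx(2))
  ultimately show ?thesis unfolding mono_list_def by presburger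
qed

lemma mono_dirs_eq: "mono_dirs \<alpha> j = map (Pair 0) (replicate j 1) @ map (\<lambda>x. (x, 0)) (mono_list \<alpha>)"
  by (simp add: mono_dirs_def mono_list_def tdir_def xdir_def[abs_def] map_concat o_def)

lemma prod_list_neg: "(-1) ^ length xs * prod_list (map z xs) = prod_list (map (\<lambda>b. - z b) (xs :: 'a list) :: complex list)"
  by (induction xs) auto

text \<open>The sign \<open>(-1) ^ length\<close> comes from transposing the derivatives onto the
  test function; together with the factors \<open>\<i> * (\<xi> \<bullet> b)\<close> of the
  transform it turns the point of evaluation into \<open>- \<i> \<xi>\<close>.\<close>

definition symbol :: "(('n::finite \<Rightarrow>\<^sub>0 nat) \<Rightarrow>\<^sub>0 complex) \<Rightarrow> real^'n \<Rightarrow> complex" where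
  "symbol q \<xi> = (\<Sum>\<alpha>\<in>Poly_Mapping.keys q. Poly_Mapping.lookup q \<alpha> * ((-1) ^ length (mono_list \<alpha>) *
     prod_list (map (\<lambda>b. \<i> * of_real (\<xi> \<bullet> b)) (mono_list \<alpha>))))"

lemma symbol_eq: "symbol q \<xi> = mpoly_eval q (\<chi> i. \<i> * of_real ((- \<xi>) $ i))"
  unfolding symbol_def mpoly_eval_def prod_list_neg
  unfolding prod_mono_list
  by (simp add: inner_axis)

lemma foldr_mulx: "foldr mulx xs \<theta> \<xi> = prod_list (map (\<lambda>b. \<i> * of_real (\<xi> \<bullet> b)) xs) * \<theta> \<xi>"
  by (induction xs) (auto simp: mulx_def mult.assoc)

lemma smooth_prod_list: "smooth_fun (\<lambda>\<xi>. prod_list (map (\<lambda>b. \<i> * complex_of_real (\<xi> \<bullet> b)) xs))"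
  by (induction xs) (auto intro!: smooth_mult mulx_smooth_factor simp: smooth_const)

lemma smooth_symbol: "smooth_fun (symbol q)"
  unfolding symbol_def[abs_def] by (intro smooth_sum smooth_cmult smooth_prod_list)

text \<open>Here \<open>w \<phi> = u \<phi> \<circ> fourier\<close> is the partial Fourier transform of \<open>u\<close>.\<close>

lemma NS_LDS_vanish:
  fixes p :: "nat \<Rightarrow>\<^sub>0 (('n::finite \<Rightarrow>\<^sub>0 nat) \<Rightarrow>\<^sub>0 complex)"
  assumes U: "U \<in> NS LDS p" and nz: "variety (CX p) \<inter> imag_axis_space = {}" and \<Phi>: "test_fun \<Phi>"
  shows "U \<Phi> = 0"
proof -
  from U have dist: "distribution U" and Dp: "\<And>\<Phi>. test_fun \<Phi> \<Longrightarrow> Dp p U \<Phi> = 0"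
    and past: "\<And>\<Phi> K. test_fun \<Phi> \<Longrightarrow> compact K \<Longrightarrow> K \<subseteq> {(x, t). t < 0} \<Longrightarrow> supported_in \<Phi> K \<Longrightarrow> U \<Phi> = 0"
    by (auto simp: NS_def LDS_def)
  from U obtain u where u: "\<forall>\<phi>. test_fun \<phi> \<longrightarrow> tempered (u \<phi>)"
    "\<forall>\<phi>1 \<phi>2 c \<psi>. test_fun \<phi>1 \<longrightarrow> test_fun \<phi>2 \<longrightarrow> schwartz_fun \<psi> \<longrightarrow>
            u (\<lambda>t. \<phi>1 t + \<phi>2 t) \<psi> = u \<phi>1 \<psi> + u \<phi>2 \<psi> \<and> u (\<lambda>t. c * \<phi>1 t) \<psi> = c * u \<phi>1 \<psi>"
    "\<forall>\<psi>. schwartz_fun \<psi> \<longrightarrow> distribution (\<lambda>\<phi>. u \<phi> \<psi>)"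
    "\<forall>\<phi> \<psi>. test_fun \<phi> \<longrightarrow> test_fun \<psi> \<longrightarrow> U (\<lambda>(x, t). \<phi> t * \<psi> x) = u \<phi> \<psi>"
    unfolding NS_def LDS_def by blast
  have sc: "schwartz_cont (u \<phi>)" if "test_fun \<phi>" for \<phi> using u(1) that tempered_schwartz_cont by blast
  have tensor: "U (\<lambda>(x, t). \<phi> t * \<psi> x) = u \<phi> \<psi>" if "test_fun \<phi>" "test_fun \<psi>" for \<phi> \<psi> using u(4) that by blast
  define d where "d j \<phi> = iterd (replicate j 1) \<phi>" for j and \<phi> :: "real \<Rightarrow> complex"
  have d_test: "test_fun (d j \<phi>)" if "test_fun \<phi>" for j \<phi>
    unfolding d_def by (rule test_iterd[OF that]) auto
  let ?c = "\<lambda>j \<alpha>. Poly_Mapping.lookup (Poly_Mapping.lookup p j) \<alpha> * (-1) ^ (j + length (mono_list \<alpha>))"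
  \<comment> \<open>The equation is at first known on tensor products of test functions; density
    extends it to Schwartz \<open>\<psi>\<close>, since transforms of test functions need not have
    compact support.\<close>
  have eqn: "(\<Sum>j\<in>Poly_Mapping.keys p. \<Sum>\<alpha>\<in>Poly_Mapping.keys (Poly_Mapping.lookup p j).
      ?c j \<alpha> * u (d j \<phi>) (iterd (mono_list \<alpha>) \<psi>)) = 0"
    if \<phi>: "test_fun \<phi>" and \<psi>: "schwartz_fun \<psi>" for \<phi> \<psi>
  proof (rule schwartz_cont_ext[OF _ _ \<psi>])
    show "schwartz_cont (\<lambda>\<psi>. \<Sum>j\<in>Poly_Mapping.keys p. \<Sum>\<alpha>\<in>Poly_Mapping.keys (Poly_Mapping.lookup p j).
        ?c j \<alpha> * u (d j \<phi>) (iterd (mono_list \<alpha>) \<psi>))"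
      by (intro schwartz_cont_sum schwartz_cont_cmult schwartz_cont_iterd sc d_test \<phi> finite_keys mono_list_Basis)
    fix \<psi> :: "real^'n \<Rightarrow> complex" assume \<psi>: "test_fun \<psi>"
    have it: "iterd (mono_dirs \<alpha> j) (\<lambda>(x, t). \<phi> t * \<psi> x) = (\<lambda>(x, t). d j \<phi> t * iterd (mono_list \<alpha>) \<psi> x)" for \<alpha> j
      unfolding mono_dirs_eq d_def
      by (rule iterd_tensor[OF test_smooth[OF \<psi>] test_smooth[OF \<phi>] mono_list_Basis]) auto
    have len: "length (mono_dirs \<alpha> j) = j + length (mono_list \<alpha>)" for \<alpha> :: "'n \<Rightarrow>\<^sub>0 nat" and j
      by (simp add: mono_dirs_eq)
    have "U (iterd (mono_dirs \<alpha> j) (\<lambda>(x, t). \<phi> t * \<psi> x)) = u (d j \<phi>) (iterd (mono_list \<alpha>) \<psi>)" for \<alpha> j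
      unfolding it by (rule tensor[OF d_test[OF \<phi>] test_iterd[OF \<psi> mono_list_Basis]])
    then show "(\<Sum>j\<in>Poly_Mapping.keys p. \<Sum>\<alpha>\<in>Poly_Mapping.keys (Poly_Mapping.lookup p j).
        ?c j \<alpha> * u (d j \<phi>) (iterd (mono_list \<alpha>) \<psi>)) = 0"
      using Dp[OF test_tensor[OF \<phi> \<psi>]] by (simp add: Dp_def len)
  qed
  define w where "w \<phi> \<theta> = u \<phi> (fourier \<theta>)" for \<phi> and \<theta> :: "real^'n \<Rightarrow> complex"
  have w_lin: "lin_on test_fun (w \<phi>)" if "test_fun \<phi>" for \<phi>
  proof -
    have lin: "lin_on schwartz_fun (u \<phi>)" using sc[OF that] by (simp add: schwartz_cont_def)
    have "fourier (\<lambda>x. f x + g x) = (\<lambda>y. fourier f y + fourier g y)" if "test_fun f" "test_fun g" for f g :: "real^'n \<Rightarrow> complex"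
      using fourier_add[OF test_cc test_cc] that by blast
    moreover have "fourier (\<lambda>x. c * f x) = (\<lambda>y. c * fourier f y)" for c and f :: "real^'n \<Rightarrow> complex"
      using fourier_cmult by blast
    ultimately show ?thesis
      unfolding lin_on_def w_def by (simp add: lin_onD[OF lin] fourier_schwartz)
  qed
  define A where "A j = symbol (Poly_Mapping.lookup p j)" for j
  have A: "smooth_fun (A j)" for j unfolding A_def by (rule smooth_symbol)
  obtain n where n: "Poly_Mapping.keys p \<subseteq> {..n}"
    using finite_nat_iff_bounded_le[THEN iffD1, OF finite_keys[of p]] by blast
  \<comment> \<open>Applied at the point \<open>- \<i> \<xi>\<close>, the hypothesis yields a
    coefficient that does not vanish there.\<close>
  have A_nz: "\<exists>j\<le>n. A j \<xi> \<noteq> 0" for \<xi>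
  proof -
    have "(\<chi> i. \<i> * of_real ((- \<xi>) $ i)) \<in> imag_axis_space" unfolding imag_axis_space_def by blast
    then have "(\<chi> i. \<i> * of_real ((- \<xi>) $ i)) \<notin> variety (CX p)" using nz by blast
    then obtain j where j: "A j \<xi> \<noteq> 0" unfolding variety_CX A_def symbol_eq by blast
    then have "j \<in> Poly_Mapping.keys p" by (auto simp: A_def in_keys_iff symbol_def)
    then show ?thesis using j n by blast
  qed
  \<comment> \<open>On the Fourier side the space derivatives become the multipliers
    \<open>A j\<close>, and only time derivatives are left. They still act on the test function,
    whence \<open>(-1) ^ j\<close>.\<close>
  have w_eqn: "(\<Sum>j\<le>n. (-1) ^ j * w (d j \<phi>) (\<lambda>\<xi>. A j \<xi> * \<theta> \<xi>)) = 0" if \<phi>: "test_fun \<phi>" and \<theta>: "test_fun \<theta>" for \<phi> \<theta>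
  proof -
    have wA: "w (d j \<phi>) (\<lambda>\<xi>. A j \<xi> * \<theta> \<xi>) = (\<Sum>\<alpha>\<in>Poly_Mapping.keys (Poly_Mapping.lookup p j).
        (Poly_Mapping.lookup (Poly_Mapping.lookup p j) \<alpha> * (-1) ^ length (mono_list \<alpha>)) * u (d j \<phi>) (iterd (mono_list \<alpha>) (fourier \<theta>)))" for j
    proof -
      obtain L where L: "DK L \<theta>" "compact L" using \<theta> by (auto simp: DK_def test_fun_def)
      have lin: "lin_on (DK L) (w (d j \<phi>))"
        using w_lin[OF d_test[OF \<phi>]] DK_test[OF L(2)] unfolding lin_on_def by blast
      let ?q = "Poly_Mapping.lookup p j"
      have "(\<lambda>\<xi>. A j \<xi> * \<theta> \<xi>) = (\<lambda>\<xi>. \<Sum>\<alpha>\<in>Poly_Mapping.keys ?q.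
          (Poly_Mapping.lookup ?q \<alpha> * (-1) ^ length (mono_list \<alpha>)) * foldr mulx (mono_list \<alpha>) \<theta> \<xi>)"
        by (simp add: A_def symbol_def sum_distrib_right foldr_mulx mult.assoc)
      then have "w (d j \<phi>) (\<lambda>\<xi>. A j \<xi> * \<theta> \<xi>) = w (d j \<phi>) (\<lambda>\<xi>. \<Sum>\<alpha>\<in>Poly_Mapping.keys ?q.
          (Poly_Mapping.lookup ?q \<alpha> * (-1) ^ length (mono_list \<alpha>)) * foldr mulx (mono_list \<alpha>) \<theta> \<xi>)"
        by simp
      also have "\<dots> = (\<Sum>\<alpha>\<in>Poly_Mapping.keys ?q.
          w (d j \<phi>) (\<lambda>\<xi>. (Poly_Mapping.lookup ?q \<alpha> * (-1) ^ length (mono_list \<alpha>)) * foldr mulx (mono_list \<alpha>) \<theta> \<xi>))"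
        by (rule lin_on_sum[OF lin finite_keys]) (rule DK_cmult[OF DK_mulxs[OF L(1)]])
      also have "\<dots> = (\<Sum>\<alpha>\<in>Poly_Mapping.keys ?q.
          (Poly_Mapping.lookup ?q \<alpha> * (-1) ^ length (mono_list \<alpha>)) * w (d j \<phi>) (foldr mulx (mono_list \<alpha>) \<theta>))"
      proof (rule sum.cong[OF refl])
        have cm: "w (d j \<phi>) (\<lambda>\<xi>. c * f \<xi>) = c * w (d j \<phi>) f" if "DK L f" for c f
          using lin that unfolding lin_on_def by blast
        show "w (d j \<phi>) (\<lambda>\<xi>. (Poly_Mapping.lookup ?q \<alpha> * (-1) ^ length (mono_list \<alpha>)) * foldr mulx (mono_list \<alpha>) \<theta> \<xi>) =
          (Poly_Mapping.lookup ?q \<alpha> * (-1) ^ length (mono_list \<alpha>)) * w (d j \<phi>) (foldr mulx (mono_list \<alpha>) \<theta>)" for \<alpha>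
          by (rule cm[OF DK_mulxs[OF L(1)]])
      qed
      finally show ?thesis by (simp add: w_def iterd_fourier[OF \<theta>])
    qed
    have "(\<Sum>j\<le>n. (-1) ^ j * w (d j \<phi>) (\<lambda>\<xi>. A j \<xi> * \<theta> \<xi>)) =
       (\<Sum>j\<in>Poly_Mapping.keys p. (-1) ^ j * w (d j \<phi>) (\<lambda>\<xi>. A j \<xi> * \<theta> \<xi>))"
    proof (rule sum.mono_neutral_right[OF finite_atMost n], intro ballI)
      fix j assume "j \<in> {..n} - Poly_Mapping.keys p"
      then have "Poly_Mapping.lookup p j = 0" by (simp add: in_keys_iff)
      then show "(-1) ^ j * w (d j \<phi>) (\<lambda>\<xi>. A j \<xi> * \<theta> \<xi>) = 0" unfolding wA by simp
    qed
    also have "\<dots> = (\<Sum>j\<in>Poly_Mapping.keys p. \<Sum>\<alpha>\<in>Poly_Mapping.keys (Poly_Mapping.lookup p j).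
        ?c j \<alpha> * u (d j \<phi>) (iterd (mono_list \<alpha>) (fourier \<theta>)))"
      unfolding wA by (simp add: sum_distrib_left power_add mult_ac)
    also have "\<dots> = 0" by (rule eqn[OF \<phi> fourier_schwartz[OF \<theta>]])
    finally show ?thesis .
  qed
  have w_zero: "w \<rho> \<theta> = 0" if \<rho>: "test_fun \<rho>" and \<theta>: "test_fun \<theta>" for \<rho> \<theta>
  proof -
    obtain K where K: "compact K" "supported_in \<rho> K" using \<rho> by (auto simp: test_fun_def)
    obtain R where R: "0 < R" "\<And>y. y \<in> K \<Longrightarrow> \<bar>y\<bar> \<le> R"
      using compact_imp_bounded[OF K(1)] unfolding bounded_pos by auto
    obtain L where L: "compact L" "DK L \<theta>" using \<theta> by (auto simp: test_fun_def DK_def)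
    \<comment> \<open>Translating \<open>\<rho>\<close> in time turns the dependence on a test
      function into a smooth dependence on \<open>t\<close>.\<close>
    define \<tau> where "\<tau> i t = (\<lambda>s. d i \<rho> (s - t))" for i and t :: real
    have \<tau>: "test_fun (\<tau> i t)" for i t
      unfolding \<tau>_def using test_shift[OF d_test[OF \<rho>], of i "- t"] by simp
    have d\<tau>: "d j (\<tau> i t) = \<tau> (i + j) t" for i j t
      unfolding d_def \<tau>_def using iterd_shift[of "replicate j 1" "iterd (replicate i 1) \<rho>" "- t"]
      by (simp add: replicate_add add.commute[of i j] iterd_append)
    \<comment> \<open>Differentiating a translate in \<open>t\<close> produces a minus sign; the
      factor \<open>(-1) ^ i\<close> compensates it, so that \<open>F (Suc i)\<close> is the
      derivative of \<open>F i\<close> and the signs in the relation cancel.\<close>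
    define F where "F i t \<theta> = (-1) ^ i * w (\<tau> i t) \<theta>" for i t and \<theta> :: "real^'n \<Rightarrow> complex"
    \<comment> \<open>As \<open>\<rho>\<close> is supported in \<open>{- R..R}\<close>, for
      \<open>t\<close> up to this value the translate lives at negative times; the extra 1 keeps its
      support strictly away from 0.\<close>
    define t0 where "t0 = - R - 1"
    have F_lin: "lin_on (DK L) (F i t)" for i t
      unfolding lin_on_def F_def
      by (auto simp: lin_onD[OF w_lin[OF \<tau>]] DK_test[OF L(1)] distrib_left)
    have F_der: "((\<lambda>t. F i t g) has_vector_derivative F (Suc i) t g) (at t)" if g: "DK L g" for i t g
    proof -
      have "distribution (\<lambda>\<phi>. u \<phi> (fourier g))" using u(3) fourier_schwartz[OF DK_test[OF L(1) g]] by blast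
      from distribution_translate_deriv[OF this d_test[OF \<rho>, of i], of t]
      have "((\<lambda>t. w (\<tau> i t) g) has_vector_derivative - w (\<tau> (Suc i) t) g) (at t)"
        by (simp add: w_def \<tau>_def d_def)
      from has_vector_derivative_mult_right[OF this, of "(-1) ^ i"]
      show ?thesis by (simp add: F_def)
    qed
    have F_past: "F i t g = 0" if "t \<le> t0" "DK L g" for i t g
    proof -
      have "u (\<tau> i t) (fourier g) = 0"
      proof (rule schwartz_cont_ext[OF sc[OF \<tau>] _ fourier_schwartz[OF DK_test[OF L(1) that(2)]]])
        fix \<psi> :: "real^'n \<Rightarrow> complex" assume \<psi>: "test_fun \<psi>"
        obtain M where M: "compact M" "supported_in \<psi> M" using \<psi> by (auto simp: test_fun_def)
        have "U (\<lambda>(x, s). \<tau> i t s * \<psi> x) = 0"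
        proof (rule past[OF test_tensor[OF \<tau> \<psi>]])
          show "compact (M \<times> {t - R..t + R})" by (intro compact_Times M compact_Icc)
          show "M \<times> {t - R..t + R} \<subseteq> {(x, t). t < 0}" using that(1) by (auto simp: t0_def)
          have "\<tau> i t s = 0" if "s \<notin> {t - R..t + R}" for s
          proof -
            have "s - t \<notin> K" using that R(2)[of "s - t"] by auto
            then show ?thesis
              using supported_iterd[OF compact_imp_closed[OF K(1)] K(2), of "replicate i 1"]
              by (simp add: \<tau>_def d_def supported_in_def)
          qed
          then show "supported_in (\<lambda>(x, s). \<tau> i t s * \<psi> x) (M \<times> {t - R..t + R})"
            using M(2) by (auto simp: supported_in_def)
        qed
        then show "u (\<tau> i t) \<psi> = 0" using tensor[OF \<tau> \<psi>] by simp
      qed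
      then show ?thesis by (simp add: F_def w_def)
    qed
    have F_ord: "\<exists>C\<ge>0. \<exists>N. \<forall>g B. DK L g \<longrightarrow> bndw (\<lambda>_. 1) N g B \<longrightarrow> norm (F i t g) \<le> C * B" for i t
    proof -
      obtain C N where C: "0 \<le> C" "\<And>f B. schwartz_fun f \<Longrightarrow> bndw (sw N) N f B \<Longrightarrow> norm (u (\<tau> i t) f) \<le> C * B"
        using schwartz_contD[OF sc[OF \<tau>]] by blast
      obtain V where V: "0 \<le> V" "\<And>g D. DK L g \<Longrightarrow> bndw (\<lambda>_. 1) N g D \<Longrightarrow> bndw (sw N) N (fourier g) (V * D)"
        using fourier_bndw[OF L(1)] by blast
      have "norm (F i t g) \<le> (C * V) * B" if "DK L g" "bndw (\<lambda>_. 1) N g B" for g B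
        using C(2)[OF fourier_schwartz[OF DK_test[OF L(1) that(1)]] V(2)[OF that]]
        by (simp add: F_def w_def norm_mult norm_power mult.assoc)
      then show ?thesis using C(1) V(1) by (intro exI[of _ "C * V"]) auto
    qed
    \<comment> \<open>The order of \<open>F i t\<close> may vary with \<open>t\<close>; boundedness
      in \<open>t\<close> for each \<open>g\<close>, from continuity on a compact interval, makes
      order and constant uniform. The interval ends at 1 because the conclusion is drawn at time 0,
      which must lie below \<open>T\<close>.\<close>
    have "\<exists>C\<ge>0. \<exists>N. \<forall>a\<in>{..2 * n} \<times> {t0..1}. \<forall>g B. DK L g \<longrightarrow> bndw (\<lambda>_. 1) N g B \<longrightarrow>
        norm ((\<lambda>(i, t). F i t) a g) \<le> C * B"
    proof (rule DK_uniform_boundedness[OF compact_imp_closed[OF L(1)]])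
      show "lin_on (DK L) ((\<lambda>(i, t). F i t) a)" for a by (cases a) (simp add: F_lin)
      show "\<exists>C\<ge>0. \<exists>N. \<forall>g B. DK L g \<longrightarrow> bndw (\<lambda>_. 1) N g B \<longrightarrow> norm ((\<lambda>(i, t). F i t) a g) \<le> C * B" for a
      proof (cases a)
        case (Pair i t)
        then show ?thesis using F_ord[of i t] by (simp only: prod.case)
      qed
      fix g assume g: "DK L g"
      have "\<exists>M. \<forall>t\<in>{t0..1}. norm (F i t g) \<le> M" for i
      proof -
        have "continuous_on {t0..1} (\<lambda>t. F i t g)"
          using has_vector_derivative_continuous[OF F_der[OF g]] by (simp add: continuous_at_imp_continuous_on)
        then have "compact ((\<lambda>t. F i t g) ` {t0..1})" by (rule compact_continuous_image) simp
        from compact_imp_bounded[OF this] show ?thesis unfolding bounded_iff by auto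
      qed
      then obtain M where M: "\<And>i t. t \<in> {t0..1} \<Longrightarrow> norm (F i t g) \<le> M i" by metis
      have "norm (F i t g) \<le> (\<Sum>i\<le>2 * n. \<bar>M i\<bar>)" if "i \<le> 2 * n" "t \<in> {t0..1}" for i t
      proof -
        have "norm (F i t g) \<le> \<bar>M i\<bar>" using M[OF that(2)] order_trans abs_ge_self by blast
        also have "\<dots> \<le> (\<Sum>i\<le>2 * n. \<bar>M i\<bar>)" using that by (intro member_le_sum) auto
        finally show ?thesis .
      qed
      then show "\<exists>M. \<forall>a\<in>{..2 * n} \<times> {t0..1}. norm ((\<lambda>(i, t). F i t) a g) \<le> M"
        by (intro exI[of _ "\<Sum>i\<le>2 * n. \<bar>M i\<bar>"]) auto
    qed
    then obtain C N where C: "0 \<le> C" "\<forall>a\<in>{..2 * n} \<times> {t0..1}. \<forall>g B. DK L g \<longrightarrow> bndw (\<lambda>_. 1) N g B \<longrightarrow>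
        norm ((\<lambda>(i, t). F i t) a g) \<le> C * B" by blast
    have bd: "norm (F i t g) \<le> C * B" if "i \<le> 2 * n" "t \<in> {t0..1}" "DK L g" "bndw (\<lambda>_. 1) N g B" for i t g B
      using C(2)[rule_format, of "(i, t)" g B] that by simp
    have fam: "causal_family L t0 1 N (2 * n) F"
      unfolding causal_family_def
    proof (intro conjI allI impI F_lin F_der F_past)
      show "\<exists>C\<ge>0. \<forall>i\<le>2 * n. \<forall>t<1. \<forall>g B. DK L g \<longrightarrow> bndw (\<lambda>_. 1) N g B \<longrightarrow> norm (F i t g) \<le> C * B"
      proof (intro exI[of _ C] conjI allI impI C(1))
        fix i t g B assume a: "i \<le> 2 * n" "t < (1::real)" "DK L g" "bndw (\<lambda>_. 1) N g B"
        show "norm (F i t g) \<le> C * B"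
        proof (cases "t \<le> t0")
          case True
          then show ?thesis using F_past[OF True a(3)] C(1) bndw_nonneg[OF a(4)] by simp
        next
          case False
          then show ?thesis using a by (intro bd) auto
        qed
      qed
    qed
    \<comment> \<open>At index 0 and time 0 the family gives back
      \<open>w \<rho> \<theta>\<close>.\<close>
    have "F 0 0 \<theta> = 0"
    proof (rule causal_family_zero[OF fam L(1) A A_nz _ _ _ L(2)])
      fix i t g assume "DK L g"
      have "(\<Sum>j\<le>n. F (i + j) t (\<lambda>x. A j x * g x)) = (-1) ^ i * (\<Sum>j\<le>n. (-1) ^ j * w (d j (\<tau> i t)) (\<lambda>x. A j x * g x))"
        by (simp add: F_def d\<tau> power_add sum_distrib_left mult.assoc)
      then show "(\<Sum>j\<le>n. F (i + j) t (\<lambda>x. A j x * g x)) = 0"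
        using w_eqn[OF \<tau> DK_test[OF L(1) \<open>DK L g\<close>]] by simp
    qed auto
    then show ?thesis by (simp add: F_def \<tau>_def d_def)
  qed
  show ?thesis
  proof (rule distribution_tensor_zero[OF dist _ \<Phi>])
    fix \<phi> :: "real \<Rightarrow> complex" and \<psi> :: "real^'n \<Rightarrow> complex" assume t: "test_fun \<phi>" "test_fun \<psi>"
    have "u \<phi> \<psi> = 0"
      by (rule schwartz_cont_fourier[OF sc[OF t(1)] _ t(2)]) (use w_zero[OF t(1)] in \<open>simp add: w_def\<close>)
    then show "U (\<lambda>(x, t). \<phi> t * \<psi> x) = 0" using tensor[OF t] by simp
  qed
qed

section \<open>Plane waves\<close>

lemma inverse_quadratic_integrable: "(\<integral>\<^sup>+x. ennreal (1 / (1 + x\<^sup>2)) \<partial>lborel) < \<infinity>"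
proof -
  let ?f = "\<lambda>x::real. 1 / (1 + x\<^sup>2)"
  have pos: "1 + x\<^sup>2 \<noteq> 0" for x :: real by (smt (verit) zero_le_power2)
  have half: "(\<integral>\<^sup>+x. ennreal (?f x) * indicator {0..} x \<partial>lborel) < \<infinity>"
  proof -
    have "(\<integral>\<^sup>+x. ennreal (?f x) * indicator {0..} x \<partial>lborel) = ennreal (pi / 2 - arctan 0)"
    proof (rule nn_integral_FTC_atLeast)
      show "(arctan has_real_derivative ?f x) (at x)" for x
        using DERIV_arctan[of x] by (simp add: inverse_eq_divide)
      show "(arctan \<longlongrightarrow> pi / 2) at_top" by (rule tendsto_arctan_at_top)
    qed auto
    then show ?thesis by simp
  qed
  have reflect: "(\<integral>\<^sup>+x. ennreal (?f x) * indicator {..0} x \<partial>lborel) = (\<integral>\<^sup>+x. ennreal (?f x) * indicator {0..} x \<partial>lborel)"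
    by (subst nn_integral_real_affine[where c="-1" and t=0]) (auto intro!: nn_integral_cong simp: indicator_def)
  have "(\<integral>\<^sup>+x. ennreal (?f x) \<partial>lborel) \<le>
      (\<integral>\<^sup>+x. ennreal (?f x) * indicator {0..} x + ennreal (?f x) * indicator {..0} x \<partial>lborel)"
    by (intro nn_integral_mono) (auto simp: indicator_def)
  also have "\<dots> = (\<integral>\<^sup>+x. ennreal (?f x) * indicator {0..} x \<partial>lborel) + (\<integral>\<^sup>+x. ennreal (?f x) * indicator {..0} x \<partial>lborel)"
    by (rule nn_integral_add) auto
  also have "\<dots> < \<infinity>" unfolding reflect using half by (simp add: ennreal_add_less_top)
  finally show ?thesis .
qed

text \<open>The exponent provides a factor \<open>(1 + norm x) ^ 2\<close> for each coordinate,
  which dominates \<open>1 + (x \<bullet> b) ^ 2\<close>; the product of the one-dimensional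
  arctangent integrals is finite.\<close>

lemma schwartz_weight_integrable: "(\<lambda>x::'a::euclidean_space. 1 / sw (2 * DIM('a)) x) integrable_on UNIV"
proof -
  let ?g = "\<lambda>x::'a. 1 / sw (2 * DIM('a)) x"
  have le: "?g x \<le> (\<Prod>b\<in>Basis. 1 / (1 + (x \<bullet> b)\<^sup>2))" for x
  proof -
    have "(\<Prod>b\<in>(Basis::'a set). 1 / (1 + norm x)\<^sup>2) \<le> (\<Prod>b\<in>Basis. 1 / (1 + (x \<bullet> b)\<^sup>2))"
    proof (intro prod_mono conjI)
      fix b :: 'a assume b: "b \<in> Basis"
      have "(x \<bullet> b)\<^sup>2 \<le> (norm x)\<^sup>2" using Basis_le_norm[OF b, of x] by (metis abs_le_square_iff abs_norm_cancel)
      moreover have "(1 + norm x)\<^sup>2 = 1 + 2 * norm x + (norm x)\<^sup>2" by (simp add: power2_sum)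
      ultimately have "1 + (x \<bullet> b)\<^sup>2 \<le> (1 + norm x)\<^sup>2" using norm_ge_zero[of x] by linarith
      moreover have "0 < 1 + (x \<bullet> b)\<^sup>2" by (simp add: add_pos_nonneg)
      ultimately show "1 / (1 + norm x)\<^sup>2 \<le> 1 / (1 + (x \<bullet> b)\<^sup>2)" by (intro frac_le) auto
    qed auto
    then show ?thesis by (simp add: power_mult power_one_over)
  qed
  have meas: "?g \<in> borel_measurable lborel" by simp
  have "(\<integral>\<^sup>+x. ennreal (?g x) \<partial>lborel) \<le> (\<integral>\<^sup>+x. (\<Prod>b\<in>(Basis::'a set). ennreal (1 / (1 + (x \<bullet> b)\<^sup>2))) \<partial>lborel)"
    by (intro nn_integral_mono) (subst prod_ennreal, auto intro!: ennreal_leI le)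
  also have "\<dots> = (\<Prod>b\<in>(Basis::'a set). (\<integral>\<^sup>+x. ennreal (1 / (1 + x\<^sup>2)) \<partial>lborel))"
    by (rule nn_integral_lborel_prod) auto
  also have "\<dots> < \<infinity>"
    using inverse_quadratic_integrable by (simp add: power_less_top_ennreal)
  finally have "integrable lborel ?g"
    using meas by (intro integrableI_bounded) auto
  then show ?thesis by (rule integrable_on_lborel)
qed

text \<open>The plane wave has to act on Schwartz functions as well, beyond compact support;
  domination by a multiple of the integrable weight gives both integrability and continuity.\<close>

lemma schwartz_fourier_integrable:
  fixes \<psi> :: "'a::euclidean_space \<Rightarrow> complex"
  assumes "schwartz_fun \<psi>"
  shows "(\<lambda>\<xi>. \<psi> \<xi> * exp (\<i> * of_real (\<xi> \<bullet> y))) integrable_on UNIV"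
    and "bndw (sw (2 * DIM('a))) N \<psi> B \<Longrightarrow> norm (fourier \<psi> y) \<le> integral UNIV (\<lambda>x::'a. 1 / sw (2 * DIM('a)) x) * B"
proof -
  let ?e = "\<lambda>\<xi>. \<psi> \<xi> * exp (\<i> * of_real (\<xi> \<bullet> y))" and ?w = "\<lambda>x::'a. 1 / sw (2 * DIM('a)) x"
  have le: "norm (?e x) \<le> B * ?w x" if "bndw (sw (2 * DIM('a))) N \<psi> B" for N B x
    using bndwD0[OF that, of x] sw_pos(1)[of x "2 * DIM('a)"] by (simp add: norm_mult field_simps)
  have int: "(\<lambda>x. B * ?w x) integrable_on UNIV" for B
    by (rule integrable_on_mult_right[OF schwartz_weight_integrable])
  obtain B0 where B0: "bndw (sw (2 * DIM('a))) 0 \<psi> B0" using schwartz_bndw[OF assms] by blast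
  have "continuous_on UNIV ?e"
    by (rule continuous_on_mult[OF smooth_continuous[OF schwartz_smooth[OF assms]] continuous_cexp])
  then have "?e \<in> borel_measurable (lebesgue_on UNIV)"
    by (intro continuous_imp_measurable_on_sets_lebesgue) auto
  then show i: "?e integrable_on UNIV"
    by (rule measurable_bounded_by_integrable_imp_integrable[OF _ int le[OF B0]]) auto
  show "norm (fourier \<psi> y) \<le> integral UNIV ?w * B" if "bndw (sw (2 * DIM('a))) N \<psi> B"
  proof -
    have "norm (integral UNIV ?e) \<le> integral UNIV (\<lambda>x. B * ?w x)"
      by (rule integral_norm_bound_integral[OF i int le[OF that]])
    also have "\<dots> = B * integral UNIV ?w" by (rule integral_mult_right)
    finally show ?thesis by (simp add: fourier_def mult.commute)
  qed
qed

section \<open>Partial Fourier transform in space\<close>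

lemma slice_smooth_iterd:
  fixes \<Phi> :: "'a::euclidean_space \<times> 'b::euclidean_space \<Rightarrow> complex"
  assumes "smooth_fun \<Phi>"
  shows "smooth_fun (\<lambda>x. \<Phi> (x, t))"
    and "b \<in> Basis \<Longrightarrow> dir_deriv b (\<lambda>x. \<Phi> (x, t)) = (\<lambda>x. dir_deriv (b, 0) \<Phi> (x, t))"
proof -
  have der: "((\<lambda>s. \<Phi> (x + s *\<^sub>R b, t)) has_vector_derivative dir_deriv (b, 0) \<Phi> (x, t)) (at 0)"
    if "smooth_fun \<Phi>" "b \<in> Basis" for \<Phi> :: "'a \<times> 'b \<Rightarrow> complex" and b x
  proof -
    have "(b, 0) \<in> (Basis :: ('a \<times> 'b) set)" using that by (simp add: Basis_prod_def)
    from smooth_deriv[OF that(1) this, of "(x, t)"] show ?thesis by simp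
  qed
  then show "b \<in> Basis \<Longrightarrow> dir_deriv b (\<lambda>x. \<Phi> (x, t)) = (\<lambda>x. dir_deriv (b, 0) \<Phi> (x, t))"
    using assms by (intro ext dir_derivI) blast
  define P where "P h \<longleftrightarrow> (\<exists>\<Phi>. smooth_fun \<Phi> \<and> h = (\<lambda>x::'a. \<Phi> (x, t :: 'b)))" for h
  have "P (\<lambda>x. \<Phi> (x, t))" using assms by (auto simp: P_def)
  then show "smooth_fun (\<lambda>x. \<Phi> (x, t))"
  proof (induction rule: smooth_coinduct[where P=P])
    case (cont g)
    then obtain \<Phi> where \<Phi>: "smooth_fun \<Phi>" "g = (\<lambda>x. \<Phi> (x, t))" by (auto simp: P_def)
    show ?case unfolding \<Phi>
      by (rule continuous_on_compose2[OF smooth_continuous[OF \<Phi>(1)]]) (auto intro: continuous_intros)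
  next
    case (step g b)
    then obtain \<Phi> where \<Phi>: "smooth_fun \<Phi>" "g = (\<lambda>x. \<Phi> (x, t))" by (auto simp: P_def)
    have "(b, 0) \<in> (Basis :: ('a \<times> 'b) set)" using step by (simp add: Basis_prod_def)
    then have "P (\<lambda>x. dir_deriv (b, 0) \<Phi> (x, t))" using smooth_dir_deriv[OF \<Phi>(1)] by (auto simp: P_def)
    then show ?case using der[OF \<Phi>(1) step(2)] \<Phi>(2) by blast
  qed
qed

lemma slice_test:
  fixes \<Phi> :: "'a::euclidean_space \<times> 'b::euclidean_space \<Rightarrow> complex"
  assumes "test_fun \<Phi>"
  shows "test_fun (\<lambda>x. \<Phi> (x, t))"
proof -
  obtain K where K: "compact K" "supported_in \<Phi> K" using assms by (auto simp: test_fun_def)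
  have "compact (fst ` K)" by (intro compact_continuous_image K continuous_on_fst continuous_on_id)
  moreover have "supported_in (\<lambda>x. \<Phi> (x, t)) (fst ` K)"
    using K(2) unfolding supported_in_def by (metis fst_conv image_eqI)
  ultimately show ?thesis using slice_smooth_iterd(1)[OF test_smooth[OF assms]] unfolding test_fun_def by blast
qed

definition xfourier :: "('a::euclidean_space \<times> real \<Rightarrow> complex) \<Rightarrow> 'a \<Rightarrow> real \<Rightarrow> complex" where
  "xfourier \<Phi> y t = fourier (\<lambda>x. \<Phi> (x, t)) y"

lemma xfourier_iterd_space:
  fixes \<Phi> :: "'a::euclidean_space \<times> real \<Rightarrow> complex"
  assumes "test_fun \<Phi>" "set xs \<subseteq> Basis"
  shows "test_fun (iterd (map (\<lambda>x. (x, 0)) xs) \<Phi>)"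
    and "xfourier (iterd (map (\<lambda>x. (x, 0)) xs) \<Phi>) y t = prod_list (map (\<lambda>b. - (\<i> * of_real (y \<bullet> b))) xs) * xfourier \<Phi> y t"
proof -
  have t: "test_fun (iterd (map (\<lambda>x. (x, 0)) xs) \<Phi>)" if "set xs \<subseteq> Basis" for xs
    by (rule test_iterd[OF assms(1)]) (use that in \<open>auto simp: Basis_prod_def\<close>)
  show "test_fun (iterd (map (\<lambda>x. (x, 0)) xs) \<Phi>)" by (rule t[OF assms(2)])
  show "xfourier (iterd (map (\<lambda>x. (x, 0)) xs) \<Phi>) y t = prod_list (map (\<lambda>b. - (\<i> * of_real (y \<bullet> b))) xs) * xfourier \<Phi> y t"
    using assms(2)
  proof (induction xs)
    case (Cons b xs)
    then have b: "b \<in> Basis" "set xs \<subseteq> Basis" by auto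
    let ?\<Psi> = "iterd (map (\<lambda>x. (x, 0)) xs) \<Phi>"
    have "xfourier (iterd (map (\<lambda>x. (x, 0)) (b # xs)) \<Phi>) y t = fourier (dir_deriv b (\<lambda>x. ?\<Psi> (x, t))) y"
      using slice_smooth_iterd(2)[OF test_smooth[OF t[OF b(2)]] b(1), of t] by (simp add: xfourier_def)
    also have "\<dots> = - (\<i> * of_real (y \<bullet> b)) * xfourier ?\<Psi> y t"
      unfolding xfourier_def by (rule fourier_dir_deriv[OF slice_test[OF t[OF b(2)]] b(1)])
    finally show ?case using Cons.IH[OF b(2)] by simp
  qed simp
qed

lemma xfourier_deriv:
  fixes \<Phi> :: "'a::euclidean_space \<times> real \<Rightarrow> complex"
  assumes "test_fun \<Phi>"
  shows "((\<lambda>t. xfourier \<Phi> y t) has_vector_derivative xfourier (dir_deriv (0, 1) \<Phi>) y t) (at t)"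
proof -
  obtain K where K: "compact K" "supported_in \<Phi> K" using assms by (auto simp: test_fun_def)
  have sm: "smooth_fun \<Phi>" by (rule test_smooth[OF assms])
  have b: "(0, 1) \<in> (Basis :: ('a \<times> real) set)" by (simp add: Basis_prod_def)
  let ?e = "\<lambda>x. exp (\<i> * complex_of_real (x \<bullet> y))"
  have cK: "compact (fst ` K)" by (intro compact_continuous_image K continuous_on_fst continuous_on_id)
  have out: "\<Phi> (x, s) = 0" "dir_deriv (0, 1) \<Phi> (x, s) = 0" if "x \<notin> fst ` K" for x s
  proof -
    have "(x, s) \<notin> K" using that by (metis fst_conv image_eqI)
    then show "\<Phi> (x, s) = 0" "dir_deriv (0, 1) \<Phi> (x, s) = 0"
      using K(2) supported_iterd[OF compact_imp_closed[OF K(1)] K(2), of "[(0, 1)]"]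
      by (auto simp: supported_in_def)
  qed
  have "((\<lambda>t. integral UNIV (\<lambda>x. \<Phi> (x, t) * ?e x)) has_vector_derivative
      integral UNIV (\<lambda>x. dir_deriv (0, 1) \<Phi> (x, t) * ?e x)) (at t)"
  proof (rule leibniz_UNIV[OF _ _ _ cK])
    show "((\<lambda>s. \<Phi> (x, s) * ?e x) has_vector_derivative dir_deriv (0, 1) \<Phi> (x, s) * ?e x) (at s)" for x s
    proof (rule has_vector_derivative_mult_left)
      show "((\<lambda>s. \<Phi> (x, s)) has_vector_derivative dir_deriv (0, 1) \<Phi> (x, s)) (at s)"
        using hvd_line[of \<Phi> "(0, 1)" "dir_deriv (0, 1) \<Phi>" "(x, 0)" s] smooth_deriv[OF sm b] by simp
    qed
    have "continuous_on UNIV (\<lambda>z::real \<times> 'a. dir_deriv (0, 1) \<Phi> (snd z, fst z))"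
      by (rule continuous_on_compose2[OF smooth_continuous[OF smooth_dir_deriv[OF sm b]]])
        (intro continuous_on_Pair continuous_on_snd continuous_on_fst continuous_on_id, simp)
    then have "continuous_on UNIV (\<lambda>z::real \<times> 'a. dir_deriv (0, 1) \<Phi> (snd z, fst z) * ?e (snd z))"
      by (rule continuous_on_mult) (intro continuous_intros)
    then show "continuous_on UNIV (\<lambda>(s, x). dir_deriv (0, 1) \<Phi> (x, s) * ?e x)" by (simp add: case_prod_beta')
    show "continuous_on UNIV (\<lambda>x. \<Phi> (x, s) * ?e x)" for s
      by (rule continuous_on_mult[OF smooth_continuous[OF slice_smooth_iterd(1)[OF sm]] continuous_cexp])
  qed (use out in auto)
  then show ?thesis by (simp add: xfourier_def fourier_def)
qed

text \<open>A proportionality valid at all times can be differentiated in time, the constant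
  \<open>c\<close> being independent of \<open>t\<close>. Thus the time derivatives are applied
  outside the space derivatives, as in \<open>mono_dirs\<close>, without exchanging them.\<close>

lemma xfourier_iterd_time:
  fixes \<Phi> \<Psi> :: "'a::euclidean_space \<times> real \<Rightarrow> complex"
  assumes "test_fun \<Phi>" "test_fun \<Psi>" "\<And>t. xfourier \<Psi> y t = c * xfourier \<Phi> y t"
  shows "xfourier (iterd (replicate j (0, 1)) \<Psi>) y t = c * xfourier (iterd (replicate j (0, 1)) \<Phi>) y t"
proof (induction j arbitrary: t)
  case 0
  then show ?case using assms by simp
next
  case (Suc j)
  have b: "set (replicate j (0, 1)) \<subseteq> (Basis :: ('a \<times> real) set)" by (auto simp: Basis_prod_def)
  let ?A = "iterd (replicate j (0, 1)) \<Psi>" and ?B = "iterd (replicate j (0, 1)) \<Phi>"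
  have "((\<lambda>t. xfourier ?A y t) has_vector_derivative xfourier (dir_deriv (0, 1) ?A) y t) (at t)"
    by (rule xfourier_deriv[OF test_iterd[OF assms(2) b]])
  moreover have "((\<lambda>t. xfourier ?A y t) has_vector_derivative c * xfourier (dir_deriv (0, 1) ?B) y t) (at t)"
    unfolding Suc.IH by (rule has_vector_derivative_mult_right[OF xfourier_deriv[OF test_iterd[OF assms(1) b]]])
  ultimately show ?case using vector_derivative_unique_at by fastforce
qed

text \<open>The plane wave \<open>exp (i x \<bullet> y)\<close> in space, tensored with the Dirac measure at time \<open>0\<close>.\<close>

lemma plane_wave_in_NS:
  fixes p :: "nat \<Rightarrow>\<^sub>0 (('n::finite \<Rightarrow>\<^sub>0 nat) \<Rightarrow>\<^sub>0 complex)"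
  assumes p: "\<And>j. mpoly_eval (Poly_Mapping.lookup p j) (\<chi> i. \<i> * complex_of_real (y $ i)) = 0"
  shows "(\<lambda>\<Phi>. xfourier \<Phi> y 0) \<in> NS LDS p"
proof -
  have zero: "fourier (\<lambda>x. 0) y = 0" by (simp add: fourier_def)
  have add: "xfourier (\<lambda>x. f x + g x) y 0 = xfourier f y 0 + xfourier g y 0" if "test_fun f" "test_fun g"
    for f g :: "(real^'n) \<times> real \<Rightarrow> complex"
    using fourier_add[OF test_cc[OF slice_test[OF that(1)]] test_cc[OF slice_test[OF that(2)]]]
    by (simp add: xfourier_def)
  have cmult: "xfourier (\<lambda>x. c * f x) y 0 = c * xfourier f y 0" for c and f :: "(real^'n) \<times> real \<Rightarrow> complex"
    by (simp add: xfourier_def fourier_cmult)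
  have dist: "distribution (\<lambda>\<Phi> :: (real^'n) \<times> real \<Rightarrow> complex. xfourier \<Phi> y 0)"
  proof (rule distributionI[OF add cmult])
    fix K :: "((real^'n) \<times> real) set" assume K: "compact K"
    have cK: "compact (fst ` K)" by (intro compact_continuous_image K continuous_on_fst continuous_on_id)
    obtain V where V: "\<forall>(\<theta> :: real^'n \<Rightarrow> complex) D x. DK (fst ` K) \<theta> \<longrightarrow> bndw (\<lambda>_. 1) 0 \<theta> D \<longrightarrow>
        sw 0 x * norm (fourier \<theta> x) \<le> V * D"
      using fourier_weighted_bound[OF cK, of 0] by blast
    have "norm (xfourier f y 0) \<le> V * B" if f: "test_fun f" "supported_in f K" "bndw (\<lambda>_. 1) 0 f B" for f B
    proof -
      have "DK (fst ` K) (\<lambda>x. f (x, 0))"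
        unfolding DK_def supported_in_def
        using slice_smooth_iterd(1)[OF test_smooth[OF f(1)]] f(2)
        by (metis fst_conv image_eqI supported_in_def)
      moreover have "bndw (\<lambda>_. 1) 0 (\<lambda>x. f (x, 0)) B" using f(3) by (simp add: bndw_0)
      ultimately have "sw 0 y * norm (fourier (\<lambda>x. f (x, 0)) y) \<le> V * B" using V by blast
      then show ?thesis by (simp add: xfourier_def)
    qed
    then show "\<exists>C N. \<forall>f B. test_fun f \<longrightarrow> supported_in f K \<longrightarrow> bndw (\<lambda>_. 1) N f B \<longrightarrow> norm (xfourier f y 0) \<le> C * B"
      by blast
  qed
  let ?u = "\<lambda>(\<phi> :: real \<Rightarrow> complex) (\<psi> :: real^'n \<Rightarrow> complex). \<phi> 0 * fourier \<psi> y"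
  have temp: "tempered (?u \<phi>)" for \<phi>
  proof (rule temperedI)
    show "\<phi> 0 * fourier (\<lambda>x. f x + g x) y = \<phi> 0 * fourier f y + \<phi> 0 * fourier g y"
      if "schwartz_fun f" "schwartz_fun g" for f g :: "real^'n \<Rightarrow> complex"
      unfolding fourier_def
      by (simp add: distrib_right integral_add schwartz_fourier_integrable(1) that flip: distrib_left)
    show "\<phi> 0 * fourier (\<lambda>x. c * f x) y = c * (\<phi> 0 * fourier f y)" for c and f :: "real^'n \<Rightarrow> complex"
      by (simp add: fourier_cmult)
    show "norm (\<phi> 0 * fourier f y) \<le> (norm (\<phi> 0) * integral UNIV (\<lambda>x::real^'n. 1 / sw (2 * DIM(real^'n)) x)) * B"
      if "schwartz_fun f" "bndw (sw (2 * DIM(real^'n))) (2 * DIM(real^'n)) f B" for f B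
      using mult_left_mono[OF schwartz_fourier_integrable(2)[OF that, of y] norm_ge_zero[of "\<phi> 0"]]
      by (simp only: norm_mult mult.assoc)
  qed
  have dist_u: "distribution (\<lambda>\<phi>. ?u \<phi> \<psi>)" for \<psi>
  proof (rule distributionI)
    fix K :: "real set"
    have "norm (?u \<phi> \<psi>) \<le> norm (fourier \<psi> y) * B" if "bndw (\<lambda>_. 1) 0 \<phi> B" for \<phi> B
      using mult_left_mono[OF bndwD0[OF that, of 0] norm_ge_zero[of "fourier \<psi> y"]] by (simp add: norm_mult mult.commute)
    then show "\<exists>C N. \<forall>f B. test_fun f \<longrightarrow> supported_in f K \<longrightarrow> bndw (\<lambda>_. 1) N f B \<longrightarrow> norm (?u f \<psi>) \<le> C * B"
      by blast
  qed (auto simp: algebra_simps)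
  have "(\<lambda>\<Phi>. xfourier \<Phi> y 0) \<in> LDS"
    unfolding LDS_def
  proof (intro CollectI conjI dist exI[of _ ?u])
    show "\<forall>\<phi> \<psi>. test_fun \<phi> \<longrightarrow> test_fun \<psi> \<longrightarrow> xfourier (\<lambda>(x, t). \<phi> t * \<psi> x) y 0 = ?u \<phi> \<psi>"
      by (simp add: xfourier_def fourier_cmult)
  qed (use temp dist_u in \<open>auto simp: algebra_simps\<close>)
  moreover have "Dp p (\<lambda>\<Phi>. xfourier \<Phi> y 0) \<Phi> = 0" if \<Phi>: "test_fun \<Phi>" for \<Phi>
  proof -
    let ?z = "\<lambda>\<alpha>. prod_list (map (\<lambda>b. - (\<i> * complex_of_real (y \<bullet> b))) (mono_list \<alpha>))"
    let ?T = "\<lambda>j. xfourier (iterd (replicate j (0, 1)) \<Phi>) y 0"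
    have it: "xfourier (iterd (mono_dirs \<alpha> j) \<Phi>) y 0 = ?z \<alpha> * ?T j" for \<alpha> j
      unfolding mono_dirs_eq iterd_append map_replicate
      by (rule xfourier_iterd_time[OF \<Phi> xfourier_iterd_space(1)[OF \<Phi> mono_list_Basis] xfourier_iterd_space(2)[OF \<Phi> mono_list_Basis]])
    have sym: "(\<Sum>\<alpha>\<in>Poly_Mapping.keys q. Poly_Mapping.lookup q \<alpha> * ((-1) ^ length (mono_list \<alpha>) * ?z \<alpha>)) = symbol q (- y)" for q
      by (simp add: symbol_def)
    \<comment> \<open>Collecting by powers of the time derivative leaves the symbol of each
      coefficient at \<open>- y\<close>, that is its value at \<open>\<i> y\<close>, which is
      0.\<close>
    have "Dp p (\<lambda>\<Phi>. xfourier \<Phi> y 0) \<Phi> = (\<Sum>j\<in>Poly_Mapping.keys p. ((-1) ^ j * ?T j) *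
        (\<Sum>\<alpha>\<in>Poly_Mapping.keys (Poly_Mapping.lookup p j). Poly_Mapping.lookup (Poly_Mapping.lookup p j) \<alpha> * ((-1) ^ length (mono_list \<alpha>) * ?z \<alpha>)))"
      unfolding Dp_def it
      by (intro sum.cong refl, subst sum_distrib_left)
        (simp add: mono_dirs_eq power_add mult_ac)
    also have "\<dots> = 0"
      unfolding sym symbol_eq using p by simp
    finally show ?thesis .
  qed
  moreover have "xfourier \<Phi> y 0 = 0" if "K \<subseteq> {(x, t). t < 0}" "supported_in \<Phi> K" for \<Phi> and K :: "((real^'n) \<times> real) set"
  proof -
    have "\<Phi> (x, 0) = 0" for x using that by (auto simp: supported_in_def)
    then show ?thesis by (simp add: xfourier_def zero)
  qed
  ultimately show ?thesis unfolding NS_def by blast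
qed

text \<open>The factor \<open>exp (- \<i> x \<bullet> y)\<close> in the test function cancels the
  plane wave and leaves the positive integral of \<open>bump\<close>.\<close>

lemma plane_wave_nonzero:
  fixes y :: "real^'n::finite"
  shows "\<exists>\<Phi>. test_fun \<Phi> \<and> xfourier \<Phi> y 0 \<noteq> 0"
proof (intro exI conjI)
  let ?\<Phi> = "\<lambda>(x::real^'n, t::real). bump t * (bump x * exp (- \<i> * of_real (x \<bullet> y)))"
  show "test_fun ?\<Phi>"
    by (rule test_tensor[OF bump_test test_mult_right[OF bump_test smooth_exp[OF smooth_inner]]])
  have "xfourier ?\<Phi> y 0 = integral UNIV (bump :: real^'n \<Rightarrow> complex)"
    by (simp add: xfourier_def fourier_def bump_0 mult.assoc flip: exp_add)
  then show "xfourier ?\<Phi> y 0 \<noteq> 0"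
    using integral_bump_pos[where 'a="real^'n"] by (simp add: integral_bump)
qed

theorem theorem1p10:
  fixes p :: "nat \<Rightarrow>\<^sub>0 (('n::finite \<Rightarrow>\<^sub>0 nat) \<Rightarrow>\<^sub>0 complex)"
  shows "trivial_NS (NS LDS p) \<longleftrightarrow> variety (CX p) \<inter> imag_axis_space = {}"
proof
  assume triv: "trivial_NS (NS LDS p)"
  show "variety (CX p) \<inter> imag_axis_space = {}"
  proof (rule ccontr)
    assume "variety (CX p) \<inter> imag_axis_space \<noteq> {}"
    then obtain y :: "real^'n" where "(\<chi> i. \<i> * complex_of_real (y $ i)) \<in> variety (CX p)"
      by (auto simp: imag_axis_space_def)
    then have mem: "(\<lambda>\<Phi>. xfourier \<Phi> y 0) \<in> NS LDS p"
      unfolding variety_CX by (intro plane_wave_in_NS) blast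
    have "xfourier \<Phi> y 0 = 0" if "test_fun \<Phi>" for \<Phi> :: "(real^'n) \<times> real \<Rightarrow> complex"
      using bspec[OF triv[unfolded trivial_NS_def] mem] that by simp
    then show False using plane_wave_nonzero by blast
  qed
next
  assume "variety (CX p) \<inter> imag_axis_space = {}"
  then show "trivial_NS (NS LDS p)"
    unfolding trivial_NS_def using NS_LDS_vanish by blast
qed

end
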